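(* Let $\bar p>2$. Assume the following. (1) Exponential family. (a) There exist continuous functions $\phi:\Theta\to\mathbb{R}$, $\psi:\Theta\to\mathbb{R}^d$ and $S:\mathbb{X}\times\mathbb{X}\times\mathbb{Y}\to\mathbb{R}^d$ such that $\log m_\theta(x,x')+\log g_\theta(x',y)=\phi(\theta)+\langle S(x,x',y),\psi(\theta)\rangle$ for all $\theta,x,x',y$. (b) There is an open set $\mathcal{S}\subset\mathbb{R}^d$ containing the convex hull of $S(\mathbb{X}\times\mathbb{X}\times\mathbb{Y})$. (c) There is a continuous function $\bar\theta:\mathcal{S}\to\Theta$ such that for every $s\in\mathcal{S}$, $\bar\theta(s)$ is the unique maximizer over $\Theta$ of $\theta\mapsto\phi(\theta)+\langle s,\psi(\theta)\rangle$. (2) Strong mixing. There exist $\sigma_-,\sigma_+$ with $0<\sigma_-\le m_\theta(x,x')\le\sigma_+$ for all $(x,x')\in\mathbb{X}^2$, $\theta\in\Theta$. (3) Moments. $\mathbb{E}\big[\sup_{(x,x')\in\mathbb{X}^2}|S(x,x',Y_0)|^{\bar p}\big]<\infty$. (4) Observations. (a) $\mathbf{Y}$ is stationary and there exist $C_0\in[0,1)$ and $\beta\in(0,1)$ with $\beta^{\mathbf{Y}}(n)\le C_0\beta^n$ for all $n\ge0$. (b) $\mathbb{E}[|\log b_-(Y_0)|+|\log b_+(Y_0)|]<\infty$, where $b_-(y)=\inf_{\theta\in\Theta}\int g_\theta(x,y)\lambda(\mathrm{d}x)$ and $b_+(y)=\sup_{\theta\in\Theta}\int g_\theta(x,y)\lambda(\mathrm{d}x)$.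 (5) Block sizes. There exist $c>0$ and $a>1$ with $\tau_n=\lfloor cn^a\rfloor$ for all $n\ge1$. (6) Monte Carlo error. There exists $b\ge(a+1)/(2a)$ such that $\|S_n-\widetilde S_n\|_{\bar p}=O(\tau_{n+1}^{-b})$. (7) Stable fixed point. $\theta_\star\in\Theta$ satisfies $\bar\theta(\bar{\mathrm S}(\theta_\star))=\theta_\star$; $\bar{\mathrm S}$ and $\bar\theta$ are twice continuously differentiable on $\Theta$ and $\mathcal{S}$ respectively; and there exists $0<\gamma<1$ such that the spectral radius of the Jacobian $\nabla_s(\bar{\mathrm S}\circ\bar\theta)$ at $s=\bar{\mathrm S}(\theta_\star)$ is lower than $\gamma$. Then for any $p\in(2,\bar p)$, the averaged sequence $\{\widetilde\theta_n\}_{n\ge1}$ satisfies $$\sqrt{T_n}\,[\widetilde\theta_n-\theta_\star]\,\mathbf{1}_{\lim_n\theta_n=\theta_\star}=O_{\mathrm{L}_p}(1)+\frac{n}{\sqrt{T_n}}\,O_{\mathrm{L}_{p/2}}(1)\,O_{\mathrm{a.s.}}(1).$$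
   Context: For random variables $Z_n$: $Z_n=O_{\mathrm{L}_p}(1)$ means $\sup_n\mathbb{E}[|Z_n|^p]<\infty$, and $Z_n=O_{\mathrm{a.s.}}(1)$ means $\sup_n|Z_n|<\infty$ $\mathbb{P}$-a.s. An identity such as $X_n=O_{\mathrm{L}_p}(1)+\epsilon_n\,O_{\mathrm{L}_{p/2}}(1)\,O_{\mathrm{a.s.}}(1)$ means $X_n=U_n+\epsilon_nV_nA_n$ for some sequences with $U_n=O_{\mathrm{L}_p}(1)$, $V_n=O_{\mathrm{L}_{p/2}}(1)$ and $A_n=O_{\mathrm{a.s.}}(1)$. Model. $\Theta$ is a compact subset of $\mathbb{R}^{d_\theta}$; $(\mathbb{X},\mathcal{X})$ and $(\mathbb{Y},\mathcal{Y})$ are general state spaces with their $\sigma$-fields (and topologies, with respect to which continuity is understood); $\lambda$ is a finite measure on $(\mathbb{X},\mathcal{X})$ and $\mu$ a $\sigma$-finite measure on $(\mathbb{Y},\mathcal{Y})$. For $\theta\in\Theta$, $m_\theta(x,\cdot)$ is a Markov transition density with respect to $\lambda$ and $g_\theta(x,\cdot)$ is a transition density from $\mathbb{X}$ to $\mathbb{Y}$ with respect to $\mu$. Observations. $\mathbf{Y}=\{Y_k\}_{k\in\mathbb{Z}}$ is a $\mathbb{Y}$-valued process on a probability space $(\Omega,\mathcal{F},\mathbb{P})$, not necessarily the observation process of a hidden Markov model with state transition density $m_\theta$ and observation density $g_\theta$ for some $\theta\in\Theta$; $\mathbb{E}$ is expectation under $\mathbb{P}$ and $\|Z\|_p=(\mathbb{E}|Z|^p)^{1/p}$.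 With $\mathcal{F}^{\mathbf{Y}}_k=\sigma(Y_u,u\le k)$ and $\mathcal{G}^{\mathbf{Y}}_k=\sigma(Y_u,u\ge k)$, the $\beta$-mixing coefficients are $\beta^{\mathbf{Y}}(n)=\sup_{u\in\mathbb{Z}}\mathbb{E}\big[\operatorname{ess\,sup}_{B\in\mathcal{G}^{\mathbf{Y}}_{u+n}}|\mathbb{P}(B|\mathcal{F}^{\mathbf{Y}}_u)-\mathbb{P}(B)|\big]$. Smoothing. For a probability distribution $\chi$ on $\mathbb{X}$, integers $r<s\le t$, $\mathbf{y}\in\mathbb{Y}^{\mathbb{Z}}$ and a function $h$ on $\mathbb{X}^2\times\mathbb{Y}$, $$\Phi^{\chi,r}_{\theta,s,t}(h,\mathbf{y})=\frac{\int\chi(\mathrm{d}x_r)\prod_{i=r}^{t-1}\{m_\theta(x_i,x_{i+1})g_\theta(x_{i+1},y_{i+1})\}\,h(x_{s-1},x_s,y_s)\,\lambda(\mathrm{d}x_{r+1:t})}{\int\chi(\mathrm{d}x_r)\prod_{i=r}^{t-1}\{m_\theta(x_i,x_{i+1})g_\theta(x_{i+1},y_{i+1})\}\,\lambda(\mathrm{d}x_{r+1:t})}.$$ For integers $T\ge 0$, $\tau\ge1$: $\bar S^{\chi,T}_\tau(\theta,\mathbf{Y})=\frac1\tau\sum_{t=T+1}^{T+\tau}\Phi^{\chi,T}_{\theta,t,T+\tau}(S,\mathbf{Y})$. Under hypotheses (1)-(4), $\Phi^{\chi,-\tau-1}_{\theta,0,\tau}(S,\mathbf{Y})$ converges $\mathbb{P}$-a.s.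 as $\tau\to\infty$ to a random variable $\mathsf{S}(\theta,\mathbf{Y})$ not depending on $\chi$, and $\bar{\mathrm S}(\theta):=\mathbb{E}[\mathsf{S}(\theta,\mathbf{Y})]$. Block Online EM (BOEM) algorithm with Monte Carlo approximation, and averaging. $\{\tau_n\}_{n\ge1}$ is the sequence of block sizes (positive integers), $T_0=0$, $T_n=\sum_{k=1}^n\tau_k$, $\{\chi_n\}_{n\ge0}$ are probability distributions on $\mathbb{X}$. Given $\theta_0\in\Theta$, for $n\ge0$: $S_n=\bar S^{\chi_n,T_n}_{\tau_{n+1}}(\theta_n,\mathbf{Y})$, $\widetilde S_n$ is an $\mathcal{S}$-valued Monte Carlo approximation of $S_n$, and $\theta_{n+1}=\bar\theta(\widetilde S_n)$. There is a nondecreasing family of $\sigma$-algebras $\mathcal{H}_{T_n}$ (generated by the simulation random variables), independent of $\mathbf{Y}$, such that with $\widetilde{\mathcal F}_{T_n}=\sigma(\mathcal{F}^{\mathbf{Y}}_{T_n},\mathcal{H}_{T_n})$, $\theta_n$ is $\widetilde{\mathcal F}_{T_n}$-measurable and $\widetilde S_n$ is $\widetilde{\mathcal F}_{T_{n+1}}$-measurable. The averaged statistics and averaged BOEM sequence are, for $n\ge1$, $\Sigma_n=\frac{1}{T_n}\sum_{j=1}^n\tau_j\widetilde S_{j-1}$ (understood to lie in $\mathcal{S}$) and $\widetilde\theta_n=\bar\theta(\Sigma_n)$. *)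

theory Defs
  imports "HOL-Probability.Probability" "HOL-Library.Landau_Symbols"
begin

section \<open>Calculus and linear algebra\<close>

text \<open>
  The derivatives are taken in the sense of Frechet. On a set \<open>A\<close> that need not be open (such as a
  compact parameter set), being \<open>C\<^sup>2\<close> means being the restriction of a \<open>C\<^sup>2\<close> function defined on
  an open neighbourhood of \<open>A\<close>; for open \<open>A\<close> this is the usual notion.
\<close>

definition C2_on :: "('a::real_normed_vector \<Rightarrow> 'b::real_normed_vector) \<Rightarrow> 'a set \<Rightarrow> bool" where
  "C2_on f A \<longleftrightarrow>
     (\<exists>U F. \<exists>F' :: 'a \<Rightarrow> 'a \<Rightarrow>\<^sub>L 'b. \<exists>F'' :: 'a \<Rightarrow> 'a \<Rightarrow>\<^sub>L ('a \<Rightarrow>\<^sub>L 'b).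
        open U \<and> A \<subseteq> U \<and> (\<forall>x\<in>A. F x = f x) \<and>
        (\<forall>x\<in>U. (F has_derivative blinfun_apply (F' x)) (at x)) \<and>
        (\<forall>x\<in>U. (F' has_derivative blinfun_apply (F'' x)) (at x)) \<and>
        continuous_on U F'')"

text \<open>The eigenvalues of a real matrix are its complex ones.\<close>

definition spectral_radius :: "real^'n^'n \<Rightarrow> real" where
  "spectral_radius A =
     Max {norm z |z. \<exists>v :: complex^'n. v \<noteq> 0 \<and> map_matrix complex_of_real A *v v = z *s v}"


section \<open>Extended logarithm\<close>

text \<open>The HOL convention \<open>ln 0 = 0\<close> would make \<open>\<bar>log b\<bar>\<close> finite where \<open>b\<close> vanishes.\<close>

definition eln :: "ennreal \<Rightarrow> ereal" where
  "eln x = (if x = 0 then - \<infinity> else if x = \<infinity> then \<infinity> else ereal (ln (enn2real x)))"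


section \<open>Stochastic orders of magnitude\<close>

text \<open>Sequences are indexed by \<open>n \<ge> 1\<close>.\<close>

definition O_Lp ::
  "'w measure \<Rightarrow> real \<Rightarrow> (nat \<Rightarrow> 'w \<Rightarrow> 'v::{real_normed_vector, second_countable_topology}) \<Rightarrow> bool"
where
  "O_Lp M p Z \<longleftrightarrow> (\<forall>n\<ge>1. Z n \<in> borel_measurable M) \<and>
     (SUP n\<in>{1..}. \<integral>\<^sup>+\<omega>. ennreal (norm (Z n \<omega>) powr p) \<partial>M) < \<infinity>"

definition O_as ::
  "'w measure \<Rightarrow> (nat \<Rightarrow> 'w \<Rightarrow> 'v::{real_normed_vector, second_countable_topology}) \<Rightarrow> bool"
where
  "O_as M Z \<longleftrightarrow> (\<forall>n\<ge>1. Z n \<in> borel_measurable M) \<and>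
     (AE \<omega> in M. bdd_above ((\<lambda>n. norm (Z n \<omega>)) ` {1..}))"

definition Lp_norm :: "'w measure \<Rightarrow> real \<Rightarrow> ('w \<Rightarrow> 'v::real_normed_vector) \<Rightarrow> real" where
  "Lp_norm M p Z = (\<integral>\<omega>. norm (Z \<omega>) powr p \<partial>M) powr (1 / p)"


section \<open>Processes and mixing\<close>

definition generated_by ::
  "'w measure \<Rightarrow> 'y measure \<Rightarrow> (int \<Rightarrow> 'w \<Rightarrow> 'y) \<Rightarrow> int set \<Rightarrow> 'w measure" where
  "generated_by M N Y I = sigma (space M) (\<Union>u\<in>I. {Y u -` A \<inter> space M |A. A \<in> sets N})"

definition past :: "'w measure \<Rightarrow> 'y measure \<Rightarrow> (int \<Rightarrow> 'w \<Rightarrow> 'y) \<Rightarrow> int \<Rightarrow> 'w measure" where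
  "past M N Y k = generated_by M N Y {..k}"

definition future :: "'w measure \<Rightarrow> 'y measure \<Rightarrow> (int \<Rightarrow> 'w \<Rightarrow> 'y) \<Rightarrow> int \<Rightarrow> 'w measure" where
  "future M N Y k = generated_by M N Y {k..}"

definition stationary :: "'w measure \<Rightarrow> 'y measure \<Rightarrow> (int \<Rightarrow> 'w \<Rightarrow> 'y) \<Rightarrow> bool" where
  "stationary M N Y \<longleftrightarrow>
     (\<forall>h. distr M (PiM UNIV (\<lambda>_. N)) (\<lambda>\<omega> k. Y (k + h) \<omega>) =
          distr M (PiM UNIV (\<lambda>_. N)) (\<lambda>\<omega> k. Y k \<omega>))"

text \<open>
  Essential supremum of a (possibly uncountable) family of random variables: an almost surely least
  measurable function that dominates each member almost surely. It is unique up to null sets.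
\<close>

definition family_esssup :: "'w measure \<Rightarrow> 'i set \<Rightarrow> ('i \<Rightarrow> 'w \<Rightarrow> ennreal) \<Rightarrow> 'w \<Rightarrow> ennreal" where
  "family_esssup M I f =
     (SOME Z. Z \<in> borel_measurable M \<and> (\<forall>i\<in>I. AE \<omega> in M. f i \<omega> \<le> Z \<omega>) \<and>
        (\<forall>W\<in>borel_measurable M. (\<forall>i\<in>I. AE \<omega> in M. f i \<omega> \<le> W \<omega>) \<longrightarrow>
           (AE \<omega> in M. Z \<omega> \<le> W \<omega>)))"

definition beta_mixing ::
  "'w measure \<Rightarrow> 'y measure \<Rightarrow> (int \<Rightarrow> 'w \<Rightarrow> 'y) \<Rightarrow> nat \<Rightarrow> ennreal" where
  "beta_mixing M N Y n =
     (SUP u. \<integral>\<^sup>+\<omega>. family_esssup M (sets (future M N Y (u + int n)))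
        (\<lambda>B \<omega>. ennreal \<bar>real_cond_exp M (past M N Y u) (indicator B) \<omega> - measure M B\<bar>) \<omega> \<partial>M)"


section \<open>State-space model and smoothing\<close>

definition transition_density :: "'a measure \<Rightarrow> 'b measure \<Rightarrow> ('a \<Rightarrow> 'b \<Rightarrow> real) \<Rightarrow> bool" where
  "transition_density A B k \<longleftrightarrow>
     (\<lambda>(x, y). k x y) \<in> borel_measurable (A \<Otimes>\<^sub>M B) \<and>
     (\<forall>x\<in>space A. \<forall>y\<in>space B. 0 \<le> k x y) \<and>
     (\<forall>x\<in>space A. (\<integral>\<^sup>+y. ennreal (k x y) \<partial>B) = 1)"

definition distribution_on :: "'a measure \<Rightarrow> 'a measure \<Rightarrow> bool" where
  "distribution_on A chi \<longleftrightarrow> prob_space chi \<and> sets chi = sets A"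

definition path_measure :: "'x measure \<Rightarrow> 'x measure \<Rightarrow> int \<Rightarrow> int \<Rightarrow> (int \<Rightarrow> 'x) measure" where
  "path_measure lam chi r t = PiM {r..t} (\<lambda>i. if i = r then chi else lam)"

definition path_weight ::
  "('x \<Rightarrow> 'x \<Rightarrow> real) \<Rightarrow> ('x \<Rightarrow> 'y \<Rightarrow> real) \<Rightarrow> int \<Rightarrow> int \<Rightarrow> (int \<Rightarrow> 'y) \<Rightarrow> (int \<Rightarrow> 'x) \<Rightarrow> real" where
  "path_weight m g r t y x = (\<Prod>i\<in>{r..<t}. m (x i) (x (i + 1)) * g (x (i + 1)) (y (i + 1)))"

text \<open>
  In \<open>smoothing lam m g chi r s t h y\<close> the functions \<open>m\<close> and \<open>g\<close> are the densities at one
  fixed value of the parameter.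
\<close>

definition smoothing ::
  "'x measure \<Rightarrow> ('x \<Rightarrow> 'x \<Rightarrow> real) \<Rightarrow> ('x \<Rightarrow> 'y \<Rightarrow> real) \<Rightarrow> 'x measure \<Rightarrow> int \<Rightarrow> int \<Rightarrow> int \<Rightarrow>
   ('x \<Rightarrow> 'x \<Rightarrow> 'y \<Rightarrow> 'v::{banach, second_countable_topology}) \<Rightarrow> (int \<Rightarrow> 'y) \<Rightarrow> 'v"
where
  "smoothing lam m g chi r s t h y =
     (\<integral>x. path_weight m g r t y x *\<^sub>R h (x (s - 1)) (x s) (y s) \<partial>path_measure lam chi r t)
     /\<^sub>R (\<integral>x. path_weight m g r t y x \<partial>path_measure lam chi r t)"

definition block_stat ::
  "'x measure \<Rightarrow> ('x \<Rightarrow> 'x \<Rightarrow> real) \<Rightarrow> ('x \<Rightarrow> 'y \<Rightarrow> real) \<Rightarrow> 'x measure \<Rightarrow> nat \<Rightarrow> nat \<Rightarrow>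
   ('x \<Rightarrow> 'x \<Rightarrow> 'y \<Rightarrow> 'v::{banach, second_countable_topology}) \<Rightarrow> (int \<Rightarrow> 'y) \<Rightarrow> 'v"
where
  "block_stat lam m g chi T \<tau> S y =
     (1 / real \<tau>) *\<^sub>R (\<Sum>t = T + 1..T + \<tau>. smoothing lam m g chi (int T) (int t) (int (T + \<tau>)) S y)"

text \<open>
  The random variable to which the smoothed statistic converges almost surely, whatever the
  initial distribution. It is determined up to null sets, so that its expectation
  \<open>mean_stat\<close> does not depend on the choice.
\<close>

definition limit_stat ::
  "'w measure \<Rightarrow> (int \<Rightarrow> 'w \<Rightarrow> 'y) \<Rightarrow> 'x measure \<Rightarrow> ('x \<Rightarrow> 'x \<Rightarrow> real) \<Rightarrow> ('x \<Rightarrow> 'y \<Rightarrow> real) \<Rightarrow>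
   ('x \<Rightarrow> 'x \<Rightarrow> 'y \<Rightarrow> 'v::{banach, second_countable_topology}) \<Rightarrow> 'w \<Rightarrow> 'v"
where
  "limit_stat M Y lam m g S =
     (SOME Z. Z \<in> borel_measurable M \<and>
        (\<forall>chi. distribution_on lam chi \<longrightarrow>
           (AE \<omega> in M. (\<lambda>\<tau>. smoothing lam m g chi (- int \<tau> - 1) 0 (int \<tau>) S (\<lambda>k. Y k \<omega>))
              \<longlonglongrightarrow> Z \<omega>)))"

definition mean_stat ::
  "'w measure \<Rightarrow> (int \<Rightarrow> 'w \<Rightarrow> 'y) \<Rightarrow> 'x measure \<Rightarrow>
   ('t \<Rightarrow> 'x \<Rightarrow> 'x \<Rightarrow> real) \<Rightarrow> ('t \<Rightarrow> 'x \<Rightarrow> 'y \<Rightarrow> real) \<Rightarrow>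
   ('x \<Rightarrow> 'x \<Rightarrow> 'y \<Rightarrow> 'v::{banach, second_countable_topology}) \<Rightarrow> 't \<Rightarrow> 'v"
where
  "mean_stat M Y lam m g S \<theta> = (\<integral>\<omega>. limit_stat M Y lam (m \<theta>) (g \<theta>) S \<omega> \<partial>M)"

definition b_minus :: "'x measure \<Rightarrow> ('t \<Rightarrow> 'x \<Rightarrow> 'y \<Rightarrow> real) \<Rightarrow> 't set \<Rightarrow> 'y \<Rightarrow> ennreal" where
  "b_minus lam g \<Theta> y = (INF \<theta>\<in>\<Theta>. \<integral>\<^sup>+x. ennreal (g \<theta> x y) \<partial>lam)"

definition b_plus :: "'x measure \<Rightarrow> ('t \<Rightarrow> 'x \<Rightarrow> 'y \<Rightarrow> real) \<Rightarrow> 't set \<Rightarrow> 'y \<Rightarrow> ennreal" where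
  "b_plus lam g \<Theta> y = (SUP \<theta>\<in>\<Theta>. \<integral>\<^sup>+x. ennreal (g \<theta> x y) \<partial>lam)"


section \<open>Block Online EM\<close>

definition block_end :: "(nat \<Rightarrow> nat) \<Rightarrow> nat \<Rightarrow> nat" where
  "block_end \<tau> n = (\<Sum>k = 1..n. \<tau> k)"

text \<open>
  \<open>H n\<close> is the \<open>\<sigma>\<close>-algebra attached to the end of block \<open>n\<close>, i.e. to time
  \<open>block_end \<tau> n\<close>.
\<close>

definition enlarged_past ::
  "'w measure \<Rightarrow> 'y measure \<Rightarrow> (int \<Rightarrow> 'w \<Rightarrow> 'y) \<Rightarrow> (nat \<Rightarrow> 'w measure) \<Rightarrow> (nat \<Rightarrow> nat) \<Rightarrow> nat \<Rightarrow> 'w measure"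
where
  "enlarged_past M N Y H \<tau> n =
     sigma (space M) (sets (past M N Y (int (block_end \<tau> n))) \<union> sets (H n))"

definition averaged_stat :: "(nat \<Rightarrow> nat) \<Rightarrow> (nat \<Rightarrow> 'w \<Rightarrow> 'v::real_vector) \<Rightarrow> nat \<Rightarrow> 'w \<Rightarrow> 'v" where
  "averaged_stat \<tau> St n \<omega> = (1 / real (block_end \<tau> n)) *\<^sub>R (\<Sum>j = 1..n. real (\<tau> j) *\<^sub>R St (j - 1) \<omega>)"

end

theory Submission
  imports Defs "HOL-Computational_Algebra.Fundamental_Theorem_Algebra" "HOL-Real_Asymp.Real_Asymp"
begin

text \<open>
  Write \<open>d n = St n - s*\<close>, where \<open>s* = mean_stat \<theta>star\<close>, and let \<open>\<Gamma>\<close> be the derivative of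
  \<open>mean_stat \<circ> \<theta>bar\<close> at the fixed point \<open>s*\<close>. Then \<open>d (n + 1) = \<Gamma> d n + r n + e (n + 1)\<close>, where \<open>r n\<close> is of
  second order in \<open>d n\<close> and \<open>e n\<close> is the sum of the Monte Carlo error and of the fluctuation of one block.

  Strong mixing makes the smoothing functional forget remote observations and initial laws
  geometrically fast. Together with the \<open>\<beta>\<close>-mixing of the observations, which lets \<open>\<theta> n\<close> be treated as
  independent of the future, this turns a sum of centred block statistics into one martingale over the
  observation times plus a term bounded in \<open>L\<^sub>p\<close> for each block, and martingale moment inequalities give
  the rate \<open>sqrt (block_end \<tau> n)\<close>.

  The linear part \<open>\<mu> n = (\<Sum>k\<le>n. \<Gamma>^(n - k) (e k))\<close> of the recursion inherits these bounds because the
  spectral radius of \<open>\<Gamma>\<close> is less than 1. On the event of convergence, \<open>d\<close> and \<open>\<mu>\<close> tend to 0 almost surely,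
  so that the quadratic remainders absorb themselves and the weighted sum of \<open>d - \<mu>\<close> is at most an almost
  surely finite factor times \<open>1 + (\<Sum>k<n. \<tau> (k + 1) * |\<mu> k|\<^sup>2)\<close>, whose \<open>L\<^sub>p\<^sub>/\<^sub>2\<close> norm is of order \<open>n\<close>.
\<close>

section \<open>Powers of a matrix\<close>

text \<open>Three obstacles shape the proof. The parameter of a block depends on the past, so
  stationarity does not apply to a block directly: the joint law of the past and of distant
  observations is compared in total variation with the product law, a distance that
  \<open>\<beta>\<close>-mixing controls. This yields geometric decay in L_1 only; interpolation
  with the moment of order \<open>pbar\<close> turns it into decay in L_p, and here p <
  \<open>pbar\<close> enters. Secondly, the expansion takes place at \<open>s*\<close>, which must
  lie in the open set \<open>SS\<close>. Limits and means of averages lie a priori only in the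
  closure of the convex hull of the values of S, so a minorization of the smoothing law and a face
  argument are needed. Lastly, the time after which the quadratic remainder is small is random, with
  no moment bound at hand. The remainder is therefore controlled path by path, the origin of the
  almost surely bounded factor. As the block sizes grow with exponent a > 1, the number n of blocks
  is at most of order \<open>sqrt (block_end \<tau> n)\<close>, which absorbs the terms bounded per
  block.\<close>

lemma linear_recursion_geometric_bound:
  fixes a :: "nat \<Rightarrow> real"
  assumes step: "\<And>k. a (Suc k) \<le> l * a k + C * r ^ k" and l: "0 \<le> l" "l < r" and C: "0 \<le> C"
  shows "\<exists>K\<ge>0. \<forall>k. a k \<le> K * r ^ k"
proof -
  \<comment> \<open>\<open>K * r ^ k\<close> has to be a supersolution: since \<open>l < r\<close>,
    the forcing fits into the gap as soon as \<open>C \<le> K * (r - l)\<close>.\<close>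
  define K where "K = max (max (a 0) 0) (C / (r - l))"
  have K: "K \<ge> 0" "a 0 \<le> K" "C \<le> K * (r - l)"
    using l C pos_divide_le_eq[of "r - l" C K] by (auto simp: K_def)
  have "a k \<le> K * r ^ k" for k
  proof (induction k)
    case (Suc k)
    have "0 \<le> r ^ k" using l by simp
    then have "C * r ^ k \<le> (K * (r - l)) * r ^ k" using mult_right_mono[OF K(3)] by blast
    then have "a (Suc k) \<le> l * (K * r ^ k) + (K * (r - l)) * r ^ k"
      using step[of k] mult_left_mono[OF Suc l(1)] by linarith
    also have "\<dots> = K * r ^ Suc k" by (simp add: algebra_simps)
    finally show ?case .
  qed (use K in simp)
  then show ?thesis using K(1) by blast
qed

lemma matrix_vector_funpow_add:
  fixes A :: "'a::field^'n^'n"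
  shows "(((*v) A) ^^ k) (x + y) = (((*v) A) ^^ k) x + (((*v) A) ^^ k) y"
  by (induction k) (auto simp: matrix_vector_right_distrib)

lemma matrix_vector_funpow_scale:
  fixes A :: "'a::field^'n^'n"
  shows "(((*v) A) ^^ k) (c *s x) = c *s (((*v) A) ^^ k) x"
  by (induction k) (auto simp: vector_scalar_commute)

lemma matrix_vector_funpow_sum:
  fixes A :: "'a::field^'n^'n"
  shows "(((*v) A) ^^ k) (\<Sum>i\<in>I. f i) = (\<Sum>i\<in>I. (((*v) A) ^^ k) (f i))"
proof (induction I rule: infinite_finite_induct)
  case empty
  then show ?case using matrix_vector_funpow_scale[of k A 0 0] by simp
next
  case (infinite I)
  then show ?case using matrix_vector_funpow_scale[of k A 0 0] by simp
qed (auto simp: matrix_vector_funpow_add)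

text \<open>The vector p(A) v. Only the action on single vectors matters, so iterates of the
  multiplication by A take the place of matrix powers.\<close>

definition mpoly_apply :: "complex poly \<Rightarrow> complex^'n^'n \<Rightarrow> complex^'n \<Rightarrow> complex^'n" where
  "mpoly_apply p A v = (\<Sum>i\<le>degree p. coeff p i *s (((*v) A) ^^ i) v)"

lemma mpoly_apply_bound:
  assumes "degree p \<le> n"
  shows "mpoly_apply p A v = (\<Sum>i\<le>n. coeff p i *s (((*v) A) ^^ i) v)"
  unfolding mpoly_apply_def using assms
  by (intro sum.mono_neutral_left) (auto simp: coeff_eq_0 not_le)

lemma mpoly_apply_add: "mpoly_apply (p + q) A v = mpoly_apply p A v + mpoly_apply q A v"
proof -
  let ?n = "max (degree p) (degree q)"
  show ?thesis
    using mpoly_apply_bound[of p ?n A v] mpoly_apply_bound[of q ?n A v]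
      mpoly_apply_bound[of "p + q" ?n A v] degree_add_le_max[of p q]
    by (simp add: vec.scale_left_distrib sum.distrib)
qed

lemma mpoly_apply_smult: "mpoly_apply (smult c p) A v = c *s mpoly_apply p A v"
  using mpoly_apply_bound[of "smult c p" "degree p" A v]
  by (simp add: mpoly_apply_def vec.scale_sum_right)

lemma mpoly_apply_pCons0: "mpoly_apply (pCons 0 p) A v = A *v mpoly_apply p A v"
proof -
  have "mpoly_apply (pCons 0 p) A v = (\<Sum>i\<le>Suc (degree p). coeff (pCons 0 p) i *s (((*v) A) ^^ i) v)"
    by (rule mpoly_apply_bound) (simp add: degree_pCons_le)
  also have "\<dots> = (\<Sum>i\<le>degree p. coeff p i *s (A *v (((*v) A) ^^ i) v))"
    by (subst sum.atMost_Suc_shift) simp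
  also have "\<dots> = A *v mpoly_apply p A v"
    by (simp add: mpoly_apply_def vec.linear_sum[of "(*v) A"] matrix_vector_mul_linear_gen vector_scalar_commute)
  finally show ?thesis .
qed

lemma mpoly_apply_linear_factor:
  "mpoly_apply ([:- l, 1:] * p) A v = A *v mpoly_apply p A v - l *s mpoly_apply p A v"
proof -
  have "[:- l, 1:] * p = smult (- l) p + pCons 0 p" by simp
  then show ?thesis
    by (simp add: mpoly_apply_add mpoly_apply_smult mpoly_apply_pCons0 del: mult_pCons_left smult_minus_left)
qed

lemma mpoly_apply_eigenvector:
  assumes "A *v v = z *s v"
  shows "mpoly_apply p A v = poly p z *s v"
proof -
  have "(((*v) A) ^^ i) v = z ^ i *s v" for i
    by (induction i) (auto simp: assms vector_scalar_commute vec.scale_scale mult.commute)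
  then show ?thesis
    by (simp add: mpoly_apply_def poly_altdef vec.scale_sum_left vec.scale_scale)
qed

lemma mpoly_apply_commute:
  "mpoly_apply p A (A *v v - l *s v) = A *v mpoly_apply p A v - l *s mpoly_apply p A v"
proof -
  have e: "A *v v - l *s v = A *v v + (- l) *s v" by simp
  have "mpoly_apply p A (A *v v - l *s v) =
     (\<Sum>i\<le>degree p. A *v (coeff p i *s (((*v) A) ^^ i) v) + (- l) *s (coeff p i *s (((*v) A) ^^ i) v))"
    unfolding mpoly_apply_def e matrix_vector_funpow_add matrix_vector_funpow_scale
    by (intro sum.cong refl)
       (simp add: vector_add_ldistrib vector_scalar_commute funpow_swap1[symmetric] vec.scale_scale mult.commute)
  also have "\<dots> = A *v mpoly_apply p A v + (- l) *s mpoly_apply p A v"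
    by (simp only: mpoly_apply_def sum.distrib vec.linear_sum[OF matrix_vector_mul_linear_gen] vec.scale_sum_right)
  finally show ?thesis by simp
qed

text \<open>Among the first \<open>CARD('n) + 1\<close> iterates either two coincide, which gives a
  difference of two monomials, or they are distinct vectors, too many to be independent. The case
  split is there because dependence concerns the set of vectors, in which a repetition is
  invisible.\<close>

lemma annihilating_poly_exists:
  fixes A :: "complex^'n^'n"
  shows "\<exists>p. p \<noteq> 0 \<and> mpoly_apply p A v = 0"
proof (cases "inj_on (\<lambda>i. (((*v) A) ^^ i) v) {..CARD('n)}")
  case True
  let ?f = "\<lambda>i. (((*v) A) ^^ i) v"
  have "card (?f ` {..CARD('n)}) > vec.dim (UNIV :: (complex^'n) set)"
    using card_image[OF True] by (simp add: vec.dim_UNIV card_cart_basis del: vec.dimension_def)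
  then have "vec.dependent (?f ` {..CARD('n)})"
    using vec.independent_card_le_dim[of "?f ` {..CARD('n)}" UNIV] by auto
  then obtain u w where u: "(\<Sum>x\<in>?f ` {..CARD('n)}. u x *s x) = 0" "w \<in> ?f ` {..CARD('n)}" "u w \<noteq> 0"
    using vec.dependent_finite[of "?f ` {..CARD('n)}"] by auto
  define p where "p = (\<Sum>i\<le>CARD('n). monom (u (?f i)) i)"
  have c: "coeff p i = (if i \<le> CARD('n) then u (?f i) else 0)" for i
    by (simp add: p_def coeff_sum sum.delta' if_distrib cong: if_cong)
  have "degree p \<le> CARD('n)" by (rule degree_le) (simp add: c)
  then have "mpoly_apply p A v = (\<Sum>i\<le>CARD('n). u (?f i) *s ?f i)"
    by (simp add: mpoly_apply_bound c)
  also have "\<dots> = 0" using u(1) by (simp add: sum.reindex[OF True])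
  finally have "mpoly_apply p A v = 0" .
  moreover obtain i where "i \<le> CARD('n)" "w = ?f i" using u(2) by auto
  then have "coeff p i \<noteq> 0" using u(3) c by simp
  then have "p \<noteq> 0" by auto
  ultimately show ?thesis by blast
next
  case False
  let ?f = "\<lambda>i. (((*v) A) ^^ i) v"
  from False obtain i' j' where ij': "?f i' = ?f j'" "i' \<noteq> j'" unfolding inj_on_def by blast
  obtain i j where ij: "?f i = ?f j" "i < j"
  proof (cases "i' < j'")
    case True
    then show ?thesis using that ij'(1) by blast
  next
    case False
    then show ?thesis using that[of j' i'] ij' by simp
  qed
  define p :: "complex poly" where "p = monom 1 j - monom 1 i"
  have c: "coeff p k = (if k = j then 1 else 0) - (if k = i then 1 else 0)" for k
    using ij by (auto simp: p_def)
  have "degree p \<le> j" by (rule degree_le) (use ij in \<open>simp add: c\<close>)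
  then have "mpoly_apply p A v = (\<Sum>k\<le>j. coeff p k *s ?f k)" by (rule mpoly_apply_bound)
  also have "\<dots> = (\<Sum>k\<le>j. (if k = j then ?f k else 0)) - (\<Sum>k\<le>j. (if k = i then ?f k else 0))"
    by (subst sum_subtractf[symmetric], intro sum.cong) (auto simp: c)
  also have "\<dots> = 0" using ij by (simp add: sum.delta)
  finally have "mpoly_apply p A v = 0" .
  moreover have "coeff p j \<noteq> 0" using ij c by simp
  then have "p \<noteq> 0" by auto
  ultimately show ?thesis by blast
qed

text \<open>The product of annihilators of the basis vectors annihilates every vector, so each
  eigenvalue is one of its roots. Finiteness is what makes the \<open>Max\<close> in
  \<open>spectral_radius\<close> an actual upper bound of the moduli.\<close>

lemma finite_eigenvalues:
  fixes A :: "complex^'n^'n"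
  shows "finite {z. \<exists>v. v \<noteq> 0 \<and> A *v v = z *s v}"
proof -
  obtain p where p: "\<And>w. p w \<noteq> 0" "\<And>w. mpoly_apply (p w) A w = 0"
    using annihilating_poly_exists[of A] by metis
  define q where "q = (\<Prod>i\<in>UNIV. p (axis i 1 :: complex^'n))"
  have q0: "q \<noteq> 0" using p by (simp add: q_def)
  have mult: "mpoly_apply (r * s) A w = 0" if "mpoly_apply s A w = 0" for r s w
  proof (induction r)
    case (pCons a r)
    have "pCons a r * s = smult a s + pCons 0 (r * s)" by simp
    then show ?case using pCons that
      by (simp add: mpoly_apply_add mpoly_apply_smult mpoly_apply_pCons0 del: mult_pCons_left)
  qed (simp add: mpoly_apply_def)
  have ann: "mpoly_apply q A (axis i 1) = 0" for i :: 'n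
    unfolding q_def by (subst prod.remove[of _ i]) (auto simp: mult.commute[of "p _"] p intro: mult)
  have all: "mpoly_apply q A v = 0" for v
  proof -
    have "v = (\<Sum>i\<in>UNIV. v $ i *s axis i 1)" by (simp add: basis_expansion)
    then have "mpoly_apply q A v = mpoly_apply q A (\<Sum>i\<in>UNIV. v $ i *s axis i 1)" by simp
    also have "\<dots> = (\<Sum>i\<in>UNIV. v $ i *s mpoly_apply q A (axis i 1))"
      unfolding mpoly_apply_def matrix_vector_funpow_sum matrix_vector_funpow_scale vec.scale_sum_right
      by (subst sum.swap) (simp add: vec.scale_scale mult.commute)
    finally show ?thesis by (simp add: ann)
  qed
  have "{z. \<exists>v. v \<noteq> 0 \<and> A *v v = z *s v} \<subseteq> {z. poly q z = 0}"
  proof safe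
    fix z v assume "v \<noteq> 0" "A *v v = z *s v"
    then show "poly q z = 0" using all[of v] mpoly_apply_eigenvector[of A v z q] by simp
  qed
  then show ?thesis using poly_roots_finite[OF q0] finite_subset by blast
qed

lemma norm_vector_scale: "norm (c *s (v :: complex^'n)) = norm c * norm v"
  by (simp add: norm_vec_def norm_mult L2_set_right_distrib)

text \<open>Induction on the linear factors of a polynomial annihilating the vector: factors whose root
  is not an eigenvalue can be cancelled.\<close>

lemma eigenvalue_power_bound:
  fixes A :: "complex^'n^'n"
  assumes ev: "\<And>z v. v \<noteq> 0 \<Longrightarrow> A *v v = z *s v \<Longrightarrow> norm z < g"
  shows "\<exists>K\<ge>0. \<forall>k. norm ((((*v) A) ^^ k) v) \<le> K * g ^ k"
proof -
  have "\<forall>v. mpoly_apply p A v = 0 \<longrightarrow> (\<exists>K\<ge>0. \<forall>k. norm ((((*v) A) ^^ k) v) \<le> K * g ^ k)"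
    if "p \<noteq> 0" "degree p = n" for p n
    using that
  proof (induction n arbitrary: p)
    case 0
    then obtain c where c: "p = [:c:]" "c \<noteq> 0" by (metis degree_eq_zeroE pCons_0_0)
    have z: "(((*v) A) ^^ k) 0 = 0" for k using matrix_vector_funpow_scale[of k A 0 0] by simp
    show ?case using c by (auto simp: mpoly_apply_def z vec.scale_eq_0_iff intro: exI[of _ 0])
  next
    case (Suc n)
    then obtain l where "poly p l = 0"
      using fundamental_theorem_of_algebra[of p] by (auto simp: constant_degree)
    then obtain q where q: "p = [:- l, 1:] * q" by (auto simp: poly_eq_0_iff_dvd elim: dvdE)
    with Suc.prems have q': "q \<noteq> 0" by auto
    have "degree p = degree [:- l, 1:] + degree q"
      unfolding q by (rule degree_mult_eq) (use q' in auto)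
    with Suc.prems have q'': "degree q = n" by simp
    note IH = Suc.IH[OF q' q'']
    show ?case
    proof (intro allI impI)
      fix v assume v: "mpoly_apply p A v = 0"
      then have pv: "A *v mpoly_apply q A v = l *s mpoly_apply q A v"
        by (simp add: q mpoly_apply_linear_factor del: mult_pCons_left)
      show "\<exists>K\<ge>0. \<forall>k. norm ((((*v) A) ^^ k) v) \<le> K * g ^ k"
      proof (cases "norm l < g")
        case False
        \<comment> \<open>Otherwise this vector would be an eigenvector whose eigenvalue
          \<open>l\<close> has modulus at least \<open>g\<close>. The factor is thus
          cancelled.\<close>
        then have "mpoly_apply q A v = 0" using ev pv by blast
        then show ?thesis using IH by blast
      next
        case True
        \<comment> \<open>The remaining factor \<open>q\<close> annihilates \<open>w\<close>, so by
          induction \<open>w\<close> acts on the iterates of \<open>v\<close> as a forcing term of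
          rate \<open>g\<close>, while their own rate \<open>norm l\<close> is smaller.\<close>
        define w where "w = A *v v - l *s v"
        have "mpoly_apply q A w = 0" unfolding w_def mpoly_apply_commute using pv by simp
        with IH obtain C where C: "C \<ge> 0" "\<And>k. norm ((((*v) A) ^^ k) w) \<le> C * g ^ k" by blast
        show ?thesis
        proof (rule linear_recursion_geometric_bound[where l = "norm l" and C = C])
          fix k
          have "A *v v = l *s v + w" by (simp add: w_def)
          then have "(((*v) A) ^^ Suc k) v = l *s (((*v) A) ^^ k) v + (((*v) A) ^^ k) w"
            by (simp only: funpow_Suc_right o_apply matrix_vector_funpow_add matrix_vector_funpow_scale)
          then show "norm ((((*v) A) ^^ Suc k) v) \<le> norm l * norm ((((*v) A) ^^ k) v) + C * g ^ k"
            using norm_triangle_ineq[of "l *s (((*v) A) ^^ k) v" "(((*v) A) ^^ k) w"] C(2)[of k]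
            by (simp only: norm_vector_scale)
        qed (use True C in auto)
      qed
    qed
  qed
  then show ?thesis using annihilating_poly_exists[of A v] by blast
qed

text \<open>Real vectors embed isometrically into the complex ones, with the same iterates. The
  constant found there depends on the vector; expanding in unit vectors and summing their constants
  makes it uniform.\<close>

lemma spectral_radius_power_bound:
  fixes A :: "real^'n^'n"
  assumes sr: "spectral_radius A < g" and g: "0 < g"
  shows "\<exists>K\<ge>0. \<forall>k v. norm ((((*v) A) ^^ k) v) \<le> K * g ^ k * norm v"
proof -
  let ?A = "map_matrix complex_of_real A"
  let ?c = "\<lambda>v::real^'n. (\<chi> i. complex_of_real (v $ i))"
  have set_eq: "{norm z |z. \<exists>v. v \<noteq> 0 \<and> ?A *v v = z *s v} = norm ` {z. \<exists>v. v \<noteq> 0 \<and> ?A *v v = z *s v}"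
    by auto
  have ev: "norm z < g" if "v \<noteq> 0" "?A *v v = z *s v" for z v
  proof -
    have "norm z \<le> spectral_radius A"
      unfolding spectral_radius_def set_eq
      by (rule Max_ge) (use that in \<open>auto intro!: finite_imageI finite_eigenvalues\<close>)
    with sr show ?thesis by simp
  qed
  have hom: "?A *v ?c v = ?c (A *v v)" for v
    by (simp add: vec_eq_iff matrix_vector_mult_def map_matrix_def)
  have homk: "(((*v) ?A) ^^ k) (?c v) = ?c ((((*v) A) ^^ k) v)" for k v
    by (induction k) (auto simp: hom)
  have nc: "norm (?c v) = norm v" for v by (simp add: norm_vec_def)
  have "\<exists>K\<ge>0. \<forall>k. norm ((((*v) A) ^^ k) v) \<le> K * g ^ k" for v
    using eigenvalue_power_bound[of ?A g "?c v"] ev by (simp add: homk nc)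
  then obtain K where K: "\<And>v. K v \<ge> 0" "\<And>v k. norm ((((*v) A) ^^ k) v) \<le> K v * g ^ k" by metis
  define C where "C = (\<Sum>i\<in>UNIV. K (axis i 1))"
  have "norm ((((*v) A) ^^ k) v) \<le> C * g ^ k * norm v" for k v
  proof -
    have "v = (\<Sum>i\<in>UNIV. v $ i *s axis i 1)" by (simp add: basis_expansion)
    then have "(((*v) A) ^^ k) v = (\<Sum>i\<in>UNIV. v $ i *s (((*v) A) ^^ k) (axis i 1))"
      by (metis (no_types, lifting) matrix_vector_funpow_scale matrix_vector_funpow_sum sum.cong)
    then have "norm ((((*v) A) ^^ k) v) \<le> (\<Sum>i\<in>UNIV. norm (v $ i *s (((*v) A) ^^ k) (axis i 1)))"
      by (simp only: norm_sum)
    also have "\<dots> \<le> (\<Sum>i\<in>UNIV. norm v * (K (axis i 1) * g ^ k))"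
    proof (rule sum_mono)
      fix i :: 'n
      show "norm (v $ i *s (((*v) A) ^^ k) (axis i 1)) \<le> norm v * (K (axis i 1) * g ^ k)"
        using K component_le_norm_cart[of v i]
        by (auto simp: scalar_mult_eq_scaleR intro!: mult_mono)
    qed
    also have "\<dots> = C * g ^ k * norm v"
      by (simp add: C_def sum_distrib_left sum_distrib_right mult_ac)
    finally show ?thesis .
  qed
  moreover have "C \<ge> 0" by (simp add: C_def K sum_nonneg)
  ultimately show ?thesis by blast
qed

section \<open>Second-order Taylor bounds\<close>

text \<open>Differentiability of the first derivative at \<open>x0\<close> bounds its variation
  linearly near \<open>x0\<close>, and the mean value inequality on a ball of radius
  \<open>norm (x - x0)\<close> turns this into the square. The bound is restricted to
  \<open>A\<close> because \<open>f\<close> agrees with its smooth extension only there.\<close>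

lemma C2_on_quadratic_bound:
  fixes f :: "'a::euclidean_space \<Rightarrow> 'b::euclidean_space"
  assumes "C2_on f A" "x0 \<in> A"
  shows "\<exists>f' K d. bounded_linear f' \<and> d > 0 \<and> K \<ge> 0 \<and>
    (\<forall>x\<in>A. dist x x0 < d \<longrightarrow> norm (f x - f x0 - f' (x - x0)) \<le> K * norm (x - x0) ^ 2)"
proof -
  obtain U F and F' :: "'a \<Rightarrow> 'a \<Rightarrow>\<^sub>L 'b" and F'' :: "'a \<Rightarrow> 'a \<Rightarrow>\<^sub>L ('a \<Rightarrow>\<^sub>L 'b)"
    where U: "open U" "A \<subseteq> U" "\<And>x. x \<in> A \<Longrightarrow> F x = f x"
    and F': "\<And>x. x \<in> U \<Longrightarrow> (F has_derivative F' x) (at x)"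
    and F'': "\<And>x. x \<in> U \<Longrightarrow> (F' has_derivative F'' x) (at x)"
    using assms(1) unfolding C2_on_def by metis
  have x0: "x0 \<in> U" using assms U by auto
  let ?K = "onorm (F'' x0) + 1"
  have "(F' has_derivative F'' x0) (at x0 within UNIV)" using F''[OF x0] by simp
  then obtain d1 where d1: "d1 > 0"
    "\<And>x. norm (x - x0) < d1 \<Longrightarrow> norm (F' x - F' x0 - F'' x0 (x - x0)) \<le> 1 * norm (x - x0)"
    unfolding has_derivative_within_alt by (metis UNIV_I zero_less_one)
  obtain d2 where d2: "d2 > 0" "ball x0 d2 \<subseteq> U" using U(1) x0 openE by blast
  let ?d = "min d1 d2"
  have Kb: "norm (F' x - F' x0) \<le> ?K * norm (x - x0)" if "norm (x - x0) < d1" for x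
  proof -
    have "norm (F' x - F' x0) \<le> norm (F' x - F' x0 - F'' x0 (x - x0)) + norm (F'' x0 (x - x0))"
      by (metis diff_add_cancel norm_triangle_ineq)
    also have "norm (F'' x0 (x - x0)) \<le> onorm (F'' x0) * norm (x - x0)"
      by (rule onorm) (rule blinfun.bounded_linear_right)
    finally show ?thesis using d1(2)[OF that] by (simp add: algebra_simps)
  qed
  have K0: "?K \<ge> 0" using onorm_pos_le[OF blinfun.bounded_linear_right[of "F'' x0"]] by simp
  have main: "norm (F x - F x0 - F' x0 (x - x0)) \<le> ?K * norm (x - x0) ^ 2" if x: "dist x x0 < ?d" for x
  proof -
    let ?r = "norm (x - x0)"
    have r: "?r < d1" "?r < d2" using x by (auto simp: dist_norm)
    have "norm (F x - F x0 - F' x0 (x - x0)) \<le> norm (x - x0) * (?K * ?r)"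
    proof (rule differentiable_bound_linearization[where S = "cball x0 ?r" and f' = F'])
      fix t :: real assume t: "t \<in> {0..1}"
      show "x0 + t *\<^sub>R (x - x0) \<in> cball x0 ?r"
        using t by (simp add: dist_norm mult_left_le_one_le)
    next
      fix z assume z: "z \<in> cball x0 ?r"
      then have zr: "norm (z - x0) \<le> ?r" by (simp add: dist_norm norm_minus_commute)
      have "z \<in> U" using z d2 r by (auto simp: subset_iff)
      then show "(F has_derivative F' z) (at z within cball x0 ?r)"
        using F' has_derivative_at_withinI by blast
      have "norm (F' z - F' x0) \<le> ?K * norm (z - x0)" using Kb zr r by force
      also have "\<dots> \<le> ?K * ?r" using zr K0 by (intro mult_left_mono)
      finally show "onorm (blinfun_apply (F' z) - blinfun_apply (F' x0)) \<le> ?K * ?r"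
        by (simp add: norm_blinfun.rep_eq minus_blinfun.rep_eq fun_diff_def)
    qed auto
    then show ?thesis by (simp add: power2_eq_square mult_ac)
  qed
  have fin: "\<forall>x\<in>A. dist x x0 < ?d \<longrightarrow> norm (f x - f x0 - F' x0 (x - x0)) \<le> ?K * norm (x - x0) ^ 2"
    using main U(3) assms(2) by metis
  have "?d > 0" using d1 d2 by simp
  then show ?thesis using fin K0 blinfun.bounded_linear_right[of "F' x0"] by blast
qed

section \<open>Bounds in Lebesgue spaces\<close>

lemma integrable_dominated_nonneg:
  fixes f g :: "'a \<Rightarrow> real"
  assumes "integrable M g" "f \<in> borel_measurable M" "\<And>x. 0 \<le> f x" "\<And>x. f x \<le> g x"
  shows "integrable M f"
  by (rule Bochner_Integration.integrable_bound[OF assms(1,2)])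
     (intro AE_I2, metis assms(3,4) abs_of_nonneg order_trans real_norm_def)

text \<open>A bound c on the L_p norm of a real random variable, written with p-th powers so that no
  root of an integral appears. Integrability is part of it because a non-integrable power has
  integral 0.\<close>

definition Lp_le :: "'w measure \<Rightarrow> real \<Rightarrow> ('w \<Rightarrow> real) \<Rightarrow> real \<Rightarrow> bool" where
  "Lp_le M p X c \<longleftrightarrow> X \<in> borel_measurable M \<and> integrable M (\<lambda>\<omega>. \<bar>X \<omega>\<bar> powr p) \<and> 0 \<le> c \<and>
     (\<integral>\<omega>. \<bar>X \<omega>\<bar> powr p \<partial>M) \<le> c powr p"

lemma Lp_leD:
  assumes "Lp_le M p X c"
  shows "X \<in> borel_measurable M" "integrable M (\<lambda>\<omega>. \<bar>X \<omega>\<bar> powr p)" "0 \<le> c"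
    "(\<integral>\<omega>. \<bar>X \<omega>\<bar> powr p \<partial>M) \<le> c powr p"
  using assms by (auto simp: Lp_le_def)

lemma Lp_le_mono: "Lp_le M p X c \<Longrightarrow> c \<le> d \<Longrightarrow> 0 \<le> p \<Longrightarrow> Lp_le M p X d"
  unfolding Lp_le_def by (auto intro: order_trans powr_mono2)

lemma Lp_le_dominated:
  assumes X: "Lp_le M p X c" and Y: "Y \<in> borel_measurable M" "AE \<omega> in M. \<bar>Y \<omega>\<bar> \<le> \<bar>X \<omega>\<bar>" and p: "0 \<le> p"
  shows "Lp_le M p Y c"
proof -
  have ae: "AE \<omega> in M. \<bar>Y \<omega>\<bar> powr p \<le> \<bar>X \<omega>\<bar> powr p"
    using Y(2) by eventually_elim (auto intro: powr_mono2 p)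
  have int: "integrable M (\<lambda>\<omega>. \<bar>Y \<omega>\<bar> powr p)"
    by (rule Bochner_Integration.integrable_bound[OF Lp_leD(2)[OF X]]) (use Y(1) ae in auto)
  show ?thesis
    using integral_mono_AE[OF int Lp_leD(2)[OF X] ae] X Y(1) int unfolding Lp_le_def by auto
qed

lemma Lp_le_cmult:
  assumes "Lp_le M p X c" shows "Lp_le M p (\<lambda>\<omega>. a * X \<omega>) (\<bar>a\<bar> * c)"
  using assms unfolding Lp_le_def
  by (auto simp: abs_mult powr_mult intro: mult_left_mono)

lemma Lp_le_const: "prob_space M \<Longrightarrow> Lp_le M p (\<lambda>_. c) \<bar>c\<bar>"
  unfolding Lp_le_def by (simp add: prob_space.prob_space prob_space.finite_measure finite_measure.integrable_const)

lemma Lp_le_zero: "Lp_le M p (\<lambda>_. 0) 0"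
  by (simp add: Lp_le_def)

lemma powr_convex_comb:
  assumes "p \<ge> 1" "0 \<le> (x::real)" "0 \<le> y" "0 \<le> u" "0 \<le> v" "u + v = 1"
  shows "(u * x + v * y) powr p \<le> u * x powr p + v * y powr p"
proof -
  have le: "u powr p \<le> u" if "0 \<le> u" "u \<le> 1" for u :: real
    using powr_mono'[of 1 p u] that assms(1) by (cases "u = 0") auto
  consider "x = 0" | "y = 0" | "x > 0" "y > 0" using assms by linarith
  then show ?thesis
  proof cases
    case 3
    have "u = 1 - v" using assms by simp
    show ?thesis unfolding \<open>u = 1 - v\<close>
      using convex_onD[OF powr_convex[OF assms(1)], of v x y] assms 3 by simp
  qed (use assms le[of u] le[of v] in \<open>auto simp: powr_mult intro!: mult_right_mono\<close>)
qed

text \<open>Convexity of the p-th power at |x| / c and |y| / d with weights c / (c + d) and d / (c +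
  d). In this form it integrates to Minkowski's inequality when c and d bound the two norms.\<close>

lemma abs_add_powr_le:
  assumes "p \<ge> 1" "c > 0" "d > 0"
  shows "\<bar>x + y\<bar> powr p \<le> (c + d :: real) powr p * (c / (c + d) * ((\<bar>x\<bar> powr p) / c powr p) + d / (c + d) * ((\<bar>y\<bar> powr p) / d powr p))"
proof -
  have "\<bar>x + y\<bar> powr p \<le> (\<bar>x\<bar> + \<bar>y\<bar>) powr p" using assms by (intro powr_mono2) auto
  also have "\<bar>x\<bar> + \<bar>y\<bar> = (c + d) * (c / (c + d) * (\<bar>x\<bar> / c) + d / (c + d) * (\<bar>y\<bar> / d))"
    using assms by (simp add: add_divide_distrib[symmetric])
  also have "\<dots> powr p = (c + d) powr p * (c / (c + d) * (\<bar>x\<bar> / c) + d / (c + d) * (\<bar>y\<bar> / d)) powr p"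
    by (rule powr_mult)
  also have "\<dots> \<le> (c + d) powr p * (c / (c + d) * (\<bar>x\<bar> / c) powr p + d / (c + d) * (\<bar>y\<bar> / d) powr p)"
    using assms by (intro mult_left_mono powr_convex_comb) (auto simp: add_divide_distrib[symmetric])
  finally show ?thesis using assms by (simp add: powr_divide)
qed

lemma Lp_le_add:
  assumes p: "p \<ge> 1" and X: "Lp_le M p X c" and Y: "Lp_le M p Y d"
  shows "Lp_le M p (\<lambda>\<omega>. X \<omega> + Y \<omega>) (c + d)"
proof -
  have null: "AE \<omega> in M. Z \<omega> = 0" if "Lp_le M p Z 0" for Z
  proof -
    have "(\<integral>\<omega>. \<bar>Z \<omega>\<bar> powr p \<partial>M) = 0"
      using Lp_leD(4)[OF that] p Bochner_Integration.integral_nonneg[of M "\<lambda>\<omega>. \<bar>Z \<omega>\<bar> powr p"] by (simp add: order_antisym)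
    then show ?thesis
      using integral_nonneg_eq_0_iff_AE[OF Lp_leD(2)[OF that]] by auto
  qed
  have [measurable]: "X \<in> borel_measurable M" "Y \<in> borel_measurable M" using X Y Lp_leD by auto
  \<comment> \<open>The weights degenerate when a bound vanishes, but the variable is then null
    almost everywhere.\<close>
  consider "c = 0" | "d = 0" | "c > 0" "d > 0" using Lp_leD(3)[OF X] Lp_leD(3)[OF Y] by linarith
  then show ?thesis
  proof cases
    case 1
    then have "AE \<omega> in M. X \<omega> = 0" using null X by simp
    then show ?thesis using 1 p by (auto intro!: Lp_le_dominated[OF Y])
  next
    case 2
    then have "AE \<omega> in M. Y \<omega> = 0" using null Y by simp
    then show ?thesis using 2 p by (auto intro!: Lp_le_dominated[OF X])
  next
    case 3
    let ?b = "\<lambda>\<omega>. (c + d) powr p * (c / (c + d) * ((\<bar>X \<omega>\<bar> powr p) / c powr p) + d / (c + d) * ((\<bar>Y \<omega>\<bar> powr p) / d powr p))"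
    have le: "\<bar>X \<omega> + Y \<omega>\<bar> powr p \<le> ?b \<omega>" for \<omega> using abs_add_powr_le[OF p 3] .
    have ib: "integrable M ?b" using Lp_leD(2)[OF X] Lp_leD(2)[OF Y] by auto
    have int: "integrable M (\<lambda>\<omega>. \<bar>X \<omega> + Y \<omega>\<bar> powr p)"
      by (rule integrable_dominated_nonneg[OF ib _ _ le]) auto
    have "(\<integral>\<omega>. \<bar>X \<omega> + Y \<omega>\<bar> powr p \<partial>M) \<le> (\<integral>\<omega>. ?b \<omega> \<partial>M)" by (rule integral_mono[OF int ib le])
    also have "\<dots> = (c + d) powr p * (c / (c + d) * ((\<integral>\<omega>. \<bar>X \<omega>\<bar> powr p \<partial>M) / c powr p) + d / (c + d) * ((\<integral>\<omega>. \<bar>Y \<omega>\<bar> powr p \<partial>M) / d powr p))"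
      using Lp_leD(2)[OF X] Lp_leD(2)[OF Y] by simp
    also have "\<dots> \<le> (c + d) powr p * (c / (c + d) * 1 + d / (c + d) * 1)"
      using Lp_leD(4)[OF X] Lp_leD(4)[OF Y] 3 by (intro mult_left_mono add_mono) auto
    also have "\<dots> = (c + d) powr p" using 3 by (simp add: add_divide_distrib[symmetric])
    finally show ?thesis using int 3 by (simp add: Lp_le_def)
  qed
qed

lemma Lp_le_sum:
  assumes p: "p \<ge> 1" and "\<And>i. i \<in> I \<Longrightarrow> Lp_le M p (X i) (c i)" "finite I"
  shows "Lp_le M p (\<lambda>\<omega>. \<Sum>i\<in>I. X i \<omega>) (\<Sum>i\<in>I. c i)"
  using assms(3,2)
proof (induction I rule: finite_induct)
  case (insert i I)
  then have "Lp_le M p (\<lambda>\<omega>. X i \<omega> + (\<Sum>i\<in>I. X i \<omega>)) (c i + (\<Sum>i\<in>I. c i))"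
    by (intro Lp_le_add[OF p]) auto
  then show ?case using insert by simp
qed (simp add: Lp_le_zero)

lemma Lp_le_diff:
  assumes "p \<ge> 1" "Lp_le M p X c" "Lp_le M p Y d"
  shows "Lp_le M p (\<lambda>\<omega>. X \<omega> - Y \<omega>) (c + d)"
  using Lp_le_add[OF assms(1,2) Lp_le_cmult[OF assms(3), of "-1"]] by simp

lemma Lp_le_integrable:
  assumes "finite_measure M" "p \<ge> 1" "Lp_le M p X c" shows "integrable M X"
proof (rule Bochner_Integration.integrable_bound)
  show "integrable M (\<lambda>\<omega>. 1 + \<bar>X \<omega>\<bar> powr p)"
    using Lp_leD(2)[OF assms(3)] finite_measure.integrable_const[OF assms(1), of "1::real"] by auto
  have "\<bar>x\<bar> \<le> 1 + \<bar>x\<bar> powr p" for x :: real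
    using powr_mono[of 1 p "\<bar>x\<bar>"] assms(2) by (cases "\<bar>x\<bar> \<ge> 1") (auto simp: add_increasing2)
  then show "AE \<omega> in M. norm (X \<omega>) \<le> norm (1 + \<bar>X \<omega>\<bar> powr p)" by (auto intro: order_trans)
qed (use Lp_leD(1)[OF assms(3)] in auto)

text \<open>Young's inequality for the product of t^q, raised to p / q, with 1. The affine weights
  make norms of different orders comparable without a change of the constant.\<close>

lemma powr_le_affine_powr:
  assumes "0 < p" "p \<le> q" "0 \<le> (t::real)"
  shows "t powr p \<le> (1 - p / q) + p / q * t powr q"
proof (cases "t = 0")
  case False
  have "(t powr q) powr (p / q) * 1 powr (1 - p / q) \<le> (p / q) * t powr q + (1 - p / q) * 1"
    using assms False by (intro Youngs_inequality_0) (auto simp: field_simps)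
  then show ?thesis using assms by (simp add: powr_powr)
qed (use assms in auto)

lemma Lp_le_exponent_mono:
  assumes M: "prob_space M" and pq: "0 < p" "p \<le> q" and X: "Lp_le M q X c" and c: "0 < c"
  shows "Lp_le M p X c"
proof -
  interpret prob_space M by fact
  let ?b = "\<lambda>\<omega>. c powr p * ((1 - p / q) + p / q * (\<bar>X \<omega>\<bar> powr q / c powr q))"
  have [measurable]: "X \<in> borel_measurable M" using X Lp_leD by auto
  have le: "\<bar>X \<omega>\<bar> powr p \<le> ?b \<omega>" for \<omega>
  proof -
    have "\<bar>X \<omega>\<bar> powr p = c powr p * (\<bar>X \<omega>\<bar> / c) powr p" using c by (simp add: powr_divide)
    also have "\<dots> \<le> c powr p * ((1 - p / q) + p / q * (\<bar>X \<omega>\<bar> / c) powr q)"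
      using pq c by (intro mult_left_mono powr_le_affine_powr) auto
    finally show ?thesis using c by (simp add: powr_divide)
  qed
  have ib: "integrable M ?b" using Lp_leD(2)[OF X] by auto
  have int: "integrable M (\<lambda>\<omega>. \<bar>X \<omega>\<bar> powr p)"
    by (rule integrable_dominated_nonneg[OF ib _ _ le]) auto
  have "(\<integral>\<omega>. \<bar>X \<omega>\<bar> powr p \<partial>M) \<le> (\<integral>\<omega>. ?b \<omega> \<partial>M)" by (rule integral_mono[OF int ib le])
  also have "\<dots> = c powr p * ((1 - p / q) + p / q * ((\<integral>\<omega>. \<bar>X \<omega>\<bar> powr q \<partial>M) / c powr q))"
    using Lp_leD(2)[OF X] by (simp add: prob_space)
  also have "\<dots> \<le> c powr p * ((1 - p / q) + p / q * 1)"
    using Lp_leD(4)[OF X] c pq by (intro mult_left_mono add_mono) auto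
  finally show ?thesis using int c by (simp add: Lp_le_def)
qed

text \<open>Exchanges integrability for decay: a small L_1 norm and a bounded L_q norm give an L_p
  norm small by a power of \<open>e\<close>. Values below a threshold are charged to the first
  moment, values above it to the q-th.\<close>

lemma Lp_le_interpolate:
  assumes M: "prob_space M" and pq: "1 < p" "p < q" and X: "Lp_le M q X c" and c: "0 < c"
    and e: "0 < e" "(\<integral>\<omega>. \<bar>X \<omega>\<bar> \<partial>M) \<le> c * e"
  shows "Lp_le M p X (2 * c * e powr ((q - p) / (p * (q - 1))))"
proof -
  interpret prob_space M by fact
  have [measurable]: "X \<in> borel_measurable M" using X Lp_leD by auto
  \<comment> \<open>This threshold makes the bounds for the small and for the large values equal,
    both being \<open>c powr p * e powr ((q - p) / (q - 1))\<close>.\<close>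
  define K where "K = c * e powr (- 1 / (q - 1))"
  have K: "K > 0" using c e by (simp add: K_def)
  let ?b = "\<lambda>\<omega>. K powr (p - 1) * \<bar>X \<omega>\<bar> + K powr (p - q) * \<bar>X \<omega>\<bar> powr q"
  have le: "\<bar>X \<omega>\<bar> powr p \<le> ?b \<omega>" for \<omega>
  proof (cases "\<bar>X \<omega>\<bar> \<le> K")
    case True
    have "\<bar>X \<omega>\<bar> powr p = \<bar>X \<omega>\<bar> powr (p - 1) * \<bar>X \<omega>\<bar>"
      using powr_add[of "\<bar>X \<omega>\<bar>" "p - 1" 1] by simp
    also have "\<dots> \<le> K powr (p - 1) * \<bar>X \<omega>\<bar>"
      using pq True by (intro mult_right_mono powr_mono2) auto
    finally show ?thesis by (simp add: add_increasing2)
  next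
    case False
    have "\<bar>X \<omega>\<bar> powr p = \<bar>X \<omega>\<bar> powr (p - q) * \<bar>X \<omega>\<bar> powr q"
      by (simp add: powr_add[symmetric])
    also have "\<dots> \<le> K powr (p - q) * \<bar>X \<omega>\<bar> powr q"
      using pq False K by (intro mult_right_mono powr_mono2') auto
    finally show ?thesis by (simp add: add_increasing)
  qed
  have iX: "integrable M X" by (rule Lp_le_integrable[OF finite_measure_axioms _ X]) (use pq in simp)
  have ib: "integrable M ?b" using Lp_leD(2)[OF X] iX by auto
  have int: "integrable M (\<lambda>\<omega>. \<bar>X \<omega>\<bar> powr p)"
    by (rule integrable_dominated_nonneg[OF ib _ _ le]) auto
  let ?d = "(q - p) / (q - 1)"
  have e1: "K powr (p - 1) * (c * e) = c powr p * e powr ?d"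
  proof -
    have "K powr (p - 1) * (c * e) = (c powr (p - 1) * c powr 1) * (e powr (- 1 / (q - 1) * (p - 1)) * e powr 1)"
      using c e by (simp add: K_def powr_mult powr_powr)
    also have "\<dots> = c powr p * e powr (- 1 / (q - 1) * (p - 1) + 1)"
      by (simp only: powr_add[symmetric]) simp
    also have "- 1 / (q - 1) * (p - 1) + 1 = ?d" using pq by (simp add: field_simps)
    finally show ?thesis .
  qed
  have e2: "K powr (p - q) * c powr q = c powr p * e powr ?d"
  proof -
    have "K powr (p - q) * c powr q = (c powr (p - q) * c powr q) * e powr (- 1 / (q - 1) * (p - q))"
      using c e by (simp add: K_def powr_mult powr_powr)
    also have "\<dots> = c powr p * e powr (- 1 / (q - 1) * (p - q))"
      by (simp only: powr_add[symmetric]) simp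
    also have "- 1 / (q - 1) * (p - q) = ?d" using pq by (simp add: field_simps)
    finally show ?thesis .
  qed
  have "(\<integral>\<omega>. \<bar>X \<omega>\<bar> powr p \<partial>M) \<le> (\<integral>\<omega>. ?b \<omega> \<partial>M)" by (rule integral_mono[OF int ib le])
  also have "\<dots> = K powr (p - 1) * (\<integral>\<omega>. \<bar>X \<omega>\<bar> \<partial>M) + K powr (p - q) * (\<integral>\<omega>. \<bar>X \<omega>\<bar> powr q \<partial>M)"
    using Lp_leD(2)[OF X] iX by simp
  also have "\<dots> \<le> K powr (p - 1) * (c * e) + K powr (p - q) * c powr q"
    using Lp_leD(4)[OF X] e by (intro add_mono mult_left_mono) auto
  also have "\<dots> = 2 * (c powr p * e powr ?d)" using e1 e2 by simp
  also have "\<dots> \<le> 2 powr p * (c powr p * e powr ?d)"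
    using pq powr_mono[of 1 p 2] by (intro mult_right_mono) auto
  also have "\<dots> = (2 * c * e powr (?d / p)) powr p"
    using c e pq by (simp add: powr_mult powr_powr)
  also have "?d / p = (q - p) / (p * (q - 1))" by (simp add: mult.commute)
  finally show ?thesis using int c by (simp add: Lp_le_def)
qed

lemma convex_on_abs_powr:
  assumes "p \<ge> 1" shows "convex_on UNIV (\<lambda>x::real. \<bar>x\<bar> powr p)"
proof (rule convex_onI)
  fix t x y :: real assume t: "0 < t" "t < 1"
  have "\<bar>(1 - t) *\<^sub>R x + t *\<^sub>R y\<bar> powr p \<le> ((1 - t) * \<bar>x\<bar> + t * \<bar>y\<bar>) powr p"
    using t assms by (intro powr_mono2) (auto simp: abs_mult intro!: order_trans[OF abs_triangle_ineq])
  also have "\<dots> \<le> (1 - t) * \<bar>x\<bar> powr p + t * \<bar>y\<bar> powr p"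
    using t assms by (intro powr_convex_comb) auto
  finally show "\<bar>(1 - t) *\<^sub>R x + t *\<^sub>R y\<bar> powr p \<le> (1 - t) * \<bar>x\<bar> powr p + t * \<bar>y\<bar> powr p" .
qed simp

lemma Lp_le_cond_exp:
  assumes M: "prob_space M" and F: "subalgebra M F" and p: "p \<ge> 1" and X: "Lp_le M p X c"
  shows "Lp_le M p (real_cond_exp M F X) c"
proof -
  interpret prob_space M by fact
  interpret finite_measure_subalgebra M F by (simp add: finite_measure_subalgebra_axioms_def finite_measure_subalgebra_def finite_measure_axioms F)
  interpret sigma_finite_subalgebra M F using finite_measure_subalgebra_axioms by (rule finite_measure_subalgebra_is_sigma_finite)
  have iX: "integrable M X" by (rule Lp_le_integrable[OF finite_measure_axioms p X])
  note J = iX _ _ Lp_leD(2)[OF X] convex_on_abs_powr[OF p]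
  have ae: "AE \<omega> in M. \<bar>real_cond_exp M F X \<omega>\<bar> powr p \<le> real_cond_exp M F (\<lambda>\<omega>. \<bar>X \<omega>\<bar> powr p) \<omega>"
    by (rule real_cond_exp_jensens_inequality(2)[OF J]) auto
  have int: "integrable M (\<lambda>\<omega>. \<bar>real_cond_exp M F X \<omega>\<bar> powr p)"
    by (rule integrable_convex_cond_exp[OF J]) auto
  have "(\<integral>\<omega>. \<bar>real_cond_exp M F X \<omega>\<bar> powr p \<partial>M) \<le> (\<integral>\<omega>. real_cond_exp M F (\<lambda>\<omega>. \<bar>X \<omega>\<bar> powr p) \<omega> \<partial>M)"
    using real_cond_exp_int(1)[OF Lp_leD(2)[OF X]] by (intro integral_mono_AE int ae)
  also have "\<dots> = (\<integral>\<omega>. \<bar>X \<omega>\<bar> powr p \<partial>M)" by (rule real_cond_exp_int(2)[OF Lp_leD(2)[OF X]])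
  finally show ?thesis using X int unfolding Lp_le_def by auto
qed

section \<open>Moments of martingales\<close>

lemma exp_le_quadratic:
  assumes "\<bar>u\<bar> \<le> (1::real)" shows "exp u \<le> 1 + u + u\<^sup>2"
proof (cases "u \<ge> 0")
  case True
  then show ?thesis using exp_bound[of u] assms by simp
next
  case False
  have "(1 - u) * (1 + u + u\<^sup>2) = 1 - u ^ 3" by (simp add: algebra_simps power2_eq_square power3_eq_cube)
  moreover have "u ^ 3 \<le> 0" using False by (simp add: power_le_zero_eq)
  ultimately have "1 / (1 - u) \<le> 1 + u + u\<^sup>2" using False by (simp add: pos_divide_le_eq mult.commute)
  moreover have "exp u \<le> 1 / (1 - u)"
    using exp_ge_add_one_self[of "- u"] False by (simp add: exp_minus field_simps)
  ultimately show ?thesis by linarith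
qed

text \<open>For small t the exponential gives the expansion. When p |t| > 1 the left side is at most
  the p-th power of (p + 1) |t|, and a negative linear term is outweighed by p^2 t^2.\<close>

lemma abs_one_plus_powr_le:
  assumes p: "p \<ge> (2::real)"
  shows "\<bar>1 + t\<bar> powr p \<le> 1 + p * t + ((p + 1) powr p + p\<^sup>2) * (t\<^sup>2 + \<bar>t\<bar> powr p)"
proof (cases "p * \<bar>t\<bar> \<le> 1")
  case True
  then have pt: "\<bar>p * t\<bar> \<le> 1" using p by (simp add: abs_mult)
  have "1 + t \<ge> 0"
  proof -
    have "1 * \<bar>t\<bar> \<le> p * \<bar>t\<bar>" using p by (intro mult_right_mono) auto
    then show ?thesis using True by linarith
  qed
  then have "\<bar>1 + t\<bar> powr p \<le> exp t powr p"
    using p by (intro powr_mono2) (auto simp: add.commute)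
  also have "\<dots> = exp (p * t)" by (simp add: powr_def)
  also have "\<dots> \<le> 1 + p * t + (p * t)\<^sup>2" by (rule exp_le_quadratic[OF pt])
  also have "(p * t)\<^sup>2 \<le> ((p + 1) powr p + p\<^sup>2) * (t\<^sup>2 + \<bar>t\<bar> powr p)"
    by (simp add: algebra_simps power_mult_distrib add_increasing2)
  finally show ?thesis by simp
next
  case False
  have t0: "\<bar>t\<bar> > 0" using False by (cases "t = 0") auto
  have "\<bar>1 + t\<bar> \<le> (p + 1) * \<bar>t\<bar>" using False by (simp add: algebra_simps)
  then have "\<bar>1 + t\<bar> powr p \<le> ((p + 1) * \<bar>t\<bar>) powr p" using p by (intro powr_mono2) auto
  also have "\<dots> = (p + 1) powr p * \<bar>t\<bar> powr p" using p by (simp add: powr_mult)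
  finally have 1: "\<bar>1 + t\<bar> powr p \<le> (p + 1) powr p * \<bar>t\<bar> powr p" .
  have "(p * \<bar>t\<bar>) * 1 \<le> (p * \<bar>t\<bar>) * (p * \<bar>t\<bar>)" using False p by (intro mult_left_mono) auto
  then have "p * \<bar>t\<bar> \<le> p\<^sup>2 * t\<^sup>2"
    by (simp only: power2_eq_square[symmetric] power_mult_distrib power2_abs mult_1_right)
  moreover have "- (p * \<bar>t\<bar>) \<le> p * t" using p by (simp add: abs_if)
  ultimately have 2: "0 \<le> p * t + p\<^sup>2 * t\<^sup>2" by linarith
  have "((p + 1) powr p + p\<^sup>2) * (t\<^sup>2 + \<bar>t\<bar> powr p) \<ge> (p + 1) powr p * \<bar>t\<bar> powr p + p\<^sup>2 * t\<^sup>2"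
    by (simp add: algebra_simps)
  then show ?thesis using 1 2 by linarith
qed

text \<open>The linear term is kept exactly, with a coefficient depending on x alone, because a
  conditional expectation will remove it. The product of |x|^(p - 2) and y^2 is split according to
  whether y^2 \<le> d x^2, and \<open>d\<close> stays free so that it can be tuned to the number of
  steps.\<close>

lemma abs_add_powr_expansion:
  assumes p: "p \<ge> (2::real)" and d: "d > 0"
  defines "C \<equiv> (p + 1) powr p + p\<^sup>2"
  shows "\<bar>x + y\<bar> powr p \<le> (1 + C * d) * \<bar>x\<bar> powr p + p * (\<bar>x\<bar> powr (p - 1) * sgn x) * y
    + C * (d powr (- (p - 2) / 2) + 1) * \<bar>y\<bar> powr p"
proof -
  have C: "C \<ge> 1" unfolding C_def using p ge_one_powr_ge_zero[of "p + 1" p] by (simp add: add_increasing2)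
  have *: "\<bar>x + y\<bar> powr p \<le> \<bar>x\<bar> powr p + p * (\<bar>x\<bar> powr (p - 1) * sgn x) * y + C * (\<bar>x\<bar> powr (p - 2) * y\<^sup>2 + \<bar>y\<bar> powr p)"
  proof (cases "x = 0")
    case True
    then show ?thesis using C p mult_right_mono[of 1 C "\<bar>y\<bar> powr p"] by simp
  next
    case False
    define t where "t = y / x"
    have y: "y = t * x" using False by (simp add: t_def)
    have x1: "\<bar>x\<bar> powr p = \<bar>x\<bar> powr (p - 1) * \<bar>x\<bar>" and x2: "\<bar>x\<bar> powr p = \<bar>x\<bar> powr (p - 2) * x\<^sup>2"
      using powr_add[of "\<bar>x\<bar>" "p - 1" 1] powr_add[of "\<bar>x\<bar>" "p - 2" 2] False
      by (auto simp: powr_numeral)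
    have "\<bar>x + y\<bar> powr p = \<bar>x\<bar> powr p * \<bar>1 + t\<bar> powr p"
      unfolding y by (simp add: powr_mult[symmetric] abs_mult[symmetric] algebra_simps)
    also have "\<dots> \<le> \<bar>x\<bar> powr p * (1 + p * t + C * (t\<^sup>2 + \<bar>t\<bar> powr p))"
      unfolding C_def by (intro mult_left_mono abs_one_plus_powr_le p) auto
    also have "\<dots> = \<bar>x\<bar> powr p + p * t * \<bar>x\<bar> powr p + C * (t\<^sup>2 * \<bar>x\<bar> powr p + (\<bar>t\<bar> * \<bar>x\<bar>) powr p)"
      by (simp add: algebra_simps powr_mult)
    also have "p * t * \<bar>x\<bar> powr p = p * (\<bar>x\<bar> powr (p - 1) * sgn x) * y"
      unfolding x1 y by (simp add: mult_sgn_abs abs_sgn mult_ac)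
    also have "t\<^sup>2 * \<bar>x\<bar> powr p = \<bar>x\<bar> powr (p - 2) * y\<^sup>2" unfolding x2 y by (simp add: power_mult_distrib)
    also have "\<bar>t\<bar> * \<bar>x\<bar> = \<bar>y\<bar>" by (simp add: y abs_mult)
    finally show ?thesis .
  qed
  have "\<bar>x\<bar> powr (p - 2) * y\<^sup>2 \<le> d * \<bar>x\<bar> powr p + d powr (- (p - 2) / 2) * \<bar>y\<bar> powr p"
  proof (cases "y\<^sup>2 \<le> d * x\<^sup>2")
    case True
    have "\<bar>x\<bar> powr (p - 2) * y\<^sup>2 \<le> \<bar>x\<bar> powr (p - 2) * (d * x\<^sup>2)" using True by (intro mult_left_mono) auto
    also have "\<dots> = d * \<bar>x\<bar> powr p"
      using powr_add[of "\<bar>x\<bar>" "p - 2" 2] p by (cases "x = 0") (auto simp: powr_numeral)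
    finally show ?thesis using d by (simp add: add_increasing2)
  next
    case False
    then have y0: "y \<noteq> 0" using d by (auto simp: not_le mult_less_0_iff)
    have xb: "x\<^sup>2 \<le> y\<^sup>2 / d" using False d by (simp add: field_simps)
    have "\<bar>x\<bar> powr (p - 2) = (x\<^sup>2) powr ((p - 2) / 2)"
    proof (cases "x = 0")
      case False
      then have e: "x\<^sup>2 = \<bar>x\<bar> powr 2" by (simp add: powr_numeral)
      show ?thesis unfolding e powr_powr by (rule arg_cong[where f = "(powr) \<bar>x\<bar>"]) simp
    qed simp
    also have "\<dots> \<le> (y\<^sup>2 / d) powr ((p - 2) / 2)" using xb p by (intro powr_mono2) auto
    also have "\<dots> = d powr (- (p - 2) / 2) * \<bar>y\<bar> powr (p - 2)"
    proof -
      have e: "y\<^sup>2 = \<bar>y\<bar> powr 2" using y0 by (simp add: powr_numeral)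
      have "(y\<^sup>2) powr ((p - 2) / 2) = \<bar>y\<bar> powr (p - 2)"
        unfolding e powr_powr by (rule arg_cong[where f = "(powr) \<bar>y\<bar>"]) simp
      moreover have "d powr (- (p - 2) / 2) = inverse (d powr ((p - 2) / 2))"
        by (simp only: minus_divide_left[symmetric] powr_minus)
      moreover have "(y\<^sup>2 / d) powr ((p - 2) / 2) = (y\<^sup>2) powr ((p - 2) / 2) / d powr ((p - 2) / 2)"
        by (rule powr_divide)
      ultimately show ?thesis by (simp only: divide_inverse mult.commute)
    qed
    finally have "\<bar>x\<bar> powr (p - 2) * y\<^sup>2 \<le> d powr (- (p - 2) / 2) * \<bar>y\<bar> powr (p - 2) * y\<^sup>2"
      by (intro mult_right_mono) auto
    also have "\<dots> = d powr (- (p - 2) / 2) * \<bar>y\<bar> powr p"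
      using powr_add[of "\<bar>y\<bar>" "p - 2" 2] y0 by (simp add: powr_numeral)
    finally show ?thesis using d by (simp add: add_increasing)
  qed
  from mult_left_mono[OF this, of C] C * show ?thesis by (simp add: algebra_simps)
qed

text \<open>\<open>X\<close> is measurable for the conditioning sigma-algebra and \<open>D\<close>
  is centred given it, so the linear term of the expansion integrates to 0.\<close>

lemma martingale_step_moment:
  assumes M: "prob_space M" and F: "subalgebra M F" and p: "p > 2" and d: "d > 0"
    and X: "X \<in> borel_measurable F" "integrable M (\<lambda>\<omega>. \<bar>X \<omega>\<bar> powr p)"
    and D: "Lp_le M p D c" "AE \<omega> in M. real_cond_exp M F D \<omega> = 0"
  defines "C \<equiv> (p + 1) powr p + p\<^sup>2"
  shows "integrable M (\<lambda>\<omega>. \<bar>X \<omega> + D \<omega>\<bar> powr p)"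
    "(\<integral>\<omega>. \<bar>X \<omega> + D \<omega>\<bar> powr p \<partial>M) \<le> (1 + C * d) * (\<integral>\<omega>. \<bar>X \<omega>\<bar> powr p \<partial>M) + C * (d powr (- (p - 2) / 2) + 1) * c powr p"
proof -
  interpret prob_space M by fact
  interpret finite_measure_subalgebra M F by (simp add: finite_measure_subalgebra_axioms_def finite_measure_subalgebra_def finite_measure_axioms F)
  interpret sigma_finite_subalgebra M F using finite_measure_subalgebra_axioms by (rule finite_measure_subalgebra_is_sigma_finite)
  note [measurable] = X(1) measurable_from_subalg[OF F X(1)] Lp_leD(1)[OF D(1)]
  let ?g = "\<lambda>\<omega>. \<bar>X \<omega>\<bar> powr (p - 1) * sgn (X \<omega>)"
  have g[measurable]: "?g \<in> borel_measurable F" by measurable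
  have i1: "integrable M (\<lambda>\<omega>. ?g \<omega> * D \<omega>)"
  proof (rule Bochner_Integration.integrable_bound)
    show "integrable M (\<lambda>\<omega>. \<bar>X \<omega>\<bar> powr p + \<bar>D \<omega>\<bar> powr p)" using X(2) Lp_leD(2)[OF D(1)] by auto
    have "\<bar>x\<bar> powr (p - 1) * \<bar>sgn x\<bar> * \<bar>y\<bar> \<le> \<bar>x\<bar> powr p + \<bar>y\<bar> powr p" for x y :: real
    proof -
      let ?m = "max \<bar>x\<bar> \<bar>y\<bar>"
      have "\<bar>x\<bar> powr (p - 1) * \<bar>sgn x\<bar> * \<bar>y\<bar> \<le> ?m powr (p - 1) * 1 * ?m"
        using p by (intro mult_mono powr_mono2) (auto simp: abs_sgn_eq)
      also have "\<dots> = ?m powr p" using powr_add[of ?m "p - 1" 1] by (simp add: max_def)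
      also have "\<dots> \<le> \<bar>x\<bar> powr p + \<bar>y\<bar> powr p" by (simp add: max_def)
      finally show ?thesis .
    qed
    then show "AE \<omega> in M. norm (?g \<omega> * D \<omega>) \<le> norm (\<bar>X \<omega>\<bar> powr p + \<bar>D \<omega>\<bar> powr p)"
      by (auto simp: abs_mult)
  qed measurable
  have z: "(\<integral>\<omega>. ?g \<omega> * D \<omega> \<partial>M) = 0"
  proof -
    have "(\<integral>\<omega>. ?g \<omega> * D \<omega> \<partial>M) = (\<integral>\<omega>. ?g \<omega> * real_cond_exp M F D \<omega> \<partial>M)"
      by (rule real_cond_exp_intg(2)[symmetric, OF i1]) auto
    also have "\<dots> = (\<integral>\<omega>. 0 \<partial>M)" using D(2) by (intro integral_cong_AE) auto
    finally show ?thesis by simp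
  qed
  let ?b = "\<lambda>\<omega>. (1 + C * d) * \<bar>X \<omega>\<bar> powr p + p * (?g \<omega> * D \<omega>) + C * (d powr (- (p - 2) / 2) + 1) * \<bar>D \<omega>\<bar> powr p"
  have le: "\<bar>X \<omega> + D \<omega>\<bar> powr p \<le> ?b \<omega>" for \<omega>
    using abs_add_powr_expansion[of p d "X \<omega>" "D \<omega>"] p d unfolding C_def by (simp add: mult_ac)
  have ib: "integrable M ?b"
    using X(2) Lp_leD(2)[OF D(1)] i1 by (intro Bochner_Integration.integrable_add integrable_mult_right) auto
  show int: "integrable M (\<lambda>\<omega>. \<bar>X \<omega> + D \<omega>\<bar> powr p)"
    by (rule integrable_dominated_nonneg[OF ib _ _ le]) auto
  have "(\<integral>\<omega>. \<bar>X \<omega> + D \<omega>\<bar> powr p \<partial>M) \<le> (\<integral>\<omega>. ?b \<omega> \<partial>M)" by (rule integral_mono[OF int ib le])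
  also have "\<dots> = (1 + C * d) * (\<integral>\<omega>. \<bar>X \<omega>\<bar> powr p \<partial>M) + p * (\<integral>\<omega>. ?g \<omega> * D \<omega> \<partial>M)
      + C * (d powr (- (p - 2) / 2) + 1) * (\<integral>\<omega>. \<bar>D \<omega>\<bar> powr p \<partial>M)"
    using X(2) Lp_leD(2)[OF D(1)] i1 by (simp add: Bochner_Integration.integral_add)
  also have "\<dots> \<le> (1 + C * d) * (\<integral>\<omega>. \<bar>X \<omega>\<bar> powr p \<partial>M) + C * (d powr (- (p - 2) / 2) + 1) * c powr p"
    using Lp_leD(4)[OF D(1)] z unfolding C_def by (auto intro!: mult_left_mono mult_nonneg_nonneg add_nonneg_nonneg)
  finally show "(\<integral>\<omega>. \<bar>X \<omega> + D \<omega>\<bar> powr p \<partial>M) \<le> \<dots>" .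
qed

text \<open>One plus twice what a single step contributes: the factor 2 lets the induction step fit
  into the growth from n + 1/2 to n + 1.\<close>

definition martingale_const :: "real \<Rightarrow> real" where
  "martingale_const p = (let C = (p + 1) powr p + p\<^sup>2 in 1 + 2 * (C * ((2 * C) powr (p / 2 - 1) + 1)))"

lemma martingale_const_ge_1: "martingale_const p \<ge> 1"
  unfolding martingale_const_def Let_def by (simp add: add_nonneg_nonneg mult_nonneg_nonneg)

text \<open>A Burkholder-type bound by induction on the number of steps: with a common bound on the
  increments, the p-th moment after n steps may grow like n^(p/2).\<close>

lemma martingale_moment:
  assumes M: "prob_space M" and F: "\<And>n. subalgebra M (F n)" "\<And>n. sets (F n) \<subseteq> sets (F (Suc n))"
    and p: "p > 2"
    and D: "\<And>n. n < N \<Longrightarrow> Lp_le M p (D n) c" "\<And>n. n < N \<Longrightarrow> D n \<in> borel_measurable (F (Suc n))"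
      "\<And>n. n < N \<Longrightarrow> AE \<omega> in M. real_cond_exp M (F n) (D n) \<omega> = 0"
    and c: "c \<ge> 0"
  shows "Lp_le M p (\<lambda>\<omega>. \<Sum>i<N. D i \<omega>) (martingale_const p * c * sqrt (real N))"
proof -
  interpret prob_space M by fact
  define C where "C = (p + 1) powr p + p\<^sup>2"
  have C: "C \<ge> 1" unfolding C_def using p ge_one_powr_ge_zero[of "p + 1" p] by (simp add: add_increasing2)
  define K where "K = martingale_const p"
  define C' where "C' = C * ((2 * C) powr (p / 2 - 1) + 1)"
  have K: "K = 1 + 2 * C'" by (simp add: K_def martingale_const_def C_def C'_def Let_def)
  have C'0: "C' \<ge> 0" using C by (simp add: C'_def)
  have sp: "space (F n) = space M" for n using F(1) by (simp add: subalgebra_def)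
  have meas: "(\<lambda>\<omega>. \<Sum>i<n. D i \<omega>) \<in> borel_measurable (F n)" if "n \<le> N" for n
    using that
  proof (induction n)
    case (Suc n)
    have "(\<lambda>\<omega>. \<Sum>i<n. D i \<omega>) \<in> borel_measurable (F (Suc n))"
      by (rule measurable_from_subalg[of _ "F n"]) (use F(2) sp Suc in \<open>auto simp: subalgebra_def\<close>)
    then show ?case using D(2)[of n] Suc.prems by simp
  qed simp
  have main: "integrable M (\<lambda>\<omega>. \<bar>\<Sum>i<n. D i \<omega>\<bar> powr p) \<and>
      (\<integral>\<omega>. \<bar>\<Sum>i<n. D i \<omega>\<bar> powr p \<partial>M) \<le> K * real n powr (p / 2) * c powr p" if "n \<le> N" for n
    using that
  proof (induction n)
    case (Suc n)
    show ?case
    proof (cases "n = 0")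
      case True
      have "c powr p \<le> K * c powr p" using K C'0 mult_right_mono[of 1 K "c powr p"] by simp
      then show ?thesis using True Suc.prems Lp_leD(2,4)[OF D(1)[of 0]] by (auto intro: order_trans)
    next
      case False
      \<comment> \<open>This turns \<open>1 + C * d\<close> into 1 + 1 / (2 n). The old part then
        uses K (n + 1/2) of the available K (n + 1) and leaves K / 2 \<ge> C' for the new
        increment.\<close>
      define d where "d = 1 / (2 * C * real n)"
      have d: "d > 0" using False C by (simp add: d_def)
      have n1: "real n \<ge> 1" using False by simp
      have IH: "integrable M (\<lambda>\<omega>. \<bar>\<Sum>i<n. D i \<omega>\<bar> powr p)"
        "(\<integral>\<omega>. \<bar>\<Sum>i<n. D i \<omega>\<bar> powr p \<partial>M) \<le> K * real n powr (p / 2) * c powr p"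
        using Suc by auto
      have X: "(\<lambda>\<omega>. \<Sum>i<n. D i \<omega>) \<in> borel_measurable (F n)" using meas Suc.prems by auto
      note st = martingale_step_moment[OF M F(1)[of n] p d X IH(1) D(1)[of n] D(3)[of n], folded C_def]
      have q: "real n powr (p / 2) = real n powr (p / 2 - 1) * real n"
        using powr_add[of "real n" "p / 2 - 1" 1] by simp
      have "(d powr (- (p - 2) / 2) + 1) = (2 * C) powr (p / 2 - 1) * real n powr (p / 2 - 1) + 1"
      proof -
        have "- (p - 2) / 2 = - (p / 2 - 1)" by (simp add: field_simps)
        then have "d powr (- (p - 2) / 2) = (inverse d) powr (p / 2 - 1)"
          using d by (simp only: powr_minus inverse_powr)
        also have "inverse d = (2 * C) * real n" by (simp add: d_def)
        finally show ?thesis using C by (simp add: powr_mult)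
      qed
      also have "\<dots> \<le> ((2 * C) powr (p / 2 - 1) + 1) * real n powr (p / 2 - 1)"
        using ge_one_powr_ge_zero[OF n1, of "p / 2 - 1"] p by (simp add: algebra_simps)
      finally have dd: "C * (d powr (- (p - 2) / 2) + 1) \<le> C' * real n powr (p / 2 - 1)"
        using C by (simp add: C'_def mult.assoc)
      have cd: "C * d = 1 / (2 * real n)" using C by (simp add: d_def)
      have "(\<integral>\<omega>. \<bar>(\<Sum>i<n. D i \<omega>) + D n \<omega>\<bar> powr p \<partial>M)
          \<le> (1 + C * d) * (K * real n powr (p / 2) * c powr p) + C' * real n powr (p / 2 - 1) * c powr p"
        using st(2) Suc.prems mult_left_mono[OF IH(2), of "1 + C * d"] C d
          mult_right_mono[OF dd, of "c powr p"] by (fastforce simp: add_nonneg_nonneg)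
      also have "\<dots> = (K * (real n + 1 / 2) + C') * real n powr (p / 2 - 1) * c powr p"
        using False unfolding q cd by (simp add: field_simps)
      also have "\<dots> \<le> (K * real (Suc n)) * real (Suc n) powr (p / 2 - 1) * c powr p"
        using K C'0 p by (intro mult_right_mono mult_mono powr_mono2) (auto simp: algebra_simps)
      also have "\<dots> = K * real (Suc n) powr (p / 2) * c powr p"
        using powr_add[of "real (Suc n)" "p / 2 - 1" 1] by (simp add: mult_ac)
      finally show ?thesis using st(1) Suc.prems by simp
    qed
  qed simp
  have "K * real N powr (p / 2) * c powr p \<le> (K * c * sqrt (real N)) powr p"
  proof -
    have "(K * c * sqrt (real N)) powr p = K powr p * c powr p * (sqrt (real N)) powr p"
      using K C'0 c by (simp add: powr_mult)
    also have "(sqrt (real N)) powr p = real N powr (p / 2)"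
      by (simp add: powr_half_sqrt[symmetric] powr_powr)
    finally have e: "(K * c * sqrt (real N)) powr p = K powr p * c powr p * real N powr (p / 2)" .
    have "K \<le> K powr p" using powr_mono[of 1 p K] K C'0 p by simp
    then have "K * real N powr (p / 2) * c powr p \<le> K powr p * real N powr (p / 2) * c powr p"
      by (intro mult_right_mono) auto
    then show ?thesis unfolding e by (simp only: mult_ac)
  qed
  then show ?thesis
    using main[of N] meas[of N] measurable_from_subalg[OF F(1)] c C'0 unfolding Lp_le_def K_def[symmetric] K
    by (auto intro: order_trans)
qed

section \<open>Decoupling under absolute regularity\<close>

lemma ennreal_AE_le_if_nn_integral_le:
  assumes [measurable]: "f \<in> borel_measurable M" "g \<in> borel_measurable M"
    and "\<And>x. x \<in> space M \<Longrightarrow> f x \<le> g x" "(\<integral>\<^sup>+x. g x \<partial>M) \<le> (\<integral>\<^sup>+x. f x \<partial>M)" "(\<integral>\<^sup>+x. f x \<partial>M) < \<infinity>"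
  shows "AE x in M. g x \<le> f x"
proof -
  have "(\<integral>\<^sup>+x. (g x - f x) \<partial>M) = (\<integral>\<^sup>+x. g x \<partial>M) - (\<integral>\<^sup>+x. f x \<partial>M)"
    using assms by (intro nn_integral_diff) auto
  also have "\<dots> = 0" using assms(4,5) le_less_trans[OF assms(4,5)] by (simp add: diff_eq_0_iff_ennreal)
  finally have "AE x in M. g x - f x = 0" by (simp add: nn_integral_0_iff_AE)
  then show ?thesis by eventually_elim (simp add: diff_eq_0_iff_ennreal)
qed

text \<open>Exhaustion: the integrals of suprema over countable subfamilies reach their supremum at
  a union of countably many subfamilies. One more index cannot raise that integral, hence raises the
  function on a null set only. The lemma gives content to the choice in
  \<open>family_esssup\<close>.\<close>

lemma family_esssup_exists:
  fixes f :: "'i \<Rightarrow> 'w \<Rightarrow> ennreal"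
  assumes M: "prob_space M" and f[measurable]: "\<And>i. i \<in> I \<Longrightarrow> f i \<in> borel_measurable M"
    and le1: "\<And>i. i \<in> I \<Longrightarrow> AE \<omega> in M. f i \<omega> \<le> 1"
  shows "\<exists>Z. Z \<in> borel_measurable M \<and> (\<forall>i\<in>I. AE \<omega> in M. f i \<omega> \<le> Z \<omega>) \<and>
        (\<forall>W\<in>borel_measurable M. (\<forall>i\<in>I. AE \<omega> in M. f i \<omega> \<le> W \<omega>) \<longrightarrow> (AE \<omega> in M. Z \<omega> \<le> W \<omega>))"
proof -
  interpret prob_space M by fact
  define C where "C = {J. J \<subseteq> I \<and> countable J}"
  define v where "v J = (\<integral>\<^sup>+\<omega>. (SUP i\<in>J. f i \<omega>) \<partial>M)" for J
  have "C \<noteq> {}" by (auto simp: C_def)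
  from ennreal_SUP_countable_SUP[OF this, of v] obtain F :: "nat \<Rightarrow> ennreal"
    where F: "range F \<subseteq> v ` C" "Sup (v ` C) = Sup (range F)" by auto
  then have "\<forall>n. \<exists>J. J \<in> C \<and> F n = v J" by blast
  then obtain Jn where Jn: "\<And>n. Jn n \<in> C" "\<And>n. F n = v (Jn n)" by metis
  define J where "J = (\<Union>n. Jn n)"
  have J: "J \<in> C" using Jn(1) by (auto simp: C_def J_def)
  have meas[measurable]: "(\<lambda>\<omega>. SUP i\<in>J. f i \<omega>) \<in> borel_measurable M" if "J \<in> C" for J
    using that f unfolding C_def by (intro borel_measurable_SUP) auto
  have mono: "v A \<le> v B" if "A \<subseteq> B" for A B
    unfolding v_def by (intro nn_integral_mono SUP_subset_mono that order_refl)
  have "Sup (v ` C) \<le> v J" unfolding F(2)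
    by (rule SUP_least) (auto simp: Jn(2) J_def intro!: mono)
  then have vJ: "v A \<le> v J" if "A \<in> C" for A using that by (meson SUP_upper order_trans)
  have fin: "v J < \<infinity>"
  proof -
    have "AE \<omega> in M. \<forall>i\<in>J. f i \<omega> \<le> 1"
      using J le1 by (subst AE_ball_countable) (auto simp: C_def)
    then have "v J \<le> (\<integral>\<^sup>+\<omega>. 1 \<partial>M)" unfolding v_def
      by (intro nn_integral_mono_AE) (auto elim!: eventually_mono intro!: SUP_least)
    then show ?thesis by (simp add: emeasure_space_1 le_less_trans)
  qed
  show ?thesis
  proof (intro exI[of _ "\<lambda>\<omega>. SUP i\<in>J. f i \<omega>"] conjI ballI impI)
    fix i assume i: "i \<in> I"
    have J': "insert i J \<in> C" using J i by (auto simp: C_def)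
    have "AE \<omega> in M. (SUP i\<in>insert i J. f i \<omega>) \<le> (SUP i\<in>J. f i \<omega>)"
      using vJ[OF J'] fin unfolding v_def
      by (intro ennreal_AE_le_if_nn_integral_le meas J J') (auto intro!: SUP_subset_mono)
    then show "AE \<omega> in M. f i \<omega> \<le> (SUP i\<in>J. f i \<omega>)"
      by eventually_elim (auto simp: SUP_insert)
  next
    fix W assume "W \<in> borel_measurable M" and W: "\<forall>i\<in>I. AE \<omega> in M. f i \<omega> \<le> W \<omega>"
    then have "AE \<omega> in M. \<forall>i\<in>J. f i \<omega> \<le> W \<omega>"
      using J by (subst AE_ball_countable) (auto simp: C_def)
    then show "AE \<omega> in M. (SUP i\<in>J. f i \<omega>) \<le> W \<omega>"
      by eventually_elim (auto intro!: SUP_least)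
  qed (use J in \<open>auto intro!: meas\<close>)
qed

text \<open>The sets that can be approximated are closed under complements and countable unions. The
  approximation works for both measures at once because the error is measured by their sum.\<close>

lemma approximation_by_algebra:
  assumes P: "finite_measure P1" "finite_measure P2" "sets P1 = sigma_sets \<Omega> G" "sets P2 = sigma_sets \<Omega> G"
    and space: "space P1 = \<Omega>"
    and Alg: "Alg \<subseteq> sets P1" "G \<subseteq> Alg" "{} \<in> Alg" "\<And>R. R \<in> Alg \<Longrightarrow> \<Omega> - R \<in> Alg"
      "\<And>R R'. R \<in> Alg \<Longrightarrow> R' \<in> Alg \<Longrightarrow> R \<union> R' \<in> Alg"
    and D: "D \<in> sets P1" and e: "e > 0"
  shows "\<exists>R\<in>Alg. measure P1 ((D - R) \<union> (R - D)) + measure P2 ((D - R) \<union> (R - D)) < e"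
proof -
  interpret P1: finite_measure P1 by fact
  interpret P2: finite_measure P2 by fact
  have s12: "sets P2 = sets P1" using P by simp
  define q where "q A = measure P1 A + measure P2 A" for A
  have q_Un: "q (A \<union> B) \<le> q A + q B" if "A \<in> sets P1" "B \<in> sets P1" for A B
    using measure_subadditive[of A P1 B] measure_subadditive[of A P2 B] that s12 unfolding q_def
    by (simp add: P1.emeasure_eq_measure P2.emeasure_eq_measure)
  have q_mono: "q A \<le> q B" if "A \<subseteq> B" "B \<in> sets P1" for A B
    unfolding q_def using that s12 by (intro add_mono P1.finite_measure_mono P2.finite_measure_mono) auto
  have q_UN: "q (\<Union>i\<in>{..<n::nat}. A i) \<le> (\<Sum>i<n. q (A i))" if "\<And>i. A i \<in> sets P1" for A n
  proof (induction n)
    case (Suc n)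
    have "q (\<Union>i\<in>{..<Suc n}. A i) \<le> q (A n) + q (\<Union>i\<in>{..<n}. A i)"
      unfolding lessThan_Suc UN_insert using that by (intro q_Un) auto
    then show ?case using Suc by simp
  qed (simp add: q_def)
  have "D \<in> sigma_sets \<Omega> G" using D P by simp
  then have "\<forall>e>0. \<exists>R\<in>Alg. q ((D - R) \<union> (R - D)) < e"
  proof (induction rule: sigma_sets.induct)
    case (Basic a)
    then show ?case using Alg(2) by (auto simp: q_def intro!: bexI[of _ a])
  next
    case Empty
    then show ?case using Alg(3) by (auto simp: q_def intro!: bexI[of _ "{}"])
  next
    case (Compl a)
    show ?case
    proof (intro allI impI)
      fix e :: real assume "e > 0"
      then obtain R where R: "R \<in> Alg" "q ((a - R) \<union> (R - a)) < e" using Compl.IH by blast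
      have sub: "a \<subseteq> \<Omega>" "R \<subseteq> \<Omega>" using Compl.hyps R(1) Alg(1) space P(3) sets.sets_into_space[of _ P1] by auto
      then have "((\<Omega> - a) - (\<Omega> - R)) \<union> ((\<Omega> - R) - (\<Omega> - a)) = (a - R) \<union> (R - a)" by auto
      then show "\<exists>R\<in>Alg. q (\<Omega> - a - R \<union> (R - (\<Omega> - a))) < e" using R Alg(4) by metis
    qed
  next
    case (Union A)
    have A: "A i \<in> sets P1" for i using Union.hyps P by auto
    let ?D = "\<Union>i. A i"
    show ?case
    proof (intro allI impI)
      fix e :: real assume e: "e > 0"
      let ?U = "\<lambda>n. \<Union>i\<in>{..<n}. A i"
      have U: "?U n \<in> sets P1" for n using A by auto
      have inc: "incseq ?U" by (fastforce simp: incseq_def)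
      have UU: "(\<Union>n. ?U n) = ?D" by auto
      have "(\<lambda>n. measure P1 (?U n)) \<longlonglongrightarrow> measure P1 ?D"
        using P1.finite_Lim_measure_incseq[of ?U] U inc UU by auto
      moreover have "(\<lambda>n. measure P2 (?U n)) \<longlonglongrightarrow> measure P2 ?D"
        using P2.finite_Lim_measure_incseq[of ?U] U s12 inc UU by auto
      ultimately have lim: "(\<lambda>n. q (?U n)) \<longlonglongrightarrow> q ?D" unfolding q_def by (rule tendsto_add)
      have "eventually (\<lambda>n. q ?D - e / 2 < q (?U n)) sequentially"
        by (rule order_tendstoD(1)[OF lim]) (use e in simp)
      then obtain n where n: "q ?D - e / 2 < q (?U n)" by (auto simp: eventually_sequentially)
      have "q (?D - ?U n) = q ?D - q (?U n)"
      proof -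
        have "measure P1 (?D - ?U n) = measure P1 ?D - measure P1 (?U n)"
          by (rule P1.finite_measure_Diff) (use A in auto)
        moreover have "measure P2 (?D - ?U n) = measure P2 ?D - measure P2 (?U n)"
          by (rule P2.finite_measure_Diff) (use A s12 in auto)
        ultimately show ?thesis unfolding q_def by linarith
      qed
      then have tail: "q (?D - ?U n) < e / 2" using n by simp
      \<comment> \<open>One half of the error pays for the tail of the union, the other is shared by
        the n approximated sets.\<close>
      define d where "d = e / (2 * (real n + 1))"
      have "d > 0" using e by (simp add: d_def)
      then have "\<forall>i. \<exists>R\<in>Alg. q ((A i - R) \<union> (R - A i)) < d" using Union.IH by blast
      then obtain R where R: "\<And>i. R i \<in> Alg" "\<And>i. q ((A i - R i) \<union> (R i - A i)) < d" by metis
      let ?R = "\<Union>i\<in>{..<n}. R i"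
      have RA: "(\<Union>i\<in>{..<m}. R i) \<in> Alg" for m
        by (induction m) (auto simp: lessThan_Suc Alg(3) intro!: Alg(5) R)
      have Rs: "R i \<in> sets P1" for i using R Alg by auto
      let ?S = "\<lambda>i. (A i - R i) \<union> (R i - A i)"
      have "q ((?D - ?R) \<union> (?R - ?D)) \<le> q ((?D - ?U n) \<union> (\<Union>i\<in>{..<n}. ?S i))"
        using A Rs by (intro q_mono) auto
      also have "\<dots> \<le> q (?D - ?U n) + q (\<Union>i\<in>{..<n}. ?S i)" using A Rs by (intro q_Un) auto
      also have "q (\<Union>i\<in>{..<n}. ?S i) \<le> (\<Sum>i<n. q (?S i))" using A Rs by (intro q_UN) auto
      also have "\<dots> \<le> (\<Sum>i<n. d)" using R(2) by (intro sum_mono less_imp_le)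
      also have "\<dots> \<le> e / 2" using e by (simp add: d_def field_simps)
      finally show "\<exists>R\<in>Alg. q ((?D - R) \<union> (R - ?D)) < e" using tail RA[of n] by (intro bexI[of _ ?R]) auto
    qed
  qed
  then show ?thesis using e unfolding q_def by blast
qed

text \<open>A nonnegative bounded function is a uniform limit of averages of indicators of its upper
  level sets, so that closeness of two measures on sets carries over to integrals.\<close>

lemma integral_diff_le_of_measure_diff_le:
  assumes P: "prob_space P1" "prob_space P2" "sets P1 = sets P2"
    and close: "\<And>D. D \<in> sets P1 \<Longrightarrow> \<bar>measure P1 D - measure P2 D\<bar> \<le> \<delta>"
    and h[measurable]: "h \<in> borel_measurable P1" and K: "K > 0" "\<And>x. x \<in> space P1 \<Longrightarrow> 0 \<le> h x \<and> h x \<le> K"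
  shows "\<bar>(\<integral>x. h x \<partial>P1) - (\<integral>x. h x \<partial>P2)\<bar> \<le> K * \<delta>"
proof -
  interpret P1: prob_space P1 by fact
  interpret P2: prob_space P2 by fact
  have sp: "space P1 = space P2" using P(3) by (rule sets_eq_imp_space_eq)
  have [measurable]: "h \<in> borel_measurable P2" using h P(3) by (simp cong: measurable_cong_sets)
  define L where "L i n = {x \<in> space P1. real i * K / real n \<le> h x}" for i n :: nat
  have L1[measurable]: "L i n \<in> sets P1" for i n unfolding L_def by measurable
  have L2[measurable]: "L i n \<in> sets P2" for i n using L1 P(3) by simp
  have \<delta>: "\<delta> \<ge> 0" using close[of "{}"] by simp
  have bound: "\<bar>(\<integral>x. h x \<partial>P1) - (\<integral>x. h x \<partial>P2)\<bar> \<le> K * \<delta> + 2 * K / real n" if n: "n > 0" for n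
  proof -
    let ?hn = "\<lambda>x. \<Sum>i\<in>{1..n}. K / real n * indicat_real (L i n) x"
    have hn: "?hn x \<le> h x \<and> h x \<le> ?hn x + K / real n" if x: "x \<in> space P1" for x
    proof -
      define y where "y = h x * real n / K"
      have y: "0 \<le> y" "y \<le> real n" using K n x by (auto simp: y_def field_simps)
      have hx: "h x = K / real n * y" using K n by (simp add: y_def)
      have "{i \<in> {1..n}. x \<in> L i n} = {1..nat \<lfloor>y\<rfloor>}"
      proof -
        have "x \<in> L i n \<longleftrightarrow> i \<le> nat \<lfloor>y\<rfloor>" if "i \<ge> 1" for i
        proof -
          have "x \<in> L i n \<longleftrightarrow> real i \<le> y" using x K n by (simp add: L_def y_def field_simps)
          also have "\<dots> \<longleftrightarrow> i \<le> nat \<lfloor>y\<rfloor>" using y by (simp add: le_nat_iff le_floor_iff)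
          finally show ?thesis .
        qed
        moreover have "nat \<lfloor>y\<rfloor> \<le> n" using y by linarith
        ultimately show ?thesis by auto
      qed
      moreover have "?hn x = (\<Sum>i\<in>{i \<in> {1..n}. x \<in> L i n}. K / real n)"
        by (rule sum.mono_neutral_cong_right) (auto simp: indicator_def)
      ultimately have "?hn x = K / real n * real (nat \<lfloor>y\<rfloor>)" by simp
      moreover have "real (nat \<lfloor>y\<rfloor>) \<le> y" "y \<le> real (nat \<lfloor>y\<rfloor>) + 1" using y by linarith+
      ultimately show ?thesis
        using K n hx mult_left_mono[of "real (nat \<lfloor>y\<rfloor>)" y "K / real n"] mult_left_mono[of y "real (nat \<lfloor>y\<rfloor>) + 1" "K / real n"]
        by (auto simp: algebra_simps add_divide_distrib)
    qed
    have iL: "integrable P1 (indicat_real (L i n))" "integrable P2 (indicat_real (L i n))" for i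
      by (auto simp: P1.emeasure_eq_measure P2.emeasure_eq_measure)
    have i1: "integrable P1 h" by (rule P1.integrable_const_bound[of _ K]) (use K in auto)
    have i2: "integrable P2 h" by (rule P2.integrable_const_bound[of _ K]) (use K sp in auto)
    have in1: "integrable P1 ?hn" and in2: "integrable P2 ?hn" using iL by (auto intro!: Bochner_Integration.integrable_sum)
    have e1: "(\<integral>x. ?hn x \<partial>P1) = (\<Sum>i\<in>{1..n}. K / real n * measure P1 (L i n))"
      using iL by (subst Bochner_Integration.integral_sum) (auto simp: Int_absorb2 sets.sets_into_space)
    have e2: "(\<integral>x. ?hn x \<partial>P2) = (\<Sum>i\<in>{1..n}. K / real n * measure P2 (L i n))"
      using iL by (subst Bochner_Integration.integral_sum) (auto simp: Int_absorb2 sets.sets_into_space)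
    have "\<bar>(\<integral>x. ?hn x \<partial>P1) - (\<integral>x. ?hn x \<partial>P2)\<bar> = \<bar>\<Sum>i\<in>{1..n}. K / real n * (measure P1 (L i n) - measure P2 (L i n))\<bar>"
      unfolding e1 e2 by (simp add: sum_subtractf right_diff_distrib)
    also have "\<dots> \<le> (\<Sum>i\<in>{1..n}. K / real n * \<delta>)"
      using K close[OF L1] by (intro order_trans[OF sum_abs] sum_mono) (auto simp: abs_mult intro!: divide_right_mono mult_left_mono)
    also have "\<dots> = K * \<delta>" using n by simp
    finally have "\<bar>(\<integral>x. ?hn x \<partial>P1) - (\<integral>x. ?hn x \<partial>P2)\<bar> \<le> K * \<delta>" .
    moreover have "(\<integral>x. ?hn x \<partial>P1) \<le> (\<integral>x. h x \<partial>P1)" "(\<integral>x. h x \<partial>P1) \<le> (\<integral>x. ?hn x + K / real n \<partial>P1)"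
      by (intro integral_mono[OF in1 i1] integral_mono[OF i1 Bochner_Integration.integrable_add[OF in1]] P1.integrable_const;
          use hn in blast)+
    moreover have "(\<integral>x. ?hn x \<partial>P2) \<le> (\<integral>x. h x \<partial>P2)" "(\<integral>x. h x \<partial>P2) \<le> (\<integral>x. ?hn x + K / real n \<partial>P2)"
      unfolding atomize_conj using hn unfolding sp
      by (intro conjI integral_mono[OF in2 i2] integral_mono[OF i2 Bochner_Integration.integrable_add[OF in2]] P2.integrable_const; blast)
    moreover have "(\<integral>x. ?hn x + K / real n \<partial>P1) = (\<integral>x. ?hn x \<partial>P1) + K / real n"
      "(\<integral>x. ?hn x + K / real n \<partial>P2) = (\<integral>x. ?hn x \<partial>P2) + K / real n"
      using in1 in2 by (auto simp: P1.prob_space P2.prob_space)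
    ultimately show ?thesis using K n by (simp add: abs_le_iff)
  qed
  have "(\<lambda>n. K * \<delta> + 2 * K / real n) \<longlonglongrightarrow> K * \<delta> + 0"
    by (intro tendsto_add tendsto_const lim_const_over_n)
  then show ?thesis
    by (intro tendsto_lowerbound[where F = sequentially]) (auto simp: eventually_sequentially intro!: exI[of _ 1] bound)
qed

lemma abs_integral_diff_le_of_measure_diff_le:
  assumes P: "prob_space P1" "prob_space P2" "sets P1 = sets P2"
    and close: "\<And>D. D \<in> sets P1 \<Longrightarrow> \<bar>measure P1 D - measure P2 D\<bar> \<le> \<delta>"
    and h[measurable]: "h \<in> borel_measurable P1" and K: "K > 0" "\<And>x. x \<in> space P1 \<Longrightarrow> \<bar>h x\<bar> \<le> K"
  shows "\<bar>(\<integral>x. h x \<partial>P1) - (\<integral>x. h x \<partial>P2)\<bar> \<le> 2 * K * \<delta>"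
proof -
  interpret P1: prob_space P1 by fact
  interpret P2: prob_space P2 by fact
  have sp: "space P1 = space P2" using P(3) by (rule sets_eq_imp_space_eq)
  have h2[measurable]: "h \<in> borel_measurable P2" using h P(3) by (simp cong: measurable_cong_sets)
  have i1: "integrable P1 h" by (rule P1.integrable_const_bound[of _ K]) (use K in auto)
  have i2: "integrable P2 h" by (rule P2.integrable_const_bound[of _ K]) (use K sp in auto)
  have "\<bar>(\<integral>x. h x + K \<partial>P1) - (\<integral>x. h x + K \<partial>P2)\<bar> \<le> (2 * K) * \<delta>"
  proof (rule integral_diff_le_of_measure_diff_le[OF P close])
    fix x assume "x \<in> space P1"
    then show "0 \<le> h x + K \<and> h x + K \<le> 2 * K" using K(2)[of x] by (simp add: abs_le_iff)
  qed (use K(1) in auto)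
  then show ?thesis using i1 i2 by (simp add: P1.prob_space P2.prob_space)
qed

section \<open>Observation sigma-algebras and mixing\<close>

lemma subalgebra_sets: "subalgebra M F \<Longrightarrow> A \<in> sets F \<Longrightarrow> A \<in> sets M"
  by (auto simp: subalgebra_def)

lemma space_generated_by [simp]: "space (generated_by M N Y I) = space M"
  by (simp add: generated_by_def space_measure_of_conv)

lemma sets_generated_by:
  "sets (generated_by M N Y I) = sigma_sets (space M) (\<Union>u\<in>I. {Y u -` A \<inter> space M |A. A \<in> sets N})"
  unfolding generated_by_def by (rule sets_measure_of) auto

lemma generated_by_mono: "I \<subseteq> J \<Longrightarrow> sets (generated_by M N Y I) \<subseteq> sets (generated_by M N Y J)"
  unfolding sets_generated_by by (intro sigma_sets_mono') auto

lemma measurable_generated_by: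
  assumes "\<And>k. Y k \<in> measurable M N" "k \<in> I"
  shows "Y k \<in> measurable (generated_by M N Y I) N"
  using assms measurable_space[OF assms(1)] unfolding measurable_def sets_generated_by
  by (auto intro!: sigma_sets.Basic)

lemma subalgebra_generated_by:
  assumes "\<And>k. Y k \<in> measurable M N"
  shows "subalgebra M (generated_by M N Y I)"
  unfolding subalgebra_def sets_generated_by
  by (auto intro!: sets.sigma_sets_subset measurable_sets[OF assms])

text \<open>\<open>HH\<close> holds the simulation noise of all times and is independent of the
  whole observation process. \<open>bk\<close> dominates the mixing coefficients and is strictly
  positive because \<open>1 / sqrt (bk k)\<close> will serve as a truncation level.\<close>

locale beta_mixing_process = prob_space M
  for M :: "'w measure" +
  fixes N :: "'y measure" and Y :: "int \<Rightarrow> 'w \<Rightarrow> 'y" and HH :: "'w set set" and bk :: "nat \<Rightarrow> real"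
  assumes Y_meas: "\<And>k. Y k \<in> measurable M N"
    and HH: "HH \<subseteq> sets M" "sigma_algebra (space M) HH"
    and HH_indep: "indep_set HH (sets (generated_by M N Y UNIV))"
    and mixing: "\<And>n. beta_mixing M N Y n \<le> ennreal (bk n)" "\<And>n. bk n > 0"
begin

text \<open>The past of the observations enlarged by the entire simulation noise, including that of
  later blocks. Independence makes the enlargement harmless, and the result is a filtration indexed
  by observation times for which the parameter of a block is known when the block starts.\<close>

definition AA :: "int \<Rightarrow> 'w measure" where
  "AA u = sigma (space M) (HH \<union> sets (past M N Y u))"

lemma space_AA [simp]: "space (AA u) = space M"
  by (simp add: AA_def space_measure_of_conv)

lemma past_sub: "sets (past M N Y u) \<subseteq> sets M"
  unfolding past_def by (intro subsetI subalgebra_sets[OF subalgebra_generated_by[OF Y_meas]])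

lemma sets_AA: "sets (AA u) = sigma_sets (space M) (HH \<union> sets (past M N Y u))"
  unfolding AA_def using HH(1) past_sub[of u] sets.sets_into_space by (intro sets_measure_of) blast

lemma subalgebra_AA: "subalgebra M (AA u)"
  unfolding subalgebra_def sets_AA using HH(1) past_sub by (auto intro!: sets.sigma_sets_subset)

lemma AA_mono: "u \<le> v \<Longrightarrow> sets (AA u) \<subseteq> sets (AA v)"
proof -
  assume "u \<le> v"
  then have "sets (past M N Y u) \<subseteq> sets (past M N Y v)" unfolding past_def by (intro generated_by_mono) auto
  then show ?thesis unfolding sets_AA by (intro sigma_sets_mono') auto
qed

lemma subalgebra_AA_mono: "u \<le> v \<Longrightarrow> subalgebra (AA v) (AA u)"
  unfolding subalgebra_def using AA_mono by auto

lemma past_le_AA: "subalgebra (AA u) (past M N Y u)"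
  unfolding subalgebra_def sets_AA by (auto simp: past_def)

lemma HH_le_AA: "HH \<subseteq> sets (AA u)"
  unfolding sets_AA by auto

lemma Y_measurable_AA: "k \<le> u \<Longrightarrow> Y k \<in> measurable (AA u) N"
  by (rule measurable_from_subalg[OF past_le_AA]) (auto simp: past_def intro!: measurable_generated_by Y_meas)

lemma subalgebra_future: "subalgebra M (future M N Y u)"
  unfolding future_def by (rule subalgebra_generated_by[OF Y_meas])

lemma Y_measurable_future: "u \<le> k \<Longrightarrow> Y k \<in> measurable (future M N Y u) N"
  unfolding future_def by (rule measurable_generated_by[OF Y_meas]) auto

lemma indep_expectation:
  assumes h: "h \<in> HH" and X: "X \<in> borel_measurable (generated_by M N Y UNIV)" "integrable M X"
  shows "(\<integral>\<omega>. indicat_real h \<omega> * X \<omega> \<partial>M) = prob h * (\<integral>\<omega>. X \<omega> \<partial>M)"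
proof -
  interpret H: sigma_algebra "space M" HH by (rule HH(2))
  have hM: "h \<in> sets M" using h HH by auto
  have "{indicat_real h -` A \<inter> space M |A. A \<in> sets borel} \<subseteq> HH"
  proof safe
    fix A :: "real set"
    have "indicat_real h -` A \<inter> space M =
      (if 1 \<in> A then (if 0 \<in> A then space M else h) else (if 0 \<in> A then space M - h else {}))"
      using sets.sets_into_space[OF hM] by (auto simp: indicator_def of_bool_def split: if_splits)
    then show "indicat_real h -` A \<inter> space M \<in> HH" using h by auto
  qed
  then have s1: "sigma_sets (space M) {indicat_real h -` A \<inter> space M |A. A \<in> sets borel} \<subseteq> HH"
    by (rule H.sigma_sets_subset)
  have "{X -` A \<inter> space M |A. A \<in> sets borel} \<subseteq> sets (generated_by M N Y UNIV)"
    using measurable_sets[OF X(1)] by auto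
  then have s2: "sigma_sets (space M) {X -` A \<inter> space M |A. A \<in> sets borel} \<subseteq> sets (generated_by M N Y UNIV)"
    using sets.sigma_sets_subset[of _ "generated_by M N Y UNIV"] by simp
  have "indep_set (sigma_sets (space M) {indicat_real h -` A \<inter> space M |A. A \<in> sets borel})
      (sigma_sets (space M) {X -` A \<inter> space M |A. A \<in> sets borel})"
    using HH_indep unfolding indep_set_def
    by (rule indep_sets_mono_sets) (use s1 s2 in \<open>auto split: bool.split\<close>)
  then have "indep_var borel (indicat_real h) borel X"
    using hM borel_measurable_integrable[OF X(2)] by (simp add: indep_var_eq)
  then have "(\<integral>\<omega>. indicat_real h \<omega> * X \<omega> \<partial>M) = (\<integral>\<omega>. indicat_real h \<omega> \<partial>M) * (\<integral>\<omega>. X \<omega> \<partial>M)"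
    using hM by (intro indep_var_lebesgue_integral X(2)) (auto simp: emeasure_eq_measure)
  then show ?thesis using sets.sets_into_space[OF hM] by (simp add: Int_absorb2)
qed

lemma finite_measure_subalgebra_past: "finite_measure_subalgebra M (past M N Y u)"
  unfolding past_def finite_measure_subalgebra_def finite_measure_subalgebra_axioms_def
  using finite_measure_axioms subalgebra_generated_by[OF Y_meas] by auto

lemma sigma_finite_subalgebra_past: "sigma_finite_subalgebra M (past M N Y u)"
  using finite_measure_subalgebra_past by (rule finite_measure_subalgebra_is_sigma_finite)

text \<open>For an observation event, conditioning on \<open>AA u\<close> or on the past of the
  observations gives the same, since the added noise is independent. This is checked on
  intersections of a noise event with a past event, a generator stable under intersection, and
  extended by complements and disjoint unions.\<close>

lemma prob_inter_AA:
  assumes A: "A \<in> sets (AA u)" and B: "B \<in> sets (generated_by M N Y UNIV)"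
  shows "prob (A \<inter> B) = (\<integral>\<omega>. indicat_real A \<omega> * real_cond_exp M (past M N Y u) (indicat_real B) \<omega> \<partial>M)"
proof -
  interpret sigma_finite_subalgebra M "past M N Y u" by (rule sigma_finite_subalgebra_past)
  interpret H: sigma_algebra "space M" HH by (rule HH(2))
  let ?q = "real_cond_exp M (past M N Y u) (indicat_real B)"
  have Bm: "B \<in> sets M" using B by (rule subalgebra_sets[OF subalgebra_generated_by[OF Y_meas]])
  have iB: "integrable M (indicat_real B)" using Bm by (simp add: emeasure_eq_measure)
  have iq: "integrable M ?q" by (rule real_cond_exp_int(1)[OF iB])
  define G where "G = {h \<inter> f |h f. h \<in> HH \<and> f \<in> sets (past M N Y u)}"
  have spp: "space M \<in> sets (past M N Y u)" using sets.top[of "past M N Y u"] by (simp add: past_def)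
  have Gsub: "G \<subseteq> sets M" using HH(1) past_sub by (auto simp: G_def)
  have Gst: "Int_stable G"
  proof (rule Int_stableI)
    fix a b assume "a \<in> G" "b \<in> G"
    then obtain h f h' f' where *: "a = h \<inter> f" "b = h' \<inter> f'" "h \<in> HH" "h' \<in> HH"
      "f \<in> sets (past M N Y u)" "f' \<in> sets (past M N Y u)" by (auto simp: G_def)
    have "a \<inter> b = (h \<inter> h') \<inter> (f \<inter> f')" using * by auto
    then show "a \<inter> b \<in> G" using * unfolding G_def by blast
  qed
  have eq: "sets (AA u) = sigma_sets (space M) G"
  proof (rule antisym)
    have "HH \<subseteq> G"
    proof
      fix h assume h: "h \<in> HH"
      then have "h = h \<inter> space M" using H.sets_into_space by auto
      then show "h \<in> G" unfolding G_def using h spp by blast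
    qed
    moreover have "sets (past M N Y u) \<subseteq> G"
    proof
      fix f assume f: "f \<in> sets (past M N Y u)"
      then have "f = space M \<inter> f" using past_sub sets.sets_into_space by blast
      then show "f \<in> G" unfolding G_def using f H.top by blast
    qed
    ultimately show "sets (AA u) \<subseteq> sigma_sets (space M) G"
      unfolding sets_AA by (intro sigma_sets_mono') auto
    have "G \<subseteq> sets (AA u)"
    proof
      fix a assume "a \<in> G"
      then obtain h f where *: "a = h \<inter> f" "h \<in> HH" "f \<in> sets (past M N Y u)" by (auto simp: G_def)
      then have "h \<in> sets (AA u)" "f \<in> sets (AA u)" using HH_le_AA subalgebra_sets[OF past_le_AA] by auto
      then show "a \<in> sets (AA u)" unfolding *(1) by (rule sets.Int)
    qed
    then show "sigma_sets (space M) G \<subseteq> sets (AA u)" using sets.sigma_sets_subset[of G "AA u"] by simp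
  qed
  have "G \<subseteq> Pow (space M)" using Gsub sets.sets_into_space by blast
  moreover have "A \<in> sigma_sets (space M) G" using A eq by simp
  ultimately show ?thesis
  proof (induction rule: sigma_sets_induct_disjoint[OF Gst, consumes 2, case_names basic empty compl union])
    case (basic a)
    then obtain h f where *: "a = h \<inter> f" "h \<in> HH" "f \<in> sets (past M N Y u)" by (auto simp: G_def)
    have f': "f \<in> sets (generated_by M N Y UNIV)"
      using *(3) generated_by_mono[of "{..u}" UNIV M N Y] unfolding past_def by auto
    have fM: "f \<in> sets M" using * past_sub by auto
    have "prob (a \<inter> B) = prob (h \<inter> (f \<inter> B))" by (simp add: * Int_assoc)
    also have "\<dots> = prob h * prob (f \<inter> B)"
      using HH_indep * f' B unfolding indep_set_def
      by (intro indep_setD[OF HH_indep]) auto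
    also have "prob (f \<inter> B) = (\<integral>\<omega>. indicat_real f \<omega> * indicat_real B \<omega> \<partial>M)"
      using fM Bm sets.sets_into_space[of "f \<inter> B" M] by (simp add: indicator_inter_arith[symmetric] Int_absorb2)
    also have "\<dots> = (\<integral>\<omega>. indicat_real f \<omega> * ?q \<omega> \<partial>M)"
      using *(3) Bm fM by (intro real_cond_exp_intg(2)[symmetric])
        (auto simp: indicator_inter_arith[symmetric] emeasure_eq_measure)
    also have "prob h * \<dots> = (\<integral>\<omega>. indicat_real h \<omega> * (indicat_real f \<omega> * ?q \<omega>) \<partial>M)"
    proof (rule indep_expectation[symmetric, OF *(2)])
      have "?q \<in> borel_measurable (generated_by M N Y UNIV)"
        using measurable_from_subalg[of "generated_by M N Y UNIV" "past M N Y u" ?q borel]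
          generated_by_mono[of "{..u}" UNIV M N Y] borel_measurable_cond_exp[of M "past M N Y u"]
        unfolding subalgebra_def past_def by simp
      then show "(\<lambda>\<omega>. indicat_real f \<omega> * ?q \<omega>) \<in> borel_measurable (generated_by M N Y UNIV)"
        using f' by auto
      show "integrable M (\<lambda>\<omega>. indicat_real f \<omega> * ?q \<omega>)"
        using integrable_mult_indicator[OF fM iq] by simp
    qed
    finally show ?case by (simp add: * indicator_inter_arith mult.assoc)
  next
    case empty
    show ?case by simp
  next
    case (compl a)
    have aM: "a \<in> sets M" using compl.hyps eq subalgebra_sets[OF subalgebra_AA] by auto
    have "prob ((space M - a) \<inter> B) = prob B - prob (a \<inter> B)"
    proof -
      have "(space M - a) \<inter> B = B - a \<inter> B" using sets.sets_into_space[OF Bm] by auto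
      then show ?thesis using finite_measure_Diff[of B "a \<inter> B"] aM Bm by auto
    qed
    also have "prob B = (\<integral>\<omega>. ?q \<omega> \<partial>M)"
      using real_cond_exp_int(2)[OF iB] sets.sets_into_space[OF Bm] by (simp add: Int_absorb2)
    also have "prob (a \<inter> B) = (\<integral>\<omega>. indicat_real a \<omega> * ?q \<omega> \<partial>M)" by (rule compl.IH)
    also have "(\<integral>\<omega>. ?q \<omega> \<partial>M) - \<dots> = (\<integral>\<omega>. ?q \<omega> - indicat_real a \<omega> * ?q \<omega> \<partial>M)"
      using iq integrable_mult_indicator[OF aM iq] by (simp add: Bochner_Integration.integral_diff)
    also have "\<dots> = (\<integral>\<omega>. indicat_real (space M - a) \<omega> * ?q \<omega> \<partial>M)"
      by (intro Bochner_Integration.integral_cong) (auto simp: indicator_def)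
    finally show ?case .
  next
    case (union Ai)
    have Ai: "Ai i \<in> sets M" for i using union.hyps eq subalgebra_sets[OF subalgebra_AA] by auto
    have "(\<lambda>i. prob (Ai i \<inter> B)) sums prob (\<Union>i. Ai i \<inter> B)"
      using Ai Bm union.hyps(1) by (intro finite_measure_UNION) (auto simp: disjoint_family_on_def)
    moreover have "(\<integral>\<omega>. indicat_real (\<Union>i. Ai i) \<omega> * ?q \<omega> \<partial>M) = (\<Sum>i. \<integral>\<omega>. indicat_real (Ai i) \<omega> * ?q \<omega> \<partial>M)"
    proof -
      have "set_integrable M (\<Union>i. Ai i) ?q"
        using integrable_mult_indicator[of "\<Union>i. Ai i" M ?q] Ai iq unfolding set_integrable_def by auto
      from lebesgue_integral_countable_add[OF Ai _ this] union.hyps(1) show ?thesis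
        unfolding set_lebesgue_integral_def disjoint_family_on_def by auto
    qed
    ultimately show ?case using union.IH by (simp add: sums_iff)
  qed
qed

text \<open>Each cell of the partition may test a different future event, but at a given point only
  one cell is active, so the single essential supremum dominates the whole sum. This uniformity over
  events is what \<open>\<beta>\<close>-mixing offers beyond a bound for each pair of
  events.\<close>

lemma mixing_partition:
  assumes f: "f \<in> measurable (AA u) (count_space UNIV)" "\<And>\<omega>. \<omega> \<in> space M \<Longrightarrow> f \<omega> < (n::nat)"
    and B: "\<And>i. B i \<in> sets (future M N Y (u + int k))"
  shows "\<bar>\<Sum>i<n. prob ({\<omega>\<in>space M. f \<omega> = i} \<inter> B i) - prob {\<omega>\<in>space M. f \<omega> = i} * prob (B i)\<bar> \<le> bk k"
proof -
  interpret sigma_finite_subalgebra M "past M N Y u" by (rule sigma_finite_subalgebra_past)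
  define q where "q B = real_cond_exp M (past M N Y u) (indicat_real B)" for B
  let ?I = "sets (future M N Y (u + int k))"
  let ?f = "\<lambda>B \<omega>. ennreal \<bar>real_cond_exp M (past M N Y u) (indicat_real B) \<omega> - measure M B\<bar>"
  have IM: "C \<in> sets M" if "C \<in> ?I" for C using that by (rule subalgebra_sets[OF subalgebra_future])
  have iB: "integrable M (indicat_real C)" if "C \<in> ?I" for C using IM[OF that] by (simp add: emeasure_eq_measure)
  have le1: "AE \<omega> in M. ?f C \<omega> \<le> 1" if "C \<in> ?I" for C
  proof -
    have "AE \<omega> in M. real_cond_exp M (past M N Y u) (indicat_real C) \<omega> \<ge> 0"
      by (rule real_cond_exp_pos) (use IM[OF that] in auto)
    moreover have "AE \<omega> in M. real_cond_exp M (past M N Y u) (indicat_real C) \<omega> \<le> 1"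
      by (rule real_cond_exp_le_c) (use iB[OF that] in \<open>auto simp: indicator_def\<close>)
    ultimately show ?thesis
    proof eventually_elim
      case (elim \<omega>)
      then have "\<bar>real_cond_exp M (past M N Y u) (indicat_real C) \<omega> - prob C\<bar> \<le> 1"
        using prob_le_1[of C] measure_nonneg[of M C] by linarith
      then show ?case by simp
    qed
  qed
  define Z where "Z = family_esssup M ?I ?f"
  have "\<exists>Z. Z \<in> borel_measurable M \<and> (\<forall>i\<in>?I. AE \<omega> in M. ?f i \<omega> \<le> Z \<omega>) \<and>
        (\<forall>W\<in>borel_measurable M. (\<forall>i\<in>?I. AE \<omega> in M. ?f i \<omega> \<le> W \<omega>) \<longrightarrow> (AE \<omega> in M. Z \<omega> \<le> W \<omega>))"
    by (rule family_esssup_exists[OF prob_space_axioms]) (use le1 in auto)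
  from someI_ex[OF this] have Z: "\<And>C. C \<in> ?I \<Longrightarrow> AE \<omega> in M. ?f C \<omega> \<le> Z \<omega>" unfolding Z_def family_esssup_def by blast
  have "(\<integral>\<^sup>+\<omega>. Z \<omega> \<partial>M) \<le> beta_mixing M N Y k"
    unfolding beta_mixing_def Z_def by (rule SUP_upper) simp
  then have intZ: "(\<integral>\<^sup>+\<omega>. Z \<omega> \<partial>M) \<le> ennreal (bk k)" using mixing(1) order_trans by blast
  let ?A = "\<lambda>i. {\<omega>\<in>space M. f \<omega> = i}"
  have A: "?A i \<in> sets (AA u)" for i
    using measurable_sets[OF f(1), of "{i}"] by (simp add: vimage_def Int_def conj_commute)
  have AM: "?A i \<in> sets M" for i using A by (rule subalgebra_sets[OF subalgebra_AA])
  have Bg: "B i \<in> sets (generated_by M N Y UNIV)" for i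
    using B generated_by_mono[of _ UNIV M N Y] unfolding future_def by blast
  have iq: "integrable M (q (B i))" for i unfolding q_def using iB[OF B] by (rule real_cond_exp_int(1))
  let ?X = "\<lambda>\<omega>. \<Sum>i<n. indicat_real (?A i) \<omega> * (q (B i) \<omega> - prob (B i))"
  have iX: "integrable M (\<lambda>\<omega>. indicat_real (?A i) \<omega> * (q (B i) \<omega> - prob (B i)))" for i
    using integrable_mult_indicator[OF AM, of "\<lambda>\<omega>. q (B i) \<omega> - prob (B i)"] iq by simp
  have "(\<Sum>i<n. prob (?A i \<inter> B i) - prob (?A i) * prob (B i)) = (\<integral>\<omega>. ?X \<omega> \<partial>M)"
  proof -
    have "prob (?A i \<inter> B i) - prob (?A i) * prob (B i) = (\<integral>\<omega>. indicat_real (?A i) \<omega> * (q (B i) \<omega> - prob (B i)) \<partial>M)" for i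
    proof -
      have "integrable M (\<lambda>\<omega>. indicat_real (?A i) \<omega> * q (B i) \<omega>)" using integrable_mult_indicator[OF AM iq] by simp
      moreover have "integrable M (\<lambda>\<omega>. indicat_real (?A i) \<omega> * prob (B i))" using AM by (auto simp: emeasure_eq_measure)
      ultimately show ?thesis
        using prob_inter_AA[OF A Bg, of i i] AM[of i] sets.sets_into_space[OF AM, of i] unfolding q_def[symmetric]
        by (simp add: right_diff_distrib Int_absorb2)
    qed
    moreover have "(\<integral>\<omega>. ?X \<omega> \<partial>M) = (\<Sum>i<n. \<integral>\<omega>. indicat_real (?A i) \<omega> * (q (B i) \<omega> - prob (B i)) \<partial>M)"
      by (rule Bochner_Integration.integral_sum) (rule iX)
    ultimately show ?thesis by (simp only:)
  qed
  moreover have "ennreal \<bar>\<integral>\<omega>. ?X \<omega> \<partial>M\<bar> \<le> ennreal (bk k)"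
  proof -
    have "integrable M ?X" by (rule Bochner_Integration.integrable_sum) (rule iX)
    from integral_norm_bound_ennreal[OF this]
    have "ennreal \<bar>\<integral>\<omega>. ?X \<omega> \<partial>M\<bar> \<le> (\<integral>\<^sup>+\<omega>. norm (?X \<omega>) \<partial>M)"
      by (simp only: real_norm_def)
    also have "\<dots> \<le> (\<integral>\<^sup>+\<omega>. Z \<omega> \<partial>M)"
    proof (rule nn_integral_mono_AE)
      have "AE \<omega> in M. \<forall>i\<in>{..<n}. ?f (B i) \<omega> \<le> Z \<omega>"
        by (subst AE_ball_countable) (use Z B in auto)
      then show "AE \<omega> in M. ennreal (norm (?X \<omega>)) \<le> Z \<omega>"
        using AE_space
      proof eventually_elim
        case (elim \<omega>)
        have "?X \<omega> = (\<Sum>i<n. if i = f \<omega> then q (B i) \<omega> - prob (B i) else 0)"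
          using elim(2) by (intro sum.cong) (auto simp: indicator_def)
        also have "\<dots> = q (B (f \<omega>)) \<omega> - prob (B (f \<omega>))" using f(2)[OF elim(2)] by simp
        finally show ?case using elim(1) f(2)[OF elim(2)] unfolding q_def by auto
      qed
    qed
    finally show ?thesis using intZ by (rule order_trans)
  qed
  ultimately show ?thesis using mixing(2)[of k] by (simp add: ennreal_le_iff)
qed

lemma finite_measure_subalgebra_AA: "finite_measure_subalgebra M (AA u)"
  unfolding finite_measure_subalgebra_def finite_measure_subalgebra_axioms_def
  using finite_measure_axioms subalgebra_AA by auto

lemma sigma_finite_subalgebra_AA: "sigma_finite_subalgebra M (AA u)"
  using finite_measure_subalgebra_AA by (rule finite_measure_subalgebra_is_sigma_finite)

text \<open>The product law: the first coordinate carries \<open>AA u\<close>, the second the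
  observations from time \<open>v\<close> on. The joint law to be compared with it is the image of
  \<open>M\<close> under the diagonal map.\<close>

definition pair_alg :: "int \<Rightarrow> int \<Rightarrow> ('w \<times> 'w) measure" where
  "pair_alg u v = restr_to_subalg M (AA u) \<Otimes>\<^sub>M restr_to_subalg M (future M N Y v)"

lemma space_pair_alg: "space (pair_alg u v) = space M \<times> space M"
  by (simp add: pair_alg_def space_pair_measure space_restr_to_subalg)

lemma measurable_diag: "(\<lambda>\<omega>. (\<omega>, \<omega>)) \<in> measurable M (pair_alg u v)"
  unfolding pair_alg_def
  by (intro measurable_Pair measurable_in_subalg'[OF subalgebra_AA] measurable_in_subalg'[OF subalgebra_future]
      measurable_ident_sets measurable_from_subalg[OF subalgebra_AA] measurable_from_subalg[OF subalgebra_future])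
     (auto simp: sets_restr_to_subalg[OF subalgebra_AA] sets_restr_to_subalg[OF subalgebra_future]
       measurable_def space_restr_to_subalg subalgebra_sets[OF subalgebra_AA] subalgebra_sets[OF subalgebra_future]
       intro!: sets.Int_space_eq2[THEN arg_cong[where f = "\<lambda>A. A \<in> _"], THEN iffD2])

text \<open>For a finite union of rectangles over a partition of the first factor the claim is
  \<open>mixing_partition\<close>. Such unions form an algebra that generates the product
  sigma-algebra, and approximation in both laws reaches every measurable set.\<close>

lemma total_variation_bound:
  assumes D: "D \<in> sets (pair_alg u (u + int k))"
  shows "\<bar>prob {\<omega>\<in>space M. (\<omega>, \<omega>) \<in> D} - measure (pair_alg u (u + int k)) D\<bar> \<le> bk k"
proof -
  let ?v = "u + int k"
  let ?A = "restr_to_subalg M (AA u)" and ?F = "restr_to_subalg M (future M N Y ?v)"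
  let ?P2 = "pair_alg u ?v" and ?P1 = "distr M (pair_alg u ?v) (\<lambda>\<omega>. (\<omega>, \<omega>))"
  interpret A: prob_space ?A by (rule prob_space_restr_to_subalg[OF subalgebra_AA prob_space_axioms])
  interpret F: prob_space ?F by (rule prob_space_restr_to_subalg[OF subalgebra_future prob_space_axioms])
  interpret AF: pair_prob_space ?A ?F ..
  interpret P1: prob_space ?P1 by (rule prob_space_distr) (rule measurable_diag)
  have P2: "prob_space ?P2" unfolding pair_alg_def by (rule AF.prob_space_axioms)
  interpret P2: prob_space ?P2 by (rule P2)
  have sA: "sets ?A = sets (AA u)" and sF: "sets ?F = sets (future M N Y ?v)"
    by (auto simp: sets_restr_to_subalg subalgebra_AA subalgebra_future)
  have spF: "space (future M N Y ?v) = space M" by (simp add: future_def)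
  define G where "G = {a \<times> b |a b. a \<in> sets ?A \<and> b \<in> sets ?F}"
  have sP: "sets ?P2 = sigma_sets (space M \<times> space M) G"
    unfolding pair_alg_def sets_pair_measure G_def by (simp add: space_restr_to_subalg)
  \<comment> \<open>A finite union of rectangles is encoded by the label \<open>f\<close> of a cell
    and the section \<open>B i\<close> over the cell with label i, so that complements act on the
    sections alone.\<close>
  define Alg where "Alg = {R. \<exists>f B n. f \<in> measurable (AA u) (count_space UNIV) \<and> (\<forall>\<omega>\<in>space M. f \<omega> < (n::nat))
      \<and> (\<forall>i::nat. B i \<in> sets (future M N Y ?v)) \<and> R = {z \<in> space M \<times> space M. snd z \<in> B (f (fst z))}}"
  have dec: "R = (\<Union>i<n. {\<omega>\<in>space M. f \<omega> = i} \<times> B i)"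
    if "R = {z \<in> space M \<times> space M. snd z \<in> B (f (fst z))}" "\<forall>\<omega>\<in>space M. f \<omega> < (n::nat)"
      "\<forall>i. B i \<in> sets (future M N Y ?v)" for R f B n
    using that sets.sets_into_space[of _ "future M N Y ?v"] spF by auto
  have fs: "{\<omega>\<in>space M. f \<omega> = i} \<in> sets ?A" if "f \<in> measurable (AA u) (count_space UNIV)" for f and i :: nat
    using measurable_sets[OF that, of "{i}"] unfolding sA by (simp add: vimage_def Int_def conj_commute)
  have Algsub: "Alg \<subseteq> sets ?P2"
  proof
    fix R assume "R \<in> Alg"
    then obtain f B n where *: "f \<in> measurable (AA u) (count_space UNIV)" "\<forall>\<omega>\<in>space M. f \<omega> < (n::nat)"
      "\<forall>i::nat. B i \<in> sets (future M N Y ?v)" "R = {z \<in> space M \<times> space M. snd z \<in> B (f (fst z))}"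
      unfolding Alg_def by blast
    show "R \<in> sets ?P2" unfolding dec[OF *(4,2,3)] pair_alg_def
      using fs[OF *(1)] *(3) sF by (intro sets.finite_UN pair_measureI) auto
  qed
  have "\<exists>R\<in>Alg. measure ?P1 ((D - R) \<union> (R - D)) + measure ?P2 ((D - R) \<union> (R - D)) < e" if "e > 0" for e
  proof (rule approximation_by_algebra[where \<Omega> = "space M \<times> space M" and G = G])
    show "finite_measure ?P1" "finite_measure ?P2" by unfold_locales
    show "G \<subseteq> Alg"
    proof
      fix R assume "R \<in> G"
      then obtain a b where ab: "R = a \<times> b" "a \<in> sets (AA u)" "b \<in> sets (future M N Y ?v)"
        by (auto simp: G_def sA sF)
      let ?f = "\<lambda>\<omega>. if \<omega> \<in> a then 1 else (0::nat)" and ?B = "\<lambda>i::nat. if i = 1 then b else {}"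
      have "?f \<in> measurable (AA u) (count_space UNIV)" using ab(2) by measurable
      moreover have "R = {z \<in> space M \<times> space M. snd z \<in> ?B (?f (fst z))}"
        using ab sets.sets_into_space[OF ab(2)] sets.sets_into_space[OF ab(3)] spF by (auto split: if_splits)
      ultimately show "R \<in> Alg" unfolding Alg_def using ab(3)
        by (intro CollectI exI[of _ ?f] exI[of _ ?B] exI[of _ 2]) auto
    qed
    show "{} \<in> Alg" unfolding Alg_def
      by (intro CollectI exI[of _ "\<lambda>_. 0"] exI[of _ "\<lambda>_. {}"] exI[of _ 1]) auto
    fix R assume "R \<in> Alg"
    then obtain f B n where *: "f \<in> measurable (AA u) (count_space UNIV)" "\<forall>\<omega>\<in>space M. f \<omega> < (n::nat)"
      "\<forall>i::nat. B i \<in> sets (future M N Y ?v)" "R = {z \<in> space M \<times> space M. snd z \<in> B (f (fst z))}"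
      unfolding Alg_def by blast
    have "\<forall>i. space M - B i \<in> sets (future M N Y ?v)"
      using *(3) spF by (metis sets.compl_sets)
    then show "space M \<times> space M - R \<in> Alg" unfolding Alg_def using *
      by (intro CollectI exI[of _ f] exI[of _ "\<lambda>i. space M - B i"] exI[of _ n]) auto
    fix R' assume "R' \<in> Alg"
    then obtain f' B' n' where hh: "f' \<in> measurable (AA u) (count_space UNIV)" "\<forall>\<omega>\<in>space M. f' \<omega> < (n'::nat)"
      "\<forall>i::nat. B' i \<in> sets (future M N Y ?v)" "R' = {z \<in> space M \<times> space M. snd z \<in> B' (f' (fst z))}"
      unfolding Alg_def by blast
    \<comment> \<open>The common refinement of two partitions: a pair of labels is coded as one
      number and decoded by \<open>div\<close> and \<open>mod\<close>.\<close>
    let ?f = "\<lambda>\<omega>. f \<omega> * n' + f' \<omega>" and ?B = "\<lambda>i. B (i div n') \<union> B' (i mod n')"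
    have "?f \<in> measurable (AA u) (count_space UNIV)" using *(1) hh(1) by measurable
    moreover have "?f \<omega> < n * n'" if "\<omega> \<in> space M" for \<omega>
    proof -
      have "f \<omega> * n' + f' \<omega> < Suc (f \<omega>) * n'" using hh(2) that by simp
      also have "\<dots> \<le> n * n'" using *(2) that by (intro mult_right_mono) (auto simp: Suc_le_eq)
      finally show ?thesis .
    qed
    moreover have "R \<union> R' = {z \<in> space M \<times> space M. snd z \<in> ?B (?f (fst z))}"
      using *(2) hh(2) unfolding *(4) hh(4) by (auto simp: div_add1_eq)
    ultimately show "R \<union> R' \<in> Alg" unfolding Alg_def using *(3) hh(3)
      by (intro CollectI exI[of _ ?f] exI[of _ ?B] exI[of _ "n * n'"]) auto
  qed (use sP Algsub D that in \<open>auto simp: space_pair_alg\<close>)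
  note approx = this
  have P1m: "measure ?P1 R = prob {\<omega>\<in>space M. (\<omega>, \<omega>) \<in> R}" if "R \<in> sets ?P2" for R
    using that by (subst measure_distr) (auto intro: measurable_diag arg_cong[where f = prob] simp: vimage_def Int_def conj_commute)
  have bR: "\<bar>measure ?P1 R - measure ?P2 R\<bar> \<le> bk k" if RA: "R \<in> Alg" for R
  proof -
    obtain f B n where *: "f \<in> measurable (AA u) (count_space UNIV)" "\<forall>\<omega>\<in>space M. f \<omega> < (n::nat)"
      "\<forall>i::nat. B i \<in> sets (future M N Y ?v)" "R = {z \<in> space M \<times> space M. snd z \<in> B (f (fst z))}"
      using RA unfolding Alg_def by blast
    let ?a = "\<lambda>i. {\<omega>\<in>space M. f \<omega> = i}"
    have aM: "?a i \<in> sets M" for i using fs[OF *(1)] unfolding sA by (rule subalgebra_sets[OF subalgebra_AA])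
    have BM: "B i \<in> sets M" for i using *(3) subalgebra_sets[OF subalgebra_future] by auto
    have disj: "disjoint_family_on (\<lambda>i. ?a i \<times> B i) {..<n}" by (auto simp: disjoint_family_on_def)
    have rs: "?a i \<times> B i \<in> sets ?P2" for i unfolding pair_alg_def using fs[OF *(1)] *(3) sF by auto
    have "measure ?P2 R = (\<Sum>i<n. measure ?P2 (?a i \<times> B i))"
      unfolding dec[OF *(4,2,3)] using disj rs by (intro P2.finite_measure_finite_Union) auto
    also have "\<dots> = (\<Sum>i<n. prob (?a i) * prob (B i))"
    proof (intro sum.cong refl)
      fix i
      have "measure ?P2 (?a i \<times> B i) = measure ?A (?a i) * measure ?F (B i)"
        unfolding pair_alg_def using fs[OF *(1)] *(3) sF
        by (simp add: measure_def F.emeasure_pair_measure_Times enn2real_mult)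
      also have "measure ?A (?a i) = prob (?a i)" using fs[OF *(1)] sA
        by (simp add: measure_def emeasure_restr_to_subalg[OF subalgebra_AA])
      also have "measure ?F (B i) = prob (B i)" using *(3)
        by (simp add: measure_def emeasure_restr_to_subalg[OF subalgebra_future])
      finally show "measure ?P2 (?a i \<times> B i) = prob (?a i) * prob (B i)" .
    qed
    finally have m2: "measure ?P2 R = (\<Sum>i<n. prob (?a i) * prob (B i))" .
    have "measure ?P1 R = (\<Sum>i<n. measure ?P1 (?a i \<times> B i))"
      unfolding dec[OF *(4,2,3)] using disj rs by (intro P1.finite_measure_finite_Union) auto
    also have "\<dots> = (\<Sum>i<n. prob (?a i \<inter> B i))"
    proof (intro sum.cong refl)
      fix i
      have "{\<omega> \<in> space M. (\<omega>, \<omega>) \<in> ?a i \<times> B i} = ?a i \<inter> B i" by auto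
      then show "measure ?P1 (?a i \<times> B i) = prob (?a i \<inter> B i)" using P1m[OF rs] by simp
    qed
    finally have m1: "measure ?P1 R = (\<Sum>i<n. prob (?a i \<inter> B i))" .
    have "\<bar>\<Sum>i<n. prob (?a i \<inter> B i) - prob (?a i) * prob (B i)\<bar> \<le> bk k"
      by (rule mixing_partition) (use * in auto)
    then show ?thesis unfolding m1 m2 by (simp add: sum_subtractf)
  qed
  have "\<bar>measure ?P1 D - measure ?P2 D\<bar> \<le> bk k + e" if e: "e > 0" for e
  proof -
    obtain R where R: "R \<in> Alg" "measure ?P1 ((D - R) \<union> (R - D)) + measure ?P2 ((D - R) \<union> (R - D)) < e"
      using approx[OF e] by blast
    have Rs: "R \<in> sets ?P2" using R Algsub by auto
    have "measure P D \<le> measure P R + measure P ((D - R) \<union> (R - D))"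
      "measure P R \<le> measure P D + measure P ((D - R) \<union> (R - D))"
      if "finite_measure P" "sets P = sets ?P2" for P
    proof -
      interpret P: finite_measure P by fact
      have s: "D \<in> sets P" "R \<in> sets P" using that D Rs by auto
      have "measure P D \<le> measure P (R \<union> ((D - R) \<union> (R - D)))" using s by (intro P.finite_measure_mono) auto
      also have "\<dots> \<le> measure P R + measure P ((D - R) \<union> (R - D))" using s by (intro measure_Un_le) auto
      finally show "measure P D \<le> measure P R + measure P ((D - R) \<union> (R - D))" .
      have "measure P R \<le> measure P (D \<union> ((D - R) \<union> (R - D)))" using s by (intro P.finite_measure_mono) auto
      also have "\<dots> \<le> measure P D + measure P ((D - R) \<union> (R - D))" using s by (intro measure_Un_le) auto
      finally show "measure P R \<le> measure P D + measure P ((D - R) \<union> (R - D))" .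
    qed
    from this[of ?P1] this[of ?P2] show ?thesis
      using bR[OF R(1)] R(2) P1.finite_measure_axioms P2.finite_measure_axioms by (auto simp: abs_le_iff)
  qed
  then have "\<bar>measure ?P1 D - measure ?P2 D\<bar> \<le> bk k" by (rule field_le_epsilon)
  then show ?thesis using P1m[OF D] by simp
qed

text \<open>Closeness in total variation controls bounded functions, so h is cut where its envelope
  \<open>H\<close> exceeds a level K. Passing from the joint to the product law changes the bounded
  part by at most \<open>2 * K * bk k\<close>, and each of the two cut parts costs the second moment
  of \<open>H\<close> divided by K. Under the product law the first argument is frozen and the
  centring applies.\<close>

lemma integral_decoupling:
  assumes h: "h \<in> borel_measurable (pair_alg u (u + int k))"
    and H: "H \<in> borel_measurable (future M N Y (u + int k))" "integrable M (\<lambda>\<omega>. (H \<omega>)\<^sup>2)"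
    and hH: "\<And>\<omega> \<omega>'. \<omega> \<in> space M \<Longrightarrow> \<omega>' \<in> space M \<Longrightarrow> \<bar>h (\<omega>, \<omega>')\<bar> \<le> H \<omega>'"
    and centred: "\<And>\<omega>. \<omega> \<in> space M \<Longrightarrow> \<bar>\<integral>\<omega>'. h (\<omega>, \<omega>') \<partial>M\<bar> \<le> \<eta>"
  shows "\<bar>\<integral>\<omega>. h (\<omega>, \<omega>) \<partial>M\<bar> \<le> \<eta> + (2 + 2 * (\<integral>\<omega>. (H \<omega>)\<^sup>2 \<partial>M)) * sqrt (bk k)"
proof -
  let ?v = "u + int k"
  let ?A = "restr_to_subalg M (AA u)" and ?F = "restr_to_subalg M (future M N Y ?v)"
  let ?P2 = "pair_alg u ?v" and ?P1 = "distr M (pair_alg u ?v) (\<lambda>\<omega>. (\<omega>, \<omega>))"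
  interpret A: prob_space ?A by (rule prob_space_restr_to_subalg[OF subalgebra_AA prob_space_axioms])
  interpret F: prob_space ?F by (rule prob_space_restr_to_subalg[OF subalgebra_future prob_space_axioms])
  interpret AF: pair_prob_space ?A ?F ..
  interpret P1: prob_space ?P1 by (rule prob_space_distr) (rule measurable_diag)
  have P2: "prob_space ?P2" unfolding pair_alg_def by (rule AF.prob_space_axioms)
  interpret P2: prob_space ?P2 by (rule P2)
  have ne: "space M \<noteq> {}" by (rule not_empty)
  note [measurable] = h
  have HF[measurable]: "H \<in> borel_measurable ?F" using H(1) by (rule measurable_in_subalg[OF subalgebra_future])
  have HM[measurable]: "H \<in> borel_measurable M" using H(1) by (rule measurable_from_subalg[OF subalgebra_future])
  have H0: "0 \<le> H \<omega>" if "\<omega> \<in> space M" for \<omega> using hH[OF that that] by linarith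
  have Hsnd[measurable]: "(\<lambda>z. H (snd z)) \<in> borel_measurable ?P2" unfolding pair_alg_def by measurable
  have iH: "integrable M H"
  proof (rule Bochner_Integration.integrable_bound)
    show "integrable M (\<lambda>\<omega>. 1 + (H \<omega>)\<^sup>2)" using H(2) by simp
    have "\<bar>x\<bar> \<le> 1 + x\<^sup>2" for x :: real
    proof -
      have "2 * \<bar>x\<bar> \<le> 1 + x\<^sup>2" using zero_le_power2[of "\<bar>x\<bar> - 1"] by (simp add: power2_diff)
      then show ?thesis by (smt (verit) abs_ge_zero)
    qed
    then show "AE \<omega> in M. norm (H \<omega>) \<le> norm (1 + (H \<omega>)\<^sup>2)" by (auto intro: order_trans)
  qed measurable
  let ?b = "bk k"
  have b: "?b > 0" by (rule mixing)
  \<comment> \<open>Balances \<open>2 * K * bk k\<close> against \<open>Q / K\<close>. Both become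
    of order \<open>sqrt (bk k)\<close>, the reason why the square root of the mixing rate appears
    later.\<close>
  define K where "K = 1 / sqrt ?b"
  have K: "K > 0" using b by (simp add: K_def)
  define Q where "Q = (\<integral>\<omega>. (H \<omega>)\<^sup>2 \<partial>M)"
  define hK where "hK z = (if H (snd z) \<le> K then h z else 0)" for z
  have hKm[measurable]: "hK \<in> borel_measurable ?P2" unfolding hK_def by measurable
  have hz: "\<bar>h z\<bar> \<le> H (snd z)" if "z \<in> space ?P2" for z using that hH by (auto simp: space_pair_alg)
  have d: "\<bar>h z - hK z\<bar> \<le> (H (snd z))\<^sup>2 / K" if "z \<in> space ?P2" for z
  proof (cases "H (snd z) \<le> K")
    case False
    then have "H (snd z) * K \<le> H (snd z) * H (snd z)" using K by (intro mult_left_mono) auto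
    then have "H (snd z) \<le> (H (snd z))\<^sup>2 / K" using K by (simp add: pos_le_divide_eq power2_eq_square)
    then show ?thesis using False hz[OF that] by (simp add: hK_def)
  qed (use K in \<open>simp add: hK_def\<close>)
  have e1: "\<bar>(\<integral>z. hK z \<partial>?P1) - (\<integral>z. hK z \<partial>?P2)\<bar> \<le> 2 * K * ?b"
  proof (rule abs_integral_diff_le_of_measure_diff_le)
    show "prob_space ?P1" "prob_space ?P2" by unfold_locales
    show "\<bar>measure ?P1 D - measure ?P2 D\<bar> \<le> ?b" if "D \<in> sets ?P1" for D
      using total_variation_bound[of D u k] that
      by (subst measure_distr) (auto intro: measurable_diag simp: vimage_def Int_def conj_commute)
    show "\<bar>hK x\<bar> \<le> K" if "x \<in> space ?P1" for x
      using that hz[of x] K by (auto simp: hK_def)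
  qed (use K in auto)
  have iH2: "integrable ?P2 (\<lambda>z. (H (snd z))\<^sup>2)" "(\<integral>z. (H (snd z))\<^sup>2 \<partial>?P2) = Q"
    and iHs: "integrable ?P2 (\<lambda>z. H (snd z))"
  proof -
    have sm: "snd \<in> measurable ?P2 ?F" unfolding pair_alg_def by simp
    have ds: "distr ?P2 ?F snd = ?F"
    proof (rule measure_eqI)
      fix B assume "B \<in> sets (distr ?P2 ?F snd)"
      then have B: "B \<in> sets ?F" by simp
      have "emeasure (distr ?P2 ?F snd) B = emeasure ?P2 (space ?A \<times> B)"
        using B sets.sets_into_space[OF B] sm
        by (subst emeasure_distr) (auto simp: space_pair_alg space_restr_to_subalg intro!: arg_cong[where f = "emeasure _"])
      also have "\<dots> = emeasure ?F B"
        unfolding pair_alg_def using B by (simp add: F.emeasure_pair_measure_Times A.emeasure_space_1)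
      finally show "emeasure (distr ?P2 ?F snd) B = emeasure ?F B" .
    qed simp
    have i2: "integrable ?F (\<lambda>\<omega>. (H \<omega>)\<^sup>2)" "integrable ?F H"
      using H(1,2) iH by (auto intro!: integrable_in_subalg[OF subalgebra_future])
    show "integrable ?P2 (\<lambda>z. (H (snd z))\<^sup>2)" "integrable ?P2 (\<lambda>z. H (snd z))"
      using i2 integrable_distr[OF sm, of "\<lambda>\<omega>. (H \<omega>)\<^sup>2"] integrable_distr[OF sm, of H] by (auto simp: ds)
    have "(\<integral>z. (H (snd z))\<^sup>2 \<partial>?P2) = (\<integral>\<omega>. (H \<omega>)\<^sup>2 \<partial>?F)"
      using integral_distr[OF sm, of "\<lambda>\<omega>. (H \<omega>)\<^sup>2"] by (simp add: ds)
    also have "\<dots> = Q" unfolding Q_def by (rule integral_subalgebra2[OF subalgebra_future]) (use H(1) in auto)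
    finally show "(\<integral>z. (H (snd z))\<^sup>2 \<partial>?P2) = Q" .
  qed
  have ih2: "integrable ?P2 h"
    by (rule Bochner_Integration.integrable_bound[OF iHs]) (use h in \<open>auto intro!: AE_I2 order_trans[OF hz abs_ge_self]\<close>)
  have ihK2: "integrable ?P2 hK" by (rule P2.integrable_const_bound[of _ K]) (use hz K in \<open>auto simp: hK_def intro!: AE_I2 intro: order_trans\<close>)
  have e2: "\<bar>(\<integral>z. h z \<partial>?P2) - (\<integral>z. hK z \<partial>?P2)\<bar> \<le> Q / K"
  proof -
    have "\<bar>(\<integral>z. h z \<partial>?P2) - (\<integral>z. hK z \<partial>?P2)\<bar> = \<bar>\<integral>z. h z - hK z \<partial>?P2\<bar>" using ih2 ihK2 by simp
    also have "\<dots> \<le> (\<integral>z. \<bar>h z - hK z\<bar> \<partial>?P2)" by (rule integral_abs_bound)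
    also have "\<dots> \<le> (\<integral>z. (H (snd z))\<^sup>2 / K \<partial>?P2)" using d iH2 ih2 ihK2 by (intro integral_mono) auto
    finally show ?thesis using iH2 by simp
  qed
  note dm = measurable_diag[of u ?v]
  have iP1: "(\<integral>z. f z \<partial>?P1) = (\<integral>\<omega>. f (\<omega>, \<omega>) \<partial>M)" if "f \<in> borel_measurable ?P2" for f :: "'w \<times> 'w \<Rightarrow> real"
    by (rule integral_distr[OF dm that])
  have mm: "(\<lambda>\<omega>. h (\<omega>, \<omega>)) \<in> borel_measurable M" "(\<lambda>\<omega>. hK (\<omega>, \<omega>)) \<in> borel_measurable M"
    using measurable_compose[OF dm h] measurable_compose[OF dm hKm] by auto
  have ih1: "integrable M (\<lambda>\<omega>. h (\<omega>, \<omega>))"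
    by (rule Bochner_Integration.integrable_bound[OF iH mm(1)]) (use hH H0 in \<open>auto intro!: AE_I2\<close>)
  have ihK1: "integrable M (\<lambda>\<omega>. hK (\<omega>, \<omega>))"
    by (rule Bochner_Integration.integrable_bound[OF iH mm(2)]) (use hH H0 in \<open>auto intro!: AE_I2 simp: hK_def\<close>)
  have e3: "\<bar>(\<integral>\<omega>. h (\<omega>, \<omega>) \<partial>M) - (\<integral>\<omega>. hK (\<omega>, \<omega>) \<partial>M)\<bar> \<le> Q / K"
  proof -
    have "\<bar>(\<integral>\<omega>. h (\<omega>, \<omega>) \<partial>M) - (\<integral>\<omega>. hK (\<omega>, \<omega>) \<partial>M)\<bar> = \<bar>\<integral>\<omega>. h (\<omega>, \<omega>) - hK (\<omega>, \<omega>) \<partial>M\<bar>" using ih1 ihK1 by simp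
    also have "\<dots> \<le> (\<integral>\<omega>. \<bar>h (\<omega>, \<omega>) - hK (\<omega>, \<omega>)\<bar> \<partial>M)" by (rule integral_abs_bound)
    also have "\<dots> \<le> (\<integral>\<omega>. (H \<omega>)\<^sup>2 / K \<partial>M)"
      using d[of "(_, _)"] H(2) ih1 ihK1 by (intro integral_mono) (auto simp: space_pair_alg)
    finally show ?thesis using H(2) by (simp add: Q_def)
  qed
  have e4: "\<bar>\<integral>z. h z \<partial>?P2\<bar> \<le> \<eta>"
  proof -
    have inner: "(\<integral>\<omega>'. h (\<omega>, \<omega>') \<partial>?F) = (\<integral>\<omega>'. h (\<omega>, \<omega>') \<partial>M)" if "\<omega> \<in> space M" for \<omega>
    proof (rule integral_subalgebra2[OF subalgebra_future])
      have "(\<lambda>\<omega>'. h (\<omega>, \<omega>')) \<in> borel_measurable ?F"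
        using h that unfolding pair_alg_def by (auto simp: space_restr_to_subalg)
      then show "(\<lambda>\<omega>'. h (\<omega>, \<omega>')) \<in> borel_measurable (future M N Y ?v)"
        by (rule measurable_in_subalg'[OF subalgebra_future])
    qed
    have "(\<integral>z. h z \<partial>?P2) = (\<integral>\<omega>. \<integral>\<omega>'. h (\<omega>, \<omega>') \<partial>?F \<partial>?A)"
      using ih2 unfolding pair_alg_def by (rule AF.integral_fst'[symmetric])
    also have "\<bar>\<dots>\<bar> \<le> (\<integral>\<omega>. \<eta> \<partial>?A)"
    proof (rule order_trans[OF integral_abs_bound], rule integral_mono)
      show "integrable ?A (\<lambda>\<omega>. \<bar>\<integral>\<omega>'. h (\<omega>, \<omega>') \<partial>?F\<bar>)"
        using AF.integrable_fst'[of h] ih2 unfolding pair_alg_def by simp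
    qed (use inner centred in \<open>auto simp: space_restr_to_subalg\<close>)
    finally show ?thesis by (simp add: A.prob_space)
  qed
  have "\<bar>\<integral>\<omega>. h (\<omega>, \<omega>) \<partial>M\<bar> \<le> \<eta> + 2 * K * ?b + 2 * (Q / K)"
    using e1 e2 e3 e4 unfolding iP1[OF hKm] by linarith
  also have "2 * K * ?b = 2 * sqrt ?b" using b by (simp add: K_def) (metis mult.commute real_div_sqrt less_imp_le times_divide_eq_right)
  also have "Q / K = Q * sqrt ?b" by (simp add: K_def)
  also have "\<eta> + 2 * sqrt ?b + 2 * (Q * sqrt ?b) = \<eta> + (2 + 2 * Q) * sqrt ?b" by (simp add: algebra_simps)
  finally show ?thesis unfolding Q_def .
qed

text \<open>The L_1 norm of the conditional expectation is its integral against its own sign. That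
  sign is measurable for \<open>AA u\<close>, so it can be absorbed into the first argument of
  \<open>h\<close> without spoiling the envelope or the centring.\<close>

lemma cond_exp_decoupling:
  assumes h: "h \<in> borel_measurable (pair_alg u (u + int k))"
    and H: "H \<in> borel_measurable (future M N Y (u + int k))" "integrable M (\<lambda>\<omega>. (H \<omega>)\<^sup>2)"
    and hH: "\<And>\<omega> \<omega>'. \<omega> \<in> space M \<Longrightarrow> \<omega>' \<in> space M \<Longrightarrow> \<bar>h (\<omega>, \<omega>')\<bar> \<le> H \<omega>'"
    and centred: "\<And>\<omega>. \<omega> \<in> space M \<Longrightarrow> \<bar>\<integral>\<omega>'. h (\<omega>, \<omega>') \<partial>M\<bar> \<le> \<eta>"
    and ih: "integrable M (\<lambda>\<omega>. h (\<omega>, \<omega>))"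
  shows "(\<integral>\<omega>. \<bar>real_cond_exp M (AA u) (\<lambda>\<omega>. h (\<omega>, \<omega>)) \<omega>\<bar> \<partial>M)
    \<le> \<eta> + (2 + 2 * (\<integral>\<omega>. (H \<omega>)\<^sup>2 \<partial>M)) * sqrt (bk k)"
proof -
  interpret sigma_finite_subalgebra M "AA u" by (rule sigma_finite_subalgebra_AA)
  let ?c = "real_cond_exp M (AA u) (\<lambda>\<omega>. h (\<omega>, \<omega>))"
  define g where "g \<omega> = sgn (?c \<omega>)" for \<omega>
  have g[measurable]: "g \<in> borel_measurable (AA u)" unfolding g_def by measurable
  have gM[measurable]: "g \<in> borel_measurable M" using g by (rule measurable_from_subalg[OF subalgebra_AA])
  have g1: "\<bar>g \<omega>\<bar> \<le> 1" for \<omega> by (simp add: g_def abs_sgn_eq)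
  let ?h = "\<lambda>z. g (fst z) * h z"
  have "(\<integral>\<omega>. \<bar>?c \<omega>\<bar> \<partial>M) = (\<integral>\<omega>. g \<omega> * ?c \<omega> \<partial>M)"
    by (simp add: g_def abs_sgn mult.commute)
  also have "\<dots> = (\<integral>\<omega>. g \<omega> * h (\<omega>, \<omega>) \<partial>M)"
  proof (rule real_cond_exp_intg(2))
    show "integrable M (\<lambda>\<omega>. g \<omega> * h (\<omega>, \<omega>))"
      by (rule Bochner_Integration.integrable_bound[OF ih])
        (use g1 ih in \<open>auto simp: abs_mult mult_left_le_one_le intro!: AE_I2\<close>)
  qed (use ih in auto)
  also have "\<dots> \<le> \<bar>\<integral>\<omega>. ?h (\<omega>, \<omega>) \<partial>M\<bar>" by simp
  also have "\<dots> \<le> \<eta> + (2 + 2 * (\<integral>\<omega>. (H \<omega>)\<^sup>2 \<partial>M)) * sqrt (bk k)"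
  proof (rule integral_decoupling[OF _ H])
    have "g \<in> borel_measurable (restr_to_subalg M (AA u))" using g by (rule measurable_in_subalg[OF subalgebra_AA])
    then have "(\<lambda>z. g (fst z)) \<in> borel_measurable (pair_alg u (u + int k))" unfolding pair_alg_def by measurable
    then show "?h \<in> borel_measurable (pair_alg u (u + int k))" using h by measurable
    fix \<omega> assume \<omega>: "\<omega> \<in> space M"
    { fix \<omega>' assume "\<omega>' \<in> space M"
      then show "\<bar>?h (\<omega>, \<omega>')\<bar> \<le> H \<omega>'"
        using hH[OF \<omega>, of \<omega>'] mult_left_le_one_le[of "\<bar>h (\<omega>, \<omega>')\<bar>" "\<bar>g \<omega>\<bar>"] g1[of \<omega>] by (simp add: abs_mult) }
    show "\<bar>\<integral>\<omega>'. ?h (\<omega>, \<omega>') \<partial>M\<bar> \<le> \<eta>"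
      using centred[OF \<omega>] mult_left_le_one_le[of "\<bar>\<integral>\<omega>'. h (\<omega>, \<omega>') \<partial>M\<bar>" "\<bar>g \<omega>\<bar>"] g1[of \<omega>]
      by (simp add: abs_mult)
  qed
  finally show ?thesis .
qed

end

section \<open>Forgetting properties of the smoothing functional\<close>

lemma integral_pos_of_pos:
  assumes "integrable M f" "\<And>x. x \<in> space M \<Longrightarrow> f x > (0::real)" "emeasure M (space M) \<noteq> 0"
  shows "(\<integral>x. f x \<partial>M) > 0"
proof -
  have "(\<integral>x. f x \<partial>M) \<noteq> 0"
  proof
    assume "(\<integral>x. f x \<partial>M) = 0"
    moreover have "AE x in M. 0 \<le> f x" using assms(2) by (intro AE_I2 less_imp_le)
    ultimately have "AE x in M. f x = 0" using integral_nonneg_eq_0_iff_AE[OF assms(1)] by simp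
    then have "AE x in M. False" using AE_space
      by eventually_elim (use assms(2) in force)
    then show False using assms(3) by (simp add: AE_iff_measurable[OF sets.top])
  qed
  moreover have "(\<integral>x. f x \<partial>M) \<ge> 0" using assms(2) by (intro Bochner_Integration.integral_nonneg) (auto intro: less_imp_le)
  ultimately show ?thesis by linarith
qed

text \<open>The bound covers degenerate paths too: the default value 0 of a non-integrable integral
  or of a division by 0 also satisfies it.\<close>

lemma smoothing_bounded:
  assumes h: "\<And>x x'. \<bar>h x x' (y s)\<bar> \<le> (c::real)"
    and pos: "\<And>x. 0 \<le> path_weight m g r t y x"
  shows "\<bar>smoothing lam m g chi r s t h y\<bar> \<le> c"
proof -
  let ?P = "path_measure lam chi r t" and ?w = "path_weight m g r t y"
  let ?n = "\<integral>x. ?w x *\<^sub>R h (x (s - 1)) (x s) (y s) \<partial>?P" and ?d = "\<integral>x. ?w x \<partial>?P"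
  have c0: "c \<ge> 0" using h[of undefined undefined] by linarith
  have d0: "?d \<ge> 0" using pos by simp
  show ?thesis
  proof (cases "?d = 0")
    case True
    then show ?thesis unfolding smoothing_def using c0 by simp
  next
    case False
    then have iw: "integrable ?P ?w" using not_integrable_integral_eq by blast
    have "\<bar>?n\<bar> \<le> c * ?d"
    proof (cases "integrable ?P (\<lambda>x. ?w x *\<^sub>R h (x (s - 1)) (x s) (y s))")
      case True
      have "\<bar>?n\<bar> \<le> (\<integral>x. \<bar>?w x *\<^sub>R h (x (s - 1)) (x s) (y s)\<bar> \<partial>?P)" by (rule integral_abs_bound)
      also have "\<dots> \<le> (\<integral>x. c * ?w x \<partial>?P)"
      proof (rule integral_mono[OF integrable_abs[OF True]])
        fix x
        show "\<bar>?w x *\<^sub>R h (x (s - 1)) (x s) (y s)\<bar> \<le> c * ?w x"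
        proof -
          have "?w x * \<bar>h (x (s - 1)) (x s) (y s)\<bar> \<le> ?w x * c" by (intro mult_left_mono h pos)
          then show ?thesis using pos[of x] by (simp add: abs_mult mult.commute)
        qed
      qed (use iw in simp)
      finally show ?thesis by simp
    next
      case False
      then show ?thesis using c0 d0 by (simp add: not_integrable_integral_eq)
    qed
    then have "\<bar>?n\<bar> / ?d \<le> c" using False d0 by (simp add: pos_divide_le_eq)
    then show ?thesis unfolding smoothing_def using d0 by (simp add: abs_mult divide_inverse_commute)
  qed
qed

text \<open>One parameter value and one path of observations are frozen. That the likelihoods are
  integrable over the states is a property of the path, later shown for almost every one.\<close>

locale hmm_kernels =
  fixes lam :: "'x measure" and m :: "'x \<Rightarrow> 'x \<Rightarrow> real" and g :: "'x \<Rightarrow> 'y \<Rightarrow> real"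
    and y :: "int \<Rightarrow> 'y" and sm sp :: real
  assumes lam: "space lam = UNIV" "finite_measure lam" "emeasure lam UNIV \<noteq> 0"
    and m_meas: "(\<lambda>(x, x'). m x x') \<in> borel_measurable (lam \<Otimes>\<^sub>M lam)"
    and m_bounds: "0 < sm" "\<And>x x'. sm \<le> m x x'" "\<And>x x'. m x x' \<le> sp"
    and g: "\<And>x i. g x (y i) > 0" "\<And>i. integrable lam (\<lambda>x. g x (y i))"
begin

lemma sm_sp: "sm \<le> sp" using m_bounds(2,3) order_trans by blast

lemma sp_pos: "0 < sp" using sm_sp m_bounds(1) by linarith

text \<open>The forgetting rate per transition in the manner of Doeblin, from the ratio of the two
  bounds on \<open>m\<close>.\<close>

definition \<rho> :: real where "\<rho> = 1 - sm / sp"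

lemma \<rho>: "0 \<le> \<rho>" "\<rho> < 1"
  using sm_sp sp_pos m_bounds(1) by (auto simp: \<rho>_def field_simps)

lemma m_pos: "0 < m x x'" using m_bounds less_le_trans by blast

lemma g_meas [measurable]: "(\<lambda>x. g x (y i)) \<in> borel_measurable lam"
  using g(2) by auto

lemma m_meas2: "f \<in> measurable A lam \<Longrightarrow> f' \<in> measurable A lam \<Longrightarrow> (\<lambda>z. m (f z) (f' z)) \<in> borel_measurable A"
  using measurable_compose[OF measurable_Pair m_meas, of f A f'] by simp

lemma g_meas2: "f \<in> measurable A lam \<Longrightarrow> (\<lambda>z. g (f z) (y i)) \<in> borel_measurable A"
  by (rule measurable_compose[OF _ g_meas])

definition bm :: "('x \<Rightarrow> real) \<Rightarrow> bool" where
  "bm b \<longleftrightarrow> b \<in> borel_measurable lam \<and> (\<exists>c. \<forall>x. \<bar>b x\<bar> \<le> c)"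

lemma bm_const: "bm (\<lambda>_. c)" by (auto simp: bm_def)

lemma bm_add: "bm b \<Longrightarrow> bm b' \<Longrightarrow> bm (\<lambda>x. b x + b' x)"
  unfolding bm_def by (auto intro: order_trans[OF abs_triangle_ineq add_mono])

lemma bm_cmult: "bm b \<Longrightarrow> bm (\<lambda>x. a * b x)"
  unfolding bm_def by (auto simp: abs_mult) (metis abs_ge_zero mult_left_mono)

lemma bm_diff: "bm b \<Longrightarrow> bm b' \<Longrightarrow> bm (\<lambda>x. b x - b' x)"
  using bm_add[of b "\<lambda>x. (- 1) * b' x"] bm_cmult[of b' "- 1"] by simp

lemma integrable_g_bounded:
  assumes "f \<in> borel_measurable lam" "\<And>x. \<bar>f x\<bar> \<le> c"
  shows "integrable lam (\<lambda>x. g x (y i) * f x)"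
proof (rule Bochner_Integration.integrable_bound)
  show "integrable lam (\<lambda>x. c * g x (y i))" using g(2) by simp
  show "AE x in lam. norm (g x (y i) * f x) \<le> norm (c * g x (y i))"
    using assms(2) g(1)[THEN less_imp_le] by (intro AE_I2) (auto simp: abs_mult mult.commute intro!: mult_right_mono order_trans[OF _ abs_ge_self])
qed (use assms in measurable)

lemma integrable_g_bm: "bm b \<Longrightarrow> integrable lam (\<lambda>x. g x (y i) * b x)"
  unfolding bm_def using integrable_g_bounded by blast

lemma integrable_mg:
  assumes "f \<in> borel_measurable lam" "\<And>z. \<bar>f z\<bar> \<le> c"
  shows "integrable lam (\<lambda>z. m x z * g z (y i) * f z)"
proof -
  have "(\<lambda>z. m x z) \<in> borel_measurable lam" by (rule m_meas2) (auto simp: lam)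
  then have "integrable lam (\<lambda>z. g z (y i) * (m x z * f z))"
  proof (intro integrable_g_bounded[where c = "sp * c"])
    show "\<bar>m x z * f z\<bar> \<le> sp * c" for z
      unfolding abs_mult using m_bounds(3) m_pos[THEN less_imp_le, of x z] sp_pos
      by (intro mult_mono assms(2)) auto
  qed (use assms(1) in auto)
  then show ?thesis by (simp add: mult_ac)
qed

text \<open>The unnormalised backward operator of one time step. Smoothing functionals are quotients
  of integrals of its iterates.\<close>

definition L :: "int \<Rightarrow> ('x \<Rightarrow> real) \<Rightarrow> 'x \<Rightarrow> real" where
  "L i b x = (\<integral>z. m x z * g z (y i) * b z \<partial>lam)"

lemma integrable_L: "bm b \<Longrightarrow> integrable lam (\<lambda>z. m x z * g z (y i) * b z)"
  unfolding bm_def using integrable_mg by blast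

lemma L_add: "bm b \<Longrightarrow> bm b' \<Longrightarrow> L i (\<lambda>x. b x + b' x) x = L i b x + L i b' x"
  unfolding L_def using integrable_L by (simp add: algebra_simps flip: Bochner_Integration.integral_add)

lemma L_cmult: "L i (\<lambda>x. a * b x) x = a * L i b x"
  unfolding L_def by (simp add: mult.left_commute flip: Bochner_Integration.integral_mult_right_zero)

lemma L_ge: "bm b \<Longrightarrow> (\<And>x. 0 \<le> b x) \<Longrightarrow> sm * (\<integral>z. g z (y i) * b z \<partial>lam) \<le> L i b x"
  unfolding L_def using integrable_L integrable_g_bm g(1)[THEN less_imp_le] m_bounds(2)
  by (subst Bochner_Integration.integral_mult_right_zero[symmetric], intro integral_mono)
     (auto simp: mult.assoc intro!: mult_right_mono)

lemma L_le: "bm b \<Longrightarrow> (\<And>x. 0 \<le> b x) \<Longrightarrow> L i b x \<le> sp * (\<integral>z. g z (y i) * b z \<partial>lam)"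
  unfolding L_def using integrable_L integrable_g_bm g(1)[THEN less_imp_le] m_bounds(3)
  by (subst Bochner_Integration.integral_mult_right_zero[symmetric], intro integral_mono)
     (auto simp: mult.assoc intro!: mult_right_mono)

lemma int_g_pos: "bm b \<Longrightarrow> (\<And>x. 0 < b x) \<Longrightarrow> 0 < (\<integral>z. g z (y i) * b z \<partial>lam)"
  using integrable_g_bm g(1) lam by (intro integral_pos_of_pos) auto

lemma L_pos: "bm b \<Longrightarrow> (\<And>x. 0 < b x) \<Longrightarrow> 0 < L i b x"
  unfolding L_def using integrable_L g(1) lam m_pos by (intro integral_pos_of_pos) auto

definition L2 :: "int \<Rightarrow> ('x \<Rightarrow> 'x \<Rightarrow> real) \<Rightarrow> 'x \<Rightarrow> real" where
  "L2 i f x = (\<integral>z. m x z * g z (y i) * f x z \<partial>lam)"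

lemma meas_L2:
  assumes "(\<lambda>(x, z). f x z) \<in> borel_measurable (A \<Otimes>\<^sub>M lam)" "p \<in> measurable A lam"
  shows "(\<lambda>w. \<integral>z. m (p w) z * g z (y i) * f w z \<partial>lam) \<in> borel_measurable A"
proof -
  interpret finite_measure lam by (rule lam)
  have [measurable]: "(\<lambda>z. f (fst z) (snd z)) \<in> borel_measurable (A \<Otimes>\<^sub>M lam)"
    using assms(1) by (simp add: case_prod_beta')
  have [measurable]: "(\<lambda>z. m (p (fst z)) (snd z)) \<in> borel_measurable (A \<Otimes>\<^sub>M lam)"
    using assms(2) by (intro m_meas2) auto
  show ?thesis
    by (rule borel_measurable_lebesgue_integral) (simp add: case_prod_beta')
qed

lemma L2_bound:
  assumes "f x \<in> borel_measurable lam" "\<And>z. \<bar>f x z\<bar> \<le> c"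
  shows "\<bar>L2 i f x\<bar> \<le> sp * (\<integral>z. g z (y i) \<partial>lam) * c"
proof -
  have "\<bar>L2 i f x\<bar> \<le> (\<integral>z. \<bar>m x z * g z (y i) * f x z\<bar> \<partial>lam)" unfolding L2_def by (rule integral_abs_bound)
  also have "\<dots> \<le> (\<integral>z. sp * g z (y i) * c \<partial>lam)"
  proof (rule integral_mono[OF integrable_abs[OF integrable_mg[OF assms]]])
    show "integrable lam (\<lambda>z. sp * g z (y i) * c)" using g(2) by simp
    show "\<bar>m x z * g z (y i) * f x z\<bar> \<le> sp * g z (y i) * c" for z
      unfolding abs_mult using m_bounds(3) m_pos[THEN less_imp_le, of x z] g(1)[THEN less_imp_le] sp_pos
      by (intro mult_mono assms(2)) auto
  qed
  finally show ?thesis by simp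
qed

lemma bm_L2:
  assumes f: "(\<lambda>(x, z). f x z) \<in> borel_measurable (lam \<Otimes>\<^sub>M lam)" "\<And>x z. \<bar>f x z\<bar> \<le> c"
  shows "bm (L2 i f)"
proof -
  have "f x \<in> borel_measurable lam" for x
    using measurable_compose[OF measurable_Pair1'[of x lam] f(1)] lam by simp
  then have "\<forall>x. \<bar>L2 i f x\<bar> \<le> sp * (\<integral>z. g z (y i) \<partial>lam) * c" using L2_bound f(2) by blast
  moreover have "L2 i f \<in> borel_measurable lam"
    unfolding L2_def by (rule meas_L2[OF f(1)]) simp
  ultimately show ?thesis unfolding bm_def by blast
qed

lemma bm_L: assumes "bm b" shows "bm (L i b)"
proof -
  from assms obtain c where b: "b \<in> borel_measurable lam" "\<And>x. \<bar>b x\<bar> \<le> c" unfolding bm_def by blast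
  have "bm (L2 i (\<lambda>_. b))" by (rule bm_L2[of _ c]) (use b in auto)
  moreover have "L2 i (\<lambda>_. b) = L i b" by (simp add: fun_eq_iff L2_def L_def)
  ultimately show ?thesis by simp
qed

subsection \<open>Integrals over paths\<close>

text \<open>The last clause speaks of all functions on the integers, not only of extensional ones,
  so that \<open>F\<close> may be evaluated after updates outside the window and in larger
  windows.\<close>

definition loc :: "int \<Rightarrow> int \<Rightarrow> ((int \<Rightarrow> 'x) \<Rightarrow> real) \<Rightarrow> bool" where
  "loc r t F \<longleftrightarrow> F \<in> borel_measurable (PiM {r..t} (\<lambda>_. lam)) \<and> (\<exists>c. \<forall>x. \<bar>F x\<bar> \<le> c) \<and>
     (\<forall>x x'. (\<forall>i\<in>{r..t}. x i = x' i) \<longrightarrow> F x = F x')"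

lemma loc_mono:
  assumes F: "loc r t F" and t: "t \<le> t'" shows "loc r t' F"
proof -
  have "(\<lambda>x. F (restrict x {r..t})) \<in> borel_measurable (PiM {r..t'} (\<lambda>_. lam))"
    using F t by (intro measurable_compose[OF measurable_restrict_subset[of "{r..t}"]]) (auto simp: loc_def)
  moreover have "(\<lambda>x. F (restrict x {r..t})) = F"
  proof
    fix x show "F (restrict x {r..t}) = F x" using F unfolding loc_def by (metis restrict_apply)
  qed
  ultimately show ?thesis using F t unfolding loc_def by (metis atLeastAtMost_iff order_trans)
qed

lemma loc_component: "bm b \<Longrightarrow> r \<le> u \<Longrightarrow> u \<le> t \<Longrightarrow> loc r t (\<lambda>x. b (x u))"
  unfolding loc_def bm_def by (auto intro!: measurable_compose[OF measurable_component_singleton])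

lemma loc_pair:
  assumes "(\<lambda>(x, z). f x z) \<in> borel_measurable (lam \<Otimes>\<^sub>M lam)" "\<And>x z. \<bar>f x z\<bar> \<le> c"
    "p \<in> {r..t}" "q \<in> {r..t}"
  shows "loc r t (\<lambda>x. f (x p) (x q))"
proof -
  have "(\<lambda>x. (\<lambda>(x, z). f x z) (x p, x q)) \<in> borel_measurable (PiM {r..t} (\<lambda>_. lam))"
    using assms by (intro measurable_compose[OF measurable_Pair assms(1)] measurable_component_singleton) auto
  then show ?thesis unfolding loc_def using assms by auto
qed

lemma loc_mult: "loc r t F \<Longrightarrow> loc r t F' \<Longrightarrow> loc r t (\<lambda>x. F x * F' x)"
proof -
  assume F: "loc r t F" "loc r t F'"
  then obtain c d where b: "\<And>x. \<bar>F x\<bar> \<le> c" "\<And>x. \<bar>F' x\<bar> \<le> d" unfolding loc_def by blast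
  have "\<bar>F x * F' x\<bar> \<le> c * d" for x
    unfolding abs_mult using b(1)[of x] by (intro mult_mono b) auto
  moreover have "F x * F' x = F x' * F' x'" if "\<forall>i\<in>{r..t}. x i = x' i" for x x'
    using F that unfolding loc_def by metis
  ultimately show ?thesis using F unfolding loc_def by (auto intro: borel_measurable_times)
qed

lemma loc_const: "loc r t (\<lambda>_. c)"
  unfolding loc_def by auto

end

locale hmm_paths = hmm_kernels lam m g y sm sp
  for lam :: "'x measure" and m :: "'x \<Rightarrow> 'x \<Rightarrow> real" and g :: "'x \<Rightarrow> 'y \<Rightarrow> real"
    and y :: "int \<Rightarrow> 'y" and sm sp :: real +
  fixes chi :: "'x measure"
  assumes chi: "distribution_on lam chi"
begin

lemma sets_chi [measurable_cong]: "sets chi = sets lam" and prob_chi: "prob_space chi" and space_chi: "space chi = UNIV"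
  using chi lam sets_eq_imp_space_eq[of chi lam] by (auto simp: distribution_on_def)

abbreviation Mi :: "int \<Rightarrow> int \<Rightarrow> 'x measure" where "Mi r \<equiv> (\<lambda>i. if i = r then chi else lam)"

lemma product_sigma_finite_Mi: "product_sigma_finite (Mi r)"
  unfolding product_sigma_finite_def
  using prob_space_imp_sigma_finite[OF prob_chi] finite_measure.axioms(1)[OF lam(2)] by simp

lemma sets_path: "sets (path_measure lam chi r t) = sets (PiM {r..t} (\<lambda>_. lam))"
  unfolding path_measure_def by (rule sets_PiM_cong) (auto simp: sets_chi)

lemma measurable_path: "measurable (path_measure lam chi r t) borel = measurable (PiM {r..t} (\<lambda>_. lam)) borel"
  by (rule measurable_cong_sets) (auto simp: sets_path)

lemma pw_meas: "path_weight m g r t y \<in> borel_measurable (PiM {r..t} (\<lambda>_. lam))"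
  unfolding path_weight_def
  by (intro borel_measurable_prod borel_measurable_times m_meas2 measurable_component_singleton
      g_meas2) auto

lemma pw_pos: "0 < path_weight m g r t y x"
  unfolding path_weight_def using m_pos g(1) by (intro prod_pos) auto

lemma pw_integrable: "integrable (path_measure lam chi r t) (path_weight m g r t y)"
proof (rule Bochner_Integration.integrable_bound)
  interpret product_sigma_finite "Mi r" by (rule product_sigma_finite_Mi)
  interpret chi: prob_space chi by (rule prob_chi)
  let ?f = "\<lambda>i x. if i = r then 1 else g x (y i)"
  show "integrable (path_measure lam chi r t) (\<lambda>x. sp ^ card {r..<t} * (\<Prod>i\<in>{r..t}. ?f i (x i)))"
    unfolding path_measure_def using g(2)
    by (intro integrable_mult_right product_integrable_prod) auto
  show "AE x in path_measure lam chi r t. norm (path_weight m g r t y x) \<le> norm (sp ^ card {r..<t} * (\<Prod>i\<in>{r..t}. ?f i (x i)))"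
  proof (intro AE_I2)
    fix x
    have "path_weight m g r t y x \<le> (\<Prod>i\<in>{r..<t}. sp * g (x (i + 1)) (y (i + 1)))"
      unfolding path_weight_def using m_pos g(1) m_bounds(3)
      by (intro prod_mono) (auto intro!: mult_right_mono less_imp_le mult_pos_pos)
    also have "\<dots> = sp ^ card {r..<t} * (\<Prod>i\<in>{r..<t}. g (x (i + 1)) (y (i + 1)))"
      by (simp add: prod.distrib)
    also have "(\<Prod>i\<in>{r..<t}. g (x (i + 1)) (y (i + 1))) = (\<Prod>i\<in>{r+1..t}. g (x i) (y i))"
      by (rule prod.reindex_bij_witness[of _ "\<lambda>i. i - 1" "\<lambda>i. i + 1"]) auto
    also have "\<dots> = (\<Prod>i\<in>{r..t}. ?f i (x i))"
      by (rule prod.mono_neutral_cong_left) auto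
    finally show "norm (path_weight m g r t y x) \<le> norm (sp ^ card {r..<t} * (\<Prod>i\<in>{r..t}. ?f i (x i)))"
      using pw_pos[of r t x] by simp
  qed
qed (simp add: measurable_path pw_meas)

text \<open>Unnormalised expectation over paths; a smoothing functional is a quotient of two of
  these.\<close>

definition E :: "int \<Rightarrow> int \<Rightarrow> ((int \<Rightarrow> 'x) \<Rightarrow> real) \<Rightarrow> real" where
  "E r t F = (\<integral>x. path_weight m g r t y x * F x \<partial>path_measure lam chi r t)"

lemma E_integrable:
  assumes "loc r t F" shows "integrable (path_measure lam chi r t) (\<lambda>x. path_weight m g r t y x * F x)"
proof -
  from assms obtain c where c: "\<And>x. \<bar>F x\<bar> \<le> c" unfolding loc_def by blast
  show ?thesis
  proof (rule Bochner_Integration.integrable_bound)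
    show "integrable (path_measure lam chi r t) (\<lambda>x. c * path_weight m g r t y x)" using pw_integrable by simp
    show "AE x in path_measure lam chi r t. norm (path_weight m g r t y x * F x) \<le> norm (c * path_weight m g r t y x)"
      using c pw_pos[THEN less_imp_le] by (intro AE_I2) (auto simp: abs_mult mult.commute intro!: mult_right_mono order_trans[OF _ abs_ge_self])
  qed (use assms pw_meas in \<open>auto simp: measurable_path loc_def\<close>)
qed

lemma E_add: "loc r t F \<Longrightarrow> loc r t F' \<Longrightarrow> E r t (\<lambda>x. F x + F' x) = E r t F + E r t F'"
  unfolding E_def using E_integrable by (simp add: distrib_left flip: Bochner_Integration.integral_add)

lemma E_cmult: "E r t (\<lambda>x. a * F x) = a * E r t F"
  unfolding E_def by (simp add: mult.left_commute flip: Bochner_Integration.integral_mult_right_zero)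

lemma E_mono: "loc r t F \<Longrightarrow> loc r t F' \<Longrightarrow> (\<And>x. F x \<le> F' x) \<Longrightarrow> E r t F \<le> E r t F'"
  unfolding E_def using E_integrable pw_pos[THEN less_imp_le] by (intro integral_mono) (auto intro!: mult_left_mono)

lemma E_pos:
  assumes "loc r t F" "\<And>x. 0 < F x" shows "0 < E r t F"
  unfolding E_def
proof (rule integral_pos_of_pos[OF E_integrable[OF assms(1)]])
  interpret product_sigma_finite "Mi r" by (rule product_sigma_finite_Mi)
  interpret chi: prob_space chi by (rule prob_chi)
  have "emeasure (path_measure lam chi r t) (Pi\<^sub>E {r..t} (\<lambda>i. space (Mi r i))) = (\<Prod>i\<in>{r..t}. emeasure (Mi r i) (space (Mi r i)))"
    unfolding path_measure_def by (rule emeasure_PiM) auto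
  also have "\<dots> \<noteq> 0" using lam chi.emeasure_space_1 by auto
  finally show "emeasure (path_measure lam chi r t) (space (path_measure lam chi r t)) \<noteq> 0"
    unfolding path_measure_def space_PiM .
qed (use assms(2) pw_pos in auto)

text \<open>The new state occurs only in the last factor of the weight, so Fubini integrates it out
  and leaves a function of the path up to \<open>t\<close>.\<close>

lemma E_peel:
  assumes rt: "r \<le> t"
    and G: "(\<lambda>(x, z). G x z) \<in> borel_measurable (PiM {r..t} (\<lambda>_. lam) \<Otimes>\<^sub>M lam)" "\<And>x z. \<bar>G x z\<bar> \<le> c"
      "\<And>x x' z. (\<forall>i\<in>{r..t}. x i = x' i) \<Longrightarrow> G x z = G x' z"
  shows "E r (t + 1) (\<lambda>x. G x (x (t + 1))) = E r t (\<lambda>x. \<integral>z. m (x t) z * g z (y (t + 1)) * G x z \<partial>lam)"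
proof -
  interpret product_sigma_finite "Mi r" by (rule product_sigma_finite_Mi)
  have ins: "{r..t + 1} = insert (t + 1) {r..t}" using rt by auto
  let ?F = "\<lambda>x. G x (x (t + 1))"
  have locF: "loc r (t + 1) ?F"
  proof -
    have "(\<lambda>x. (\<lambda>(x, z). G x z) (restrict x {r..t}, x (t + 1))) \<in> borel_measurable (PiM {r..t+1} (\<lambda>_. lam))"
      by (intro measurable_compose[OF measurable_Pair G(1)] measurable_restrict_subset measurable_component_singleton) (use rt in auto)
    moreover have "(\<lambda>x. (\<lambda>(x, z). G x z) (restrict x {r..t}, x (t + 1))) = ?F"
      by (auto intro!: G(3))
    moreover have "?F x = ?F x'" if "\<forall>i\<in>{r..t+1}. x i = x' i" for x x'
      using that rt G(3)[of x x' "x' (t + 1)"] by auto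
    ultimately show ?thesis unfolding loc_def using G(2) by (intro conjI allI impI exI[of _ c]) auto
  qed
  have "E r (t + 1) ?F = (\<integral>x. (\<integral>z. path_weight m g r (t + 1) y (x(t + 1 := z)) * ?F (x(t + 1 := z)) \<partial>Mi r (t + 1)) \<partial>PiM {r..t} (Mi r))"
    unfolding E_def path_measure_def ins
    by (rule product_integral_insert) (use E_integrable[OF locF] in \<open>auto simp: path_measure_def ins\<close>)
  also have "\<dots> = (\<integral>x. path_weight m g r t y x * (\<integral>z. m (x t) z * g z (y (t + 1)) * G x z \<partial>lam) \<partial>PiM {r..t} (Mi r))"
  proof (rule Bochner_Integration.integral_cong[OF refl])
    fix x
    have "{r..<t + 1} = insert t {r..<t}" using rt by auto
    then have "path_weight m g r (t + 1) y (x(t + 1 := z)) = path_weight m g r t y x * (m (x t) z * g z (y (t + 1)))" for z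
      unfolding path_weight_def by (simp add: mult.commute)
    moreover have "G (x(t + 1 := z)) z = G x z" for z by (rule G(3)) auto
    ultimately show "(\<integral>z. path_weight m g r (t + 1) y (x(t + 1 := z)) * ?F (x(t + 1 := z)) \<partial>Mi r (t + 1)) =
       path_weight m g r t y x * (\<integral>z. m (x t) z * g z (y (t + 1)) * G x z \<partial>lam)"
      using rt by (simp add: mult.assoc)
  qed
  finally show ?thesis unfolding E_def path_measure_def .
qed

lemma E_peel_mult:
  assumes "r \<le> t" "loc r t F" "bm b"
  shows "E r (t + 1) (\<lambda>x. F x * b (x (t + 1))) = E r t (\<lambda>x. F x * L (t + 1) b (x t))"
proof -
  from assms obtain c d where c: "\<And>x. \<bar>F x\<bar> \<le> c" "\<And>x. \<bar>b x\<bar> \<le> d" unfolding loc_def bm_def by blast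
  have [measurable]: "F \<in> borel_measurable (PiM {r..t} (\<lambda>_. lam))" "b \<in> borel_measurable lam"
    using assms by (auto simp: loc_def bm_def)
  have "E r (t + 1) (\<lambda>x. F x * b (x (t + 1))) = E r t (\<lambda>x. \<integral>z. m (x t) z * g z (y (t + 1)) * (F x * b z) \<partial>lam)"
  proof (rule E_peel[OF assms(1), where c = "c * d"])
    show "\<bar>F x * b z\<bar> \<le> c * d" for x z
      unfolding abs_mult using c(1)[of x] by (intro mult_mono c) auto
    show "F x * b z = F x' * b z" if "\<forall>i\<in>{r..t}. x i = x' i" for x x' z
      using assms(2) that unfolding loc_def by metis
  qed measurable
  also have "\<dots> = E r t (\<lambda>x. F x * L (t + 1) b (x t))"
    unfolding L_def by (simp add: mult.left_commute[of _ "F _"] flip: Bochner_Integration.integral_mult_right_zero)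
  finally show ?thesis .
qed

lemma E_peel_pair:
  assumes "r \<le> t" and f: "(\<lambda>(x, z). f x z) \<in> borel_measurable (lam \<Otimes>\<^sub>M lam)" "\<And>x z. \<bar>f x z\<bar> \<le> c"
  shows "E r (t + 1) (\<lambda>x. f (x t) (x (t + 1))) = E r t (\<lambda>x. L2 (t + 1) f (x t))"
  unfolding L2_def
proof (rule E_peel[OF assms(1), where c = c])
  have "(\<lambda>w. (fst w t, snd w)) \<in> measurable (PiM {r..t} (\<lambda>_. lam) \<Otimes>\<^sub>M lam) (lam \<Otimes>\<^sub>M lam)"
    using assms(1) by (intro measurable_Pair measurable_compose[OF measurable_fst measurable_component_singleton]) auto
  from measurable_compose[OF this f(1)]
  show "(\<lambda>(x, z). f (x t) z) \<in> borel_measurable (PiM {r..t} (\<lambda>_. lam) \<Otimes>\<^sub>M lam)" by (simp add: case_prod_beta')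
qed (use assms in auto)

end

section \<open>Contraction of ratios and forgetting\<close>

context hmm_kernels
begin

text \<open>The function \<open>bw t b k\<close> lives at time \<open>t - k\<close>.\<close>

primrec bw :: "int \<Rightarrow> ('x \<Rightarrow> real) \<Rightarrow> nat \<Rightarrow> 'x \<Rightarrow> real" where
  "bw t b 0 = b" |
  "bw t b (Suc k) = L (t - int k) (bw t b k)"

lemma bm_bw: "bm b \<Longrightarrow> bm (bw t b k)"
  by (induction k) (auto intro: bm_L)

lemma bw_pos: "bm b \<Longrightarrow> (\<And>x. 0 < b x) \<Longrightarrow> 0 < bw t b k x"
  by (induction k arbitrary: x) (auto intro: L_pos bm_bw)

text \<open>\<open>L\<close> keeps at least \<open>sm\<close> times the likelihood integrals of the
  nonnegative functions n - lo d and hi d - n, while \<open>L i d\<close> is at most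
  \<open>sp\<close> times that of d. Hence both ends of the interval of ratios move inwards, and as
  the two integrals add up to hi - lo times that of d, the length shrinks exactly by
  \<open>\<rho>\<close>.\<close>

lemma L_contraction:
  assumes n: "bm n" and d: "bm d" "\<And>x. 0 < d x" and le: "\<And>x. lo * d x \<le> n x" "\<And>x. n x \<le> hi * d x"
  shows "\<exists>lo' hi'. hi' - lo' = \<rho> * (hi - lo) \<and> (\<forall>x. lo' * L i d x \<le> L i n x \<and> L i n x \<le> hi' * L i d x)"
proof -
  define D where "D = (\<integral>z. g z (y i) * d z \<partial>lam)"
  define N where "N = (\<integral>z. g z (y i) * n z \<partial>lam)"
  have D: "D > 0" unfolding D_def by (rule int_g_pos[OF d])
  define I1 where "I1 = N - lo * D"
  define I2 where "I2 = hi * D - N"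
  have Ldpos: "0 < L i d x" "L i d x \<le> sp * D" for x
    using L_pos[OF d] L_le[OF d(1) less_imp_le[OF d(2)]] by (auto simp: D_def)
  have i: "integrable lam (\<lambda>z. g z (y i) * n z)" "integrable lam (\<lambda>z. g z (y i) * d z)"
    using integrable_g_bm n d by auto
  have b1: "bm (\<lambda>x. n x - lo * d x)" and b2: "bm (\<lambda>x. hi * d x - n x)"
    using n d by (auto intro: bm_diff bm_cmult)
  have e1: "(\<integral>z. g z (y i) * (n z - lo * d z) \<partial>lam) = I1"
    unfolding I1_def N_def D_def using i by (simp add: right_diff_distrib mult.left_commute[of _ lo])
  have e2: "(\<integral>z. g z (y i) * (hi * d z - n z) \<partial>lam) = I2"
    unfolding I2_def N_def D_def using i by (simp add: right_diff_distrib mult.left_commute[of _ hi])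
  have l1: "L i (\<lambda>x. n x - lo * d x) x = L i n x - lo * L i d x" for x
    using L_add[OF n bm_cmult[OF d(1), of "- lo"], of i x] L_cmult[of i "- lo" d x] by simp
  have l2: "L i (\<lambda>x. hi * d x - n x) x = hi * L i d x - L i n x" for x
    using L_add[OF bm_cmult[OF d(1), of hi] bm_cmult[OF n, of "-1"], of i x] L_cmult[of i hi d x] L_cmult[of i "-1" n x] by simp
  have g1: "sm * I1 \<le> L i n x - lo * L i d x" for x
    using L_ge[OF b1, of i x] le(1) unfolding l1 e1 by simp
  have g2: "sm * I2 \<le> hi * L i d x - L i n x" for x
    using L_ge[OF b2, of i x] le(2) unfolding l2 e2 by simp
  have I: "I1 \<ge> 0" "I2 \<ge> 0"
    unfolding e1[symmetric] e2[symmetric] using le g(1)[THEN less_imp_le] by (auto intro!: Bochner_Integration.integral_nonneg)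
  define e where "e = sm / sp"
  have k: "e * (J / D) * L i d x \<le> sm * J" if "J \<ge> 0" for J x
  proof -
    have "e * (J / D) * L i d x \<le> e * (J / D) * (sp * D)"
      using Ldpos that D m_bounds(1) sp_pos by (intro mult_left_mono) (auto simp: e_def)
    also have "\<dots> = sm * J" using D sp_pos by (simp add: e_def)
    finally show ?thesis .
  qed
  have "(lo + e * (I1 / D)) * L i d x \<le> L i n x" for x
    using k[OF I(1), of x] g1[of x] by (simp add: distrib_right)
  moreover have "L i n x \<le> (hi - e * (I2 / D)) * L i d x" for x
    using k[OF I(2), of x] g2[of x] by (simp add: left_diff_distrib)
  moreover have "(hi - e * (I2 / D)) - (lo + e * (I1 / D)) = \<rho> * (hi - lo)"
  proof -
    have "I1 / D + I2 / D = hi - lo" using D by (simp add: I1_def I2_def field_simps)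
    then have "e * (I1 / D) + e * (I2 / D) = e * (hi - lo)" by (simp only: distrib_left[symmetric])
    then show ?thesis unfolding \<rho>_def e_def[symmetric] by (simp add: algebra_simps)
  qed
  ultimately show ?thesis by blast
qed

lemma bw_contraction:
  assumes n: "bm n" and d: "bm d" "\<And>x. 0 < d x" and le: "\<And>x. lo * d x \<le> n x" "\<And>x. n x \<le> hi * d x"
  shows "\<exists>lo' hi'. hi' - lo' = \<rho> ^ k * (hi - lo) \<and> (\<forall>x. lo' * bw t d k x \<le> bw t n k x \<and> bw t n k x \<le> hi' * bw t d k x)"
proof (induction k)
  case 0
  then show ?case using le by (intro exI[of _ lo] exI[of _ hi]) auto
next
  case (Suc k)
  then obtain lo' hi' where *: "hi' - lo' = \<rho> ^ k * (hi - lo)"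
    "\<And>x. lo' * bw t d k x \<le> bw t n k x" "\<And>x. bw t n k x \<le> hi' * bw t d k x" by blast
  from L_contraction[OF bm_bw[OF n] bm_bw[OF d(1)] bw_pos[OF d] *(2,3), of "t - int k"]
  show ?case using *(1) by (simp add: mult.assoc)
qed

text \<open>The backward function at time s - 1 belonging to the numerator of a smoothing
  functional; h = 1 gives that of the denominator.\<close>

definition nf :: "int \<Rightarrow> int \<Rightarrow> ('x \<Rightarrow> 'x \<Rightarrow> real) \<Rightarrow> 'x \<Rightarrow> real" where
  "nf s t h = L2 s (\<lambda>x z. h x z * bw t (\<lambda>_. 1) (nat (t - s)) z)"

lemma hB_meas_bounded:
  assumes h: "(\<lambda>(x, z). h x z) \<in> borel_measurable (lam \<Otimes>\<^sub>M lam)" "\<And>x z. \<bar>h x z\<bar> \<le> c" and b: "bm b"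
  shows "(\<lambda>(x, z). h x z * b z) \<in> borel_measurable (lam \<Otimes>\<^sub>M lam)" "\<exists>c. \<forall>x z. \<bar>h x z * b z\<bar> \<le> c"
proof -
  have [measurable]: "b \<in> borel_measurable lam" using b by (simp add: bm_def)
  have "(\<lambda>w. (\<lambda>(x, z). h x z) w * b (snd w)) \<in> borel_measurable (lam \<Otimes>\<^sub>M lam)" using h(1) by measurable
  then show "(\<lambda>(x, z). h x z * b z) \<in> borel_measurable (lam \<Otimes>\<^sub>M lam)" by (simp add: case_prod_beta')
  from b obtain d where "\<And>x. \<bar>b x\<bar> \<le> d" unfolding bm_def by blast
  then have "\<bar>h x z * b z\<bar> \<le> c * d" for x z
    using h(2)[of x z] by (auto simp: abs_mult intro!: mult_mono order_trans[OF abs_ge_zero])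
  then show "\<exists>c. \<forall>x z. \<bar>h x z * b z\<bar> \<le> c" by blast
qed

lemma bm_nf:
  assumes h: "(\<lambda>(x, z). h x z) \<in> borel_measurable (lam \<Otimes>\<^sub>M lam)" "\<And>x z. \<bar>h x z\<bar> \<le> c"
  shows "bm (nf s t h)"
proof -
  note * = hB_meas_bounded[OF h bm_bw[OF bm_const[of 1]], of t "nat (t - s)"]
  then obtain d where "\<And>x z. \<bar>h x z * bw t (\<lambda>_. 1) (nat (t - s)) z\<bar> \<le> d" by blast
  then show ?thesis unfolding nf_def by (intro bm_L2[OF *(1)])
qed

lemma nf_add:
  assumes h: "(\<lambda>(x, z). h x z) \<in> borel_measurable (lam \<Otimes>\<^sub>M lam)" "\<And>x z. \<bar>h x z\<bar> \<le> c"
  shows "nf s t (\<lambda>x z. a + h x z) x = a * nf s t (\<lambda>_ _. 1) x + nf s t h x"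
    "nf s t (\<lambda>x z. a - h x z) x = a * nf s t (\<lambda>_ _. 1) x - nf s t h x"
proof -
  let ?B = "bw t (\<lambda>_. 1) (nat (t - s))"
  note * = hB_meas_bounded[OF h bm_bw[OF bm_const[of 1]], of t "nat (t - s)"]
  then obtain d where d: "\<And>x z. \<bar>h x z * ?B z\<bar> \<le> d" by blast
  have "(\<lambda>z. h x z * ?B z) \<in> borel_measurable lam"
    using measurable_compose[OF measurable_Pair1'[of x lam] *(1)] lam by simp
  then have i1: "integrable lam (\<lambda>z. m x z * g z (y s) * (h x z * ?B z))" by (rule integrable_mg) (rule d)
  have i2: "integrable lam (\<lambda>z. m x z * g z (y s) * (1 * ?B z))"
    using integrable_L[OF bm_bw[OF bm_const[of 1]]] by simp
  show "nf s t (\<lambda>x z. a + h x z) x = a * nf s t (\<lambda>_ _. 1) x + nf s t h x"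
    "nf s t (\<lambda>x z. a - h x z) x = a * nf s t (\<lambda>_ _. 1) x - nf s t h x"
    unfolding nf_def L2_def
    using Bochner_Integration.integral_add[OF integrable_mult_right[OF i2, of a] i1]
      Bochner_Integration.integral_diff[OF integrable_mult_right[OF i2, of a] i1]
    by (auto simp: algebra_simps)
qed

lemma nf_nonneg: "(\<And>x z. 0 \<le> h x z) \<Longrightarrow> 0 \<le> nf s t h x"
  unfolding nf_def L2_def using m_pos[THEN less_imp_le] g(1)[THEN less_imp_le] bw_pos[OF bm_const[of 1], THEN less_imp_le]
  by (intro Bochner_Integration.integral_nonneg) auto

lemma nf_one: "nf s t (\<lambda>_ _. 1) = L s (bw t (\<lambda>_. 1) (nat (t - s)))"
  by (simp add: fun_eq_iff nf_def L2_def L_def)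

lemma nf_one_pos: "0 < nf s t (\<lambda>_ _. 1) x"
  unfolding nf_one by (rule L_pos[OF bm_bw[OF bm_const] bw_pos[OF bm_const]]) auto

end

context hmm_paths
begin

lemma E_bw:
  assumes "r \<le> t - int k" "loc r (t - int k) F" "bm b"
  shows "E r t (\<lambda>x. F x * b (x t)) = E r (t - int k) (\<lambda>x. F x * bw t b k (x (t - int k)))"
  using assms
proof (induction k)
  case (Suc k)
  have l: "loc r (t - int k) F" by (rule loc_mono[OF Suc.prems(2)]) simp
  have "E r t (\<lambda>x. F x * b (x t)) = E r (t - int k) (\<lambda>x. F x * bw t b k (x (t - int k)))"
    by (rule Suc.IH) (use Suc.prems l in auto)
  also have "\<dots> = E r (t - int (Suc k)) (\<lambda>x. F x * L (t - int (Suc k) + 1) (bw t b k) (x (t - int (Suc k))))"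
    using E_peel_mult[OF Suc.prems(1,2) bm_bw[OF assms(3)], of t k] by simp
  finally show ?case by simp
qed simp

text \<open>The path is integrated out from its end down to time \<open>u\<close>: plain backward
  steps above \<open>s\<close>, one step that involves the pair of states, plain steps below
  \<open>s - 1\<close>. The initial law survives only in the outer expectation, so that bounds on
  the backward functions hold uniformly in it.\<close>

lemma E_pair_backward:
  assumes rs: "r \<le> u" "u \<le> s - 1" "s \<le> t"
    and h: "(\<lambda>(x, z). h x z) \<in> borel_measurable (lam \<Otimes>\<^sub>M lam)" "\<And>x z. \<bar>h x z\<bar> \<le> c"
  shows "E r t (\<lambda>x. h (x (s - 1)) (x s)) = E r u (\<lambda>x. bw (s - 1) (nf s t h) (nat (s - 1 - u)) (x u))"
proof -
  let ?B = "bw t (\<lambda>_. 1) (nat (t - s))"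
  have l: "loc r s (\<lambda>x. h (x (s - 1)) (x s))" by (rule loc_pair[OF h]) (use rs in auto)
  have "E r t (\<lambda>x. h (x (s - 1)) (x s)) = E r s (\<lambda>x. h (x (s - 1)) (x s) * ?B (x s))"
    using E_bw[of r t "nat (t - s)" "\<lambda>x. h (x (s - 1)) (x s)" "\<lambda>_. 1"] rs l bm_const[of 1] by simp
  also have "\<dots> = E r (s - 1) (\<lambda>x. nf s t h (x (s - 1)))"
  proof -
    note * = hB_meas_bounded[OF h bm_bw[OF bm_const[of 1]], of t "nat (t - s)"]
    then obtain d where "\<And>x z. \<bar>h x z * ?B z\<bar> \<le> d" by blast
    from E_peel_pair[OF _ *(1) this, of r "s - 1"] show ?thesis using rs by (simp add: nf_def)
  qed
  also have "\<dots> = E r u (\<lambda>x. bw (s - 1) (nf s t h) (nat (s - 1 - u)) (x u))"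
    using E_bw[of r "s - 1" "nat (s - 1 - u)" "\<lambda>_. 1" "nf s t h"] rs bm_nf[OF h] loc_const[of r u 1] by simp
  finally show ?thesis .
qed

lemma smoothing_eq_E:
  "smoothing lam m g chi r s t (\<lambda>x z _. h x z) y = E r t (\<lambda>x. h (x (s - 1)) (x s)) / E r t (\<lambda>_. 1)"
  unfolding smoothing_def E_def by (simp add: divide_inverse_commute)

lemma E_one_pos: "0 < E r t (\<lambda>_. 1)"
  by (rule E_pos[OF loc_const]) simp

text \<open>Here the final time moves. The function b stands for the likelihood of all later
  observations, so bounds uniform in b \<ge> 0 locate the functional for every later final time. In
  one step \<open>L b\<close> splits into the constant \<open>sm * cb\<close> and a nonnegative
  rest; the constant part reproduces the value \<open>R\<close> of the ratio at b = 1 and pulls both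
  ends of the interval towards it.\<close>

lemma forward_contraction:
  assumes rs: "r \<le> s - 1"
    and h: "(\<lambda>(x, z). h x z) \<in> borel_measurable (lam \<Otimes>\<^sub>M lam)" "\<And>x z. \<bar>h x z\<bar> \<le> c"
  shows "\<exists>lo hi. hi - lo = 2 * c * \<rho> ^ k \<and> (\<forall>b. bm b \<longrightarrow> (\<forall>x. 0 \<le> b x) \<longrightarrow>
    lo * E r (s + int k) (\<lambda>x. b (x (s + int k))) \<le> E r (s + int k) (\<lambda>x. h (x (s - 1)) (x s) * b (x (s + int k))) \<and>
    E r (s + int k) (\<lambda>x. h (x (s - 1)) (x s) * b (x (s + int k))) \<le> hi * E r (s + int k) (\<lambda>x. b (x (s + int k))))"
proof (induction k)
  case 0
  show ?case
  proof (rule exI[of _ "-c"], rule exI[of _ c], intro conjI allI impI)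
    fix b assume b: "bm b" "\<forall>x. 0 \<le> b x"
    have l: "loc r s (\<lambda>x. h (x (s - 1)) (x s) * b (x s))" "loc r s (\<lambda>x. b (x s))"
      using rs b by (auto intro!: loc_mult loc_pair[OF h] loc_component)
    have cc: "loc r s (\<lambda>x. a * b (x s))" for a using loc_mult[OF loc_const l(2)] .
    have "- c * b z \<le> h x x' * b z" "h x x' * b z \<le> c * b z" for x x' z
      using h(2)[of x x'] b mult_right_mono[of "- c" "h x x'" "b z"] mult_right_mono[of "h x x'" c "b z"]
      by (auto simp: abs_le_iff)
    then show "- c * E r (s + int 0) (\<lambda>x. b (x (s + int 0))) \<le> E r (s + int 0) (\<lambda>x. h (x (s - 1)) (x s) * b (x (s + int 0)))"
      "E r (s + int 0) (\<lambda>x. h (x (s - 1)) (x s) * b (x (s + int 0))) \<le> c * E r (s + int 0) (\<lambda>x. b (x (s + int 0)))"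
      unfolding E_cmult[symmetric]
      using E_mono[OF cc[of "- c"] l(1)] E_mono[OF l(1) cc[of c]] \<open>\<And>x x' z. - c * b z \<le> h x x' * b z\<close>
        \<open>\<And>x x' z. h x x' * b z \<le> c * b z\<close> by simp_all
  qed simp
next
  case (Suc k)
  let ?u = "s + int k"
  let ?h = "\<lambda>x. h (x (s - 1)) (x s)"
  obtain lo hi where w: "hi - lo = 2 * c * \<rho> ^ k" and IH: "\<And>b. bm b \<Longrightarrow> (\<And>x. 0 \<le> b x) \<Longrightarrow>
      lo * E r ?u (\<lambda>x. b (x ?u)) \<le> E r ?u (\<lambda>x. ?h x * b (x ?u)) \<and>
      E r ?u (\<lambda>x. ?h x * b (x ?u)) \<le> hi * E r ?u (\<lambda>x. b (x ?u))" using Suc by blast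
  \<comment> \<open>The smoothed value with final time \<open>?u\<close> itself, which lies in the
    current interval.\<close>
  define R where "R = E r ?u ?h / E r ?u (\<lambda>_. 1)"
  have E1: "0 < E r ?u (\<lambda>_. 1)" by (rule E_one_pos)
  have Rh: "E r ?u ?h = R * E r ?u (\<lambda>_. 1)" using E1 by (simp add: R_def)
  have R: "lo \<le> R" "R \<le> hi" using IH[OF bm_const[of 1]] E1 unfolding R_def by (auto simp: pos_le_divide_eq pos_divide_le_eq)
  define e where "e = sm / sp"
  have lh: "loc r ?u ?h" by (rule loc_pair[OF h]) (use rs in auto)
  show ?case
  proof (rule exI[of _ "lo + e * (R - lo)"], rule exI[of _ "hi - e * (hi - R)"], intro conjI allI impI)
    show "hi - e * (hi - R) - (lo + e * (R - lo)) = 2 * c * \<rho> ^ Suc k"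
    proof -
      have "hi - e * (hi - R) - (lo + e * (R - lo)) = \<rho> * (hi - lo)"
        unfolding \<rho>_def e_def[symmetric] by (simp add: algebra_simps)
      then show ?thesis using w by (simp add: mult_ac)
    qed
    fix b assume b: "bm b" "\<forall>x. 0 \<le> b x"
    have u1: "s + int (Suc k) = ?u + 1" by simp
    have ru: "r \<le> ?u" using rs by simp
    have eh: "E r (?u + 1) (\<lambda>x. ?h x * b (x (?u + 1))) = E r ?u (\<lambda>x. ?h x * L (?u + 1) b (x ?u))"
      by (rule E_peel_mult[OF ru lh b(1)])
    have e1: "E r (?u + 1) (\<lambda>x. b (x (?u + 1))) = E r ?u (\<lambda>x. L (?u + 1) b (x ?u))"
      using E_peel_mult[OF ru loc_const[of r ?u 1] b(1)] by simp
    define cb where "cb = (\<integral>z. g z (y (?u + 1)) * b z \<partial>lam)"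
    have cb: "0 \<le> cb" unfolding cb_def using b(2) g(1)[THEN less_imp_le] by (intro Bochner_Integration.integral_nonneg) auto
    define rest where "rest x = L (?u + 1) b x - sm * cb" for x
    have br: "bm rest" unfolding rest_def using bm_diff[OF bm_L[OF b(1)] bm_const] .
    have r0: "0 \<le> rest x" for x using L_ge[OF b(1), of "?u + 1" x] b(2) by (simp add: rest_def cb_def)
    have lr: "loc r ?u (\<lambda>x. rest (x ?u))" using br ru by (intro loc_component) auto
    have Lb: "L (?u + 1) b x = sm * cb + rest x" for x by (simp add: rest_def)
    have x1: "E r ?u (\<lambda>x. L (?u + 1) b (x ?u)) = sm * cb * E r ?u (\<lambda>_. 1) + E r ?u (\<lambda>x. rest (x ?u))"
      unfolding Lb using E_add[OF loc_const[of r ?u "sm * cb"] lr] E_cmult[of r ?u "sm * cb" "\<lambda>_. 1"] by simp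
    have x2: "E r ?u (\<lambda>x. ?h x * L (?u + 1) b (x ?u)) = sm * cb * (R * E r ?u (\<lambda>_. 1)) + E r ?u (\<lambda>x. ?h x * rest (x ?u))"
      unfolding Lb distrib_left
      using E_add[OF loc_mult[OF lh loc_const[of r ?u "sm * cb"]] loc_mult[OF lh lr]] E_cmult[of r ?u "sm * cb" ?h]
      by (simp add: Rh mult.commute[of _ "sm * cb"])
    have up: "E r ?u (\<lambda>x. L (?u + 1) b (x ?u)) \<le> sp * cb * E r ?u (\<lambda>_. 1)"
      unfolding E_cmult[symmetric]
      using L_le[OF b(1), of "?u + 1"] b(2) ru
      by (intro E_mono loc_component bm_L b loc_mult loc_const) (auto simp: cb_def)
    \<comment> \<open>\<open>L b\<close> is at most \<open>sp * cb\<close>, so the constant part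
      carries at least the share \<open>e\<close> of the total mass.\<close>
    have key: "e * J * E r ?u (\<lambda>x. L (?u + 1) b (x ?u)) \<le> sm * cb * J * E r ?u (\<lambda>_. 1)" if "J \<ge> 0" for J
    proof -
      have "e * J * E r ?u (\<lambda>x. L (?u + 1) b (x ?u)) \<le> e * J * (sp * cb * E r ?u (\<lambda>_. 1))"
        using up that m_bounds(1) sp_pos by (intro mult_left_mono) (auto simp: e_def)
      then show ?thesis using sp_pos by (simp add: e_def mult_ac)
    qed
    note IHr = IH[OF br r0]
    show "(lo + e * (R - lo)) * E r (s + int (Suc k)) (\<lambda>x. b (x (s + int (Suc k))))
        \<le> E r (s + int (Suc k)) (\<lambda>x. ?h x * b (x (s + int (Suc k))))"
      unfolding u1 eh e1 distrib_right x2 using key[of "R - lo"] R IHr unfolding x1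
      by (simp add: algebra_simps)
    show "E r (s + int (Suc k)) (\<lambda>x. ?h x * b (x (s + int (Suc k))))
        \<le> (hi - e * (hi - R)) * E r (s + int (Suc k)) (\<lambda>x. b (x (s + int (Suc k))))"
      unfolding u1 eh e1 left_diff_distrib x2 using key[of "hi - R"] R IHr unfolding x1
      by (simp add: algebra_simps)
  qed
qed

text \<open>Both functionals are ratios in which b is the backward likelihood of the observations
  after \<open>u\<close>, hence both lie in the interval found in
  \<open>forward_contraction\<close>.\<close>

lemma smoothing_forward:
  assumes rs: "r \<le> s - 1" "s \<le> u" "u \<le> t" "u \<le> t'"
    and h: "(\<lambda>(x, z). h x z) \<in> borel_measurable (lam \<Otimes>\<^sub>M lam)" "\<And>x z. \<bar>h x z\<bar> \<le> c"
  shows "\<bar>smoothing lam m g chi r s t (\<lambda>x z _. h x z) y - smoothing lam m g chi r s t' (\<lambda>x z _. h x z) y\<bar> \<le> 2 * c * \<rho> ^ nat (u - s)"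
proof -
  let ?h = "\<lambda>x. h (x (s - 1)) (x s)"
  from forward_contraction[OF rs(1) h, of "nat (u - s)"] rs(2)
  obtain lo hi where w: "hi - lo = 2 * c * \<rho> ^ nat (u - s)" and b: "\<And>b. bm b \<Longrightarrow> (\<And>x. 0 \<le> b x) \<Longrightarrow>
      lo * E r u (\<lambda>x. b (x u)) \<le> E r u (\<lambda>x. ?h x * b (x u)) \<and>
      E r u (\<lambda>x. ?h x * b (x u)) \<le> hi * E r u (\<lambda>x. b (x u))" by auto
  have "lo \<le> smoothing lam m g chi r s t (\<lambda>x z _. h x z) y \<and> smoothing lam m g chi r s t (\<lambda>x z _. h x z) y \<le> hi" if "u \<le> t" for t
  proof -
    let ?B = "bw t (\<lambda>_. 1) (nat (t - u))"
    have l: "loc r u ?h" by (rule loc_pair[OF h]) (use rs in auto)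
    have e1: "E r t ?h = E r u (\<lambda>x. ?h x * ?B (x u))"
      using E_bw[of r t "nat (t - u)" ?h "\<lambda>_. 1"] rs that l bm_const[of 1] by simp
    have e2: "E r t (\<lambda>_. 1) = E r u (\<lambda>x. ?B (x u))"
      using E_bw[of r t "nat (t - u)" "\<lambda>_. 1" "\<lambda>_. 1"] rs that loc_const[of r u 1] bm_const[of 1] by simp
    have "0 < E r u (\<lambda>x. ?B (x u))" using E_one_pos[of r t] e2 by simp
    then show ?thesis
      using b[OF bm_bw[OF bm_const[of 1]], of t "nat (t - u)"] bw_pos[OF bm_const[of 1], THEN less_imp_le]
      unfolding smoothing_eq_E e1 e2 by (auto simp: pos_le_divide_eq pos_divide_le_eq)
  qed
  from this[OF rs(3)] this[OF rs(4)] w show ?thesis by (auto simp: abs_le_iff)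
qed

end

context hmm_kernels
begin

lemma nf_bounds:
  assumes h: "(\<lambda>(x, z). h x z) \<in> borel_measurable (lam \<Otimes>\<^sub>M lam)" "\<And>x z. \<bar>h x z\<bar> \<le> c"
  shows "(- c) * nf s t (\<lambda>_ _. 1) x \<le> nf s t h x" "nf s t h x \<le> c * nf s t (\<lambda>_ _. 1) x"
proof -
  have "0 \<le> c + h x z" "0 \<le> c - h x z" for x z using h(2)[of x z] by (auto simp: abs_le_iff)
  from nf_nonneg[of "\<lambda>x z. c + h x z" s t x, OF this(1)] nf_nonneg[of "\<lambda>x z. c - h x z" s t x, OF this(2)]
  show "(- c) * nf s t (\<lambda>_ _. 1) x \<le> nf s t h x" "nf s t h x \<le> c * nf s t (\<lambda>_ _. 1) x"
    unfolding nf_add[OF h] by auto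
qed

text \<open>Neither the initial law nor the initial time enters the bounds for the backward ratio at
  time \<open>u\<close>, so the two functionals share one short interval.\<close>

lemma smoothing_backward:
  assumes chi: "distribution_on lam chi" "distribution_on lam chi'"
    and rs: "r \<le> u" "r' \<le> u" "u \<le> s - 1" "s \<le> t"
    and h: "(\<lambda>(x, z). h x z) \<in> borel_measurable (lam \<Otimes>\<^sub>M lam)" "\<And>x z. \<bar>h x z\<bar> \<le> c"
  shows "\<bar>smoothing lam m g chi r s t (\<lambda>x z _. h x z) y - smoothing lam m g chi' r' s t (\<lambda>x z _. h x z) y\<bar> \<le> 2 * c * \<rho> ^ nat (s - 1 - u)"
proof -
  let ?k = "nat (s - 1 - u)" and ?n = "nf s t h" and ?d = "nf s t (\<lambda>_ _. 1)"
  have one: "(\<lambda>(x, z). 1 :: real) \<in> borel_measurable (lam \<Otimes>\<^sub>M lam)" by simp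
  have bd: "bm ?d" by (rule bm_nf[of _ 1]) auto
  obtain lo hi where w: "hi - lo = \<rho> ^ ?k * (c - (- c))"
    and b: "\<And>x. lo * bw (s - 1) ?d ?k x \<le> bw (s - 1) ?n ?k x" "\<And>x. bw (s - 1) ?n ?k x \<le> hi * bw (s - 1) ?d ?k x"
    using bw_contraction[OF bm_nf[OF h] bd nf_one_pos nf_bounds[OF h], of ?k "s - 1"] by blast
  have "lo \<le> smoothing lam m g chi r s t (\<lambda>x z _. h x z) y \<and> smoothing lam m g chi r s t (\<lambda>x z _. h x z) y \<le> hi"
    if "distribution_on lam chi" "r \<le> u" for chi r
  proof -
    interpret hmm_paths lam m g y sm sp chi by standard (rule that)
    note eh = E_pair_backward[OF that(2) rs(3,4) h] and e1 = E_pair_backward[OF that(2) rs(3,4), of "\<lambda>_ _. 1" 1]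
    have l: "loc r u (\<lambda>x. bw (s - 1) ?n ?k (x u))" "loc r u (\<lambda>x. bw (s - 1) ?d ?k (x u))"
      using that(2) by (auto intro!: loc_component bm_bw bm_nf[OF h] bd)
    have "lo * E r u (\<lambda>x. bw (s - 1) ?d ?k (x u)) \<le> E r u (\<lambda>x. bw (s - 1) ?n ?k (x u))"
      "E r u (\<lambda>x. bw (s - 1) ?n ?k (x u)) \<le> hi * E r u (\<lambda>x. bw (s - 1) ?d ?k (x u))"
      unfolding E_cmult[symmetric] by (auto intro!: E_mono l loc_mult loc_const b)
    then show ?thesis using E_one_pos[of r t] e1 unfolding smoothing_eq_E eh
      by (auto simp: pos_le_divide_eq pos_divide_le_eq)
  qed
  from this[OF chi(1) rs(1)] this[OF chi(2) rs(2)] w show ?thesis by (auto simp: abs_le_iff algebra_simps)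
qed

lemma smoothing_window:
  assumes dchi: "distribution_on lam chi" "distribution_on lam chi'"
    and rs: "r \<le> u" "r' \<le> u" "u \<le> s - 1" "s \<le> v" "v \<le> t" "v \<le> t'"
    and h: "(\<lambda>(x, z). h x z) \<in> borel_measurable (lam \<Otimes>\<^sub>M lam)" "\<And>x z. \<bar>h x z\<bar> \<le> c"
  shows "\<bar>smoothing lam m g chi r s t (\<lambda>x z _. h x z) y - smoothing lam m g chi' r' s t' (\<lambda>x z _. h x z) y\<bar>
    \<le> 2 * c * (\<rho> ^ nat (s - 1 - u) + \<rho> ^ nat (v - s))"
proof -
  interpret hmm_paths lam m g y sm sp chi' by standard (rule dchi)
  have "\<bar>smoothing lam m g chi r s t (\<lambda>x z _. h x z) y - smoothing lam m g chi' r' s t (\<lambda>x z _. h x z) y\<bar> \<le> 2 * c * \<rho> ^ nat (s - 1 - u)"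
    using rs by (intro smoothing_backward[OF dchi _ _ _ _ h]) auto
  moreover have "\<bar>smoothing lam m g chi' r' s t (\<lambda>x z _. h x z) y - smoothing lam m g chi' r' s t' (\<lambda>x z _. h x z) y\<bar> \<le> 2 * c * \<rho> ^ nat (v - s)"
    using rs by (intro smoothing_forward[OF _ _ _ _ h]) auto
  ultimately show ?thesis by (simp add: distrib_left)
qed

lemma bw_comparable: "sm / sp * bw t (\<lambda>_. 1) k z' \<le> bw t (\<lambda>_. 1) k z"
proof (cases k)
  case 0
  then show ?thesis using sm_sp sp_pos by simp
next
  case (Suc j)
  let ?b = "bw t (\<lambda>_. 1) j"
  have b: "bm ?b" "\<And>x. 0 \<le> ?b x" using bm_bw[OF bm_const[of 1]] bw_pos[OF bm_const[of 1], THEN less_imp_le] by auto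
  let ?I = "\<integral>z. g z (y (t - int j)) * ?b z \<partial>lam"
  have "sm / sp * L (t - int j) ?b z' \<le> sm / sp * (sp * ?I)"
    using L_le[OF b] m_bounds(1) sp_pos by (intro mult_left_mono) auto
  also have "\<dots> \<le> L (t - int j) ?b z" using L_ge[OF b] sp_pos by simp
  finally show ?thesis using Suc by simp
qed

text \<open>The lower bound does not depend on the final time and uses a measure with positive
  density with respect to the square of \<open>lam\<close>. Since \<open>r \<le> s - 2\<close>, the
  state at time \<open>s - 1\<close> comes from a transition and not from the initial law. Each of
  the two transitions costs a factor \<open>sm / sp\<close>, and so does each of the two
  replacements of the backward likelihood by a constant.\<close>

lemma smoothing_minorization:
  assumes chi: "distribution_on lam chi" and rs: "r \<le> s - 2" "s \<le> t"
    and h: "(\<lambda>(x, z). h x z) \<in> borel_measurable (lam \<Otimes>\<^sub>M lam)" "\<And>x z. 0 \<le> h x z" "\<And>x z. h x z \<le> c"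
  shows "(sm / sp) ^ 4 / ((\<integral>x. g x (y (s - 1)) \<partial>lam) * (\<integral>x. g x (y s) \<partial>lam)) *
      (\<integral>x. g x (y (s - 1)) * (\<integral>z. g z (y s) * h x z \<partial>lam) \<partial>lam)
    \<le> smoothing lam m g chi r s t (\<lambda>x z _. h x z) y"
proof -
  interpret hmm_paths lam m g y sm sp chi by standard (rule chi)
  let ?B = "bw t (\<lambda>_. 1) (nat (t - s))"
  define B0 where "B0 = ?B undefined"
  define e where "e = sm / sp"
  have e: "0 < e" using m_bounds sp_pos by (simp add: e_def)
  have B0: "B0 > 0" unfolding B0_def by (rule bw_pos[OF bm_const]) simp
  have Blo: "e * B0 \<le> ?B z" and Bhi: "e * ?B z \<le> B0" for z
    unfolding B0_def e_def by (rule bw_comparable)+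
  have hc: "\<bar>h x z\<bar> \<le> c" for x z using h(2,3) by simp
  define q where "q x = (\<integral>z. g z (y s) * h x z \<partial>lam)" for x
  define Q where "Q = (\<integral>x. g x (y (s - 1)) * q x \<partial>lam)"
  define G1 where "G1 = (\<integral>x. g x (y (s - 1)) \<partial>lam)"
  define G0 where "G0 = (\<integral>x. g x (y s) \<partial>lam)"
  have G: "G1 > 0" "G0 > 0" using int_g_pos[OF bm_const[of 1]] by (auto simp: G1_def G0_def)
  have hm: "h x \<in> borel_measurable lam" for x
    using measurable_compose[OF measurable_Pair1'[of x lam] h(1)] lam by simp
  have ih: "integrable lam (\<lambda>z. g z (y s) * h x z)" for x by (rule integrable_g_bounded[OF hm hc])
  have q0: "0 \<le> q x" for x unfolding q_def using h(2) g(1)[THEN less_imp_le] by (intro Bochner_Integration.integral_nonneg) auto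
  have qb: "bm q"
  proof -
    interpret finite_measure lam by (rule lam)
    have "(\<lambda>(x, z). g z (y s) * h x z) \<in> borel_measurable (lam \<Otimes>\<^sub>M lam)"
    proof -
      have [measurable]: "(\<lambda>w. h (fst w) (snd w)) \<in> borel_measurable (lam \<Otimes>\<^sub>M lam)" using h(1) by (simp add: case_prod_beta')
      show ?thesis by (simp add: case_prod_beta')
    qed
    then have "q \<in> borel_measurable lam" unfolding q_def by (rule borel_measurable_lebesgue_integral)
    moreover have "\<bar>q x\<bar> \<le> G0 * c" for x
    proof -
      have "q x \<le> (\<integral>z. g z (y s) * c \<partial>lam)" unfolding q_def
        using ih g h(3) by (intro integral_mono) (auto intro!: mult_left_mono less_imp_le)
      then show ?thesis using q0[of x] by (simp add: G0_def)
    qed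
    ultimately show ?thesis unfolding bm_def by blast
  qed
  have Q0: "0 \<le> Q" unfolding Q_def using q0 g(1)[THEN less_imp_le] by (intro Bochner_Integration.integral_nonneg) auto
  have nlo: "sm * e * B0 * q x \<le> nf s t h x" for x
  proof -
    note * = hB_meas_bounded[OF h(1) hc bm_bw[OF bm_const[of 1]], of t "nat (t - s)"]
    then obtain d where d: "\<And>x z. \<bar>h x z * ?B z\<bar> \<le> d" by blast
    have "(\<lambda>z. h x z * ?B z) \<in> borel_measurable lam"
      using measurable_compose[OF measurable_Pair1'[of x lam] *(1)] lam by simp
    then have i1: "integrable lam (\<lambda>z. m x z * g z (y s) * (h x z * ?B z))" by (rule integrable_mg) (rule d)
    have "sm * e * B0 * q x = (\<integral>z. sm * g z (y s) * (h x z * (e * B0)) \<partial>lam)"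
      unfolding q_def by (simp add: mult_ac flip: Bochner_Integration.integral_mult_right_zero)
    also have "\<dots> \<le> (\<integral>z. m x z * g z (y s) * (h x z * ?B z) \<partial>lam)"
    proof (rule integral_mono[OF _ i1])
      show "integrable lam (\<lambda>z. sm * g z (y s) * (h x z * (e * B0)))"
        using integrable_mult_right[OF ih[of x], of "sm * (e * B0)"] by (simp add: mult_ac)
      show "sm * g z (y s) * (h x z * (e * B0)) \<le> m x z * g z (y s) * (h x z * ?B z)" for z
        using m_bounds(1,2) m_pos[THEN less_imp_le, of x z] g(1)[THEN less_imp_le, of z s] h(2)[of x z] Blo[of z] e B0
        by (intro mult_mono) auto
    qed
    finally show ?thesis by (simp add: nf_def L2_def)
  qed
  have dhi: "e * nf s t (\<lambda>_ _. 1) x \<le> sp * B0 * G0" for x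
  proof -
    have bB: "bm ?B" "\<And>x. 0 \<le> ?B x" using bm_bw[OF bm_const[of 1]] bw_pos[OF bm_const[of 1], THEN less_imp_le] by auto
    have "e * nf s t (\<lambda>_ _. 1) x = L s (\<lambda>z. e * ?B z) x" unfolding nf_one L_cmult ..
    also have "\<dots> \<le> sp * (\<integral>z. g z (y s) * (e * ?B z) \<partial>lam)"
      using e bB by (intro L_le bm_cmult) auto
    also have "\<dots> \<le> sp * (\<integral>z. g z (y s) * B0 \<partial>lam)"
      using Bhi g sp_pos integrable_g_bm[OF bm_cmult[OF bB(1), of e]]
      by (intro mult_left_mono integral_mono) (auto intro!: mult_left_mono less_imp_le)
    finally show ?thesis by (simp add: G0_def mult_ac)
  qed
  define N where "N = L (s - 1) (nf s t h)"
  define D where "D = L (s - 1) (nf s t (\<lambda>_ _. 1))"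
  have bn: "bm (nf s t h)" "bm (nf s t (\<lambda>_ _. 1))" using bm_nf[OF h(1) hc] bm_nf[of "\<lambda>_ _. 1" 1] by auto
  have N: "sm * (sm * e * B0) * Q \<le> N x" for x
  proof -
    have "sm * (sm * e * B0) * Q = sm * (\<integral>z. g z (y (s - 1)) * (sm * e * B0 * q z) \<partial>lam)"
      unfolding Q_def by (simp add: mult.left_commute[of _ "sm * e * B0"])
    also have "\<dots> \<le> sm * (\<integral>z. g z (y (s - 1)) * nf s t h z \<partial>lam)"
      using m_bounds(1) integrable_g_bm[OF bm_cmult[OF qb, of "sm * e * B0"]] integrable_g_bm[OF bn(1)] nlo g(1)[THEN less_imp_le]
      by (intro mult_left_mono integral_mono) (auto intro!: mult_left_mono)
    also have "\<dots> \<le> N x" unfolding N_def using h(2) by (intro L_ge[OF bn(1)] nf_nonneg)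
    finally show ?thesis .
  qed
  have D: "e * D x \<le> sp * (sp * B0 * G0) * G1" for x
  proof -
    have "e * D x = L (s - 1) (\<lambda>z. e * nf s t (\<lambda>_ _. 1) z) x" unfolding D_def L_cmult ..
    also have "\<dots> \<le> sp * (\<integral>z. g z (y (s - 1)) * (e * nf s t (\<lambda>_ _. 1) z) \<partial>lam)"
      using e nf_one_pos[THEN less_imp_le] by (intro L_le bm_cmult bn) auto
    also have "\<dots> \<le> sp * (\<integral>z. g z (y (s - 1)) * (sp * B0 * G0) \<partial>lam)"
      using sp_pos integrable_g_bm[OF bm_cmult[OF bn(2), of e]] dhi g
      by (intro mult_left_mono integral_mono) (auto intro!: mult_left_mono less_imp_le)
    finally show ?thesis by (simp add: G1_def mult_ac)
  qed
  have ND: "e ^ 4 / (G1 * G0) * Q * D x \<le> N x" for x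
  proof -
    have "e ^ 4 / (G1 * G0) * Q * D x = e ^ 3 / (G1 * G0) * Q * (e * D x)" by (simp add: power4_eq_xxxx power3_eq_cube mult_ac)
    also have "\<dots> \<le> e ^ 3 / (G1 * G0) * Q * (sp * (sp * B0 * G0) * G1)"
      using e G Q0 D by (intro mult_left_mono) auto
    also have "\<dots> = sm * (sm * e * B0) * Q" using G sp_pos by (simp add: e_def power3_eq_cube field_simps)
    finally show ?thesis using N[of x] by linarith
  qed
  have bw1: "bw (s - 1) b (nat (s - 1 - (s - 2))) = L (s - 1) b" for b by simp
  have u: "r \<le> s - 2" "s - 2 \<le> s - 1" using rs by auto
  have eh: "E r t (\<lambda>x. h (x (s - 1)) (x s)) = E r (s - 2) (\<lambda>x. N (x (s - 2)))"
    using E_pair_backward[OF u rs(2) h(1) hc] unfolding bw1 N_def .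
  have e1: "E r t (\<lambda>_. 1) = E r (s - 2) (\<lambda>x. D (x (s - 2)))"
    using E_pair_backward[OF u rs(2), of "\<lambda>_ _. 1" 1] unfolding bw1 D_def by simp
  have "e ^ 4 / (G1 * G0) * Q * E r (s - 2) (\<lambda>x. D (x (s - 2))) \<le> E r (s - 2) (\<lambda>x. N (x (s - 2)))"
    unfolding E_cmult[symmetric]
    using u ND by (intro E_mono loc_mult loc_const loc_component) (auto simp: N_def D_def intro!: bm_L bn)
  then have "e ^ 4 / (G1 * G0) * Q \<le> smoothing lam m g chi r s t (\<lambda>x z _. h x z) y"
    unfolding smoothing_eq_E eh using E_one_pos[of r t] e1 by (simp add: pos_le_divide_eq)
  then show ?thesis unfolding e_def G1_def G0_def Q_def q_def .
qed

end

section \<open>Expectations and convex sets\<close>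

text \<open>Induction on the dimension: a point outside a convex set lies on a proper face of its closure
  or is strictly separated from it.\<close>

lemma in_convex_of_supporting:
  fixes z :: "'a::euclidean_space" and X :: "'b \<Rightarrow> 'a"
  assumes face: "\<And>v c. AE w in N. X w \<bullet> v \<le> c \<Longrightarrow> z \<bullet> v \<le> c \<and> (z \<bullet> v = c \<longrightarrow> (AE w in N. X w \<bullet> v = c))"
    and C: "convex C" "AE w in N. X w \<in> C"
  shows "z \<in> C"
  using C
proof (induction "nat (aff_dim C + 1)" arbitrary: C rule: less_induct)
  case (less C)
  note cC = less.prems(1) and aC = less.prems(2)
  show ?case
  proof (rule ccontr)
    assume z: "z \<notin> C"
    have zcl: "z \<in> closure C"
    proof (rule ccontr)
      assume "z \<notin> closure C"
      then obtain a b where ab: "a \<bullet> z < b" "\<And>x. x \<in> closure C \<Longrightarrow> b < a \<bullet> x"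
        using separating_hyperplane_closed_point[of "closure C" z] cC by (auto simp: convex_closure)
      have "AE w in N. X w \<bullet> (- a) \<le> - b"
        using aC by eventually_elim (use ab(2) closure_subset in \<open>fastforce simp: inner_commute\<close>)
      from conjunct1[OF face[OF this]] show False using ab(1) by (simp add: inner_commute)
    qed
    have "z \<notin> rel_interior (closure C)"
      using z cC convex_rel_interior_closure rel_interior_subset by blast
    then obtain a where a: "\<And>y. y \<in> closure C \<Longrightarrow> a \<bullet> z \<le> a \<bullet> y"
      "\<And>y. y \<in> rel_interior (closure C) \<Longrightarrow> a \<bullet> z < a \<bullet> y"
      using supporting_hyperplane_rel_boundary[of "closure C" z] cC zcl by (metis convex_closure)
    have "AE w in N. X w \<bullet> (- a) \<le> - (a \<bullet> z)"
      using aC by eventually_elim (use a(1) closure_subset in \<open>fastforce simp: inner_commute\<close>)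
    from conjunct2[OF face[OF this]] have "AE w in N. X w \<bullet> a = a \<bullet> z" by (simp add: inner_commute)
    then have aC': "AE w in N. X w \<in> C \<inter> {x. a \<bullet> x = a \<bullet> z}"
      using aC by eventually_elim (auto simp: inner_commute)
    have cC': "convex (C \<inter> {x. a \<bullet> x = a \<bullet> z})" using cC by (intro convex_Int convex_hyperplane)
    have "C \<noteq> {}" using zcl by auto
    then obtain y0 where y0: "y0 \<in> rel_interior C" using cC rel_interior_eq_empty by blast
    then have y0': "a \<bullet> z < a \<bullet> y0" "y0 \<in> C" using a(2) cC convex_rel_interior_closure rel_interior_subset by blast+
    have sub: "affine hull (C \<inter> {x. a \<bullet> x = a \<bullet> z}) \<subseteq> {x. a \<bullet> x = a \<bullet> z}"
      by (rule hull_minimal) (auto simp: affine_hyperplane)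
    have "affine hull (C \<inter> {x. a \<bullet> x = a \<bullet> z}) \<subset> affine hull C"
    proof (rule psubsetI)
      show "affine hull (C \<inter> {x. a \<bullet> x = a \<bullet> z}) \<subseteq> affine hull C" by (rule hull_mono) auto
      show "affine hull (C \<inter> {x. a \<bullet> x = a \<bullet> z}) \<noteq> affine hull C"
        using sub y0' hull_inc[of y0 C affine] by force
    qed
    then have "aff_dim (C \<inter> {x. a \<bullet> x = a \<bullet> z}) < aff_dim C" by (rule aff_dim_psubset)
    then have "nat (aff_dim (C \<inter> {x. a \<bullet> x = a \<bullet> z}) + 1) < nat (aff_dim C + 1)"
      using aff_dim_geq[of "C \<inter> {x. a \<bullet> x = a \<bullet> z}"] by linarith
    from less.hyps[OF this cC' aC'] z show False by blast
  qed
qed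

text \<open>If the mean lies on a hyperplane that bounds the values almost surely, the nonnegative
  gap has mean 0 and vanishes. This is the face condition, so the mean belongs to \<open>C\<close>
  itself and not merely to its closure.\<close>

lemma expectation_in_convex:
  fixes X :: "'b \<Rightarrow> 'a::euclidean_space"
  assumes "prob_space N" "integrable N X" "convex C" "AE w in N. X w \<in> C"
  shows "(\<integral>w. X w \<partial>N) \<in> C"
proof (rule in_convex_of_supporting[OF _ assms(3,4)])
  interpret prob_space N by fact
  fix v c assume le: "AE w in N. X w \<bullet> v \<le> c"
  have i: "integrable N (\<lambda>w. c - X w \<bullet> v)" using assms(2) by simp
  have eq: "(\<integral>w. c - X w \<bullet> v \<partial>N) = c - (\<integral>w. X w \<partial>N) \<bullet> v" using assms(2) by (simp add: prob_space)
  have nn: "AE w in N. 0 \<le> c - X w \<bullet> v" using le by eventually_elim simp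
  have "0 \<le> (\<integral>w. c - X w \<bullet> v \<partial>N)" using nn by (rule integral_nonneg_AE)
  moreover have "AE w in N. X w \<bullet> v = c" if "(\<integral>w. X w \<partial>N) \<bullet> v = c"
  proof -
    have "AE w in N. c - X w \<bullet> v = 0" using integral_nonneg_eq_0_iff_AE[OF i nn] that eq by simp
    then show ?thesis by eventually_elim simp
  qed
  ultimately show "(\<integral>w. X w \<partial>N) \<bullet> v \<le> c \<and> ((\<integral>w. X w \<partial>N) \<bullet> v = c \<longrightarrow> (AE w in N. X w \<bullet> v = c))"
    using eq by auto
qed

section \<open>Path measures\<close>

lemma (in product_sigma_finite) AE_PiM_pair:
  assumes I: "finite I" "p \<in> I" "q \<in> I" "p \<noteq> q"
    and ae: "AE w in M p \<Otimes>\<^sub>M M q. P w" "Measurable.pred (M p \<Otimes>\<^sub>M M q) P"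
  shows "AE x in PiM I M. P (x p, x q)"
proof -
  define J where "J = I - {p, q}"
  have Ieq: "I = insert q (insert p J)" and J: "finite J" "p \<notin> J" "q \<notin> insert p J"
    using I by (auto simp: J_def)
  have [measurable]: "Measurable.pred (M p \<Otimes>\<^sub>M M q) P" by (rule ae)
  have meas: "(\<lambda>x. (x p, x q)) \<in> measurable (PiM (insert q (insert p J)) M) (M p \<Otimes>\<^sub>M M q)"
    by (intro measurable_Pair measurable_component_singleton) auto
  have m1[measurable]: "(\<lambda>x. indicator {w \<in> space (M p \<Otimes>\<^sub>M M q). \<not> P w} (x p, x q) :: ennreal) \<in> borel_measurable (PiM (insert q (insert p J)) M)"
    by (rule measurable_compose[OF meas]) measurable
  have "(\<integral>\<^sup>+x. indicator {w \<in> space (M p \<Otimes>\<^sub>M M q). \<not> P w} (x p, x q) \<partial>PiM I M) =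
     (\<integral>\<^sup>+x. (\<integral>\<^sup>+b. indicator {w \<in> space (M p \<Otimes>\<^sub>M M q). \<not> P w} (x p, b) \<partial>M q) \<partial>PiM (insert p J) M)"
    unfolding Ieq using J I(4) by (subst product_nn_integral_insert) auto
  also have "\<dots> = (\<integral>\<^sup>+x. (\<integral>\<^sup>+a. (\<integral>\<^sup>+b. indicator {w \<in> space (M p \<Otimes>\<^sub>M M q). \<not> P w} (a, b) \<partial>M q) \<partial>M p) \<partial>PiM J M)"
    using J by (subst product_nn_integral_insert) (auto intro!: measurable_compose[OF measurable_component_singleton sigma_finite_measure.borel_measurable_nn_integral_fst[OF sigma_finite_measures]])
  also have "(\<integral>\<^sup>+a. (\<integral>\<^sup>+b. indicator {w \<in> space (M p \<Otimes>\<^sub>M M q). \<not> P w} (a, b) \<partial>M q) \<partial>M p) = 0"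
  proof -
    have "(\<integral>\<^sup>+a. (\<integral>\<^sup>+b. indicator {w \<in> space (M p \<Otimes>\<^sub>M M q). \<not> P w} (a, b) \<partial>M q) \<partial>M p) =
      emeasure (M p \<Otimes>\<^sub>M M q) {w \<in> space (M p \<Otimes>\<^sub>M M q). \<not> P w}"
      by (rule sigma_finite_measure.emeasure_pair_measure[OF sigma_finite_measures, symmetric]) auto
    also have "\<dots> = 0" using ae by (subst AE_iff_measurable[symmetric, OF _ refl]) auto
    finally show ?thesis .
  qed
  finally have "(\<integral>\<^sup>+x. indicator {w \<in> space (M p \<Otimes>\<^sub>M M q). \<not> P w} (x p, x q) \<partial>PiM I M) = 0" by simp
  then have "AE x in PiM I M. indicator {w \<in> space (M p \<Otimes>\<^sub>M M q). \<not> P w} (x p, x q) = (0::ennreal)"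
    using m1 unfolding Ieq by (subst (asm) nn_integral_0_iff_AE) auto
  then show ?thesis using AE_space
    by eventually_elim (use I in \<open>auto simp: indicator_def space_pair_measure space_PiM PiE_iff split: if_splits\<close>)
qed

lemma path_measure_shift:
  assumes lam: "finite_measure lam" and chi: "distribution_on lam chi"
  shows "distr (path_measure lam chi (r + k) (t + k)) (path_measure lam chi r t) (\<lambda>x. \<lambda>i\<in>{r..t}. x (i + k)) = path_measure lam chi r t"
proof -
  let ?Mi = "\<lambda>i::int. if i = r then chi else lam" and ?Mk = "\<lambda>i::int. if i = r + k then chi else lam"
  have sf: "product_sigma_finite ?Mi" "product_sigma_finite ?Mk"
    unfolding product_sigma_finite_def using chi lam prob_space_imp_sigma_finite[of chi] finite_measure.axioms(1)[OF lam]
    by (auto simp: distribution_on_def)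
  interpret A: product_sigma_finite ?Mi by (rule sf)
  interpret B: product_sigma_finite ?Mk by (rule sf)
  let ?T = "\<lambda>x::int \<Rightarrow> 'a. \<lambda>i\<in>{r..t}. x (i + k)"
  have T: "?T \<in> measurable (PiM {r+k..t+k} ?Mk) (PiM {r..t} ?Mi)"
  proof (rule measurable_restrict)
    fix i assume "i \<in> {r..t}"
    then have "(\<lambda>x. x (i + k)) \<in> measurable (PiM {r+k..t+k} ?Mk) (?Mk (i + k))"
      by (intro measurable_component_singleton) auto
    then show "(\<lambda>x. x (i + k)) \<in> measurable (PiM {r+k..t+k} ?Mk) (?Mi i)" by (simp split: if_splits)
  qed
  show ?thesis unfolding path_measure_def
  proof (rule A.PiM_eqI)
    fix A assume A: "\<And>i. i \<in> {r..t} \<Longrightarrow> A i \<in> sets (?Mi i)"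
    have pre: "?T -` Pi\<^sub>E {r..t} A \<inter> space (PiM {r+k..t+k} ?Mk) = Pi\<^sub>E {r+k..t+k} (\<lambda>i. A (i - k))"
    proof (intro set_eqI iffI)
      fix x assume x: "x \<in> ?T -` Pi\<^sub>E {r..t} A \<inter> space (PiM {r+k..t+k} ?Mk)"
      show "x \<in> Pi\<^sub>E {r+k..t+k} (\<lambda>i. A (i - k))"
      proof (rule PiE_I)
        fix i assume "i \<in> {r+k..t+k}"
        then have "i - k \<in> {r..t}" by auto
        then show "x i \<in> A (i - k)" using x by (auto simp: PiE_iff dest!: bspec[of _ _ "i - k"])
      qed (use x in \<open>auto simp: space_PiM PiE_iff extensional_def\<close>)
    next
      fix x assume x: "x \<in> Pi\<^sub>E {r+k..t+k} (\<lambda>i. A (i - k))"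
      have "x i \<in> space (?Mk i)" if "i \<in> {r+k..t+k}" for i
      proof -
        have "x i \<in> A (i - k)" using x that by auto
        moreover have "A (i - k) \<in> sets (?Mi (i - k))" using that by (intro A) auto
        ultimately show ?thesis using sets.sets_into_space[of "A (i - k)" "?Mi (i - k)"] by (auto split: if_splits)
      qed
      moreover have "x (i + k) \<in> A i" if "i \<in> {r..t}" for i using x that by (auto simp: PiE_iff dest!: bspec[of _ _ "i + k"])
      ultimately show "x \<in> ?T -` Pi\<^sub>E {r..t} A \<inter> space (PiM {r+k..t+k} ?Mk)"
        using x by (auto simp: space_PiM PiE_iff extensional_def)
    qed
    have "emeasure (distr (PiM {r+k..t+k} ?Mk) (PiM {r..t} ?Mi) ?T) (Pi\<^sub>E {r..t} A) = emeasure (PiM {r+k..t+k} ?Mk) (Pi\<^sub>E {r+k..t+k} (\<lambda>i. A (i - k)))"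
      using A by (subst emeasure_distr[OF T]) (auto simp: pre intro!: sets_PiM_I_finite)
    also have "\<dots> = (\<Prod>i\<in>{r+k..t+k}. emeasure (?Mk i) (A (i - k)))"
    proof (rule B.emeasure_PiM)
      fix i assume "i \<in> {r+k..t+k}"
      then show "A (i - k) \<in> sets (?Mk i)" using A[of "i - k"] by (auto split: if_splits)
    qed simp
    also have "\<dots> = (\<Prod>i\<in>{r..t}. emeasure (?Mi i) (A i))"
      by (rule prod.reindex_bij_witness[of _ "\<lambda>i. i + k" "\<lambda>i. i - k"]) auto
    finally show "emeasure (distr (PiM {r+k..t+k} ?Mk) (PiM {r..t} ?Mi) ?T) (Pi\<^sub>E {r..t} A) = (\<Prod>i\<in>{r..t}. emeasure (?Mi i) (A i))" .
  qed auto
qed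

section \<open>The exponential family: essential envelope and measurability of smoothing\<close>

lemma borel_measurable_vec_lambda:
  assumes "\<And>i. (\<lambda>x. f x i) \<in> borel_measurable M"
  shows "(\<lambda>x. (\<chi> i. f x i) :: real^'n) \<in> borel_measurable M"
proof (rule borel_measurable_euclidean_space[THEN iffD2], rule ballI)
  fix b :: "real^'n" assume "b \<in> Basis"
  then obtain i where "b = axis i 1" by (auto simp: Basis_vec_def)
  then show "(\<lambda>x. (\<chi> i. f x i) \<bullet> b) \<in> borel_measurable M" using assms by (simp add: inner_axis)
qed

text \<open>\<open>K\<close> collects the laws that the state before a transition may have:
  \<open>lam\<close>, or the initial law of a block. An initial law may charge
  \<open>lam\<close>-null sets, so null sets are controlled for each of these laws, and countability
  keeps the resulting supremum measurable.\<close>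

locale exp_family_model =
  fixes \<Theta> :: "(real^'k) set" and lam :: "'x measure" and mu :: "'y measure"
    and m :: "real^'k \<Rightarrow> 'x \<Rightarrow> 'x \<Rightarrow> real" and g :: "real^'k \<Rightarrow> 'x \<Rightarrow> 'y \<Rightarrow> real"
    and \<phi> :: "real^'k \<Rightarrow> real" and \<psi> :: "real^'k \<Rightarrow> real^'d" and S :: "'x \<Rightarrow> 'x \<Rightarrow> 'y \<Rightarrow> real^'d"
    and sm sp :: real and K :: "'x measure set"
  assumes Theta_compact: "compact \<Theta>"
    and lam: "space lam = UNIV" "finite_measure lam"
    and mu: "space mu = UNIV"
    and m_density: "\<And>t. t \<in> \<Theta> \<Longrightarrow> transition_density lam lam (m t)"
    and g_density: "\<And>t. t \<in> \<Theta> \<Longrightarrow> transition_density lam mu (g t)"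
    and phi_cont: "continuous_on \<Theta> \<phi>"
    and psi_cont: "continuous_on \<Theta> \<psi>"
    and S_measurable: "(\<lambda>(x, x', y). S x x' y) \<in> borel_measurable (lam \<Otimes>\<^sub>M lam \<Otimes>\<^sub>M mu)"
    and exp_family: "\<And>t x x' y. t \<in> \<Theta> \<Longrightarrow>
      m t x x' > 0 \<and> g t x' y > 0 \<and> ln (m t x x') + ln (g t x' y) = \<phi> t + S x x' y \<bullet> \<psi> t"
    and strong_mixing: "0 < sm" "\<And>t x x'. t \<in> \<Theta> \<Longrightarrow> sm \<le> m t x x' \<and> m t x x' \<le> sp"
    and K: "countable K" "lam \<in> K" "\<And>\<kappa>. \<kappa> \<in> K \<Longrightarrow> finite_measure \<kappa> \<and> sets \<kappa> = sets lam"
begin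

lemma mg_eq: "t \<in> \<Theta> \<Longrightarrow> m t x x' * g t x' y = exp (\<phi> t + S x x' y \<bullet> \<psi> t)"
  using exp_family[of t x x' y] by (metis exp_add exp_ln)

lemma lam_nonzero: assumes "t \<in> \<Theta>" shows "emeasure lam UNIV \<noteq> 0"
proof
  assume "emeasure lam UNIV = 0"
  then have "AE x in lam. False" using lam(1) by (simp add: AE_iff_measurable[OF sets.top])
  then have "(\<integral>\<^sup>+y. ennreal (m t undefined y) \<partial>lam) = (\<integral>\<^sup>+y. 0 \<partial>lam)" by (intro nn_integral_cong_AE) auto
  then show False using m_density[OF assms] lam unfolding transition_density_def by simp
qed

lemma S_meas3:
  assumes "f \<in> measurable A lam" "f' \<in> measurable A lam" "f'' \<in> measurable A mu"
  shows "(\<lambda>z. S (f z) (f' z) (f'' z)) \<in> borel_measurable A"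
proof -
  have "(\<lambda>z. (f z, f' z, f'' z)) \<in> measurable A (lam \<Otimes>\<^sub>M lam \<Otimes>\<^sub>M mu)" using assms by auto
  from measurable_compose[OF this S_measurable] show ?thesis by simp
qed

text \<open>The supremum of \<open>|S(x,x',y)|\<close> over \<open>(x,x')\<close> need not be measurable in \<open>y\<close>. It is replaced by
  a countable supremum of essential suprema, which suffices because the smoothing integrals only
  see \<open>S\<close> up to null sets.\<close>

definition exceed :: "'x measure \<Rightarrow> real \<Rightarrow> 'y \<Rightarrow> bool" where
  "exceed \<kappa> q y \<longleftrightarrow> emeasure (\<kappa> \<Otimes>\<^sub>M lam) {w \<in> space (\<kappa> \<Otimes>\<^sub>M lam). q < norm (S (fst w) (snd w) y)} \<noteq> 0"

definition ess :: "'y \<Rightarrow> ennreal" where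
  "ess y = (SUP \<kappa>\<in>K. SUP q\<in>\<rat> \<inter> {0..}. if exceed \<kappa> q y then ennreal q else 0)"

lemma sigma_finite_pair_K: "\<kappa> \<in> K \<Longrightarrow> sigma_finite_measure (\<kappa> \<Otimes>\<^sub>M lam)"
  using K(3) lam(2) by (intro sigma_finite_pair_measure) (auto dest: finite_measure.axioms(1))

lemma measurable_exceed: assumes "\<kappa> \<in> K" shows "Measurable.pred mu (exceed \<kappa> q)"
proof -
  interpret P: sigma_finite_measure "\<kappa> \<Otimes>\<^sub>M lam" by (rule sigma_finite_pair_K[OF assms])
  have [measurable_cong]: "sets \<kappa> = sets lam" using K(3) assms by blast
  have [measurable]: "(\<lambda>z. S (fst (snd z)) (snd (snd z)) (fst z)) \<in> borel_measurable (mu \<Otimes>\<^sub>M \<kappa> \<Otimes>\<^sub>M lam)"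
    by (rule S_meas3) measurable
  let ?Q = "{z \<in> space (mu \<Otimes>\<^sub>M \<kappa> \<Otimes>\<^sub>M lam). q < norm (S (fst (snd z)) (snd (snd z)) (fst z))}"
  have "?Q \<in> sets (mu \<Otimes>\<^sub>M \<kappa> \<Otimes>\<^sub>M lam)" by measurable
  from P.measurable_emeasure_Pair[OF this]
  have [measurable]: "(\<lambda>y. emeasure (\<kappa> \<Otimes>\<^sub>M lam) (Pair y -` ?Q)) \<in> borel_measurable mu" .
  have "Pair y -` ?Q = {w \<in> space (\<kappa> \<Otimes>\<^sub>M lam). q < norm (S (fst w) (snd w) y)}" for y
    using mu by (auto simp: space_pair_measure)
  then have "exceed \<kappa> q = (\<lambda>y. emeasure (\<kappa> \<Otimes>\<^sub>M lam) (Pair y -` ?Q) \<noteq> 0)" by (auto simp: exceed_def)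
  then show ?thesis by (simp only:) measurable
qed

lemma measurable_ess [measurable]: "ess \<in> borel_measurable mu"
proof -
  have "countable (\<rat> \<inter> {0..} :: real set)" using countable_rat by auto
  then show ?thesis unfolding ess_def
    using K(1) by (intro borel_measurable_SUP measurable_If predE[OF measurable_exceed]) auto
qed

lemma AE_le_ess:
  assumes k: "\<kappa> \<in> K" shows "AE w in \<kappa> \<Otimes>\<^sub>M lam. ennreal (norm (S (fst w) (snd w) y)) \<le> ess y"
proof -
  have [measurable_cong]: "sets \<kappa> = sets lam" using K(3) k by blast
  have [measurable]: "(\<lambda>w. S (fst w) (snd w) y) \<in> borel_measurable (\<kappa> \<Otimes>\<^sub>M lam)"
    by (rule S_meas3) (auto simp: mu)
  let ?R = "\<rat> \<inter> {0..} :: real set"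
  have cR: "countable ?R" using countable_rat by auto
  have "AE w in \<kappa> \<Otimes>\<^sub>M lam. \<forall>q\<in>?R. \<not> exceed \<kappa> q y \<longrightarrow> norm (S (fst w) (snd w) y) \<le> q"
  proof (subst AE_ball_countable[OF cR], intro ballI)
    fix q
    show "AE w in \<kappa> \<Otimes>\<^sub>M lam. \<not> exceed \<kappa> q y \<longrightarrow> norm (S (fst w) (snd w) y) \<le> q"
    proof (cases "exceed \<kappa> q y")
      case False
      have "AE w in \<kappa> \<Otimes>\<^sub>M lam. norm (S (fst w) (snd w) y) \<le> q"
        by (subst AE_iff_measurable[OF _ refl]) (use False in \<open>auto simp: exceed_def not_le\<close>)
      then show ?thesis by eventually_elim simp
    qed simp
  qed
  then show ?thesis
  proof eventually_elim
    case (elim w)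
    show ?case
    proof (rule ccontr)
      assume "\<not> ennreal (norm (S (fst w) (snd w) y)) \<le> ess y"
      then have lt: "ess y < ennreal (norm (S (fst w) (snd w) y))" by simp
      then obtain e where e: "ess y = ennreal e" "0 \<le> e" by (cases "ess y") auto
      with lt have "e < norm (S (fst w) (snd w) y)" by (simp add: ennreal_less_iff)
      then obtain q where q: "q \<in> \<rat>" "e < q" "q < norm (S (fst w) (snd w) y)" using Rats_dense_in_real by blast
      then have qR: "q \<in> ?R" using e by auto
      with elim q have "exceed \<kappa> q y" by force
      then have "ennreal q \<le> (SUP q\<in>?R. if exceed \<kappa> q y then ennreal q else 0)"
        by (intro SUP_upper2[OF qR]) auto
      also have "\<dots> \<le> ess y" unfolding ess_def by (rule SUP_upper[OF k])
      finally show False using e q by (simp add: ennreal_le_iff)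
    qed
  qed
qed

lemma ess_le:
  assumes p: "p > 0"
    and fin: "(SUP (x, x')\<in>UNIV. ennreal (norm (S x x' y) powr p)) < \<infinity>"
  shows "ess y < \<infinity> \<and> ennreal (enn2real (ess y) powr p) \<le> (SUP (x, x')\<in>UNIV. ennreal (norm (S x x' y) powr p))"
proof -
  let ?U = "SUP (x, x')\<in>UNIV. ennreal (norm (S x x' y) powr p)"
  obtain C where C: "?U = ennreal C" "0 \<le> C" using fin by (cases ?U) auto
  have "ess y \<le> ennreal (C powr (1 / p))"
    unfolding ess_def
  proof (intro SUP_least)
    fix \<kappa> and q :: real assume k: "\<kappa> \<in> K" and q: "q \<in> \<rat> \<inter> {0..}"
    show "(if exceed \<kappa> q y then ennreal q else 0) \<le> ennreal (C powr (1 / p))"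
    proof (cases "exceed \<kappa> q y")
      case True
      then have "{w \<in> space (\<kappa> \<Otimes>\<^sub>M lam). q < norm (S (fst w) (snd w) y)} \<noteq> {}" unfolding exceed_def by force
      then obtain x x' where x: "q < norm (S x x' y)" by auto
      have "ennreal (norm (S x x' y) powr p) \<le> ?U" by (rule SUP_upper2[of "(x, x')"]) auto
      then have "norm (S x x' y) powr p \<le> C" using C by (simp add: ennreal_le_iff)
      then have "(norm (S x x' y) powr p) powr (1 / p) \<le> C powr (1 / p)" using p by (intro powr_mono2) auto
      then have "norm (S x x' y) \<le> C powr (1 / p)" using p by (simp add: powr_powr)
      then show ?thesis using x True by (simp add: ennreal_leI)
    qed simp
  qed
  then have e: "ess y < \<infinity>" "enn2real (ess y) \<le> C powr (1 / p)"
    by (auto simp: le_less_trans enn2real_leI)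
  have "enn2real (ess y) powr p \<le> (C powr (1 / p)) powr p" using e p by (intro powr_mono2) auto
  then have "enn2real (ess y) powr p \<le> C" using p C by (simp add: powr_powr)
  then show ?thesis using e C by (simp add: ennreal_leI)
qed

definition sr :: "'y \<Rightarrow> real" where "sr y = enn2real (ess y)"

lemma sr_nonneg: "0 \<le> sr y" by (simp add: sr_def)

lemma measurable_sr [measurable]: "sr \<in> borel_measurable mu"
  unfolding sr_def by measurable

text \<open>Where \<open>ess y\<close> is finite, this differs from the component of S only on sets
  that are null for every law in \<open>K\<close>. In exchange the bound by \<open>sr\<close> holds
  everywhere.\<close>

definition tr :: "'d \<Rightarrow> 'x \<Rightarrow> 'x \<Rightarrow> 'y \<Rightarrow> real" where
  "tr l x x' y = (if ess y < \<infinity> \<and> ennreal (norm (S x x' y)) \<le> ess y then S x x' y $ l else 0)"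

lemma tr_bound: "\<bar>tr l x x' y\<bar> \<le> sr y"
proof (cases "ess y < \<infinity> \<and> ennreal (norm (S x x' y)) \<le> ess y")
  case True
  then have "norm (S x x' y) \<le> sr y" unfolding sr_def by (metis enn2real_ennreal enn2real_mono norm_ge_zero infinity_ennreal_def)
  then show ?thesis using True component_le_norm_cart[of "S x x' y" l] by (simp add: tr_def)
qed (auto simp: tr_def sr_nonneg)

lemma tr_meas3:
  assumes [measurable]: "f \<in> measurable A lam" "f' \<in> measurable A lam" "f'' \<in> measurable A mu"
  shows "(\<lambda>z. tr l (f z) (f' z) (f'' z)) \<in> borel_measurable A"
proof -
  have [measurable]: "(\<lambda>z. S (f z) (f' z) (f'' z)) \<in> borel_measurable A" by (rule S_meas3) fact+
  have [measurable]: "(\<lambda>z. ess (f'' z)) \<in> borel_measurable A"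
    using assms(3) by (rule measurable_compose) (rule measurable_ess)
  have eq: "(\<lambda>z. tr l (f z) (f' z) (f'' z)) = (\<lambda>z. if ess (f'' z) < \<infinity> \<and> ennreal (norm (S (f z) (f' z) (f'' z))) \<le> ess (f'' z)
      then S (f z) (f' z) (f'' z) \<bullet> axis l 1 else 0)" by (simp add: tr_def inner_axis fun_eq_iff)
  show ?thesis unfolding eq by measurable
qed

lemma tr_pair_meas: "(\<lambda>(x, z). tr l x z y) \<in> borel_measurable (lam \<Otimes>\<^sub>M lam)"
  using tr_meas3[of fst "lam \<Otimes>\<^sub>M lam" snd "\<lambda>_. y" l] by (simp add: case_prod_beta' mu)

text \<open>Measurability in a random parameter comes from the exponential form of the weight, in
  which \<open>\<phi>\<close> and \<open>\<psi>\<close> are continuous and S is jointly measurable;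
  the densities are given separately for each parameter value.\<close>

lemma smoothing_measurable:
  assumes chi: "distribution_on lam chi"
    and th: "th \<in> borel_measurable P" "\<And>p. p \<in> space P \<Longrightarrow> th p \<in> \<Theta>"
    and yy: "\<And>i. i \<in> {r+1..t} \<Longrightarrow> yy i \<in> measurable P mu"
    and s: "r + 1 \<le> s" "s \<le> t"
  shows "(\<lambda>p. smoothing lam (m (th p)) (g (th p)) chi r s t (tr l) (\<lambda>i. yy i p)) \<in> borel_measurable P"
proof -
  let ?Pm = "path_measure lam chi r t"
  have sc[measurable_cong]: "sets chi = sets lam" using chi by (simp add: distribution_on_def)
  have sp: "sets ?Pm = sets (PiM {r..t} (\<lambda>_. lam))" unfolding path_measure_def by (rule sets_PiM_cong) (auto simp: sc)
  interpret sigma_finite_measure ?Pm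
  proof -
    have "product_sigma_finite (\<lambda>i::int. if i = r then chi else lam)"
      unfolding product_sigma_finite_def using chi lam(2) prob_space_imp_sigma_finite[of chi] finite_measure.axioms(1)[OF lam(2)]
      by (auto simp: distribution_on_def)
    then show "sigma_finite_measure ?Pm" unfolding path_measure_def by (intro product_sigma_finite.sigma_finite) auto
  qed
  have cX: "(\<lambda>z. snd z i) \<in> measurable (P \<Otimes>\<^sub>M ?Pm) lam" if "i \<in> {r..t}" for i
    by (rule measurable_compose[OF measurable_snd])
      (use that in \<open>simp add: measurable_cong_sets[OF sp refl] measurable_component_singleton\<close>)
  have cY: "(\<lambda>z. yy i (fst z)) \<in> measurable (P \<Otimes>\<^sub>M ?Pm) mu" if "i \<in> {r+1..t}" for i
    by (rule measurable_compose[OF measurable_fst yy[OF that]])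
  have thr: "th \<in> measurable P (restrict_space borel \<Theta>)"
    using th by (intro measurable_restrict_space2) auto
  have [measurable]: "(\<lambda>p. \<phi> (th p)) \<in> borel_measurable P" "(\<lambda>p. \<psi> (th p)) \<in> borel_measurable P"
    using measurable_compose[OF thr borel_measurable_continuous_on_restrict[OF phi_cont]]
      measurable_compose[OF thr borel_measurable_continuous_on_restrict[OF psi_cont]] by auto
  define w where "w = (\<lambda>z. \<Prod>i\<in>{r..<t}. exp (\<phi> (th (fst z)) + S (snd z i) (snd z (i + 1)) (yy (i + 1) (fst z)) \<bullet> \<psi> (th (fst z))))"
  have weq: "path_weight (m (th p)) (g (th p)) r t (\<lambda>i. yy i p) x = w (p, x)" if "p \<in> space P" for p x
    unfolding path_weight_def w_def using th(2)[OF that] by (simp add: mg_eq)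
  have [measurable]: "w \<in> borel_measurable (P \<Otimes>\<^sub>M ?Pm)"
    unfolding w_def
  proof (rule borel_measurable_prod)
    fix i assume i: "i \<in> {r..<t}"
    have [measurable]: "(\<lambda>z. S (snd z i) (snd z (i + 1)) (yy (i + 1) (fst z))) \<in> borel_measurable (P \<Otimes>\<^sub>M ?Pm)"
      by (rule S_meas3[OF cX cX cY]) (use i in auto)
    show "(\<lambda>z. exp (\<phi> (th (fst z)) + S (snd z i) (snd z (i + 1)) (yy (i + 1) (fst z)) \<bullet> \<psi> (th (fst z)))) \<in> borel_measurable (P \<Otimes>\<^sub>M ?Pm)"
      by measurable
  qed
  have [measurable]: "(\<lambda>z. tr l (snd z (s - 1)) (snd z s) (yy s (fst z))) \<in> borel_measurable (P \<Otimes>\<^sub>M ?Pm)"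
    by (rule tr_meas3[OF cX cX cY]) (use s in auto)
  have "(\<lambda>p. (\<integral>x. w (p, x) *\<^sub>R tr l (x (s - 1)) (x s) (yy s p) \<partial>?Pm) /\<^sub>R (\<integral>x. w (p, x) \<partial>?Pm)) \<in> borel_measurable P"
  proof (intro borel_measurable_scaleR borel_measurable_inverse borel_measurable_lebesgue_integral)
    show "(\<lambda>(p, x). w (p, x)) \<in> borel_measurable (P \<Otimes>\<^sub>M ?Pm)" by simp
    have "(\<lambda>z. w z *\<^sub>R tr l (snd z (s - 1)) (snd z s) (yy s (fst z))) \<in> borel_measurable (P \<Otimes>\<^sub>M ?Pm)" by measurable
    then show "(\<lambda>(p, x). w (p, x) *\<^sub>R tr l (x (s - 1)) (x s) (yy s p)) \<in> borel_measurable (P \<Otimes>\<^sub>M ?Pm)"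
      by (simp add: case_prod_beta')
  qed
  then show ?thesis
    by (rule measurable_cong[THEN iffD1, rotated]) (simp add: smoothing_def weq)
qed

lemma smoothing_tr_bound:
  assumes "t \<in> \<Theta>" shows "\<bar>smoothing lam (m t) (g t) chi r s u (tr l) y\<bar> \<le> sr (y s)"
proof (rule smoothing_bounded[where c = "sr (y s)"])
  show "\<bar>tr l x x' (y s)\<bar> \<le> sr (y s)" for x x' by (rule tr_bound)
  show "0 \<le> path_weight (m t) (g t) r u y x" for x
    unfolding path_weight_def using exp_family[OF assms] by (intro prod_nonneg) (auto intro: less_imp_le)
qed

lemma smoothing_shift:
  assumes chi: "distribution_on lam chi" and t: "t \<in> \<Theta>" and rs: "r + 1 \<le> s" "s \<le> u"
  shows "smoothing lam (m t) (g t) chi (r + k) (s + k) (u + k) (tr l) y = smoothing lam (m t) (g t) chi r s u (tr l) (\<lambda>i. y (i + k))"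
proof -
  let ?T = "\<lambda>x::int \<Rightarrow> 'x. \<lambda>i\<in>{r..u}. x (i + k)"
  let ?P = "path_measure lam chi r u" and ?Pk = "path_measure lam chi (r + k) (u + k)"
  have sc: "sets chi = sets lam" using chi by (simp add: distribution_on_def)
  have sp: "sets ?P = sets (PiM {r..u} (\<lambda>_. lam))" "sets ?Pk = sets (PiM {r+k..u+k} (\<lambda>_. lam))"
    unfolding path_measure_def by (rule sets_PiM_cong; simp add: sc)+
  have T: "?T \<in> measurable ?Pk ?P"
    unfolding measurable_cong_sets[OF sp(2,1)] by (intro measurable_restrict measurable_component_singleton) auto
  have pw: "path_weight (m t) (g t) r u (\<lambda>i. y (i + k)) (?T x) = path_weight (m t) (g t) (r + k) (u + k) y x" for x
    unfolding path_weight_def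
    by (rule prod.reindex_bij_witness[of _ "\<lambda>i. i - k" "\<lambda>i. i + k"]) (auto simp: algebra_simps)
  have cX: "(\<lambda>x. x i) \<in> measurable ?P lam" if "i \<in> {r..u}" for i
    using that by (simp add: measurable_cong_sets[OF sp(1) refl] measurable_component_singleton)
  have pwm: "path_weight (m t) (g t) r u (\<lambda>i. y (i + k)) \<in> borel_measurable ?P"
  proof -
    have "(\<lambda>x. \<Prod>i\<in>{r..<u}. exp (\<phi> t + S (x i) (x (i + 1)) (y (i + 1 + k)) \<bullet> \<psi> t)) \<in> borel_measurable ?P"
    proof (rule borel_measurable_prod)
      fix i assume i: "i \<in> {r..<u}"
      have [measurable]: "(\<lambda>x. S (x i) (x (i + 1)) (y (i + 1 + k))) \<in> borel_measurable ?P"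
        by (rule S_meas3[OF cX cX]) (use i in \<open>auto simp: mu\<close>)
      show "(\<lambda>x. exp (\<phi> t + S (x i) (x (i + 1)) (y (i + 1 + k)) \<bullet> \<psi> t)) \<in> borel_measurable ?P" by measurable
    qed
    then show ?thesis unfolding path_weight_def by (simp add: mg_eq[OF t] fun_eq_iff)
  qed
  have trm: "(\<lambda>x. tr l (x (s - 1)) (x s) (y (s + k))) \<in> borel_measurable ?P"
    by (rule tr_meas3[OF cX cX]) (use rs in \<open>auto simp: mu\<close>)
  have "(\<integral>x. path_weight (m t) (g t) r u (\<lambda>i. y (i + k)) x *\<^sub>R tr l (x (s - 1)) (x s) (y (s + k)) \<partial>?P)
    = (\<integral>x. path_weight (m t) (g t) r u (\<lambda>i. y (i + k)) (?T x) *\<^sub>R tr l (?T x (s - 1)) (?T x s) (y (s + k)) \<partial>?Pk)"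
    by (subst path_measure_shift[OF lam(2) chi, of r k u, symmetric], rule integral_distr[OF T])
      (use pwm trm in measurable)
  also have "\<dots> = (\<integral>x. path_weight (m t) (g t) (r + k) (u + k) y x *\<^sub>R tr l (x (s + k - 1)) (x (s + k)) (y (s + k)) \<partial>?Pk)"
    unfolding pw using rs by (simp add: algebra_simps)
  finally have n: "(\<integral>x. path_weight (m t) (g t) r u (\<lambda>i. y (i + k)) x *\<^sub>R tr l (x (s - 1)) (x s) (y (s + k)) \<partial>?P) = \<dots>" .
  have "(\<integral>x. path_weight (m t) (g t) r u (\<lambda>i. y (i + k)) x \<partial>?P) = (\<integral>x. path_weight (m t) (g t) r u (\<lambda>i. y (i + k)) (?T x) \<partial>?Pk)"
    by (subst path_measure_shift[OF lam(2) chi, of r k u, symmetric], rule integral_distr[OF T pwm])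
  then show ?thesis unfolding smoothing_def pw n by simp
qed

text \<open>A transition density integrates to 1 over observations, not over states. Boundedness
  over states comes from the exponential form: fix a state x for which S is essentially bounded in
  its second argument, and divide by m, which is at least \<open>sm\<close>.\<close>

lemma g_integrable:
  assumes t: "t \<in> \<Theta>" and y: "ess y < \<infinity>"
  shows "integrable lam (\<lambda>x. g t x y)"
proof -
  interpret finite_measure lam by (rule lam)
  interpret PP: pair_sigma_finite lam lam ..
  have gm: "(\<lambda>x. g t x y) \<in> borel_measurable lam"
  proof -
    have "(\<lambda>(x, y). g t x y) \<in> borel_measurable (lam \<Otimes>\<^sub>M mu)" using g_density[OF t] by (simp add: transition_density_def)
    from measurable_compose[OF measurable_Pair2'[of y mu] this] show ?thesis using mu by simp
  qed
  have "AE x in lam. AE x' in lam. ennreal (norm (S x x' y)) \<le> ess y"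
    using PP.AE_pair[OF AE_le_ess[OF K(2), of y]] by simp
  then have ae: "AE x in lam. False" if "\<nexists>x. AE x' in lam. ennreal (norm (S x x' y)) \<le> ess y"
    by eventually_elim (use that in blast)
  have "\<exists>x. AE x' in lam. ennreal (norm (S x x' y)) \<le> ess y"
  proof (rule ccontr)
    assume "\<nexists>x. AE x' in lam. ennreal (norm (S x x' y)) \<le> ess y"
    from ae[OF this] have "emeasure lam (space lam) = 0" by (simp add: AE_iff_measurable[OF sets.top])
    then show False using lam_nonzero[OF t] lam(1) by simp
  qed
  then obtain x where x: "AE x' in lam. ennreal (norm (S x x' y)) \<le> ess y" by blast
  let ?B = "exp (\<phi> t + sr y * norm (\<psi> t)) / sm"
  have "AE x' in lam. norm (g t x' y) \<le> ?B" using x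
  proof eventually_elim
    case (elim x')
    have "norm (S x x' y) \<le> sr y" using elim y unfolding sr_def
      by (metis enn2real_ennreal enn2real_mono norm_ge_zero infinity_ennreal_def)
    then have "S x x' y \<bullet> \<psi> t \<le> sr y * norm (\<psi> t)"
      by (meson mult_right_mono norm_cauchy_schwarz norm_ge_zero order_trans)
    then have "m t x x' * g t x' y \<le> exp (\<phi> t + sr y * norm (\<psi> t))" unfolding mg_eq[OF t] by simp
    moreover have "sm * g t x' y \<le> m t x x' * g t x' y"
      using strong_mixing(2)[OF t] exp_family[OF t] by (intro mult_right_mono) (auto intro: less_imp_le)
    ultimately have "sm * g t x' y \<le> exp (\<phi> t + sr y * norm (\<psi> t))" by linarith
    then have "g t x' y \<le> ?B" by (simp only: pos_le_divide_eq[OF strong_mixing(1)] mult.commute[of _ sm])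
    then show ?case using exp_family[OF t, of x x' y] by simp
  qed
  then show ?thesis by (rule integrable_const_bound) (rule gm)
qed

text \<open>The paths along which the deterministic forgetting estimates hold.\<close>

definition good :: "(int \<Rightarrow> 'y) \<Rightarrow> bool" where "good y \<longleftrightarrow> (\<forall>k. ess (y k) < \<infinity>)"

lemma hmm_kernels_at: assumes t: "t \<in> \<Theta>" and y: "good y" shows "hmm_kernels lam (m t) (g t) y sm sp"
proof (rule hmm_kernels.intro)
  show "(\<lambda>(x, x'). m t x x') \<in> borel_measurable (lam \<Otimes>\<^sub>M lam)"
    using m_density[OF t] by (simp add: transition_density_def)
  show "space lam = UNIV" "finite_measure lam" "emeasure lam UNIV \<noteq> 0" "0 < sm"
    by (rule lam lam_nonzero[OF t] strong_mixing)+
  show "sm \<le> m t x x'" "m t x x' \<le> sp" for x x' using strong_mixing(2)[OF t] by auto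
  show "0 < g t x (y i)" for x i using exp_family[OF t] by blast
  show "integrable lam (\<lambda>x. g t x (y i))" for i
    using y unfolding good_def by (intro g_integrable[OF t]) auto
qed

definition rho :: real where "rho = 1 - sm / sp"

lemma smoothing_tr_window:
  assumes t: "t \<in> \<Theta>" and y: "good y"
    and chi: "distribution_on lam chi" "distribution_on lam chi'"
    and rs: "r \<le> u" "r' \<le> u" "u \<le> s - 1" "s \<le> v" "v \<le> w" "v \<le> w'"
  shows "\<bar>smoothing lam (m t) (g t) chi r s w (tr l) y - smoothing lam (m t) (g t) chi' r' s w' (tr l) y\<bar>
    \<le> 2 * sr (y s) * (rho ^ nat (s - 1 - u) + rho ^ nat (v - s))"
proof -
  interpret hmm_kernels lam "m t" "g t" y sm sp by (rule hmm_kernels_at[OF t y])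
  have eq: "smoothing lam (m t) (g t) chi r s w (tr l) y = smoothing lam (m t) (g t) chi r s w (\<lambda>x z _. tr l x z (y s)) y" for chi r w
    by (simp add: smoothing_def)
  show ?thesis unfolding eq
    using smoothing_window[OF chi rs tr_pair_meas[of l "y s"] tr_bound] unfolding \<rho>_def rho_def .
qed

lemma smoothing_AE_cong:
  fixes f f' :: "'x \<Rightarrow> 'x \<Rightarrow> 'y \<Rightarrow> 'v::{banach, second_countable_topology}"
  assumes t: "t \<in> \<Theta>" and y: "good y" and chi: "distribution_on lam chi" and rs: "r \<le> s - 1" "s \<le> u"
    and f: "(\<lambda>w. f (fst w) (snd w) (y s)) \<in> borel_measurable (lam \<Otimes>\<^sub>M lam)"
      "(\<lambda>w. f' (fst w) (snd w) (y s)) \<in> borel_measurable (lam \<Otimes>\<^sub>M lam)"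
    and ae: "AE w in (if s - 1 = r then chi else lam) \<Otimes>\<^sub>M lam. f (fst w) (snd w) (y s) = f' (fst w) (snd w) (y s)"
  shows "smoothing lam (m t) (g t) chi r s u f y = smoothing lam (m t) (g t) chi r s u f' y"
proof -
  interpret hmm_kernels lam "m t" "g t" y sm sp by (rule hmm_kernels_at[OF t y])
  interpret hmm_paths lam "m t" "g t" y sm sp chi by standard (rule chi)
  interpret product_sigma_finite "Mi r" by (rule product_sigma_finite_Mi)
  note [measurable] = f
  have "AE x in PiM {r..u} (Mi r). f (fst (x (s - 1), x s)) (snd (x (s - 1), x s)) (y s) = f' (fst (x (s - 1), x s)) (snd (x (s - 1), x s)) (y s)"
    by (rule AE_PiM_pair[of "{r..u}" "s - 1" s]) (use rs ae in \<open>auto simp: sets_chi split: if_splits\<close>)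
  then have A: "AE x in path_measure lam chi r u. f (x (s - 1)) (x s) (y s) = f' (x (s - 1)) (x s) (y s)"
    unfolding path_measure_def by simp
  have pr: "(\<lambda>x. (x (s - 1), x s)) \<in> measurable (PiM {r..u} (\<lambda>_. lam)) (lam \<Otimes>\<^sub>M lam)"
    using rs by (intro measurable_Pair measurable_component_singleton) auto
  have "(\<lambda>x. f (x (s - 1)) (x s) (y s)) \<in> borel_measurable (path_measure lam chi r u)"
    "(\<lambda>x. f' (x (s - 1)) (x s) (y s)) \<in> borel_measurable (path_measure lam chi r u)"
    using measurable_compose[OF pr f(1)] measurable_compose[OF pr f(2)] by (auto simp: measurable_path)
  moreover have "path_weight (m t) (g t) r u y \<in> borel_measurable (path_measure lam chi r u)"
    using pw_meas by (simp add: measurable_path)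
  ultimately have "(\<integral>x. path_weight (m t) (g t) r u y x *\<^sub>R f (x (s - 1)) (x s) (y s) \<partial>path_measure lam chi r u)
    = (\<integral>x. path_weight (m t) (g t) r u y x *\<^sub>R f' (x (s - 1)) (x s) (y s) \<partial>path_measure lam chi r u)"
    using A by (intro integral_cong_AE) auto
  then show ?thesis unfolding smoothing_def by simp
qed

text \<open>S may be replaced by its truncated components only up to null sets of the measure
  governing the state at time \<open>s - 1\<close>. If that is the initial time the measure is
  \<open>chi\<close>, whence the assumption on \<open>chi\<close> in this case.\<close>

lemma smoothing_S_component:
  assumes t: "t \<in> \<Theta>" and y: "good y" and chi: "distribution_on lam chi" and rs: "r \<le> s - 1" "s \<le> u"
    and K': "s - 1 = r \<Longrightarrow> chi \<in> K"
  shows "smoothing lam (m t) (g t) chi r s u S y $ l = smoothing lam (m t) (g t) chi r s u (tr l) y"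
proof -
  interpret hmm_kernels lam "m t" "g t" y sm sp by (rule hmm_kernels_at[OF t y])
  interpret hmm_paths lam "m t" "g t" y sm sp chi by standard (rule chi)
  define f where "f x x' z = (if ennreal (norm (S x x' z)) \<le> ess z then S x x' z else 0)" for x x' z
  have fin: "ess (y s) < \<infinity>" using y by (simp add: good_def)
  have [measurable]: "(\<lambda>w. S (fst w) (snd w) (y s)) \<in> borel_measurable (lam \<Otimes>\<^sub>M lam)"
    by (rule S_meas3) (auto simp: mu)
  have fm: "(\<lambda>w. f (fst w) (snd w) (y s)) \<in> borel_measurable (lam \<Otimes>\<^sub>M lam)" unfolding f_def by measurable
  have "smoothing lam (m t) (g t) chi r s u S y = smoothing lam (m t) (g t) chi r s u f y"
  proof (rule smoothing_AE_cong[where f = S and f' = f, OF t y chi rs _ fm])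
    have "(if s - 1 = r then chi else lam) \<in> K" using K' K(2) by auto
    from AE_le_ess[OF this, of "y s"]
    show "AE w in (if s - 1 = r then chi else lam) \<Otimes>\<^sub>M lam. S (fst w) (snd w) (y s) = f (fst w) (snd w) (y s)"
      by eventually_elim (simp add: f_def)
  qed simp
  moreover have "smoothing lam (m t) (g t) chi r s u f y $ l = smoothing lam (m t) (g t) chi r s u (tr l) y"
  proof -
    let ?F = "\<lambda>x. path_weight (m t) (g t) r u y x *\<^sub>R f (x (s - 1)) (x s) (y s)"
    have pr: "(\<lambda>x. (x (s - 1), x s)) \<in> measurable (PiM {r..u} (\<lambda>_. lam)) (lam \<Otimes>\<^sub>M lam)"
      using rs by (intro measurable_Pair measurable_component_singleton) auto
    have "(\<lambda>x. f (x (s - 1)) (x s) (y s)) \<in> borel_measurable (path_measure lam chi r u)"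
      using measurable_compose[OF pr fm] by (simp add: measurable_path)
    then have Fm: "?F \<in> borel_measurable (path_measure lam chi r u)" using pw_meas by (auto simp: measurable_path)
    have nf: "norm (f x x' (y s)) \<le> sr (y s)" for x x'
      using fin unfolding sr_def f_def
      by (auto simp: enn2real_nonneg) (metis enn2real_ennreal enn2real_mono norm_ge_zero infinity_ennreal_def top.not_eq_extremum)
    have int: "integrable (path_measure lam chi r u) ?F"
    proof (rule Bochner_Integration.integrable_bound[OF _ Fm])
      show "integrable (path_measure lam chi r u) (\<lambda>x. sr (y s) * path_weight (m t) (g t) r u y x)" using pw_integrable by simp
      show "AE x in path_measure lam chi r u. norm (?F x) \<le> norm (sr (y s) * path_weight (m t) (g t) r u y x)"
      proof (intro AE_I2)
        fix x
        have "path_weight (m t) (g t) r u y x * norm (f (x (s - 1)) (x s) (y s)) \<le> path_weight (m t) (g t) r u y x * sr (y s)"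
          using pw_pos[of r u x] by (intro mult_left_mono nf) auto
        then show "norm (?F x) \<le> norm (sr (y s) * path_weight (m t) (g t) r u y x)"
          using pw_pos[of r u x] sr_nonneg[of "y s"] by (simp add: mult.commute)
      qed
    qed
    have ft: "f x x' (y s) $ l = tr l x x' (y s)" for x x' using fin by (simp add: f_def tr_def)
    have "(\<integral>x. ?F x \<partial>path_measure lam chi r u) $ l = (\<integral>x. ?F x $ l \<partial>path_measure lam chi r u)"
      by (rule integral_bounded_linear[OF bounded_linear_vec_nth int, symmetric])
    then show ?thesis unfolding smoothing_def by (simp add: ft)
  qed
  ultimately show ?thesis by simp
qed

end

section \<open>The limiting statistic and its mean\<close>

lemma convergent_of_geometric_tail:
  fixes a :: "nat \<Rightarrow> real"
  assumes "\<And>N i j. N \<le> i \<Longrightarrow> N \<le> j \<Longrightarrow> \<bar>a i - a j\<bar> \<le> C * r ^ N" "0 \<le> r" "r < 1"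
  shows "convergent a"
proof -
  have lim: "(\<lambda>N. C * r ^ N) \<longlonglongrightarrow> 0" using tendsto_mult_right_zero[OF LIMSEQ_realpow_zero[OF assms(2,3)]] .
  have "Cauchy a"
  proof (rule metric_CauchyI)
    fix e :: real assume "e > 0"
    with order_tendstoD(2)[OF lim] obtain N where N: "C * r ^ N < e" by (auto simp: eventually_sequentially)
    then show "\<exists>M. \<forall>i\<ge>M. \<forall>j\<ge>M. dist (a i) (a j) < e"
      using assms(1)[of N] by (intro exI[of _ N]) (auto simp: dist_real_def intro: le_less_trans)
  qed
  then show ?thesis by (simp add: Cauchy_convergent_iff)
qed

locale stationary_hmm =
  exp_family_model \<Theta> lam mu m g \<phi> \<psi> S sm sp K + prob_space M
  for \<Theta> :: "(real^'k) set" and lam :: "'x measure" and mu :: "'y measure"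
    and m :: "real^'k \<Rightarrow> 'x \<Rightarrow> 'x \<Rightarrow> real" and g :: "real^'k \<Rightarrow> 'x \<Rightarrow> 'y \<Rightarrow> real"
    and \<phi> :: "real^'k \<Rightarrow> real" and \<psi> :: "real^'k \<Rightarrow> real^'d" and S :: "'x \<Rightarrow> 'x \<Rightarrow> 'y \<Rightarrow> real^'d"
    and sm sp :: real and K :: "'x measure set" and M :: "'w measure" +
  fixes Y :: "int \<Rightarrow> 'w \<Rightarrow> 'y" and pbar :: real and chi0 :: "'x measure"
  assumes Y_measurable: "\<And>k. Y k \<in> measurable M mu"
    and Y_stationary: "stationary M mu Y"
    and pbar: "pbar > 2"
    and moments:
      "(\<lambda>\<omega>. SUP (x, x')\<in>UNIV. ennreal (norm (S x x' (Y 0 \<omega>)) powr pbar)) \<in> borel_measurable M"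
      "(\<integral>\<^sup>+\<omega>. (SUP (x, x')\<in>UNIV. ennreal (norm (S x x' (Y 0 \<omega>)) powr pbar)) \<partial>M) < \<infinity>"
    and chi0: "distribution_on lam chi0"
begin

lemmas [measurable] = Y_measurable

lemma Y_shift_measurable: "(\<lambda>\<omega> i. Y (i + k) \<omega>) \<in> measurable M (PiM UNIV (\<lambda>_. mu))"
  by (rule measurable_PiM_single') (auto simp: mu)

lemma distr_Y_shift: "distr M (PiM UNIV (\<lambda>_. mu)) (\<lambda>\<omega> i. Y (i + k) \<omega>) = distr M (PiM UNIV (\<lambda>_. mu)) (\<lambda>\<omega> i. Y i \<omega>)"
  using Y_stationary unfolding stationary_def by blast

lemma expectation_shift:
  fixes F :: "(int \<Rightarrow> 'y) \<Rightarrow> real"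
  assumes "F \<in> borel_measurable (PiM UNIV (\<lambda>_. mu))"
  shows "(\<integral>\<omega>. F (\<lambda>i. Y (i + k) \<omega>) \<partial>M) = (\<integral>\<omega>. F (\<lambda>i. Y i \<omega>) \<partial>M)"
proof -
  have "(\<integral>\<omega>. F (\<lambda>i. Y (i + k) \<omega>) \<partial>M) = (\<integral>x. F x \<partial>distr M (PiM UNIV (\<lambda>_. mu)) (\<lambda>\<omega> i. Y (i + k) \<omega>))"
    by (rule integral_distr[symmetric, OF Y_shift_measurable assms])
  also have "\<dots> = (\<integral>\<omega>. F (\<lambda>i. Y i \<omega>) \<partial>M)"
    unfolding distr_Y_shift using Y_shift_measurable[of 0] by (intro integral_distr assms) simp
  finally show ?thesis .
qed

lemma distr_Y: "distr M mu (Y k) = distr M mu (Y 0)"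
proof -
  have c: "(\<lambda>x. x 0) \<in> measurable (PiM UNIV (\<lambda>_. mu)) mu" by (rule measurable_component_singleton) simp
  have "distr M mu (Y j) = distr (distr M (PiM UNIV (\<lambda>_. mu)) (\<lambda>\<omega> i. Y (i + j) \<omega>)) mu (\<lambda>x. x (0::int))" for j
    by (subst distr_distr[OF c Y_shift_measurable]) (simp add: comp_def)
  then show ?thesis unfolding distr_Y_shift by metis
qed

lemma ess_Y0:
  "AE \<omega> in M. ess (Y 0 \<omega>) < \<infinity>" "integrable M (\<lambda>\<omega>. sr (Y 0 \<omega>) powr pbar)"
proof -
  let ?U = "\<lambda>\<omega>. SUP (x, x')\<in>UNIV. ennreal (norm (S x x' (Y 0 \<omega>)) powr pbar)"
  have "AE \<omega> in M. ?U \<omega> \<noteq> \<infinity>" using moments by (intro nn_integral_PInf_AE) auto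
  then have ae: "AE \<omega> in M. ess (Y 0 \<omega>) < \<infinity> \<and> ennreal (sr (Y 0 \<omega>) powr pbar) \<le> ?U \<omega>"
    unfolding sr_def
  proof eventually_elim
    case (elim \<omega>)
    then have "?U \<omega> < \<infinity>" by (simp only: infinity_ennreal_def top.not_eq_extremum)
    then show ?case using pbar by (intro ess_le) auto
  qed
  then show "AE \<omega> in M. ess (Y 0 \<omega>) < \<infinity>" by eventually_elim simp
  show "integrable M (\<lambda>\<omega>. sr (Y 0 \<omega>) powr pbar)"
  proof (rule integrableI_nonneg)
    have "(\<integral>\<^sup>+\<omega>. ennreal (sr (Y 0 \<omega>) powr pbar) \<partial>M) \<le> (\<integral>\<^sup>+\<omega>. ?U \<omega> \<partial>M)"
      by (rule nn_integral_mono_AE) (use ae in eventually_elim, simp)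
    then show "(\<integral>\<^sup>+\<omega>. ennreal (sr (Y 0 \<omega>) powr pbar) \<partial>M) < \<infinity>" using moments(2) by (rule le_less_trans)
  qed auto
qed

lemma AE_good: "AE \<omega> in M. good (\<lambda>k. Y k \<omega>)"
  unfolding good_def
proof (subst AE_all_countable, rule allI)
  fix k
  have "AE y in distr M mu (Y 0). ess y < \<infinity>" using ess_Y0(1) by (subst AE_distr_iff) auto
  then have "AE y in distr M mu (Y k). ess y < \<infinity>" by (simp only: distr_Y[of k])
  then show "AE \<omega> in M. ess (Y k \<omega>) < \<infinity>" by (subst (asm) AE_distr_iff) auto
qed

text \<open>The summand 1 makes the constant positive, as the comparison of norms of different
  orders requires.\<close>

definition Cs :: real where
  "Cs = 1 + (\<integral>\<omega>. sr (Y 0 \<omega>) powr pbar \<partial>M) powr (1 / pbar)"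

lemma Cs_pos: "Cs > 0" unfolding Cs_def by (simp add: add_pos_nonneg)

lemma Lp_sr: "Lp_le M pbar (\<lambda>\<omega>. sr (Y k \<omega>)) Cs"
proof -
  have f: "(\<lambda>y. sr y powr pbar) \<in> borel_measurable mu" by measurable
  have "integrable (distr M mu (Y 0)) (\<lambda>y. sr y powr pbar)" using ess_Y0(2) by (subst integrable_distr_eq) auto
  then have i: "integrable M (\<lambda>\<omega>. sr (Y k \<omega>) powr pbar)"
    unfolding distr_Y[of k, symmetric] by (subst (asm) integrable_distr_eq) auto
  have e: "(\<integral>\<omega>. sr (Y k \<omega>) powr pbar \<partial>M) = (\<integral>\<omega>. sr (Y 0 \<omega>) powr pbar \<partial>M)"
    using integral_distr[OF Y_measurable[of k] f] integral_distr[OF Y_measurable[of 0] f] distr_Y[of k] by simp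
  let ?I = "\<integral>\<omega>. sr (Y 0 \<omega>) powr pbar \<partial>M"
  have I0: "?I \<ge> 0" by simp
  have "?I = (?I powr (1 / pbar)) powr pbar" using pbar I0 by (simp add: powr_powr)
  also have "\<dots> \<le> Cs powr pbar" unfolding Cs_def using pbar by (intro powr_mono2) auto
  finally show ?thesis unfolding Lp_le_def using i e Cs_pos by (simp add: sr_nonneg)
qed

lemma sr_integrable: "integrable M (\<lambda>\<omega>. sr (Y k \<omega>))" "(\<integral>\<omega>. sr (Y k \<omega>) \<partial>M) \<le> Cs"
proof -
  show i: "integrable M (\<lambda>\<omega>. sr (Y k \<omega>))"
    by (rule Lp_le_integrable[OF finite_measure_axioms _ Lp_sr]) (use pbar in simp)
  have "Lp_le M 1 (\<lambda>\<omega>. sr (Y k \<omega>)) Cs"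
    by (rule Lp_le_exponent_mono[OF prob_space_axioms _ _ Lp_sr Cs_pos]) (use pbar in auto)
  from Lp_leD(4)[OF this] show "(\<integral>\<omega>. sr (Y k \<omega>) \<partial>M) \<le> Cs" using sr_nonneg Cs_pos by simp
qed

abbreviation smo :: "real^'k \<Rightarrow> 'x measure \<Rightarrow> int \<Rightarrow> int \<Rightarrow> int \<Rightarrow> 'd \<Rightarrow> 'w \<Rightarrow> real" where
  "smo t chi r s u l \<omega> \<equiv> smoothing lam (m t) (g t) chi r s u (tr l) (\<lambda>k. Y k \<omega>)"

lemma rho: "t \<in> \<Theta> \<Longrightarrow> 0 \<le> rho \<and> rho < 1"
proof -
  assume "t \<in> \<Theta>"
  then have "sm \<le> sp" using strong_mixing(2) order_trans by blast
  then show ?thesis using strong_mixing(1) by (simp add: rho_def field_simps)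
qed

lemma smo_measurable:
  assumes "t \<in> \<Theta>" "distribution_on lam chi" "r + 1 \<le> s" "s \<le> u"
  shows "smo t chi r s u l \<in> borel_measurable M"
  using smoothing_measurable[OF assms(2), of "\<lambda>_. t" M r u Y s l] assms by simp

lemma smo_integrable:
  assumes "t \<in> \<Theta>" "distribution_on lam chi" "r + 1 \<le> s" "s \<le> u"
  shows "integrable M (smo t chi r s u l)"
  by (rule Bochner_Integration.integrable_bound[OF sr_integrable(1)[of s] smo_measurable[OF assms]])
    (use smoothing_tr_bound[OF assms(1)] sr_nonneg in \<open>auto intro!: AE_I2\<close>)

lemma smo_window:
  assumes t: "t \<in> \<Theta>" and y: "good (\<lambda>k. Y k \<omega>)"
    and "distribution_on lam chi" "distribution_on lam chi'"
    and "r \<le> u" "r' \<le> u" "u \<le> s - 1" "s \<le> v" "v \<le> w" "v \<le> w'"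
  shows "\<bar>smo t chi r s w l \<omega> - smo t chi' r' s w' l \<omega>\<bar> \<le> 2 * sr (Y s \<omega>) * (rho ^ nat (s - 1 - u) + rho ^ nat (v - s))"
  by (rule smoothing_tr_window[OF assms])

text \<open>Makes the choice in \<open>limit_stat\<close> usable: along the single initial law
  \<open>chi0\<close> a limit exists by forgetting, and forgetting of the initial law identifies it
  as the limit for all others.\<close>

lemma limit_stat_properties:
  assumes t: "t \<in> \<Theta>"
  defines "LS \<equiv> limit_stat M Y lam (m t) (g t) S"
  shows "LS \<in> borel_measurable M"
    "AE \<omega> in M. \<forall>l. (\<lambda>\<tau>. smo t chi0 (- int \<tau> - 1) 0 (int \<tau>) l \<omega>) \<longlonglongrightarrow> LS \<omega> $ l"
proof -
  have r: "0 \<le> rho" "rho < 1" using rho[OF t] by auto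
  define Z :: "'w \<Rightarrow> real^'d" where "Z \<omega> = (\<chi> l. lim (\<lambda>\<tau>. smo t chi0 (- int \<tau> - 1) 0 (int \<tau>) l \<omega>))" for \<omega>
  have Zm: "Z \<in> borel_measurable M" unfolding Z_def
    by (intro borel_measurable_vec_lambda borel_measurable_lim_metric smo_measurable t chi0) auto
  have conv: "(\<lambda>\<tau>. smo t chi0 (- int \<tau> - 1) 0 (int \<tau>) l \<omega>) \<longlonglongrightarrow> Z \<omega> $ l" if y: "good (\<lambda>k. Y k \<omega>)" for \<omega> l
  proof -
    have "convergent (\<lambda>\<tau>. smo t chi0 (- int \<tau> - 1) 0 (int \<tau>) l \<omega>)"
    proof (rule convergent_of_geometric_tail[OF _ r])
      fix N i j :: nat assume "N \<le> i" "N \<le> j"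
      then have "\<bar>smo t chi0 (- int i - 1) 0 (int i) l \<omega> - smo t chi0 (- int j - 1) 0 (int j) l \<omega>\<bar>
        \<le> 2 * sr (Y 0 \<omega>) * (rho ^ nat (0 - 1 - (- int N - 1)) + rho ^ nat (int N - 0))"
        by (intro smo_window[OF t y chi0 chi0]) auto
      then show "\<bar>smo t chi0 (- int i - 1) 0 (int i) l \<omega> - smo t chi0 (- int j - 1) 0 (int j) l \<omega>\<bar> \<le> (4 * sr (Y 0 \<omega>)) * rho ^ N"
        by simp
    qed
    then show ?thesis by (simp add: Z_def convergent_LIMSEQ_iff)
  qed
  \<comment> \<open>From \<open>\<tau> = 1\<close> on, time -1 is not the initial time, so initial
    laws outside \<open>K\<close> are admissible as well.\<close>
  have comp: "\<forall>\<^sub>F \<tau> in sequentially. smoothing lam (m t) (g t) chi (- int \<tau> - 1) 0 (int \<tau>) S (\<lambda>k. Y k \<omega>) $ l = smo t chi (- int \<tau> - 1) 0 (int \<tau>) l \<omega>"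
    if "good (\<lambda>k. Y k \<omega>)" "distribution_on lam chi" for chi \<omega> l
    unfolding eventually_sequentially
    by (intro exI[of _ 1] allI impI smoothing_S_component[OF t that]) auto
  have "\<exists>Z. Z \<in> borel_measurable M \<and> (\<forall>chi. distribution_on lam chi \<longrightarrow>
           (AE \<omega> in M. (\<lambda>\<tau>. smoothing lam (m t) (g t) chi (- int \<tau> - 1) 0 (int \<tau>) S (\<lambda>k. Y k \<omega>)) \<longlonglongrightarrow> Z \<omega>))"
  proof (intro exI[of _ Z] conjI allI impI Zm)
    fix chi assume chi: "distribution_on lam chi"
    show "AE \<omega> in M. (\<lambda>\<tau>. smoothing lam (m t) (g t) chi (- int \<tau> - 1) 0 (int \<tau>) S (\<lambda>k. Y k \<omega>)) \<longlonglongrightarrow> Z \<omega>"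
      using AE_good
    proof eventually_elim
      case (elim \<omega>)
      show ?case
      proof (rule vec_tendstoI)
        fix l
        have "(\<lambda>\<tau>. smo t chi (- int \<tau> - 1) 0 (int \<tau>) l \<omega> - smo t chi0 (- int \<tau> - 1) 0 (int \<tau>) l \<omega>) \<longlonglongrightarrow> 0"
        proof (rule Lim_null_comparison)
          show "\<forall>\<^sub>F \<tau> in sequentially. norm (smo t chi (- int \<tau> - 1) 0 (int \<tau>) l \<omega> - smo t chi0 (- int \<tau> - 1) 0 (int \<tau>) l \<omega>) \<le> (4 * sr (Y 0 \<omega>)) * rho ^ \<tau>"
          proof (intro always_eventually allI)
            fix \<tau> :: nat
            have "\<bar>smo t chi (- int \<tau> - 1) 0 (int \<tau>) l \<omega> - smo t chi0 (- int \<tau> - 1) 0 (int \<tau>) l \<omega>\<bar>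
              \<le> 2 * sr (Y 0 \<omega>) * (rho ^ nat (0 - 1 - (- int \<tau> - 1)) + rho ^ nat (int \<tau> - 0))"
              by (intro smo_window[OF t elim chi chi0]) auto
            then show "norm (smo t chi (- int \<tau> - 1) 0 (int \<tau>) l \<omega> - smo t chi0 (- int \<tau> - 1) 0 (int \<tau>) l \<omega>) \<le> (4 * sr (Y 0 \<omega>)) * rho ^ \<tau>"
              by simp
          qed
          show "(\<lambda>\<tau>. (4 * sr (Y 0 \<omega>)) * rho ^ \<tau>) \<longlonglongrightarrow> 0"
            by (rule tendsto_mult_right_zero[OF LIMSEQ_realpow_zero[OF r]])
        qed
        from tendsto_add[OF this conv[OF elim, of l]]
        have "(\<lambda>\<tau>. smo t chi (- int \<tau> - 1) 0 (int \<tau>) l \<omega>) \<longlonglongrightarrow> Z \<omega> $ l" by simp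
        then show "(\<lambda>\<tau>. smoothing lam (m t) (g t) chi (- int \<tau> - 1) 0 (int \<tau>) S (\<lambda>k. Y k \<omega>) $ l) \<longlonglongrightarrow> Z \<omega> $ l"
          by (rule tendsto_cong[THEN iffD2, rotated]) (rule comp[OF elim chi])
      qed
    qed
  qed
  from someI_ex[OF this] have LS: "LS \<in> borel_measurable M"
    "AE \<omega> in M. (\<lambda>\<tau>. smoothing lam (m t) (g t) chi0 (- int \<tau> - 1) 0 (int \<tau>) S (\<lambda>k. Y k \<omega>)) \<longlonglongrightarrow> LS \<omega>"
    using chi0 unfolding LS_def limit_stat_def by blast+
  show "LS \<in> borel_measurable M" by (rule LS)
  show "AE \<omega> in M. \<forall>l. (\<lambda>\<tau>. smo t chi0 (- int \<tau> - 1) 0 (int \<tau>) l \<omega>) \<longlonglongrightarrow> LS \<omega> $ l"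
    using LS(2) AE_good
  proof eventually_elim
    case (elim \<omega>)
    show ?case
    proof
      fix l
      from tendsto_vec_nth[OF elim(1), of l]
      show "(\<lambda>\<tau>. smo t chi0 (- int \<tau> - 1) 0 (int \<tau>) l \<omega>) \<longlonglongrightarrow> LS \<omega> $ l"
        by (rule tendsto_cong[THEN iffD1, rotated]) (rule comp[OF elim(2) chi0])
    qed
  qed
qed

lemma limit_stat_window:
  assumes t: "t \<in> \<Theta>"
  shows "AE \<omega> in M. \<forall>l chi r w. distribution_on lam chi \<longrightarrow> r \<le> - 1 \<longrightarrow> 0 \<le> w \<longrightarrow>
    \<bar>smo t chi r 0 w l \<omega> - limit_stat M Y lam (m t) (g t) S \<omega> $ l\<bar> \<le> 2 * sr (Y 0 \<omega>) * (rho ^ nat (- 1 - r) + rho ^ nat w)"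
  using limit_stat_properties(2)[OF t] AE_good
proof eventually_elim
  case (elim \<omega>)
  show ?case
  proof (intro allI impI)
    fix l chi and r w :: int assume *: "distribution_on lam chi" "r \<le> - 1" "0 \<le> w"
    have "(\<lambda>\<tau>. \<bar>smo t chi r 0 w l \<omega> - smo t chi0 (- int \<tau> - 1) 0 (int \<tau>) l \<omega>\<bar>) \<longlonglongrightarrow> \<bar>smo t chi r 0 w l \<omega> - limit_stat M Y lam (m t) (g t) S \<omega> $ l\<bar>"
      using elim(1) by (intro tendsto_intros) auto
    then show "\<bar>smo t chi r 0 w l \<omega> - limit_stat M Y lam (m t) (g t) S \<omega> $ l\<bar> \<le> 2 * sr (Y 0 \<omega>) * (rho ^ nat (- 1 - r) + rho ^ nat w)"
    proof (rule tendsto_upperbound)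
      show "\<forall>\<^sub>F \<tau> in sequentially. \<bar>smo t chi r 0 w l \<omega> - smo t chi0 (- int \<tau> - 1) 0 (int \<tau>) l \<omega>\<bar> \<le> 2 * sr (Y 0 \<omega>) * (rho ^ nat (- 1 - r) + rho ^ nat w)"
        unfolding eventually_sequentially
      proof (intro exI[of _ "nat (max (- r) w)"] allI impI)
        fix \<tau> assume "nat (max (- r) w) \<le> \<tau>"
        then have "\<bar>smo t chi r 0 w l \<omega> - smo t chi0 (- int \<tau> - 1) 0 (int \<tau>) l \<omega>\<bar> \<le> 2 * sr (Y 0 \<omega>) * (rho ^ nat (0 - 1 - r) + rho ^ nat (w - 0))"
          using * by (intro smo_window[OF t elim(2) *(1) chi0]) auto
        then show "\<bar>smo t chi r 0 w l \<omega> - smo t chi0 (- int \<tau> - 1) 0 (int \<tau>) l \<omega>\<bar> \<le> 2 * sr (Y 0 \<omega>) * (rho ^ nat (- 1 - r) + rho ^ nat w)" by simp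
      qed
    qed simp
  qed
qed

lemma limit_stat_bound:
  assumes t: "t \<in> \<Theta>"
  shows "AE \<omega> in M. \<forall>l. \<bar>limit_stat M Y lam (m t) (g t) S \<omega> $ l\<bar> \<le> sr (Y 0 \<omega>)"
  using limit_stat_properties(2)[OF t]
proof eventually_elim
  case (elim \<omega>)
  show ?case
  proof
    fix l
    have "(\<lambda>\<tau>. \<bar>smo t chi0 (- int \<tau> - 1) 0 (int \<tau>) l \<omega>\<bar>) \<longlonglongrightarrow> \<bar>limit_stat M Y lam (m t) (g t) S \<omega> $ l\<bar>"
      using elim by (intro tendsto_rabs) auto
    then show "\<bar>limit_stat M Y lam (m t) (g t) S \<omega> $ l\<bar> \<le> sr (Y 0 \<omega>)"
      by (rule tendsto_upperbound) (auto intro!: always_eventually smoothing_tr_bound[OF t])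
  qed
qed

lemma limit_stat_integrable:
  assumes t: "t \<in> \<Theta>"
  shows "integrable M (\<lambda>\<omega>. limit_stat M Y lam (m t) (g t) S \<omega> $ l)"
    "integrable M (limit_stat M Y lam (m t) (g t) S)"
    "mean_stat M Y lam m g S t $ l = (\<integral>\<omega>. limit_stat M Y lam (m t) (g t) S \<omega> $ l \<partial>M)"
proof -
  let ?LS = "limit_stat M Y lam (m t) (g t) S"
  have LSm[measurable]: "?LS \<in> borel_measurable M" by (rule limit_stat_properties[OF t])
  have m: "(\<lambda>\<omega>. ?LS \<omega> $ l) \<in> borel_measurable M" for l
  proof -
    have "(\<lambda>\<omega>. ?LS \<omega> \<bullet> axis l 1) \<in> borel_measurable M" by measurable
    then show ?thesis by (simp add: inner_axis)
  qed
  have i: "integrable M (\<lambda>\<omega>. ?LS \<omega> $ l)" for l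
  proof (rule Bochner_Integration.integrable_bound[OF sr_integrable(1)[of 0] m])
    show "AE \<omega> in M. norm (?LS \<omega> $ l) \<le> norm (sr (Y 0 \<omega>))"
      using limit_stat_bound[OF t] by eventually_elim (use sr_nonneg in auto)
  qed
  then show "integrable M (\<lambda>\<omega>. ?LS \<omega> $ l)" .
  have eq: "?LS = (\<lambda>\<omega>. \<Sum>l\<in>UNIV. (?LS \<omega> $ l) *\<^sub>R axis l 1)"
    by (simp add: fun_eq_iff basis_expansion flip: scalar_mult_eq_scaleR)
  show int: "integrable M ?LS" by (subst eq) (intro Bochner_Integration.integrable_sum integrable_scaleR_left i)
  show "mean_stat M Y lam m g S t $ l = (\<integral>\<omega>. ?LS \<omega> $ l \<partial>M)"
    unfolding mean_stat_def by (rule integral_bounded_linear[OF bounded_linear_vec_nth int, symmetric])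
qed

lemma mean_stat_bound:
  assumes t: "t \<in> \<Theta>" shows "\<bar>mean_stat M Y lam m g S t $ l\<bar> \<le> Cs"
proof -
  let ?LS = "limit_stat M Y lam (m t) (g t) S"
  have "\<bar>mean_stat M Y lam m g S t $ l\<bar> \<le> (\<integral>\<omega>. \<bar>?LS \<omega> $ l\<bar> \<partial>M)"
    unfolding limit_stat_integrable(3)[OF t] by (rule integral_abs_bound)
  also have "\<dots> \<le> (\<integral>\<omega>. sr (Y 0 \<omega>) \<partial>M)"
    using limit_stat_integrable(1)[OF t] sr_integrable(1) limit_stat_bound[OF t]
    by (intro integral_mono_AE) (auto elim: eventually_mono)
  finally show ?thesis using sr_integrable(2)[of 0] by linarith
qed

text \<open>Stationarity moves time \<open>s\<close> to 0, where the functional is within the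
  forgetting error of the limiting statistic.\<close>

lemma smo_mean:
  assumes t: "t \<in> \<Theta>" and chi: "distribution_on lam chi" and rs: "r \<le> s - 1" "s \<le> w"
  shows "\<bar>(\<integral>\<omega>. smo t chi r s w l \<omega> \<partial>M) - mean_stat M Y lam m g S t $ l\<bar> \<le> 2 * Cs * (rho ^ nat (s - 1 - r) + rho ^ nat (w - s))"
proof -
  let ?LS = "limit_stat M Y lam (m t) (g t) S"
  have r: "0 \<le> rho" using rho[OF t] by auto
  have Fm: "(\<lambda>y. smoothing lam (m t) (g t) chi (r - s) 0 (w - s) (tr l) (\<lambda>i. y i)) \<in> borel_measurable (PiM UNIV (\<lambda>_. mu))"
    using rs t by (intro smoothing_measurable[OF chi, where th = "\<lambda>_. t"]) (auto intro!: measurable_component_singleton)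
  have "smo t chi r s w l \<omega> = smoothing lam (m t) (g t) chi (r - s) 0 (w - s) (tr l) (\<lambda>i. Y (i + s) \<omega>)" for \<omega>
    using smoothing_shift[OF chi t, of "r - s" 0 "w - s" s l "\<lambda>k. Y k \<omega>"] rs by simp
  then have "(\<integral>\<omega>. smo t chi r s w l \<omega> \<partial>M) = (\<integral>\<omega>. smo t chi (r - s) 0 (w - s) l \<omega> \<partial>M)"
    using expectation_shift[OF Fm, of s] by simp
  also have "\<dots> - mean_stat M Y lam m g S t $ l = (\<integral>\<omega>. smo t chi (r - s) 0 (w - s) l \<omega> - ?LS \<omega> $ l \<partial>M)"
    unfolding limit_stat_integrable(3)[OF t]
    using smo_integrable[OF t chi, of "r - s" 0 "w - s"] rs limit_stat_integrable(1)[OF t] by simp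
  also have "\<bar>\<dots>\<bar> \<le> (\<integral>\<omega>. \<bar>smo t chi (r - s) 0 (w - s) l \<omega> - ?LS \<omega> $ l\<bar> \<partial>M)" by (rule integral_abs_bound)
  also have "\<dots> \<le> (\<integral>\<omega>. 2 * sr (Y 0 \<omega>) * (rho ^ nat (s - 1 - r) + rho ^ nat (w - s)) \<partial>M)"
  proof (rule integral_mono_AE)
    show "integrable M (\<lambda>\<omega>. \<bar>smo t chi (r - s) 0 (w - s) l \<omega> - ?LS \<omega> $ l\<bar>)"
      using smo_integrable[OF t chi, of "r - s" 0 "w - s"] rs limit_stat_integrable(1)[OF t] by auto
    show "AE \<omega> in M. \<bar>smo t chi (r - s) 0 (w - s) l \<omega> - ?LS \<omega> $ l\<bar> \<le> 2 * sr (Y 0 \<omega>) * (rho ^ nat (s - 1 - r) + rho ^ nat (w - s))"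
      using limit_stat_window[OF t]
    proof eventually_elim
      case (elim \<omega>)
      have "- 1 - (r - s) = s - 1 - r" by simp
      with elim[rule_format, of chi "r - s" "w - s" l] chi rs show ?case by simp
    qed
  qed (use sr_integrable(1) in auto)
  also have "\<dots> \<le> 2 * Cs * (rho ^ nat (s - 1 - r) + rho ^ nat (w - s))"
    using sr_integrable[of 0] r by (auto intro!: mult_right_mono)
  finally show ?thesis .
qed

text \<open>A limit of averages lies a priori only in the closure of the hull, while
  \<open>SS\<close> will be known to contain just the hull. The face condition closes the gap: if
  the values of S lie almost everywhere in a half-space, the minorization keeps the distance of the
  smoothed value to its boundary above a fixed multiple of the integrated distance, also in the
  limit. A limit on the boundary thus forces the values onto it.\<close>

lemma limit_stat_in_hull:
  assumes t: "t \<in> \<Theta>"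
  shows "AE \<omega> in M. limit_stat M Y lam (m t) (g t) S \<omega> \<in> convex hull (range (\<lambda>(x, x', y). S x x' y))"
  using limit_stat_properties(2)[OF t] AE_good
proof eventually_elim
  case (elim \<omega>)
  let ?y = "\<lambda>k. Y k \<omega>" and ?z = "limit_stat M Y lam (m t) (g t) S \<omega>"
  let ?N = "lam \<Otimes>\<^sub>M lam" and ?X = "\<lambda>w. S (fst w) (snd w) (Y 0 \<omega>)"
  interpret hmm_kernels lam "m t" "g t" ?y sm sp by (rule hmm_kernels_at[OF t elim(2)])
  interpret finite_measure lam by (rule lam)
  interpret PP: pair_sigma_finite lam lam ..
  have y0: "ess (Y 0 \<omega>) < \<infinity>" using elim(2) by (simp add: good_def)
  have Xm[measurable]: "?X \<in> borel_measurable ?N" by (rule S_meas3) (auto simp: mu)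
  have aeX: "AE w in ?N. ennreal (norm (?X w)) \<le> ess (Y 0 \<omega>)" by (rule AE_le_ess[OF K(2)])
  have trm[measurable]: "(\<lambda>w. tr l (fst w) (snd w) (Y 0 \<omega>)) \<in> borel_measurable ?N" for l by (rule tr_meas3) (auto simp: mu)
  show ?case
  proof (rule in_convex_of_supporting[where N = ?N and X = ?X])
    fix v c assume le: "AE w in ?N. ?X w \<bullet> v \<le> c"
    define T where "T x z = (\<Sum>l\<in>UNIV. v $ l * tr l x z (Y 0 \<omega>))" for x z
    define B where "B = (\<Sum>l\<in>UNIV. \<bar>v $ l\<bar> * sr (Y 0 \<omega>))"
    have TX: "AE w in ?N. T (fst w) (snd w) = ?X w \<bullet> v"
      using aeX by eventually_elim (use y0 in \<open>auto simp: T_def tr_def inner_vec_def mult.commute\<close>)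
    have Tb: "\<bar>T x z\<bar> \<le> B" for x z
      unfolding T_def B_def
      by (intro order_trans[OF sum_abs] sum_mono) (auto simp: abs_mult intro!: mult_left_mono tr_bound)
    \<comment> \<open>Cut at 0 to be nonnegative everywhere, as the minorization demands; this
      alters the gap on a null set only.\<close>
    define h where "h x z = max 0 (c - T x z)" for x z
    have Tm[measurable]: "(\<lambda>w. T (fst w) (snd w)) \<in> borel_measurable ?N" unfolding T_def by measurable
    have hm: "(\<lambda>(x, z). h x z) \<in> borel_measurable ?N" unfolding h_def by (simp add: case_prod_beta')
    have h0: "0 \<le> h x z" and hB: "h x z \<le> \<bar>c\<bar> + B" for x z
      using Tb[of x z] by (auto simp: h_def max_def abs_le_iff)
    define Q where "Q = (\<integral>x. g t x (Y (- 1) \<omega>) * (\<integral>z. g t z (Y 0 \<omega>) * h x z \<partial>lam) \<partial>lam)"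
    define e where "e = (sm / sp) ^ 4 / ((\<integral>x. g t x (Y (- 1) \<omega>) \<partial>lam) * (\<integral>x. g t x (Y 0 \<omega>) \<partial>lam))"
    have gp: "(\<integral>x. g t x (Y i \<omega>) \<partial>lam) > 0" for i using int_g_pos[OF bm_const[of 1], of i] by simp
    have e: "e > 0" unfolding e_def using gp m_bounds(1) sp_pos by auto
    have low: "e * Q \<le> c - (\<Sum>l\<in>UNIV. v $ l * smo t chi0 (- int \<tau> - 1) 0 (int \<tau>) l \<omega>)" if "\<tau> \<ge> 1" for \<tau>
    proof -
      let ?r = "- int \<tau> - 1"
      interpret P: hmm_paths lam "m t" "g t" ?y sm sp chi0 by standard (rule chi0)
      have rr: "?r \<le> 0 - 2" "(0::int) \<le> int \<tau>" "?r \<le> 0 - 1" "(0::int) - 1 \<noteq> ?r" using that by auto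
      have "e * Q \<le> smoothing lam (m t) (g t) chi0 ?r 0 (int \<tau>) (\<lambda>x z _. h x z) ?y"
        using smoothing_minorization[OF chi0 rr(1,2) hm h0 hB] unfolding e_def Q_def by simp
      also have "\<dots> = smoothing lam (m t) (g t) chi0 ?r 0 (int \<tau>) (\<lambda>x z _. c - T x z) ?y"
      proof (rule smoothing_AE_cong[OF t elim(2) chi0 rr(3,2)])
        show "AE w in (if 0 - 1 = ?r then chi0 else lam) \<Otimes>\<^sub>M lam. h (fst w) (snd w) = c - T (fst w) (snd w)"
          using rr(4) le TX by (auto simp: h_def elim!: eventually_elim2)
      qed (auto simp: h_def)
      also have "\<dots> = c - (\<Sum>l\<in>UNIV. v $ l * smo t chi0 ?r 0 (int \<tau>) l \<omega>)"
      proof -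
        have eqs: "smo t chi0 ?r 0 (int \<tau>) l \<omega> = P.E ?r (int \<tau>) (\<lambda>x. tr l (x (- 1)) (x 0) (Y 0 \<omega>)) / P.E ?r (int \<tau>) (\<lambda>_. 1)" for l
          using P.smoothing_eq_E[of ?r 0 "int \<tau>" "\<lambda>x z. tr l x z (Y 0 \<omega>)"] by (simp add: smoothing_def)
        have lt: "loc ?r (int \<tau>) (\<lambda>x. tr l (x (- 1)) (x 0) (Y 0 \<omega>))" for l
          using loc_pair[OF tr_pair_meas[of l "Y 0 \<omega>"] tr_bound, of "- 1" ?r "int \<tau>" 0] rr by auto
        have "P.E ?r (int \<tau>) (\<lambda>x. c - T (x (- 1)) (x 0))
          = c * P.E ?r (int \<tau>) (\<lambda>_. 1) - (\<Sum>l\<in>UNIV. v $ l * P.E ?r (int \<tau>) (\<lambda>x. tr l (x (- 1)) (x 0) (Y 0 \<omega>)))"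
        proof -
          let ?pw = "path_weight (m t) (g t) ?r (int \<tau>) ?y" and ?pm = "path_measure lam chi0 ?r (int \<tau>)"
          have i1: "integrable ?pm (\<lambda>x. c * ?pw x)" using P.pw_integrable by simp
          have i2: "integrable ?pm (\<lambda>x. v $ l * (?pw x * tr l (x (- 1)) (x 0) (Y 0 \<omega>)))" for l
            using P.E_integrable[OF lt] by simp
          have "P.E ?r (int \<tau>) (\<lambda>x. c - T (x (- 1)) (x 0)) = (\<integral>x. c * ?pw x - (\<Sum>l\<in>UNIV. v $ l * (?pw x * tr l (x (- 1)) (x 0) (Y 0 \<omega>))) \<partial>?pm)"
            unfolding P.E_def T_def by (intro Bochner_Integration.integral_cong) (auto simp: right_diff_distrib sum_distrib_left mult_ac)
          also have "\<dots> = (\<integral>x. c * ?pw x \<partial>?pm) - (\<Sum>l\<in>UNIV. \<integral>x. v $ l * (?pw x * tr l (x (- 1)) (x 0) (Y 0 \<omega>)) \<partial>?pm)"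
            using i1 i2 by (subst Bochner_Integration.integral_diff) (auto simp: Bochner_Integration.integral_sum)
          finally show ?thesis unfolding P.E_def by simp
        qed
        then show ?thesis
          unfolding eqs using P.smoothing_eq_E[of ?r 0 "int \<tau>" "\<lambda>x z. c - T x z"] P.E_one_pos[of ?r "int \<tau>"]
          by (simp add: diff_divide_distrib sum_divide_distrib)
      qed
      finally show ?thesis .
    qed
    have lim: "(\<lambda>\<tau>. c - (\<Sum>l\<in>UNIV. v $ l * smo t chi0 (- int \<tau> - 1) 0 (int \<tau>) l \<omega>)) \<longlonglongrightarrow> c - (\<Sum>l\<in>UNIV. v $ l * ?z $ l)"
      using elim(1) by (intro tendsto_intros) auto
    have "e * Q \<le> c - (\<Sum>l\<in>UNIV. v $ l * ?z $ l)"
      by (rule tendsto_lowerbound[OF lim]) (auto simp: eventually_sequentially intro!: exI[of _ 1] low)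
    then have main: "e * Q \<le> c - ?z \<bullet> v" by (simp add: inner_vec_def mult.commute)
    have gm: "integrable lam (\<lambda>z. g t z (Y 0 \<omega>) * h x z)" for x
    proof (rule integrable_g_bounded[of _ "\<bar>c\<bar> + B" 0, simplified])
      show "h x \<in> borel_measurable lam" using measurable_compose[OF measurable_Pair1'[of x lam] hm] lam by simp
      show "\<bar>h x z\<bar> \<le> \<bar>c\<bar> + B" for z using h0[of x z] hB[of x z] by simp
    qed
    define q where "q x = (\<integral>z. g t z (Y 0 \<omega>) * h x z \<partial>lam)" for x
    have q0: "0 \<le> q x" for x unfolding q_def using h0 hmm_kernels.g(1)[OF hmm_kernels_axioms, THEN less_imp_le]
      by (intro Bochner_Integration.integral_nonneg) auto
    have Q0: "0 \<le> Q" unfolding Q_def q_def[symmetric] using q0 hmm_kernels.g(1)[OF hmm_kernels_axioms, THEN less_imp_le]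
      by (intro Bochner_Integration.integral_nonneg) auto
    have "AE w in ?N. ?X w \<bullet> v = c" if "?z \<bullet> v = c"
    proof -
      have "Q = 0" using main that e Q0 by (simp add: mult_le_0_iff)
      have qm: "q \<in> borel_measurable lam" "\<And>x. \<bar>q x\<bar> \<le> (\<integral>z. g t z (Y 0 \<omega>) \<partial>lam) * (\<bar>c\<bar> + B)"
      proof -
        have [measurable]: "(\<lambda>w. h (fst w) (snd w)) \<in> borel_measurable ?N" using hm by (simp add: case_prod_beta')
        have "(\<lambda>(x, z). g t z (Y 0 \<omega>) * h x z) \<in> borel_measurable ?N"
          using measurable_compose[OF measurable_snd g_meas[of 0], of lam] by (simp add: case_prod_beta')
        then show "q \<in> borel_measurable lam" unfolding q_def by (rule borel_measurable_lebesgue_integral)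
        fix x
        have "q x \<le> (\<integral>z. g t z (Y 0 \<omega>) * (\<bar>c\<bar> + B) \<partial>lam)" unfolding q_def
          using gm hB hmm_kernels.g[OF hmm_kernels_axioms] by (intro integral_mono) (auto intro!: mult_left_mono less_imp_le)
        then show "\<bar>q x\<bar> \<le> (\<integral>z. g t z (Y 0 \<omega>) \<partial>lam) * (\<bar>c\<bar> + B)" using q0[of x] by simp
      qed
      have iq: "integrable lam (\<lambda>x. g t x (Y (- 1) \<omega>) * q x)" by (rule integrable_g_bounded[OF qm])
      have "AE x in lam. g t x (Y (- 1) \<omega>) * q x = 0"
        using \<open>Q = 0\<close> q0 hmm_kernels.g(1)[OF hmm_kernels_axioms, THEN less_imp_le] unfolding Q_def q_def[symmetric]
        by (subst integral_nonneg_eq_0_iff_AE[OF iq, symmetric]) auto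
      then have "AE x in lam. AE z in lam. h x z = 0"
      proof eventually_elim
        case (elim x)
        then have "q x = 0" using hmm_kernels.g(1)[OF hmm_kernels_axioms, of x "- 1"] by simp
        then have "AE z in lam. g t z (Y 0 \<omega>) * h x z = 0"
          using h0 hmm_kernels.g(1)[OF hmm_kernels_axioms, THEN less_imp_le] unfolding q_def
          by (subst integral_nonneg_eq_0_iff_AE[OF gm, symmetric]) auto
        then show ?case
        proof eventually_elim
          case (elim z)
          then show ?case using hmm_kernels.g(1)[OF hmm_kernels_axioms, of z 0] by simp
        qed
      qed
      then have "AE w in ?N. h (fst w) (snd w) = 0"
      proof (intro PP.AE_pair_measure)
        have [measurable]: "(\<lambda>w. h (fst w) (snd w)) \<in> borel_measurable ?N" using hm by (simp add: case_prod_beta')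
        show "{w \<in> space ?N. h (fst w) (snd w) = 0} \<in> sets ?N" by measurable
      qed auto
      then show ?thesis using TX le
        by eventually_elim (auto simp: h_def max_def split: if_splits)
    qed
    moreover have "?z \<bullet> v \<le> c" using main e Q0 mult_nonneg_nonneg[of e Q] by linarith
    ultimately show "?z \<bullet> v \<le> c \<and> (?z \<bullet> v = c \<longrightarrow> (AE w in ?N. ?X w \<bullet> v = c))" by blast
  next
    show "AE w in ?N. ?X w \<in> convex hull (range (\<lambda>(x, x', y). S x x' y))"
    proof (intro AE_I2 hull_inc)
      fix w show "?X w \<in> range (\<lambda>(x, x', y). S x x' y)" by (rule range_eqI[of _ _ "(fst w, snd w, Y 0 \<omega>)"]) simp
    qed
  qed (rule convex_convex_hull)
qed

lemma mean_stat_in_hull: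
  assumes t: "t \<in> \<Theta>"
  shows "mean_stat M Y lam m g S t \<in> convex hull (range (\<lambda>(x, x', y). S x x' y))"
  unfolding mean_stat_def
  by (rule expectation_in_convex[OF prob_space_axioms limit_stat_integrable(2)[OF t] convex_convex_hull limit_stat_in_hull[OF t]])

end

section \<open>Moments of the block errors\<close>

context exp_family_model
begin

text \<open>With a common initial law and time, the error term of the left end in
  \<open>smoothing_tr_window\<close> disappears.\<close>

lemma smoothing_tr_forward:
  assumes t: "t \<in> \<Theta>" and y: "good y" and dchi: "distribution_on lam chi"
    and rs: "r \<le> s - 1" "s \<le> v" "v \<le> w" "v \<le> w'"
  shows "\<bar>smoothing lam (m t) (g t) chi r s w (tr l) y - smoothing lam (m t) (g t) chi r s w' (tr l) y\<bar> \<le> 2 * sr (y s) * rho ^ nat (v - s)"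
proof -
  interpret hmm_kernels lam "m t" "g t" y sm sp by (rule hmm_kernels_at[OF t y])
  interpret P: hmm_paths lam "m t" "g t" y sm sp chi by standard (rule dchi)
  have eq: "smoothing lam (m t) (g t) chi r s w (tr l) y = smoothing lam (m t) (g t) chi r s w (\<lambda>x z _. tr l x z (y s)) y" for w
    by (simp add: smoothing_def)
  show ?thesis unfolding eq
    using P.smoothing_forward[OF rs tr_pair_meas[of l "y s"] tr_bound] unfolding \<rho>_def rho_def .
qed

end

locale boem_blocks =
  stationary_hmm \<Theta> lam mu m g \<phi> \<psi> S sm sp K M Y pbar chi0 + beta_mixing_process M mu Y HH bk
  for \<Theta> :: "(real^'k) set" and lam :: "'x measure" and mu :: "'y measure"
    and m :: "real^'k \<Rightarrow> 'x \<Rightarrow> 'x \<Rightarrow> real" and g :: "real^'k \<Rightarrow> 'x \<Rightarrow> 'y \<Rightarrow> real"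
    and \<phi> :: "real^'k \<Rightarrow> real" and \<psi> :: "real^'k \<Rightarrow> real^'d" and S :: "'x \<Rightarrow> 'x \<Rightarrow> 'y \<Rightarrow> real^'d"
    and sm sp :: real and K :: "'x measure set" and M :: "'w measure"
    and Y :: "int \<Rightarrow> 'w \<Rightarrow> 'y" and pbar :: real and chi0 :: "'x measure"
    and HH :: "'w set set" and bk :: "nat \<Rightarrow> real" +
  fixes \<beta> Cb p :: real
  assumes bk: "\<And>n. bk n = Cb * \<beta> ^ n" and beta: "0 < \<beta>" "\<beta> < 1" and Cb: "Cb > 0"
    and p: "2 < p" "p < pbar"
    and Sb_cont: "continuous_on \<Theta> (mean_stat M Y lam m g S)"
    and Theta_ne: "\<Theta> \<noteq> {}"
begin

abbreviation "Sb \<equiv> mean_stat M Y lam m g S"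

lemma rho': "0 \<le> rho" "rho < 1" using rho Theta_ne by auto

text \<open>The centred summand of a block at a random parameter \<open>th\<close>. The window is an
  argument because a term is compared with the same term over another window, chosen so that it is
  decoupled from the past or measurable earlier.\<close>

definition X :: "'x measure \<Rightarrow> ('w \<Rightarrow> real^'k) \<Rightarrow> int \<Rightarrow> int \<Rightarrow> 'd \<Rightarrow> int \<Rightarrow> 'w \<Rightarrow> real" where
  "X chi th a b l t \<omega> = smo (th \<omega>) chi a t b l \<omega> - Sb (th \<omega>) $ l"

lemma Sb_comp_measurable:
  assumes "th \<in> borel_measurable P" "\<And>q. q \<in> space P \<Longrightarrow> th q \<in> \<Theta>"
  shows "(\<lambda>q. Sb (th q) $ l) \<in> borel_measurable P"
proof -
  have "th \<in> measurable P (restrict_space borel \<Theta>)" using assms by (intro measurable_restrict_space2) auto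
  from measurable_compose[OF this borel_measurable_continuous_on_restrict[OF Sb_cont]]
  have "(\<lambda>q. Sb (th q) \<bullet> axis l 1) \<in> borel_measurable P" by measurable
  then show ?thesis by (simp add: inner_axis)
qed

text \<open>The slower of two rates: forgetting by the kernels, and the square root of the mixing
  rate that the truncation leaves.\<close>

definition qq :: real where "qq = max rho (sqrt \<beta>)"

lemma qq: "0 < qq" "qq < 1" "rho \<le> qq" "sqrt \<beta> \<le> qq"
  using beta rho' by (auto simp: qq_def less_max_iff_disj)

text \<open>The root compensates for using only half of a time gap for each of the two effects;
  rounding in the halving costs a factor \<open>1 / kp\<close>.\<close>

definition kp :: real where "kp = sqrt qq"

lemma kp: "0 < kp" "kp < 1" using qq by (auto simp: kp_def)

lemma qq_le_kp: "qq \<le> kp" using qq by (simp add: kp_def real_le_rsqrt power2_eq_square mult_left_le)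

lemma qq_half: "qq ^ (k div 2) \<le> kp ^ k / kp"
proof -
  have "qq = kp ^ 2" using qq by (simp add: kp_def)
  then have "qq ^ (k div 2) = kp ^ (2 * (k div 2))" by (simp add: power_mult)
  moreover have "kp ^ Suc (2 * (k div 2)) \<le> kp ^ k" using kp by (intro power_decreasing) auto
  ultimately show ?thesis using kp by (simp add: pos_le_divide_eq mult.commute)
qed

lemma rho_pow_le: "rho ^ n \<le> qq ^ n" using rho' qq by (intro power_mono)

definition D1 :: real where
  "D1 = (8 * Cs + (2 + 8 * Cs\<^sup>2) * sqrt Cb) / kp + 6 * Cs"

lemma D1: "D1 > 0" "6 * Cs \<le> D1" "(8 * Cs + (2 + 8 * Cs\<^sup>2) * sqrt Cb) / kp \<le> D1"
  using Cs_pos Cb kp by (auto simp: D1_def intro!: add_pos_nonneg add_nonneg_pos divide_nonneg_nonneg add_nonneg_nonneg mult_nonneg_nonneg)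

lemma cond_exp_L1_le:
  assumes "integrable M f" shows "(\<integral>\<omega>. \<bar>real_cond_exp M (AA s) f \<omega>\<bar> \<partial>M) \<le> (\<integral>\<omega>. \<bar>f \<omega>\<bar> \<partial>M)"
proof -
  have "Lp_le M 1 f (\<integral>\<omega>. \<bar>f \<omega>\<bar> \<partial>M)" using assms by (auto simp: Lp_le_def)
  from Lp_leD(4)[OF Lp_le_cond_exp[OF prob_space_axioms subalgebra_AA _ this]] show ?thesis by simp
qed

text \<open>At once a bound for the moment of order \<open>pbar\<close> and a prefactor of the decay
  in L_1, because the interpolation works with one constant for both.\<close>

definition c0 :: real where "c0 = max (4 * Cs) (4 * D1 / kp)"

text \<open>The rate that remains after interpolating between decay in L_1 and boundedness at order
  \<open>pbar\<close>; it is below 1 because \<open>p < pbar\<close>.\<close>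

definition k1 :: real where "k1 = kp powr ((pbar - p) / (p * (pbar - 1)))"

lemma c0_pos: "c0 > 0" using Cs_pos by (simp add: c0_def less_max_iff_disj)

lemma k1: "0 < k1" "k1 < 1"
proof -
  have "(pbar - p) / (p * (pbar - 1)) > 0" using p by (intro divide_pos_pos mult_pos_pos) auto
  then show "0 < k1" "k1 < 1" using kp powr_less_mono2[of "(pbar - p) / (p * (pbar - 1))" kp 1] by (auto simp: k1_def)
qed

text \<open>The prefactor \<open>2 * c0\<close> times at most three geometric sums of ratio
  \<open>k1\<close>: two for the times on either side of a given one, one for the distance to the
  end of the block.\<close>

definition C2 :: real where "C2 = 6 * c0 / (1 - k1)"

lemma C2_pos: "C2 > 0" using c0_pos k1 by (simp add: C2_def)

section \<open>Centred terms of one block with a random parameter\<close>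

context
  fixes chi :: "'x measure" and th :: "'w \<Rightarrow> real^'k" and a b :: int
  assumes chi: "distribution_on lam chi"
    and th: "th \<in> borel_measurable (AA a)" "\<And>\<omega>. \<omega> \<in> space M \<Longrightarrow> th \<omega> \<in> \<Theta>"
    and ab: "a \<le> b"
begin

lemma th_AA: "a \<le> s \<Longrightarrow> th \<in> borel_measurable (AA s)"
  using measurable_from_subalg[OF subalgebra_AA_mono th(1)] by blast

lemma th_M: "th \<in> borel_measurable M"
  by (rule measurable_from_subalg[OF subalgebra_AA th(1)])

lemma X_measurable:
  assumes "a' + 1 \<le> t" "t \<le> b'" shows "X chi th a' b' l t \<in> borel_measurable M"
  unfolding X_def
  by (intro borel_measurable_diff Sb_comp_measurable th_M smoothing_measurable[OF chi th_M]) (use assms th in auto)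

lemma X_measurable_AA:
  assumes "a' + 1 \<le> t" "t \<le> b'" "a \<le> b'" shows "X chi th a' b' l t \<in> borel_measurable (AA b')"
  unfolding X_def
  by (intro borel_measurable_diff Sb_comp_measurable th_AA smoothing_measurable[OF chi th_AA] Y_measurable_AA)
    (use assms th in auto)

lemma X_bound:
  assumes "\<omega> \<in> space M" shows "\<bar>X chi th a' b' l t \<omega>\<bar> \<le> sr (Y t \<omega>) + Cs"
  unfolding X_def using smoothing_tr_bound[OF th(2)[OF assms], of chi a' t b' l "\<lambda>k. Y k \<omega>"] mean_stat_bound[OF th(2)[OF assms], of l]
  by linarith

lemma Lp_sr_Cs: "Lp_le M pbar (\<lambda>\<omega>. sr (Y t \<omega>) + Cs) (2 * Cs)"
  using Lp_le_add[OF _ Lp_sr Lp_le_const[OF prob_space_axioms], of t Cs] pbar Cs_pos by simp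

lemma X_Lp:
  assumes "a' + 1 \<le> t" "t \<le> b'" shows "Lp_le M pbar (X chi th a' b' l t) (2 * Cs)"
proof (rule Lp_le_dominated[OF Lp_sr_Cs X_measurable[OF assms]])
  show "AE \<omega> in M. \<bar>X chi th a' b' l t \<omega>\<bar> \<le> \<bar>sr (Y t \<omega>) + Cs\<bar>"
    using X_bound sr_nonneg Cs_pos by (intro AE_I2) (auto intro: order_trans)
qed (use pbar in auto)

lemma X_integrable:
  assumes "a' + 1 \<le> t" "t \<le> b'" shows "integrable M (X chi th a' b' l t)"
  by (rule Lp_le_integrable[OF finite_measure_axioms _ X_Lp[OF assms]]) (use pbar in auto)

lemma X_L1:
  assumes "a' + 1 \<le> t" "t \<le> b'" shows "(\<integral>\<omega>. \<bar>X chi th a' b' l t \<omega>\<bar> \<partial>M) \<le> 2 * Cs"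
proof -
  have "Lp_le M 1 (X chi th a' b' l t) (2 * Cs)"
    by (rule Lp_le_exponent_mono[OF prob_space_axioms _ _ X_Lp[OF assms]]) (use pbar Cs_pos in auto)
  from Lp_leD(4)[OF this] show ?thesis using Cs_pos by simp
qed

text \<open>The term is replaced by one whose window has half-width j, half the gap. That one
  depends on observations at distance at least j from s, so decoupling applies, and its mean at each
  frozen parameter is small by stationarity. The change of window costs \<open>rho ^ j\<close>,
  except near the right end of the block, where only \<open>b - t\<close> observations follow; this
  gives the second summand.\<close>

lemma X_cond_exp_past_strict:
  assumes st: "a \<le> s" "s < t" "t \<le> b"
  shows "(\<integral>\<omega>. \<bar>real_cond_exp M (AA s) (X chi th a b l t) \<omega>\<bar> \<partial>M) \<le> D1 * (kp ^ nat (t - s) + kp ^ nat (b - t))"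
proof -
  interpret sigma_finite_subalgebra M "AA s" by (rule sigma_finite_subalgebra_AA)
  define k where "k = nat (t - s)"
  define j where "j = k div 2"
  define k' where "k' = k - j"
  have kj: "k \<ge> 1" "j \<le> k'" "int k = t - s" "int k' + int j = t - s" "k' \<ge> 1"
    using st by (auto simp: k_def j_def k'_def)
  have sk: "s + int k' = t - int j" using kj by simp
  let ?X = "X chi th a b l t" and ?X' = "X chi th (t - int j - 1) (t + int j) l t"
  \<comment> \<open>Both windows reach at least to \<open>?v\<close>, which equals b when the new
    window overshoots the block.\<close>
  let ?v = "min (t + int j) b"
  have win: "t - int j - 1 + 1 \<le> t" "t \<le> t + int j" "a + 1 \<le> t" using st by auto
  have iX: "integrable M ?X" "integrable M ?X'" using X_integrable st win by auto
  have diff: "(\<integral>\<omega>. \<bar>?X \<omega> - ?X' \<omega>\<bar> \<partial>M) \<le> 2 * Cs * (rho ^ j + rho ^ nat (?v - t))"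
  proof -
    have "(\<integral>\<omega>. \<bar>?X \<omega> - ?X' \<omega>\<bar> \<partial>M) \<le> (\<integral>\<omega>. 2 * sr (Y t \<omega>) * (rho ^ j + rho ^ nat (?v - t)) \<partial>M)"
    proof (rule integral_mono_AE)
      show "AE \<omega> in M. \<bar>?X \<omega> - ?X' \<omega>\<bar> \<le> 2 * sr (Y t \<omega>) * (rho ^ j + rho ^ nat (?v - t))"
        using AE_good AE_space
      proof eventually_elim
        case (elim \<omega>)
        have "\<bar>smo (th \<omega>) chi a t b l \<omega> - smo (th \<omega>) chi (t - int j - 1) t (t + int j) l \<omega>\<bar>
           \<le> 2 * sr (Y t \<omega>) * (rho ^ nat (t - 1 - (t - int j - 1)) + rho ^ nat (?v - t))"
          by (rule smo_window[OF th(2)[OF elim(2)] elim(1) chi chi]) (use st kj in auto)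
        then show ?case by (simp add: X_def)
      qed
    qed (use iX sr_integrable(1) in auto)
    also have "\<dots> = 2 * (\<integral>\<omega>. sr (Y t \<omega>) \<partial>M) * (rho ^ j + rho ^ nat (?v - t))" by simp
    also have "\<dots> \<le> 2 * Cs * (rho ^ j + rho ^ nat (?v - t))"
      using sr_integrable(2)[of t] rho' by (intro mult_right_mono) auto
    finally show ?thesis .
  qed
  let ?h = "\<lambda>z. smo (th (fst z)) chi (t - int j - 1) t (t + int j) l (snd z) - Sb (th (fst z)) $ l"
  let ?H = "\<lambda>\<omega>. sr (Y t \<omega>) + Cs"
  have H2: "integrable M (\<lambda>\<omega>. (?H \<omega>)\<^sup>2)" "(\<integral>\<omega>. (?H \<omega>)\<^sup>2 \<partial>M) \<le> 4 * Cs\<^sup>2"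
  proof -
    have "Lp_le M 2 ?H (2 * Cs)"
      by (rule Lp_le_exponent_mono[OF prob_space_axioms _ _ Lp_sr_Cs]) (use pbar Cs_pos in auto)
    moreover have "\<bar>?H \<omega>\<bar> powr 2 = (?H \<omega>)\<^sup>2" for \<omega> using sr_nonneg[of "Y t \<omega>"] Cs_pos by (simp add: powr_numeral)
    moreover have "(2 * Cs) powr 2 = 4 * Cs\<^sup>2" using Cs_pos by (simp add: powr_numeral power2_eq_square)
    ultimately show "integrable M (\<lambda>\<omega>. (?H \<omega>)\<^sup>2)" "(\<integral>\<omega>. (?H \<omega>)\<^sup>2 \<partial>M) \<le> 4 * Cs\<^sup>2"
      unfolding Lp_le_def by auto
  qed
  have main: "(\<integral>\<omega>. \<bar>real_cond_exp M (AA s) ?X' \<omega>\<bar> \<partial>M) \<le> 4 * Cs * rho ^ j + (2 + 2 * (4 * Cs\<^sup>2)) * sqrt (bk k')"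
  proof -
    have thA: "(\<lambda>z. th (fst z)) \<in> borel_measurable (pair_alg s (s + int k'))"
      unfolding pair_alg_def
      by (rule measurable_compose[OF measurable_fst measurable_in_subalg[OF subalgebra_AA th_AA[OF st(1)]]])
    have YF: "(\<lambda>z. Y i (snd z)) \<in> measurable (pair_alg s (s + int k')) mu" if "t - int j \<le> i" for i
      unfolding pair_alg_def
      by (rule measurable_compose[OF measurable_snd measurable_in_subalg[OF subalgebra_future Y_measurable_future]])
        (use that sk in simp)
    have hm: "?h \<in> borel_measurable (pair_alg s (s + int k'))"
      by (intro borel_measurable_diff Sb_comp_measurable thA smoothing_measurable[OF chi thA] YF)
        (use th(2) in \<open>auto simp: space_pair_alg\<close>)
    have "(\<integral>\<omega>. \<bar>real_cond_exp M (AA s) (\<lambda>\<omega>. ?h (\<omega>, \<omega>)) \<omega>\<bar> \<partial>M) \<le> 4 * Cs * rho ^ j + (2 + 2 * (\<integral>\<omega>. (?H \<omega>)\<^sup>2 \<partial>M)) * sqrt (bk k')"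
    proof (rule cond_exp_decoupling[OF hm _ H2(1)])
      show "?H \<in> borel_measurable (future M mu Y (s + int k'))"
        using measurable_compose[OF Y_measurable_future measurable_sr, of "s + int k'" t] sk by simp
      fix \<omega> \<omega>' assume \<omega>: "\<omega> \<in> space M" "\<omega>' \<in> space M"
      show "\<bar>?h (\<omega>, \<omega>')\<bar> \<le> ?H \<omega>'"
        using smoothing_tr_bound[OF th(2)[OF \<omega>(1)], of chi "t - int j - 1" t "t + int j" l "\<lambda>k. Y k \<omega>'"] mean_stat_bound[OF th(2)[OF \<omega>(1)], of l]
        by simp
    next
      fix \<omega> assume \<omega>: "\<omega> \<in> space M"
      have "(\<integral>\<omega>'. ?h (\<omega>, \<omega>') \<partial>M) = (\<integral>\<omega>'. smo (th \<omega>) chi (t - int j - 1) t (t + int j) l \<omega>' \<partial>M) - Sb (th \<omega>) $ l"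
        using smo_integrable[OF th(2)[OF \<omega>] chi, of "t - int j - 1" t "t + int j" l] by (simp add: prob_space)
      then show "\<bar>\<integral>\<omega>'. ?h (\<omega>, \<omega>') \<partial>M\<bar> \<le> 4 * Cs * rho ^ j"
        using smo_mean[OF th(2)[OF \<omega>] chi, of "t - int j - 1" t "t + int j" l] by simp
    next
      show "integrable M (\<lambda>\<omega>. ?h (\<omega>, \<omega>))" using iX(2) unfolding X_def[abs_def] by simp
    qed
    also have "\<dots> \<le> 4 * Cs * rho ^ j + (2 + 2 * (4 * Cs\<^sup>2)) * sqrt (bk k')"
      using H2(2) Cb beta by (intro add_left_mono mult_right_mono) (auto simp: bk)
    finally show ?thesis unfolding X_def[abs_def] by simp
  qed
  have sq: "sqrt (bk k') \<le> sqrt Cb * qq ^ j"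
  proof -
    have "sqrt (bk k') = sqrt Cb * sqrt \<beta> ^ k'" using beta by (simp add: bk real_sqrt_mult real_sqrt_power)
    also have "sqrt \<beta> ^ k' \<le> qq ^ k'" using qq beta by (intro power_mono) auto
    also have "qq ^ k' \<le> qq ^ j" using qq kj by (intro power_decreasing) auto
    finally show ?thesis using Cb by (simp add: mult_left_mono)
  qed
  have rv: "rho ^ nat (?v - t) \<le> qq ^ j + qq ^ nat (b - t)"
  proof (cases "t + int j \<le> b")
    case True
    then show ?thesis using rho_pow_le[of j] qq by (simp add: add_increasing2)
  next
    case False
    then show ?thesis using rho_pow_le[of "nat (b - t)"] qq by (simp add: add_increasing min_def)
  qed
  have aeq: "AE \<omega> in M. real_cond_exp M (AA s) ?X \<omega> = real_cond_exp M (AA s) ?X' \<omega> + real_cond_exp M (AA s) (\<lambda>\<omega>. ?X \<omega> - ?X' \<omega>) \<omega>"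
    using real_cond_exp_add[OF iX(2) Bochner_Integration.integrable_diff[OF iX]] by simp
  have ic: "integrable M (real_cond_exp M (AA s) ?X')" "integrable M (real_cond_exp M (AA s) (\<lambda>\<omega>. ?X \<omega> - ?X' \<omega>))"
    "integrable M (real_cond_exp M (AA s) ?X)"
    using iX by (auto intro!: real_cond_exp_int(1))
  have "(\<integral>\<omega>. \<bar>real_cond_exp M (AA s) ?X \<omega>\<bar> \<partial>M) \<le> (\<integral>\<omega>. \<bar>real_cond_exp M (AA s) ?X' \<omega>\<bar> + \<bar>real_cond_exp M (AA s) (\<lambda>\<omega>. ?X \<omega> - ?X' \<omega>) \<omega>\<bar> \<partial>M)"
    using aeq ic by (intro integral_mono_AE) (auto elim!: eventually_mono)
  also have "\<dots> = (\<integral>\<omega>. \<bar>real_cond_exp M (AA s) ?X' \<omega>\<bar> \<partial>M) + (\<integral>\<omega>. \<bar>real_cond_exp M (AA s) (\<lambda>\<omega>. ?X \<omega> - ?X' \<omega>) \<omega>\<bar> \<partial>M)"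
    using ic by simp
  also have "\<dots> \<le> (4 * Cs * rho ^ j + (2 + 2 * (4 * Cs\<^sup>2)) * sqrt (bk k')) + 2 * Cs * (rho ^ j + rho ^ nat (?v - t))"
    using main cond_exp_L1_le[OF Bochner_Integration.integrable_diff[OF iX], of s] diff by linarith
  also have "\<dots> \<le> (4 * Cs * qq ^ j + (2 + 2 * (4 * Cs\<^sup>2)) * (sqrt Cb * qq ^ j)) + 2 * Cs * (qq ^ j + (qq ^ j + qq ^ nat (b - t)))"
    using Cs_pos rho_pow_le[of j] sq rv by (intro add_mono mult_left_mono) auto
  also have "\<dots> = (8 * Cs + (2 + 8 * Cs\<^sup>2) * sqrt Cb) * qq ^ j + 2 * Cs * qq ^ nat (b - t)" by (simp add: algebra_simps)
  also have "\<dots> \<le> (8 * Cs + (2 + 8 * Cs\<^sup>2) * sqrt Cb) * (kp ^ k / kp) + 2 * Cs * kp ^ nat (b - t)"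
    using Cs_pos Cb qq_half[of k] qq qq_le_kp unfolding j_def
    by (intro add_mono mult_left_mono power_mono) (auto intro!: add_nonneg_nonneg)
  also have "\<dots> = (8 * Cs + (2 + 8 * Cs\<^sup>2) * sqrt Cb) / kp * kp ^ k + 2 * Cs * kp ^ nat (b - t)" by simp
  also have "\<dots> \<le> D1 * kp ^ k + D1 * kp ^ nat (b - t)"
    using kp D1 Cs_pos by (intro add_mono mult_right_mono) auto
  finally show ?thesis by (simp add: k_def distrib_left)
qed

lemma X_cond_exp_past:
  assumes st: "a \<le> s" "s \<le> t" "a < t" "t \<le> b"
  shows "(\<integral>\<omega>. \<bar>real_cond_exp M (AA s) (X chi th a b l t) \<omega>\<bar> \<partial>M) \<le> D1 * (kp ^ nat (t - s) + kp ^ nat (b - t))"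
proof (cases "s < t")
  case True
  then show ?thesis using X_cond_exp_past_strict st by blast
next
  case False
  have w: "a + 1 \<le> t" "t \<le> b" using st by auto
  have "(\<integral>\<omega>. \<bar>real_cond_exp M (AA s) (X chi th a b l t) \<omega>\<bar> \<partial>M) \<le> 2 * Cs"
    using cond_exp_L1_le[OF X_integrable[OF w]] X_L1[OF w] by (rule order_trans)
  also have "\<dots> \<le> D1 * 1" using D1 Cs_pos by linarith
  also have "\<dots> \<le> D1 * (kp ^ nat (t - s) + kp ^ nat (b - t))"
    using False D1 kp by (intro mult_left_mono) auto
  finally show ?thesis .
qed

text \<open>Ending the window at \<open>s\<close> instead of \<open>b\<close> makes the term
  measurable for \<open>AA s\<close>, so the forgetting of the final time bounds its distance to the
  conditional expectation.\<close>

lemma X_cond_exp_future: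
  assumes st: "a < t" "t \<le> s" "s \<le> b"
  shows "(\<integral>\<omega>. \<bar>X chi th a b l t \<omega> - real_cond_exp M (AA s) (X chi th a b l t) \<omega>\<bar> \<partial>M) \<le> D1 * kp ^ nat (s - t)"
proof -
  interpret sigma_finite_subalgebra M "AA s" by (rule sigma_finite_subalgebra_AA)
  let ?X = "X chi th a b l t" and ?X' = "X chi th a s l t"
  have win: "a + 1 \<le> t" "t \<le> b" "t \<le> s" "a \<le> s" using st by auto
  have iX: "integrable M ?X" "integrable M ?X'" using X_integrable win by auto
  have X'm: "?X' \<in> borel_measurable (AA s)" using X_measurable_AA win by auto
  have diff: "(\<integral>\<omega>. \<bar>?X \<omega> - ?X' \<omega>\<bar> \<partial>M) \<le> 2 * Cs * rho ^ nat (s - t)"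
  proof -
    have "(\<integral>\<omega>. \<bar>?X \<omega> - ?X' \<omega>\<bar> \<partial>M) \<le> (\<integral>\<omega>. 2 * sr (Y t \<omega>) * rho ^ nat (s - t) \<partial>M)"
    proof (rule integral_mono_AE)
      show "AE \<omega> in M. \<bar>?X \<omega> - ?X' \<omega>\<bar> \<le> 2 * sr (Y t \<omega>) * rho ^ nat (s - t)"
        using AE_good AE_space
      proof eventually_elim
        case (elim \<omega>)
        have "\<bar>smo (th \<omega>) chi a t b l \<omega> - smo (th \<omega>) chi a t s l \<omega>\<bar> \<le> 2 * sr (Y t \<omega>) * rho ^ nat (s - t)"
          by (rule smoothing_tr_forward[OF th(2)[OF elim(2)] elim(1) chi]) (use st in auto)
        then show ?case by (simp add: X_def)
      qed
    qed (use iX sr_integrable(1) in auto)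
    also have "\<dots> = 2 * (\<integral>\<omega>. sr (Y t \<omega>) \<partial>M) * rho ^ nat (s - t)" by simp
    also have "\<dots> \<le> 2 * Cs * rho ^ nat (s - t)"
      using sr_integrable(2)[of t] rho' by (intro mult_right_mono) auto
    finally show ?thesis .
  qed
  have id: "integrable M (\<lambda>\<omega>. ?X \<omega> - ?X' \<omega>)" using iX by simp
  have aeq: "AE \<omega> in M. ?X \<omega> - real_cond_exp M (AA s) ?X \<omega> = (?X \<omega> - ?X' \<omega>) - real_cond_exp M (AA s) (\<lambda>\<omega>. ?X \<omega> - ?X' \<omega>) \<omega>"
    using real_cond_exp_diff[OF iX] real_cond_exp_F_meas[OF iX(2) X'm] by eventually_elim simp
  have ic: "integrable M (real_cond_exp M (AA s) (\<lambda>\<omega>. ?X \<omega> - ?X' \<omega>))" "integrable M (real_cond_exp M (AA s) ?X)"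
    using iX id by (auto intro!: real_cond_exp_int(1))
  have "(\<integral>\<omega>. \<bar>?X \<omega> - real_cond_exp M (AA s) ?X \<omega>\<bar> \<partial>M) \<le> (\<integral>\<omega>. \<bar>?X \<omega> - ?X' \<omega>\<bar> + \<bar>real_cond_exp M (AA s) (\<lambda>\<omega>. ?X \<omega> - ?X' \<omega>) \<omega>\<bar> \<partial>M)"
    using aeq ic iX by (intro integral_mono_AE) (auto elim!: eventually_mono)
  also have "\<dots> = (\<integral>\<omega>. \<bar>?X \<omega> - ?X' \<omega>\<bar> \<partial>M) + (\<integral>\<omega>. \<bar>real_cond_exp M (AA s) (\<lambda>\<omega>. ?X \<omega> - ?X' \<omega>) \<omega>\<bar> \<partial>M)"
    using ic id by simp
  also have "\<dots> \<le> 2 * (2 * Cs * rho ^ nat (s - t))"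
    using diff cond_exp_L1_le[OF id, of s] by linarith
  also have "\<dots> \<le> D1 * kp ^ nat (s - t)"
  proof -
    have "rho ^ nat (s - t) \<le> kp ^ nat (s - t)" using rho' qq qq_le_kp by (intro power_mono) auto
    then have "4 * Cs * rho ^ nat (s - t) \<le> D1 * kp ^ nat (s - t)" using D1 Cs_pos rho' by (intro mult_mono) auto
    then show ?thesis by simp
  qed
  finally show ?thesis .
qed

lemma interpolated_bound:
  assumes Z: "Lp_le M pbar Z (4 * Cs)" and L1: "(\<integral>\<omega>. \<bar>Z \<omega>\<bar> \<partial>M) \<le> 2 * D1 / kp * (kp ^ i + kp ^ j)"
  shows "Lp_le M p Z (2 * c0 * (k1 ^ i + k1 ^ j))"
proof -
  let ?n = "min i j"
  have "kp ^ i + kp ^ j \<le> 2 * kp ^ ?n" using kp power_decreasing[of i j kp] power_decreasing[of j i kp] by (auto simp: min_def)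
  then have "2 * D1 / kp * (kp ^ i + kp ^ j) \<le> 2 * D1 / kp * (2 * kp ^ ?n)" using D1 kp by (intro mult_left_mono) auto
  also have "\<dots> = 4 * D1 / kp * kp ^ ?n" by simp
  also have "\<dots> \<le> c0 * kp ^ ?n" using kp by (intro mult_right_mono) (auto simp: c0_def)
  finally have L: "(\<integral>\<omega>. \<bar>Z \<omega>\<bar> \<partial>M) \<le> c0 * kp ^ ?n" using L1 by linarith
  have Zc: "Lp_le M pbar Z c0" by (rule Lp_le_mono[OF Z]) (use pbar in \<open>auto simp: c0_def\<close>)
  have "Lp_le M p Z (2 * c0 * (kp ^ ?n) powr ((pbar - p) / (p * (pbar - 1))))"
    by (rule Lp_le_interpolate[OF prob_space_axioms _ _ Zc c0_pos _ L]) (use p kp in auto)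
  also have "(kp ^ ?n) powr ((pbar - p) / (p * (pbar - 1))) = k1 ^ ?n"
    using kp by (simp add: k1_def powr_realpow[symmetric] powr_powr mult.commute)
  finally have "Lp_le M p Z (2 * c0 * k1 ^ ?n)" .
  then show ?thesis
    by (rule Lp_le_mono) (use p c0_pos k1 in \<open>auto simp: min_def intro!: mult_left_mono\<close>)
qed

lemma cond_exp_X_Lp:
  assumes "a + 1 \<le> t" "t \<le> b" shows "Lp_le M pbar (real_cond_exp M (AA s) (X chi th a b l t)) (2 * Cs)"
  using Lp_le_cond_exp[OF prob_space_axioms subalgebra_AA _ X_Lp[OF assms]] pbar by simp

text \<open>Up to time t both conditional expectations are small because the term is nearly centred
  given the past; after t both are close to the term itself. Either way the increment decays in the
  distance between s and t, up to the effect of the end of the block.\<close>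

lemma increment_L1:
  assumes s: "a < s" "s \<le> b" and t: "a < t" "t \<le> b"
  shows "(\<integral>\<omega>. \<bar>real_cond_exp M (AA s) (X chi th a b l t) \<omega> - real_cond_exp M (AA (s - 1)) (X chi th a b l t) \<omega>\<bar> \<partial>M)
    \<le> 2 * D1 / kp * (kp ^ nat \<bar>t - s\<bar> + kp ^ nat (b - t))"
proof -
  let ?X = "X chi th a b l t"
  let ?E = "\<lambda>s. real_cond_exp M (AA s) ?X"
  have w: "a + 1 \<le> t" "t \<le> b" using t by auto
  have iX: "integrable M ?X" by (rule X_integrable[OF w])
  have iE: "integrable M (?E s)" for s
    using sigma_finite_subalgebra.real_cond_exp_int(1)[OF sigma_finite_subalgebra_AA iX] .
  have inv: "D1 * z \<le> D1 / kp * z" if "z \<ge> 0" for z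
    using that D1 kp by (intro mult_right_mono) (auto simp: field_simps)
  have pw: "kp ^ n = kp ^ Suc n / kp" for n using kp by simp
  show ?thesis
  proof (cases "s \<le> t")
    case True
    have "(\<integral>\<omega>. \<bar>?E s \<omega> - ?E (s - 1) \<omega>\<bar> \<partial>M) \<le> (\<integral>\<omega>. \<bar>?E s \<omega>\<bar> + \<bar>?E (s - 1) \<omega>\<bar> \<partial>M)"
      using iE by (intro integral_mono) auto
    also have "\<dots> = (\<integral>\<omega>. \<bar>?E s \<omega>\<bar> \<partial>M) + (\<integral>\<omega>. \<bar>?E (s - 1) \<omega>\<bar> \<partial>M)" using iE by simp
    also have "\<dots> \<le> D1 * (kp ^ nat (t - s) + kp ^ nat (b - t)) + D1 * (kp ^ nat (t - (s - 1)) + kp ^ nat (b - t))"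
      using s t True by (intro add_mono X_cond_exp_past) auto
    also have "\<dots> \<le> D1 * (kp ^ nat (t - s) + kp ^ nat (b - t)) + D1 * (kp ^ nat (t - s) + kp ^ nat (b - t))"
      using D1 kp True by (intro add_mono mult_left_mono power_decreasing order_refl) auto
    also have "\<dots> = 2 * (D1 * (kp ^ nat (t - s) + kp ^ nat (b - t)))" by simp
    also have "\<dots> \<le> 2 * (D1 / kp * (kp ^ nat (t - s) + kp ^ nat (b - t)))"
      using kp by (intro mult_left_mono inv) auto
    finally show ?thesis using True by simp
  next
    case False
    have "(\<integral>\<omega>. \<bar>?E s \<omega> - ?E (s - 1) \<omega>\<bar> \<partial>M) \<le> (\<integral>\<omega>. \<bar>?X \<omega> - ?E s \<omega>\<bar> + \<bar>?X \<omega> - ?E (s - 1) \<omega>\<bar> \<partial>M)"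
      using iE iX by (intro integral_mono) auto
    also have "\<dots> = (\<integral>\<omega>. \<bar>?X \<omega> - ?E s \<omega>\<bar> \<partial>M) + (\<integral>\<omega>. \<bar>?X \<omega> - ?E (s - 1) \<omega>\<bar> \<partial>M)" using iE iX by simp
    also have "\<dots> \<le> D1 * kp ^ nat (s - t) + D1 * kp ^ nat (s - 1 - t)"
      using s t False by (intro add_mono X_cond_exp_future) auto
    also have "D1 * kp ^ nat (s - 1 - t) = D1 / kp * kp ^ nat (s - t)"
    proof -
      have "nat (s - t) = Suc (nat (s - 1 - t))" using False by auto
      then show ?thesis using kp by simp
    qed
    also have "D1 * kp ^ nat (s - t) + D1 / kp * kp ^ nat (s - t) \<le> 2 * D1 / kp * kp ^ nat (s - t)"
      using inv[of "kp ^ nat (s - t)"] kp by simp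
    also have "\<dots> \<le> 2 * D1 / kp * (kp ^ nat (s - t) + kp ^ nat (b - t))"
      using D1 kp by (intro mult_left_mono) auto
    finally show ?thesis using False by simp
  qed
qed

text \<open>The fluctuation of one block before normalisation: along good paths, the block length
  times the deviation of a component of the block statistic from its mean.\<close>

definition B :: "'d \<Rightarrow> 'w \<Rightarrow> real" where
  "B l \<omega> = (\<Sum>t\<in>{a+1..b}. X chi th a b l t \<omega>)"

lemma B_integrable: "integrable M (B l)"
  unfolding B_def by (intro Bochner_Integration.integrable_sum X_integrable) auto

lemma B_measurable_AA: "B l \<in> borel_measurable (AA b)"
  unfolding B_def using ab by (intro borel_measurable_sum X_measurable_AA) auto

lemma cond_exp_B: "AE \<omega> in M. real_cond_exp M (AA s) (B l) \<omega> = (\<Sum>t\<in>{a+1..b}. real_cond_exp M (AA s) (X chi th a b l t) \<omega>)"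
proof -
  interpret sigma_finite_subalgebra M "AA s" by (rule sigma_finite_subalgebra_AA)
  \<comment> \<open>Extended by zero because integrability is known for the times inside the block
    only.\<close>
  let ?f = "\<lambda>t. if t \<in> {a+1..b} then X chi th a b l t else (\<lambda>_. 0)"
  have "AE \<omega> in M. real_cond_exp M (AA s) (\<lambda>\<omega>. \<Sum>t\<in>{a+1..b}. ?f t \<omega>) \<omega> = (\<Sum>t\<in>{a+1..b}. real_cond_exp M (AA s) (?f t) \<omega>)"
    by (rule real_cond_exp_sum) (auto intro!: X_integrable)
  moreover have "(\<lambda>\<omega>. \<Sum>t\<in>{a+1..b}. ?f t \<omega>) = B l" by (simp add: B_def fun_eq_iff)
  ultimately show ?thesis by (auto elim!: eventually_mono)
qed

lemma geometric_sum_le: "(\<Sum>t\<in>{a+1..b}. k1 ^ nat (t - a)) \<le> 1 / (1 - k1)" "(\<Sum>t\<in>{a+1..b}. k1 ^ nat (b - t)) \<le> 1 / (1 - k1)"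
  "(\<Sum>t\<in>{a+1..b}. k1 ^ nat \<bar>t - s\<bar>) \<le> 2 / (1 - k1)"
proof -
  have g: "(\<Sum>t\<in>I. k1 ^ f t) \<le> 1 / (1 - k1)" if "finite I" "inj_on f I" for I :: "int set" and f :: "int \<Rightarrow> nat"
  proof -
    have "(\<Sum>t\<in>I. k1 ^ f t) = (\<Sum>n\<in>f ` I. k1 ^ n)" using that by (simp add: sum.reindex)
    also have "\<dots> \<le> (\<Sum>n. k1 ^ n)" using that k1 by (intro sum_le_suminf summable_geometric) auto
    also have "\<dots> = 1 / (1 - k1)" using k1 by (intro suminf_geometric) auto
    finally show ?thesis .
  qed
  show "(\<Sum>t\<in>{a+1..b}. k1 ^ nat (t - a)) \<le> 1 / (1 - k1)" by (rule g) (auto simp: inj_on_def)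
  show "(\<Sum>t\<in>{a+1..b}. k1 ^ nat (b - t)) \<le> 1 / (1 - k1)" by (rule g) (auto simp: inj_on_def)
  have "(\<Sum>t\<in>{a+1..b}. k1 ^ nat \<bar>t - s\<bar>) = (\<Sum>t\<in>{a+1..b} \<inter> {..s}. k1 ^ nat \<bar>t - s\<bar>) + (\<Sum>t\<in>{a+1..b} \<inter> {s<..}. k1 ^ nat \<bar>t - s\<bar>)"
    by (subst sum.union_disjoint[symmetric]) (auto intro!: sum.cong)
  also have "\<dots> \<le> 1 / (1 - k1) + 1 / (1 - k1)" by (intro add_mono g) (auto simp: inj_on_def)
  finally show "(\<Sum>t\<in>{a+1..b}. k1 ^ nat \<bar>t - s\<bar>) \<le> 2 / (1 - k1)" by simp
qed

text \<open>The summands decay geometrically away from the two ends of the block, so what is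
  predictable at its start stays bounded whatever its length.\<close>

lemma B_cond_exp_start: "Lp_le M p (real_cond_exp M (AA a) (B l)) C2"
proof -
  have "Lp_le M p (\<lambda>\<omega>. \<Sum>t\<in>{a+1..b}. real_cond_exp M (AA a) (X chi th a b l t) \<omega>) (\<Sum>t\<in>{a+1..b}. 2 * c0 * (k1 ^ nat (t - a) + k1 ^ nat (b - t)))"
  proof (rule Lp_le_sum)
    fix t assume t: "t \<in> {a+1..b}"
    show "Lp_le M p (real_cond_exp M (AA a) (X chi th a b l t)) (2 * c0 * (k1 ^ nat (t - a) + k1 ^ nat (b - t)))"
    proof (rule interpolated_bound)
      show "Lp_le M pbar (real_cond_exp M (AA a) (X chi th a b l t)) (4 * Cs)"
        by (rule Lp_le_mono[OF cond_exp_X_Lp]) (use t Cs_pos pbar in auto)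
      have "(\<integral>\<omega>. \<bar>real_cond_exp M (AA a) (X chi th a b l t) \<omega>\<bar> \<partial>M) \<le> D1 * (kp ^ nat (t - a) + kp ^ nat (b - t))"
        by (rule X_cond_exp_past) (use t in auto)
      also have "\<dots> \<le> 2 * D1 / kp * (kp ^ nat (t - a) + kp ^ nat (b - t))"
        using D1 kp by (intro mult_right_mono) (auto simp: field_simps)
      finally show "(\<integral>\<omega>. \<bar>real_cond_exp M (AA a) (X chi th a b l t) \<omega>\<bar> \<partial>M) \<le> 2 * D1 / kp * (kp ^ nat (t - a) + kp ^ nat (b - t))" .
    qed
  qed (use p in auto)
  then have "Lp_le M p (\<lambda>\<omega>. \<Sum>t\<in>{a+1..b}. real_cond_exp M (AA a) (X chi th a b l t) \<omega>) C2"
  proof (rule Lp_le_mono)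
    have "(\<Sum>t\<in>{a+1..b}. 2 * c0 * (k1 ^ nat (t - a) + k1 ^ nat (b - t))) = 2 * c0 * ((\<Sum>t\<in>{a+1..b}. k1 ^ nat (t - a)) + (\<Sum>t\<in>{a+1..b}. k1 ^ nat (b - t)))"
      by (simp add: sum_distrib_left sum.distrib distrib_left)
    also have "\<dots> \<le> 2 * c0 * (1 / (1 - k1) + 1 / (1 - k1))"
      using c0_pos geometric_sum_le by (intro mult_left_mono add_mono) auto
    also have "\<dots> \<le> C2" using c0_pos k1 by (simp add: C2_def divide_right_mono)
    finally show "(\<Sum>t\<in>{a+1..b}. 2 * c0 * (k1 ^ nat (t - a) + k1 ^ nat (b - t))) \<le> C2" .
  qed (use p in auto)
  then show ?thesis
    by (rule Lp_le_dominated) (use p cond_exp_B[of a l] in \<open>auto elim!: eventually_mono\<close>)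
qed

text \<open>Revealing one observation moves the conditional expectation of a whole block by an
  amount bounded in L_p: the effect on the term at time t is geometric in the distance of t to s,
  plus an effect of the end of the block that is summable too.\<close>

lemma B_increment:
  assumes s: "a < s" "s \<le> b"
  shows "Lp_le M p (\<lambda>\<omega>. real_cond_exp M (AA s) (B l) \<omega> - real_cond_exp M (AA (s - 1)) (B l) \<omega>) C2"
proof -
  let ?P = "\<lambda>t \<omega>. real_cond_exp M (AA s) (X chi th a b l t) \<omega> - real_cond_exp M (AA (s - 1)) (X chi th a b l t) \<omega>"
  have "Lp_le M p (\<lambda>\<omega>. \<Sum>t\<in>{a+1..b}. ?P t \<omega>) (\<Sum>t\<in>{a+1..b}. 2 * c0 * (k1 ^ nat \<bar>t - s\<bar> + k1 ^ nat (b - t)))"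
  proof (rule Lp_le_sum)
    fix t assume t: "t \<in> {a+1..b}"
    show "Lp_le M p (?P t) (2 * c0 * (k1 ^ nat \<bar>t - s\<bar> + k1 ^ nat (b - t)))"
    proof (rule interpolated_bound)
      show "Lp_le M pbar (?P t) (4 * Cs)"
        using Lp_le_diff[OF _ cond_exp_X_Lp cond_exp_X_Lp, of t t s l "s - 1" l] t pbar by simp
      show "(\<integral>\<omega>. \<bar>?P t \<omega>\<bar> \<partial>M) \<le> 2 * D1 / kp * (kp ^ nat \<bar>t - s\<bar> + kp ^ nat (b - t))"
        by (rule increment_L1) (use s t in auto)
    qed
  qed (use p in auto)
  then have L: "Lp_le M p (\<lambda>\<omega>. \<Sum>t\<in>{a+1..b}. ?P t \<omega>) C2"
  proof (rule Lp_le_mono)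
    have "(\<Sum>t\<in>{a+1..b}. 2 * c0 * (k1 ^ nat \<bar>t - s\<bar> + k1 ^ nat (b - t))) = 2 * c0 * ((\<Sum>t\<in>{a+1..b}. k1 ^ nat \<bar>t - s\<bar>) + (\<Sum>t\<in>{a+1..b}. k1 ^ nat (b - t)))"
      by (simp add: sum_distrib_left sum.distrib distrib_left)
    also have "\<dots> \<le> 2 * c0 * (2 / (1 - k1) + 1 / (1 - k1))"
      using c0_pos geometric_sum_le by (intro mult_left_mono add_mono) auto
    also have "\<dots> = C2" by (simp add: C2_def add_divide_distrib[symmetric])
    finally show "(\<Sum>t\<in>{a+1..b}. 2 * c0 * (k1 ^ nat \<bar>t - s\<bar> + k1 ^ nat (b - t))) \<le> C2" .
  qed (use p in auto)
  show ?thesis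
  proof (rule Lp_le_dominated[OF L])
    show "AE \<omega> in M. \<bar>real_cond_exp M (AA s) (B l) \<omega> - real_cond_exp M (AA (s - 1)) (B l) \<omega>\<bar> \<le> \<bar>\<Sum>t\<in>{a+1..b}. ?P t \<omega>\<bar>"
      using cond_exp_B[of s l] cond_exp_B[of "s - 1" l] by eventually_elim (simp add: sum_subtractf)
  qed (use p in auto)
qed

lemma B_increment_centred:
  "AE \<omega> in M. real_cond_exp M (AA (s - 1)) (\<lambda>\<omega>. real_cond_exp M (AA s) (B l) \<omega> - real_cond_exp M (AA (s - 1)) (B l) \<omega>) \<omega> = 0"
proof -
  interpret F: sigma_finite_subalgebra M "AA (s - 1)" by (rule sigma_finite_subalgebra_AA)
  interpret G: sigma_finite_subalgebra M "AA s" by (rule sigma_finite_subalgebra_AA)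
  have i: "integrable M (real_cond_exp M (AA s) (B l))" "integrable M (real_cond_exp M (AA (s - 1)) (B l))"
    using F.real_cond_exp_int(1)[OF B_integrable] G.real_cond_exp_int(1)[OF B_integrable] by auto
  have n: "AE \<omega> in M. real_cond_exp M (AA (s - 1)) (real_cond_exp M (AA s) (B l)) \<omega> = real_cond_exp M (AA (s - 1)) (B l) \<omega>"
    by (rule F.real_cond_exp_nested_subalg[OF subalgebra_AA subalgebra_AA_mono B_integrable]) simp
  have m: "AE \<omega> in M. real_cond_exp M (AA (s - 1)) (real_cond_exp M (AA (s - 1)) (B l)) \<omega> = real_cond_exp M (AA (s - 1)) (B l) \<omega>"
    by (rule F.real_cond_exp_F_meas[OF i(2)]) simp
  show ?thesis using F.real_cond_exp_diff[OF i] n m by eventually_elim simp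
qed

text \<open>Conditional expectations telescope along the observation times, and at time
  \<open>b\<close> the block is measurable. What remains after the predictable start is a sum of
  martingale increments.\<close>

lemma B_decomposition:
  "AE \<omega> in M. B l \<omega> = real_cond_exp M (AA a) (B l) \<omega> + (\<Sum>s\<in>{a+1..b}. real_cond_exp M (AA s) (B l) \<omega> - real_cond_exp M (AA (s - 1)) (B l) \<omega>)"
proof -
  have "real_cond_exp M (AA (a + int n)) (B l) \<omega> = real_cond_exp M (AA a) (B l) \<omega> + (\<Sum>s\<in>{a+1..a + int n}. real_cond_exp M (AA s) (B l) \<omega> - real_cond_exp M (AA (s - 1)) (B l) \<omega>)" for n \<omega>
  proof (induction n)
    case (Suc n)
    have "{a+1..a + int (Suc n)} = insert (a + int (Suc n)) {a+1..a + int n}" by auto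
    then show ?case using Suc by simp
  qed simp
  from this[of "nat (b - a)"] have tel: "real_cond_exp M (AA b) (B l) \<omega> = real_cond_exp M (AA a) (B l) \<omega> + (\<Sum>s\<in>{a+1..b}. real_cond_exp M (AA s) (B l) \<omega> - real_cond_exp M (AA (s - 1)) (B l) \<omega>)" for \<omega>
    using ab by simp
  show ?thesis
    using sigma_finite_subalgebra.real_cond_exp_F_meas[OF sigma_finite_subalgebra_AA B_integrable[of l] B_measurable_AA[of l]]
    by eventually_elim (simp only: tel[symmetric])
qed

end

end

section \<open>Deterministic estimates for the averaged recursion\<close>

lemma C2_on_compose_quadratic_bound:
  fixes f :: "real^'k \<Rightarrow> real^'d" and h :: "real^'d \<Rightarrow> real^'k"
  assumes f: "C2_on f A" and h: "C2_on h U" and U: "open U" "s0 \<in> U" "\<And>s. s \<in> U \<Longrightarrow> h s \<in> A"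
  shows "\<exists>K d. d > 0 \<and> K \<ge> 0 \<and> (\<forall>s. norm (s - s0) < d \<longrightarrow>
    norm (f (h s) - f (h s0) - jacobian (f \<circ> h) (at s0) *v (s - s0)) \<le> K * (norm (s - s0))\<^sup>2)"
proof -
  obtain f' Kf df where f': "bounded_linear f'" "df > 0" "Kf \<ge> 0"
    "\<And>x. x \<in> A \<Longrightarrow> dist x (h s0) < df \<Longrightarrow> norm (f x - f (h s0) - f' (x - h s0)) \<le> Kf * norm (x - h s0) ^ 2"
    using C2_on_quadratic_bound[OF f U(3)[OF U(2)]] by metis
  obtain h' Kh dh where h': "bounded_linear h'" "dh > 0" "Kh \<ge> 0"
    "\<And>x. x \<in> U \<Longrightarrow> dist x s0 < dh \<Longrightarrow> norm (h x - h s0 - h' (x - s0)) \<le> Kh * norm (x - s0) ^ 2"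
    using C2_on_quadratic_bound[OF h U(2)] by metis
  obtain du where du: "du > 0" "ball s0 du \<subseteq> U" using U openE by blast
  obtain Bh where Bh: "Bh > 0" "\<And>x. norm (h' x) \<le> norm x * Bh" using bounded_linear.pos_bounded[OF h'(1)] by blast
  obtain Bf where Bf: "Bf > 0" "\<And>x. norm (f' x) \<le> norm x * Bf" using bounded_linear.pos_bounded[OF f'(1)] by blast
  define d where "d = min (min dh du) (min 1 (df / (Bh + Kh)))"
  define K where "K = Kf * (Bh + Kh)\<^sup>2 + Kh * Bf"
  have d: "d > 0" unfolding d_def using h' du f' Bh by simp
  have K: "K \<ge> 0" unfolding K_def using f' h' Bf by (intro add_nonneg_nonneg mult_nonneg_nonneg) auto
  let ?D = "\<lambda>v. f' (h' v)"
  have Dl: "bounded_linear ?D" using bounded_linear_compose[OF f'(1) h'(1)] .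
  have q: "norm (f (h s) - f (h s0) - ?D (s - s0)) \<le> K * (norm (s - s0))\<^sup>2" if s: "norm (s - s0) < d" for s
  proof -
    have r: "norm (s - s0) < dh" "norm (s - s0) < du" "norm (s - s0) \<le> 1" "norm (s - s0) < df / (Bh + Kh)"
      using s by (auto simp: d_def)
    have sU: "s \<in> U" using du r by (auto simp: dist_norm norm_minus_commute subset_iff)
    have e1: "norm (h s - h s0 - h' (s - s0)) \<le> Kh * norm (s - s0) ^ 2" using h'(4)[OF sU] r by (simp add: dist_norm)
    have sq: "(norm (s - s0))\<^sup>2 \<le> norm (s - s0)" using r by (simp add: power2_eq_square mult_left_le)
    have "norm (h s - h s0) \<le> norm (h s - h s0 - h' (s - s0)) + norm (h' (s - s0))" by (metis diff_add_cancel norm_triangle_ineq)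
    also have "\<dots> \<le> Kh * norm (s - s0) + norm (s - s0) * Bh"
      using e1 Bh(2) sq h'(3) by (intro add_mono) (auto intro: order_trans mult_left_mono)
    finally have lip: "norm (h s - h s0) \<le> (Bh + Kh) * norm (s - s0)" by (simp add: algebra_simps)
    also have "\<dots> < df" using r(4) Bh h'(3) by (simp add: pos_less_divide_eq mult.commute)
    finally have dist: "dist (h s) (h s0) < df" by (simp add: dist_norm)
    have e2: "norm (f (h s) - f (h s0) - f' (h s - h s0)) \<le> Kf * norm (h s - h s0) ^ 2" using f'(4)[OF U(3)[OF sU] dist] .
    have "f (h s) - f (h s0) - ?D (s - s0) = (f (h s) - f (h s0) - f' (h s - h s0)) + f' (h s - h s0 - h' (s - s0))"
      by (simp add: linear_diff[OF bounded_linear.linear[OF f'(1)]])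
    then have "norm (f (h s) - f (h s0) - ?D (s - s0)) \<le> norm (f (h s) - f (h s0) - f' (h s - h s0)) + norm (f' (h s - h s0 - h' (s - s0)))"
      by (metis norm_triangle_ineq)
    also have "\<dots> \<le> Kf * norm (h s - h s0) ^ 2 + norm (h s - h s0 - h' (s - s0)) * Bf" by (intro add_mono e2 Bf)
    also have "\<dots> \<le> Kf * ((Bh + Kh) * norm (s - s0)) ^ 2 + (Kh * norm (s - s0) ^ 2) * Bf"
      using lip e1 f'(3) Bf by (intro add_mono mult_left_mono mult_right_mono power_mono) auto
    also have "\<dots> = K * (norm (s - s0))\<^sup>2" unfolding K_def power_mult_distrib by (simp add: algebra_simps)
    finally show ?thesis .
  qed
  have "((f \<circ> h) has_derivative ?D) (at s0)"
  proof (rule has_derivativeI_sandwich[OF d Dl])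
    fix s assume "s \<noteq> s0" "dist s s0 < d"
    then have "norm (f (h s) - f (h s0) - ?D (s - s0)) \<le> K * (norm (s - s0))\<^sup>2" using q by (simp add: dist_norm)
    then show "norm ((f \<circ> h) s - (f \<circ> h) s0 - ?D (s - s0)) / norm (s - s0) \<le> K * norm (s - s0)"
      using \<open>s \<noteq> s0\<close> by (simp add: pos_divide_le_eq power2_eq_square mult.assoc)
  next
    have "((\<lambda>s. K * norm (s - s0)) \<longlongrightarrow> K * norm (s0 - s0)) (at s0)" by (intro tendsto_intros)
    then show "((\<lambda>s. K * norm (s - s0)) \<longlongrightarrow> 0) (at s0)" by simp
  qed
  then have "frechet_derivative (f \<circ> h) (at s0) = ?D" by (rule frechet_derivative_at[symmetric])
  then have "jacobian (f \<circ> h) (at s0) *v v = ?D v" for v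
    unfolding jacobian_def using matrix_works[OF bounded_linear.linear[OF Dl, unfolded linear_matrix_vector_mul_eq[symmetric]]]
    by (simp add: matrix_works bounded_linear.linear[OF Dl] linear_linear)
  then show ?thesis using q d K by auto
qed

lemma affine_recursion_solution:
  fixes A :: "real^'n^'n"
  assumes "\<And>n. x (Suc n) = A *v x n + u (Suc n)"
  shows "x n = (((*v) A) ^^ n) (x 0) + (\<Sum>k=1..n. (((*v) A) ^^ (n - k)) (u k))"
proof (induction n)
  case (Suc n)
  have "A *v (\<Sum>k=1..n. (((*v) A) ^^ (n - k)) (u k)) = (\<Sum>k=1..n. (((*v) A) ^^ (Suc n - k)) (u k))"
    by (subst vec.linear_sum[OF matrix_vector_mul_linear_gen], intro sum.cong) (auto simp: Suc_diff_le)
  then show ?case using assms[of n] Suc by (simp add: matrix_vector_right_distrib)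
qed simp

text \<open>Exchanging the sums collects the weights that one \<open>f k\<close> meets at later
  times. The hypothesis says that \<open>t\<close> grows slowly compared with the decay of the
  powers of \<open>q\<close>.\<close>

lemma weighted_convolution_le:
  fixes t f :: "nat \<Rightarrow> real"
  assumes t: "\<And>k n. (\<Sum>i<n. q ^ i * t (Suc (k + i))) \<le> C * t (Suc k)" and f: "\<And>i. 0 \<le> f i"
  shows "(\<Sum>j<n. t (Suc j) * (\<Sum>k=1..j. q ^ (j - k) * f k)) \<le> C * (\<Sum>k=1..<n. t (Suc k) * f k)"
proof -
  have "(\<Sum>j<n. t (Suc j) * (\<Sum>k=1..j. q ^ (j - k) * f k)) = (\<Sum>j<n. \<Sum>k\<in>{1..j}. t (Suc j) * q ^ (j - k) * f k)"
    by (simp add: sum_distrib_left mult.assoc)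
  also have "\<dots> = (\<Sum>(j, k)\<in>(SIGMA j:{..<n}. {1..j}). t (Suc j) * q ^ (j - k) * f k)"
    by (simp add: sum.Sigma)
  also have "\<dots> = (\<Sum>(k, i)\<in>(SIGMA k:{1..<n}. {..<n - k}). t (Suc (k + i)) * q ^ i * f k)"
    by (rule sum.reindex_bij_witness[of _ "\<lambda>(k, i). (k + i, k)" "\<lambda>(j, k). (k, j - k)"]) auto
  also have "\<dots> = (\<Sum>k\<in>{1..<n}. f k * (\<Sum>i<n - k. q ^ i * t (Suc (k + i))))"
    by (simp add: sum.Sigma[symmetric] sum_distrib_left mult_ac)
  also have "\<dots> \<le> (\<Sum>k\<in>{1..<n}. f k * (C * t (Suc k)))" using t f by (intro sum_mono mult_left_mono) auto
  also have "\<dots> = C * (\<Sum>k=1..<n. t (Suc k) * f k)" by (simp add: sum_distrib_left mult_ac)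
  finally show ?thesis .
qed

text \<open>The weighted sum of the nonlinear remainders is absorbed: each remainder is quadratic in the
  iterate, hence eventually a small multiple of the deviation from the linear part plus the square of
  the linear part.\<close>

lemma nonlinear_remainder_bound:
  fixes d e :: "nat \<Rightarrow> real^'n" and A :: "real^'n^'n" and t :: "nat \<Rightarrow> real"
  defines "mu \<equiv> \<lambda>n. \<Sum>k=1..n. (((*v) A) ^^ (n - k)) (e k)"
  assumes A: "\<And>k v. norm ((((*v) A) ^^ k) v) \<le> K * q ^ k * norm v" "K \<ge> 0" "0 < q"
    and t: "\<And>k n. (\<Sum>i<n. q ^ i * t (Suc (k + i))) \<le> C * t (Suc k)" "\<And>k. t k \<ge> 0" "C > 0"
    and d: "\<And>n. d (Suc n) = A *v d n + r n + e (Suc n)"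
    and r: "\<And>n. norm (d n) < dl \<Longrightarrow> norm (r n) \<le> R * (norm (d n))\<^sup>2" "dl > 0" "R \<ge> 0"
    and lim: "d \<longlonglongrightarrow> 0" "mu \<longlonglongrightarrow> 0"
  shows "\<exists>A0\<ge>0. \<forall>n. (\<Sum>j<n. t (Suc j) * norm (d j - mu j)) \<le> A0 + 4 * R * K * C\<^sup>2 / q * (\<Sum>i<n. t (Suc i) * (norm (mu i))\<^sup>2)"
proof -
  define rho where "rho n = d n - mu n" for n
  define C' where "C' = K * (C\<^sup>2 / q)"
  have C': "C' \<ge> 0" using A t by (simp add: C'_def)
  \<comment> \<open>The remainder produced at time i acts from time i + 1 on; the first two terms of
    the convolution bound compare the corresponding weights.\<close>
  have tnext: "t (Suc (Suc i)) \<le> C / q * t (Suc i)" for i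
  proof -
    have "q * t (Suc (Suc i)) \<le> (\<Sum>j<2. q ^ j * t (Suc (i + j)))" using t(2) by (simp add: numeral_2_eq_2)
    also have "\<dots> \<le> C * t (Suc i)" by (rule t(1))
    finally show ?thesis using A(3) by (simp add: pos_le_divide_eq mult.commute)
  qed
  have muS: "mu (Suc n) = A *v mu n + e (Suc n)" for n
  proof -
    have "A *v (\<Sum>k=1..n. (((*v) A) ^^ (n - k)) (e k)) = (\<Sum>k=1..n. (((*v) A) ^^ (Suc n - k)) (e k))"
      by (subst vec.linear_sum[OF matrix_vector_mul_linear_gen], intro sum.cong) (auto simp: Suc_diff_le)
    then show ?thesis by (simp add: mu_def)
  qed
  have rhoS: "rho (Suc n) = A *v rho n + r n" for n
    unfolding rho_def d muS by (simp add: matrix_vector_mult_diff_distrib)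
  have rho0: "rho 0 = d 0" by (simp add: rho_def mu_def)
  have sol: "rho j = (((*v) A) ^^ j) (d 0) + (\<Sum>k=1..j. (((*v) A) ^^ (j - k)) (r (k - 1)))" for j
    using affine_recursion_solution[of rho A "\<lambda>k. r (k - 1)" j] rhoS rho0 by simp
  have nrho: "norm (rho j) \<le> K * q ^ j * norm (d 0) + (\<Sum>k=1..j. q ^ (j - k) * (K * norm (r (k - 1))))" for j
  proof -
    have "norm (rho j) \<le> norm ((((*v) A) ^^ j) (d 0)) + (\<Sum>k=1..j. norm ((((*v) A) ^^ (j - k)) (r (k - 1))))"
      unfolding sol by (intro order_trans[OF norm_triangle_ineq] add_left_mono norm_sum)
    also have "\<dots> \<le> K * q ^ j * norm (d 0) + (\<Sum>k=1..j. K * q ^ (j - k) * norm (r (k - 1)))"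
      by (intro add_mono sum_mono A(1))
    finally show ?thesis by (simp add: mult_ac)
  qed
  have R1: "(\<Sum>j<n. t (Suc j) * norm (rho j)) \<le> K * norm (d 0) * (C * t 1) + C' * (\<Sum>i<n. t (Suc i) * norm (r i))" for n
  proof -
    have "(\<Sum>j<n. t (Suc j) * norm (rho j)) \<le> (\<Sum>j<n. t (Suc j) * (K * q ^ j * norm (d 0) + (\<Sum>k=1..j. q ^ (j - k) * (K * norm (r (k - 1))))))"
      using t(2) nrho by (intro sum_mono mult_left_mono) auto
    also have "\<dots> = K * norm (d 0) * (\<Sum>i<n. q ^ i * t (Suc (0 + i))) + (\<Sum>j<n. t (Suc j) * (\<Sum>k=1..j. q ^ (j - k) * (K * norm (r (k - 1)))))"
      by (simp add: distrib_left sum.distrib sum_distrib_left mult_ac)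
    also have "\<dots> \<le> K * norm (d 0) * (C * t (Suc 0)) + C * (\<Sum>k=1..<n. t (Suc k) * (K * norm (r (k - 1))))"
      using A(2) by (intro add_mono mult_left_mono t(1) weighted_convolution_le) auto
    also have "(\<Sum>k=1..<n. t (Suc k) * (K * norm (r (k - 1)))) = (\<Sum>i<n - 1. t (Suc (Suc i)) * (K * norm (r i)))"
      by (rule sum.reindex_bij_witness[of _ Suc "\<lambda>k. k - 1"]) auto
    also have "\<dots> \<le> (\<Sum>i<n. (C / q * t (Suc i)) * (K * norm (r i)))"
    proof -
      have "(\<Sum>i<n - 1. t (Suc (Suc i)) * (K * norm (r i))) \<le> (\<Sum>i<n - 1. (C / q * t (Suc i)) * (K * norm (r i)))"
        using tnext A(2) by (intro sum_mono mult_right_mono) auto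
      also have "\<dots> \<le> (\<Sum>i<n. (C / q * t (Suc i)) * (K * norm (r i)))"
        using t A by (intro sum_mono2) auto
      finally show ?thesis .
    qed
    also have "C * (\<Sum>i<n. (C / q * t (Suc i)) * (K * norm (r i))) = C' * (\<Sum>i<n. t (Suc i) * norm (r i))"
      by (simp add: C'_def sum_distrib_left power2_eq_square mult_ac)
    finally show ?thesis using t(3) by (simp add: mult_left_mono)
  qed
  have rlim: "rho \<longlonglongrightarrow> 0" unfolding rho_def using tendsto_diff[OF lim] by simp
  \<comment> \<open>Chosen so that \<open>C' * (2 * R) * eta\<close> is at most 1/2: the part of the
    remainder that is linear in \<open>rho\<close> is then absorbed by the left-hand side.\<close>
  define eta where "eta = 1 / (2 * (C' + 1) * (2 * R + 1))"
  have eta: "eta > 0" using C' r(3) by (simp add: eta_def)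
  have "\<forall>\<^sub>F n in sequentially. norm (d n) < dl \<and> norm (rho n) < eta"
    using order_tendstoD(2)[OF tendsto_norm[OF lim(1)], of dl] order_tendstoD(2)[OF tendsto_norm[OF rlim], of eta] r(2) eta
    by (auto elim: eventually_elim2)
  then obtain N where N: "\<And>n. N \<le> n \<Longrightarrow> norm (d n) < dl \<and> norm (rho n) < eta" by (auto simp: eventually_sequentially)
  \<comment> \<open>The finitely many steps before the trajectory is small enter through an additive
    constant depending on the trajectory, not through the coefficient of the quadratic sum.\<close>
  define A1 where "A1 = (\<Sum>i<N. t (Suc i) * norm (r i))"
  have A1: "A1 \<ge> 0" unfolding A1_def using t(2) by (intro sum_nonneg) auto
  have rb: "norm (r i) \<le> 2 * R * (norm (mu i))\<^sup>2 + 2 * R * eta * norm (rho i)" if "N \<le> i" for i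
  proof -
    have "norm (d i) \<le> norm (mu i) + norm (rho i)"
      unfolding rho_def using norm_triangle_ineq[of "mu i" "d i - mu i"] by simp
    then have "(norm (d i))\<^sup>2 \<le> (norm (mu i) + norm (rho i))\<^sup>2" by (intro power_mono) auto
    also have "\<dots> \<le> 2 * (norm (mu i))\<^sup>2 + 2 * (norm (rho i))\<^sup>2"
      using zero_le_power2[of "norm (mu i) - norm (rho i)"] by (simp add: power2_sum power2_diff)
    also have "(norm (rho i))\<^sup>2 \<le> eta * norm (rho i)" using N[OF that] by (simp add: power2_eq_square mult_right_mono)
    finally have "R * (norm (d i))\<^sup>2 \<le> R * (2 * (norm (mu i))\<^sup>2 + 2 * (eta * norm (rho i)))" using r(3) by (intro mult_left_mono) auto
    then show ?thesis using r(1)[of i] N[OF that] by (simp add: algebra_simps)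
  qed
  have final: "(\<Sum>j<n. t (Suc j) * norm (rho j)) \<le> 2 * (K * norm (d 0) * (C * t 1) + C' * A1) + 4 * R * C' * (\<Sum>i<n. t (Suc i) * (norm (mu i))\<^sup>2)" for n
  proof -
    let ?R = "\<Sum>j<n. t (Suc j) * norm (rho j)" and ?M = "\<Sum>i<n. t (Suc i) * (norm (mu i))\<^sup>2"
    have "(\<Sum>i<n. t (Suc i) * norm (r i)) \<le> (\<Sum>i<n. (if i < N then t (Suc i) * norm (r i) else 0) + t (Suc i) * (2 * R * (norm (mu i))\<^sup>2 + 2 * R * eta * norm (rho i)))"
      using t(2) rb r(3) eta by (intro sum_mono) (auto simp: not_less intro!: mult_left_mono)
    also have "\<dots> = (\<Sum>i<n. if i < N then t (Suc i) * norm (r i) else 0) + 2 * R * ?M + 2 * R * eta * ?R"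
      by (simp add: sum.distrib distrib_left sum_distrib_left mult_ac)
    also have "(\<Sum>i<n. if i < N then t (Suc i) * norm (r i) else 0) \<le> A1"
    proof -
      have "(\<Sum>i<n. if i < N then t (Suc i) * norm (r i) else 0) = (\<Sum>i\<in>{..<n} \<inter> {..<N}. t (Suc i) * norm (r i))"
        by (subst sum.inter_restrict) auto
      also have "\<dots> \<le> A1" unfolding A1_def using t(2) by (intro sum_mono2) auto
      finally show ?thesis .
    qed
    finally have "(\<Sum>i<n. t (Suc i) * norm (r i)) \<le> A1 + 2 * R * ?M + 2 * R * eta * ?R" by simp
    then have "C' * (\<Sum>i<n. t (Suc i) * norm (r i)) \<le> C' * (A1 + 2 * R * ?M + 2 * R * eta * ?R)" using C' by (intro mult_left_mono) auto
    moreover have "C' * (2 * R * eta * ?R) \<le> 1 / 2 * ?R"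
    proof -
      have "C' * (2 * R) \<le> (C' + 1) * (2 * R + 1)" using C' r(3) by (intro mult_mono) auto
      then have "C' * (2 * R) * eta \<le> (C' + 1) * (2 * R + 1) * eta" using eta by (intro mult_right_mono) auto
      also have "\<dots> = 1 / 2" using C' r(3) by (simp add: eta_def)
      finally have "C' * (2 * R) * eta * ?R \<le> 1 / 2 * ?R" using t(2) by (intro mult_right_mono sum_nonneg) auto
      then show ?thesis by (simp add: mult_ac)
    qed
    ultimately have "?R \<le> K * norm (d 0) * (C * t 1) + (C' * A1 + C' * (2 * R * ?M) + 1 / 2 * ?R)"
      using R1[of n] by (simp add: distrib_left)
    then show ?thesis by (simp add: algebra_simps)
  qed
  show ?thesis
  proof (intro exI[of _ "2 * (K * norm (d 0) * (C * t 1) + C' * A1)"] conjI allI)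
    show "0 \<le> 2 * (K * norm (d 0) * (C * t 1) + C' * A1)" using A t C' A1 by simp
    have "4 * R * C' = 4 * R * K * C\<^sup>2 / q" by (simp add: C'_def)
    then show "(\<Sum>j<n. t (Suc j) * norm (d j - mu j)) \<le> 2 * (K * norm (d 0) * (C * t 1) + C' * A1) + 4 * R * K * C\<^sup>2 / q * (\<Sum>i<n. t (Suc i) * (norm (mu i))\<^sup>2)" for n
      using final[of n] unfolding rho_def by simp
  qed
qed

section \<open>Block sizes\<close>

lemma summable_geometric_powr:
  fixes q a :: real
  assumes "0 < q" "q < 1"
  shows "summable (\<lambda>i. q ^ i * (1 + real i) powr a)"
proof -
  let ?f = "\<lambda>i. q ^ i * (1 + real i) powr a"
  have "((\<lambda>i. ((2 + real i) / (1 + real i)) powr a) \<longlongrightarrow> 1) sequentially" by real_asymp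
  moreover have "1 < 1 / sqrt q" using assms by simp
  ultimately have "\<forall>\<^sub>F i in sequentially. ((2 + real i) / (1 + real i)) powr a < 1 / sqrt q" by (rule order_tendstoD(2))
  then obtain N where N: "\<And>i. N \<le> i \<Longrightarrow> ((2 + real i) / (1 + real i)) powr a < 1 / sqrt q"
    by (auto simp: eventually_sequentially)
  show ?thesis
  proof (rule summable_ratio_test[where c = "sqrt q" and N = N])
    fix i assume i: "N \<le> i"
    have "?f (Suc i) = q * ((2 + real i) / (1 + real i)) powr a * ?f i" by (simp add: powr_divide add_ac)
    also have "\<dots> \<le> q * (1 / sqrt q) * ?f i"
      using N[OF i] assms by (intro mult_right_mono mult_left_mono) auto
    also have "q * (1 / sqrt q) = sqrt q" using assms by (simp add: real_div_sqrt)
    finally show "norm (?f (Suc i)) \<le> sqrt q * norm (?f i)" using assms by simp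
  qed (use assms in simp)
qed

locale block_sizes =
  fixes c a :: real and \<tau> :: "nat \<Rightarrow> nat"
  assumes c_a: "c > 0" "a > 1"
    and tau: "\<And>n. n \<ge> 1 \<Longrightarrow> \<tau> n > 0" "\<And>n. n \<ge> 1 \<Longrightarrow> int (\<tau> n) = \<lfloor>c * real n powr a\<rfloor>"
begin

lemma tau_le: "n \<ge> 1 \<Longrightarrow> real (\<tau> n) \<le> c * real n powr a"
  using tau(2)[of n] of_int_floor_le[of "c * real n powr a"] by (metis of_int_of_nat_eq)

text \<open>A positive integer is at least half of any number below its successor, so the floor
  loses at most a factor 2.\<close>

lemma tau_ge: "n \<ge> 1 \<Longrightarrow> c / 2 * real n powr a \<le> real (\<tau> n)"
proof -
  assume n: "n \<ge> 1"
  have "c * real n powr a < real (\<tau> n) + 1"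
    using tau(2)[OF n] floor_correct[of "c * real n powr a"] by (metis of_int_add of_int_1 of_int_of_nat_eq)
  moreover have "1 \<le> real (\<tau> n)" using tau(1)[OF n] by simp
  ultimately show ?thesis by simp
qed

text \<open>From k + i + 1 \<le> (1 + i) (k + 1); the factor 2 pays for the floors. The growth is
  polynomial, so geometric weights outweigh it.\<close>

lemma tau_ratio: "real (\<tau> (Suc (k + i))) \<le> 2 * (1 + real i) powr a * real (\<tau> (Suc k))"
proof -
  have "real (Suc (k + i)) \<le> (1 + real i) * real (Suc k)" by (simp add: algebra_simps)
  then have "real (Suc (k + i)) powr a \<le> ((1 + real i) * real (Suc k)) powr a" using c_a by (intro powr_mono2) auto
  also have "\<dots> = (1 + real i) powr a * real (Suc k) powr a" by (rule powr_mult)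
  finally have "c * real (Suc (k + i)) powr a \<le> 2 * (1 + real i) powr a * (c / 2 * real (Suc k) powr a)"
    using c_a by (simp add: mult_left_mono)
  also have "\<dots> \<le> 2 * (1 + real i) powr a * real (\<tau> (Suc k))"
    using tau_ge[of "Suc k"] by (intro mult_left_mono) auto
  finally show ?thesis using tau_le[of "Suc (k + i)"] by linarith
qed

text \<open>Bounds each geometrically weighted sum of later block sizes relative to the present
  one.\<close>

definition G :: "real \<Rightarrow> real" where "G q = 2 * (\<Sum>i. q ^ i * (1 + real i) powr a)"

lemma G_bound:
  assumes q: "0 < q" "q < 1"
  shows "(\<Sum>i<n. q ^ i * (2 * (1 + real i) powr a)) \<le> G q" "G q \<ge> 1"
proof -
  have s: "summable (\<lambda>i. q ^ i * (1 + real i) powr a)" by (rule summable_geometric_powr[OF q])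
  have le: "(\<Sum>i<n. q ^ i * (1 + real i) powr a) \<le> (\<Sum>i. q ^ i * (1 + real i) powr a)" for n
    using q by (intro sum_le_suminf[OF s]) auto
  have "(\<Sum>i<n. q ^ i * (2 * (1 + real i) powr a)) = 2 * (\<Sum>i<n. q ^ i * (1 + real i) powr a)"
    by (simp add: sum_distrib_left mult_ac)
  then show "(\<Sum>i<n. q ^ i * (2 * (1 + real i) powr a)) \<le> G q" using le[of n] by (simp add: G_def)
  show "G q \<ge> 1" using le[of 1] by (simp add: G_def)
qed

lemma tau_convolution:
  assumes q: "0 < q" "q < 1"
  shows "(\<Sum>i<n. q ^ i * real (\<tau> (Suc (k + i)))) \<le> G q * real (\<tau> (Suc k))"
proof -
  have "(\<Sum>i<n. q ^ i * real (\<tau> (Suc (k + i)))) \<le> (\<Sum>i<n. q ^ i * (2 * (1 + real i) powr a * real (\<tau> (Suc k))))"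
    using q tau_ratio by (intro sum_mono mult_left_mono) auto
  also have "\<dots> = (\<Sum>i<n. q ^ i * (2 * (1 + real i) powr a)) * real (\<tau> (Suc k))" by (simp only: sum_distrib_right mult.assoc)
  also have "\<dots> \<le> G q * real (\<tau> (Suc k))" using G_bound[OF q] by (intro mult_right_mono) auto
  finally show ?thesis .
qed

lemma block_end_Suc: "block_end \<tau> (Suc n) = block_end \<tau> n + \<tau> (Suc n)"
  by (simp add: block_end_def)

lemma block_end_0: "block_end \<tau> 0 = 0" by (simp add: block_end_def)

lemma block_end_mono: "block_end \<tau> n \<le> block_end \<tau> (Suc n)" by (simp add: block_end_Suc)

definition c3 :: real where "c3 = sqrt (c / 4 * (1 / 2) powr a)"

lemma c3_pos: "c3 > 0" using c_a by (simp add: c3_def)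

text \<open>Only the later half of the blocks is counted: at least n / 2 of them, each of size at
  least c / 2 times (n / 2)^a.\<close>

lemma sqrt_block_end_ge: "c3 * real n powr ((a + 1) / 2) \<le> sqrt (real (block_end \<tau> n))"
proof -
  have "c / 4 * (1 / 2) powr a * real n powr (a + 1) \<le> real (block_end \<tau> n)"
  proof -
    have "real n / 2 * (c / 2 * (real n / 2) powr a) \<le> (\<Sum>k\<in>{k\<in>{1..n}. n \<le> 2 * k}. c / 2 * (real n / 2) powr a)"
    proof -
      have "{n - n div 2..n} - {0} \<subseteq> {k\<in>{1..n}. n \<le> 2 * k}" by auto
      then have "card ({n - n div 2..n} - {0}) \<le> card {k\<in>{1..n}. n \<le> 2 * k}" by (intro card_mono) auto
      moreover have "n \<le> 2 * card ({n - n div 2..n} - {0})"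
      proof (cases "n = 0")
        case False
        then have "{n - n div 2..n} - {0} = {n - n div 2..n}" by auto
        then show ?thesis by simp
      qed simp
      ultimately have "real n / 2 \<le> real (card {k\<in>{1..n}. n \<le> 2 * k})" by linarith
      then have "real n / 2 * (c / 2 * (real n / 2) powr a) \<le> real (card {k\<in>{1..n}. n \<le> 2 * k}) * (c / 2 * (real n / 2) powr a)"
        using c_a by (intro mult_right_mono) auto
      then show ?thesis by (simp only: sum_constant)
    qed
    also have "\<dots> \<le> (\<Sum>k\<in>{k\<in>{1..n}. n \<le> 2 * k}. real (\<tau> k))"
    proof (rule sum_mono)
      fix k assume k: "k \<in> {k\<in>{1..n}. n \<le> 2 * k}"
      have "c / 2 * (real n / 2) powr a \<le> c / 2 * real k powr a"
        using k c_a by (intro mult_left_mono powr_mono2) auto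
      then show "c / 2 * (real n / 2) powr a \<le> real (\<tau> k)" using tau_ge[of k] k by auto
    qed
    also have "\<dots> \<le> (\<Sum>k\<in>{1..n}. real (\<tau> k))" by (intro sum_mono2) auto
    also have "\<dots> = real (block_end \<tau> n)" by (simp add: block_end_def)
    finally have *: "real n / 2 * (c / 2 * (real n / 2) powr a) \<le> real (block_end \<tau> n)" .
    have "(real n / 2) powr a = (1 / 2) powr a * real n powr a" using powr_mult[of "1/2" "real n" a] by simp
    moreover have "real n powr (a + 1) = real n powr a * real n" by (simp add: powr_add)
    ultimately have "c / 4 * (1 / 2) powr a * real n powr (a + 1) = real n / 2 * (c / 2 * (real n / 2) powr a)"
      by (simp add: mult_ac)
    then show ?thesis using * by (simp only:)
  qed
  then have "sqrt (c / 4 * (1 / 2) powr a * real n powr (a + 1)) \<le> sqrt (real (block_end \<tau> n))" by (rule real_sqrt_le_mono)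
  moreover have "sqrt (real n powr (a + 1)) = real n powr ((a + 1) / 2)"
    by (simp add: powr_half_sqrt[symmetric] powr_powr)
  then have "c3 * real n powr ((a + 1) / 2) = sqrt (c / 4 * (1 / 2) powr a * real n powr (a + 1))"
    unfolding c3_def by (simp only: real_sqrt_mult)
  ultimately show ?thesis by (simp only:)
qed

text \<open>Since a > 1, one bounded term per block adds up to no more than the order of the
  martingale part.\<close>

lemma n_le_sqrt_block_end: "real n \<le> sqrt (real (block_end \<tau> n)) / c3"
proof (cases "n = 0")
  case False
  then have "real n powr 1 \<le> real n powr ((a + 1) / 2)" using c_a by (intro powr_mono) auto
  then have "real n \<le> real n powr ((a + 1) / 2)" using False by simp
  then have "c3 * real n \<le> sqrt (real (block_end \<tau> n))"
    using sqrt_block_end_ge[of n] c3_pos by (meson mult_left_mono less_imp_le order_trans)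
  then show ?thesis using c3_pos by (simp add: pos_le_divide_eq mult.commute)
qed (simp add: block_end_0)

lemma block_end_pos: "n \<ge> 1 \<Longrightarrow> block_end \<tau> n > 0"
  using tau(1)[of n] by (cases n) (auto simp: block_end_Suc)

text \<open>\<open>b0\<close> is the smallest admissible Monte Carlo exponent: the accumulated
  errors are at most of order n times n^((a - 1) / 2), the lower bound known for the root of the
  total block length.\<close>

lemma sum_tau_powr:
  defines "b0 \<equiv> (a + 1) / (2 * a)"
  shows "(\<Sum>k<n. real (\<tau> (Suc k)) powr (1 - b0)) \<le> c powr (1 - b0) / c3 * sqrt (real (block_end \<tau> n))"
proof (cases "n = 0")
  case False
  have b0: "1 - b0 \<ge> 0" "a * (1 - b0) = (a - 1) / 2" using c_a by (auto simp: b0_def field_simps)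
  have "(\<Sum>k<n. real (\<tau> (Suc k)) powr (1 - b0)) \<le> (\<Sum>k<n. c powr (1 - b0) * real n powr ((a - 1) / 2))"
  proof (rule sum_mono)
    fix k assume k: "k \<in> {..<n}"
    have "real (\<tau> (Suc k)) \<le> c * real n powr a"
      using tau_le[of "Suc k"] k c_a powr_mono2[of a "real (Suc k)" "real n"] by (auto intro: order_trans)
    then have "real (\<tau> (Suc k)) powr (1 - b0) \<le> (c * real n powr a) powr (1 - b0)" using b0 by (intro powr_mono2) auto
    also have "\<dots> = c powr (1 - b0) * real n powr (a * (1 - b0))" by (simp add: powr_mult powr_powr)
    finally show "real (\<tau> (Suc k)) powr (1 - b0) \<le> c powr (1 - b0) * real n powr ((a - 1) / 2)" using b0 by simp
  qed
  also have "\<dots> = c powr (1 - b0) * (real n powr ((a - 1) / 2) * real n powr 1)" using False by simp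
  also have "real n powr ((a - 1) / 2) * real n powr 1 = real n powr ((a + 1) / 2)"
    by (simp only: powr_add[symmetric]) (simp add: field_simps)
  also have "c powr (1 - b0) * real n powr ((a + 1) / 2) \<le> c powr (1 - b0) * (sqrt (real (block_end \<tau> n)) / c3)"
    using sqrt_block_end_ge[of n] c3_pos by (intro mult_left_mono) (auto simp: pos_le_divide_eq mult.commute)
  finally show ?thesis by simp
qed (simp add: block_end_0)

end

section \<open>Sums of block errors\<close>

context boem_blocks
begin

text \<open>All blocks share one martingale, whose increment at an observation time is that of the
  block containing this time. Separate bounds would add up the roots of the block sizes instead of
  giving the root of their sum. The predictable starts are merely summed. The weights
  \<open>w\<close> are there for the later convolution with powers of
  \<open>\<Gamma>\<close>.\<close>

lemma block_moment:
  fixes T :: "nat \<Rightarrow> nat" and w :: "nat \<Rightarrow> real"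
  assumes chi: "\<And>j. distribution_on lam (chi j)"
    and th: "\<And>j. th j \<in> borel_measurable (AA (int (T j)))" "\<And>j \<omega>. \<omega> \<in> space M \<Longrightarrow> th j \<omega> \<in> \<Theta>"
    and T: "\<And>j. T j \<le> T (Suc j)" and w: "\<And>j. \<bar>w j\<bar> \<le> 1" and n: "i0 \<le> n"
  shows "Lp_le M p (\<lambda>\<omega>. \<Sum>j\<in>{i0..<n}. w j * B (chi j) (th j) (int (T j)) (int (T (Suc j))) l \<omega>)
    (C2 * real (n - i0) + martingale_const p * C2 * sqrt (real (T n - T i0)))"
proof -
  define Bj where "Bj j = B (chi j) (th j) (int (T j)) (int (T (Suc j))) l" for j
  have Tint: "int (T j) \<le> int (T (Suc j))" for j using T by simp
  have Tmono: "i \<le> j \<Longrightarrow> T i \<le> T j" for i j using T by (rule lift_Suc_mono_le)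
  note facts = chi th(1) th(2) Tint
  define E where "E j s = real_cond_exp M (AA s) (Bj j)" for j s
  \<comment> \<open>The block containing time s, where block j covers the times from
    \<open>T j + 1\<close> to \<open>T (Suc j)\<close>.\<close>
  define blk where "blk s = (LEAST j. s \<le> T (Suc j))" for s
  have blk: "blk s = j" if "T j < s" "s \<le> T (Suc j)" for s j
    unfolding blk_def
  proof (rule Least_equality)
    fix j' assume "s \<le> T (Suc j')"
    show "j \<le> j'"
    proof (rule ccontr)
      assume "\<not> j \<le> j'"
      then have "T (Suc j') \<le> T j" by (intro Tmono) simp
      then show False using that \<open>s \<le> T (Suc j')\<close> by simp
    qed
  qed (rule that)
  have blk_range: "T (blk s) < s \<and> s \<le> T (Suc (blk s))" if "T i0 < s" "s \<le> T n" for s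
  proof -
    have n0: "n \<noteq> 0" using that n by (cases n) auto
    then have "s \<le> T (Suc (n - 1))" using that by simp
    then have up: "s \<le> T (Suc (blk s))" unfolding blk_def by (rule LeastI)
    have "T (blk s) < s"
    proof (cases "blk s")
      case 0
      then show ?thesis using Tmono[of 0 i0] that by simp
    next
      case (Suc j)
      then have "j < blk s" by simp
      then have "\<not> s \<le> T (Suc j)" unfolding blk_def by (rule not_less_Least)
      then show ?thesis using Suc by simp
    qed
    then show ?thesis using up by simp
  qed
  define D where "D s \<omega> = w (blk s) * (E (blk s) (int s) \<omega> - E (blk s) (int s - 1) \<omega>)" for s \<omega>
  have blocksum: "(\<Sum>s\<in>{T j + 1..T (Suc j)}. D s \<omega>) = w j * (\<Sum>s\<in>{int (T j) + 1..int (T (Suc j))}. E j s \<omega> - E j (s - 1) \<omega>)" for j \<omega>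
  proof -
    have "(\<Sum>s\<in>{T j + 1..T (Suc j)}. D s \<omega>) = (\<Sum>s\<in>{T j + 1..T (Suc j)}. w j * (E j (int s) \<omega> - E j (int s - 1) \<omega>))"
      by (intro sum.cong refl) (auto simp: D_def blk[of j])
    also have "\<dots> = (\<Sum>s\<in>{int (T j) + 1..int (T (Suc j))}. w j * (E j s \<omega> - E j (s - 1) \<omega>))"
      by (rule sum.reindex_bij_witness[of _ nat int]) auto
    finally show ?thesis by (simp add: sum_distrib_left)
  qed
  have total: "(\<Sum>s\<in>{T i0 + 1..T k}. D s \<omega>) = (\<Sum>j\<in>{i0..<k}. w j * (\<Sum>s\<in>{int (T j) + 1..int (T (Suc j))}. E j s \<omega> - E j (s - 1) \<omega>))" if "i0 \<le> k" for k \<omega>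
    using that
  proof (induction rule: dec_induct)
    case (step k)
    have "{T i0 + 1..T (Suc k)} = {T i0 + 1..T k} \<union> {T k + 1..T (Suc k)}"
      using Tmono[of i0 k] T[of k] step.hyps by auto
    then have "(\<Sum>s\<in>{T i0 + 1..T (Suc k)}. D s \<omega>) = (\<Sum>s\<in>{T i0 + 1..T k}. D s \<omega>) + (\<Sum>s\<in>{T k + 1..T (Suc k)}. D s \<omega>)"
      by (simp add: sum.union_disjoint)
    then show ?case using step blocksum[of \<omega> k] by simp
  qed simp
  let ?N = "T n - T i0"
  have shift: "(\<Sum>i<?N. D (T i0 + i + 1) \<omega>) = (\<Sum>s\<in>{T i0 + 1..T n}. D s \<omega>)" for \<omega>
    by (rule sum.reindex_bij_witness[of _ "\<lambda>s. s - T i0 - 1" "\<lambda>i. T i0 + i + 1"]) auto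
  have L1: "Lp_le M p (\<lambda>\<omega>. \<Sum>i<?N. D (T i0 + i + 1) \<omega>) (martingale_const p * C2 * sqrt (real ?N))"
  proof (rule martingale_moment[OF prob_space_axioms, where F = "\<lambda>i. AA (int (T i0 + i))"])
    show "subalgebra M (AA (int (T i0 + i)))" for i by (rule subalgebra_AA)
    show "sets (AA (int (T i0 + i))) \<subseteq> sets (AA (int (T i0 + Suc i)))" for i by (rule AA_mono) simp
    fix i assume "i < ?N"
    then have s: "T i0 < T i0 + i + 1" "T i0 + i + 1 \<le> T n" by auto
    let ?s = "T i0 + i + 1"
    let ?j = "blk ?s"
    have r: "int (T ?j) < int ?s" "int ?s \<le> int (T (Suc ?j))" using blk_range[OF s] by auto
    have s1: "int ?s - 1 = int (T i0 + i)" by simp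
    have inc: "Lp_le M p (\<lambda>\<omega>. E ?j (int ?s) \<omega> - E ?j (int ?s - 1) \<omega>) C2"
      unfolding E_def Bj_def by (rule B_increment[OF facts r])
    have "Lp_le M p (D ?s) (\<bar>w ?j\<bar> * C2)" unfolding D_def by (rule Lp_le_cmult[OF inc])
    then show "Lp_le M p (D ?s) C2"
      by (rule Lp_le_mono) (use w[of ?j] C2_pos p in \<open>auto simp: mult_le_cancel_right1\<close>)
    have Em: "E ?j v \<in> borel_measurable (AA (int (T i0 + Suc i)))" if "v \<le> int ?s" for v
      using measurable_from_subalg[OF subalgebra_AA_mono borel_measurable_cond_exp, of v "int (T i0 + Suc i)"] that
      unfolding E_def by simp
    show "D ?s \<in> borel_measurable (AA (int (T i0 + Suc i)))"
      unfolding D_def using Em[of "int ?s"] Em[of "int ?s - 1"] by measurable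
    have im: "integrable M (\<lambda>\<omega>. E ?j (int ?s) \<omega> - E ?j (int ?s - 1) \<omega>)"
      by (rule Lp_le_integrable[OF finite_measure_axioms _ inc]) (use p in simp)
    have "AE \<omega> in M. real_cond_exp M (AA (int ?s - 1)) (D ?s) \<omega> = w ?j * real_cond_exp M (AA (int ?s - 1)) (\<lambda>\<omega>. E ?j (int ?s) \<omega> - E ?j (int ?s - 1) \<omega>) \<omega>"
      unfolding D_def by (rule sigma_finite_subalgebra.real_cond_exp_cmult[OF sigma_finite_subalgebra_AA im])
    moreover have "AE \<omega> in M. real_cond_exp M (AA (int ?s - 1)) (\<lambda>\<omega>. E ?j (int ?s) \<omega> - E ?j (int ?s - 1) \<omega>) \<omega> = 0"
      unfolding E_def Bj_def by (rule B_increment_centred[OF facts])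
    ultimately show "AE \<omega> in M. real_cond_exp M (AA (int (T i0 + i))) (D ?s) \<omega> = 0"
      unfolding s1 by eventually_elim simp
  qed (use p C2_pos in auto)
  have L2: "Lp_le M p (\<lambda>\<omega>. \<Sum>j\<in>{i0..<n}. w j * E j (int (T j)) \<omega>) (\<Sum>j\<in>{i0..<n}. C2)"
  proof (rule Lp_le_sum)
    fix j
    have "Lp_le M p (\<lambda>\<omega>. w j * E j (int (T j)) \<omega>) (\<bar>w j\<bar> * C2)"
      unfolding E_def Bj_def by (rule Lp_le_cmult[OF B_cond_exp_start[OF facts]])
    then show "Lp_le M p (\<lambda>\<omega>. w j * E j (int (T j)) \<omega>) C2"
      by (rule Lp_le_mono) (use w[of j] C2_pos p in \<open>auto simp: mult_le_cancel_right1\<close>)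
  qed (use p in auto)
  have L: "Lp_le M p (\<lambda>\<omega>. (\<Sum>j\<in>{i0..<n}. w j * E j (int (T j)) \<omega>) + (\<Sum>i<?N. D (T i0 + i + 1) \<omega>))
     (C2 * real (n - i0) + martingale_const p * C2 * sqrt (real ?N))"
    using Lp_le_add[OF _ L2 L1] p by (simp add: mult.commute)
  have "AE \<omega> in M. \<forall>j. Bj j \<omega> = E j (int (T j)) \<omega> + (\<Sum>s\<in>{int (T j) + 1..int (T (Suc j))}. E j s \<omega> - E j (s - 1) \<omega>)"
    unfolding AE_all_countable E_def Bj_def using B_decomposition[OF facts] by blast
  then have "AE \<omega> in M. (\<Sum>j\<in>{i0..<n}. w j * Bj j \<omega>) = (\<Sum>j\<in>{i0..<n}. w j * E j (int (T j)) \<omega>) + (\<Sum>i<?N. D (T i0 + i + 1) \<omega>)"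
    unfolding shift total[OF n] by eventually_elim (simp add: distrib_left sum.distrib)
  then have "AE \<omega> in M. \<bar>\<Sum>j\<in>{i0..<n}. w j * Bj j \<omega>\<bar> \<le> \<bar>(\<Sum>j\<in>{i0..<n}. w j * E j (int (T j)) \<omega>) + (\<Sum>i<?N. D (T i0 + i + 1) \<omega>)\<bar>"
    by eventually_elim simp
  moreover have "(\<lambda>\<omega>. \<Sum>j\<in>{i0..<n}. w j * Bj j \<omega>) \<in> borel_measurable M"
    unfolding Bj_def using borel_measurable_integrable[OF B_integrable[OF facts]] by auto
  ultimately show ?thesis unfolding Bj_def[symmetric] using p by (intro Lp_le_dominated[OF L]) auto
qed

end

section \<open>Almost sure convergence and vector norms\<close>

text \<open>The series of the p-th powers has finite expectation, so almost surely it converges and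
  its terms vanish in the limit.\<close>

lemma AE_tendsto_0_of_summable_moments:
  assumes M: "prob_space M" and p: "p > 0" and Z: "\<And>n. Lp_le M p (Z n) (c n)" and s: "summable (\<lambda>n. c n powr p)"
  shows "AE \<omega> in M. (\<lambda>n. Z n \<omega>) \<longlonglongrightarrow> 0"
proof -
  have [measurable]: "Z n \<in> borel_measurable M" for n using Lp_leD(1)[OF Z] .
  have "(\<integral>\<^sup>+\<omega>. (\<Sum>n. ennreal (\<bar>Z n \<omega>\<bar> powr p)) \<partial>M) = (\<Sum>n. \<integral>\<^sup>+\<omega>. ennreal (\<bar>Z n \<omega>\<bar> powr p) \<partial>M)"
    by (rule nn_integral_suminf) measurable
  also have "\<dots> \<le> (\<Sum>n. ennreal (c n powr p))"
  proof (intro suminf_le allI)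
    fix n show "(\<integral>\<^sup>+\<omega>. ennreal (\<bar>Z n \<omega>\<bar> powr p) \<partial>M) \<le> ennreal (c n powr p)"
      using Lp_leD(2,4)[OF Z[of n]] by (subst nn_integral_eq_integral) (auto intro: ennreal_leI)
  qed auto
  also have "\<dots> < \<infinity>" using s by (simp add: suminf_ennreal_eq[OF _ summable_sums[OF s]] less_top[symmetric])
  finally have "AE \<omega> in M. (\<Sum>n. ennreal (\<bar>Z n \<omega>\<bar> powr p)) \<noteq> \<infinity>" by (intro nn_integral_PInf_AE) auto
  then show ?thesis
  proof eventually_elim
    case (elim \<omega>)
    then have "summable (\<lambda>n. \<bar>Z n \<omega>\<bar> powr p)" by (intro summable_suminf_not_top) auto
    then have "(\<lambda>n. \<bar>Z n \<omega>\<bar> powr p) \<longlonglongrightarrow> 0" by (rule summable_LIMSEQ_zero)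
    then have "(\<lambda>n. (\<bar>Z n \<omega>\<bar> powr p) powr (1 / p)) \<longlonglongrightarrow> 0 powr (1 / p)"
      using p by (intro tendsto_powr') auto
    then have "(\<lambda>n. \<bar>Z n \<omega>\<bar>) \<longlonglongrightarrow> 0" using p by (simp add: powr_powr)
    then show ?case by (rule tendsto_rabs_zero_cancel)
  qed
qed

lemma Lp_le_norm_vec:
  fixes Z :: "'w \<Rightarrow> real^'n"
  assumes p: "p \<ge> 1" and Z: "\<And>i. Lp_le M p (\<lambda>\<omega>. Z \<omega> $ i) c"
  shows "Lp_le M p (\<lambda>\<omega>. norm (Z \<omega>)) (real CARD('n) * c)"
proof -
  have ab: "Lp_le M p (\<lambda>\<omega>. \<bar>Z \<omega> $ i\<bar>) c" for i
    using Z[of i] unfolding Lp_le_def by auto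
  have S: "Lp_le M p (\<lambda>\<omega>. \<Sum>i\<in>UNIV. \<bar>Z \<omega> $ i\<bar>) (\<Sum>i\<in>(UNIV::'n set). c)"
    by (rule Lp_le_sum[OF p ab]) auto
  have "(\<lambda>\<omega>. (\<chi> i. Z \<omega> $ i)) \<in> borel_measurable M"
    by (rule borel_measurable_vec_lambda) (rule Lp_leD(1)[OF Z])
  then have "Z \<in> borel_measurable M" by simp
  then have "Lp_le M p (\<lambda>\<omega>. norm (Z \<omega>)) (\<Sum>i\<in>(UNIV::'n set). c)"
    by (intro Lp_le_dominated[OF S]) (use p norm_le_l1_cart in \<open>auto simp: sum_nonneg\<close>)
  then show ?thesis by simp
qed

lemma Lp_le_square:
  assumes "Lp_le M p Z c" "p > 0"
  shows "Lp_le M (p / 2) (\<lambda>\<omega>. (Z \<omega>)\<^sup>2) (c\<^sup>2)"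
proof -
  have e: "\<bar>x\<^sup>2\<bar> powr (p / 2) = \<bar>x\<bar> powr p" for x :: real
  proof (cases "x = 0")
    case False
    have s: "x\<^sup>2 = \<bar>x\<bar> powr 2" using False by (simp add: powr_numeral)
    have "\<bar>x\<^sup>2\<bar> = \<bar>x\<bar> powr 2" using s by simp
    then show ?thesis by (simp only: powr_powr) simp
  qed (use assms in simp)
  have "(c\<^sup>2) powr (p / 2) = c powr p" using e[of c] Lp_leD(3)[OF assms(1)] by simp
  then show ?thesis using assms(1) unfolding Lp_le_def e by (auto intro: borel_measurable_power)
qed

lemma nn_integral_of_Lp_le:
  assumes "Lp_le M p Z c"
  shows "(\<integral>\<^sup>+\<omega>. ennreal (norm (Z \<omega>) powr p) \<partial>M) \<le> ennreal (c powr p)"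
  using Lp_leD[OF assms] by (subst nn_integral_eq_integral) (auto intro: ennreal_leI)

text \<open>A vector is split along its own direction into a part of norm at most \<open>u\<close> and the rest.\<close>

lemma O_decomposition:
  fixes x :: "nat \<Rightarrow> 'w \<Rightarrow> real^'k" and s :: "nat \<Rightarrow> real"
  assumes M: "prob_space M" and x[measurable]: "\<And>n. n \<ge> 1 \<Longrightarrow> x n \<in> borel_measurable M"
    and U: "\<And>n. n \<ge> 1 \<Longrightarrow> Lp_le M p (u n) cu" and V: "\<And>n. n \<ge> 1 \<Longrightarrow> Lp_le M (p / 2) (v n) cv"
    and v1: "\<And>n \<omega>. n \<ge> 1 \<Longrightarrow> 1 \<le> v n \<omega>" and s: "\<And>n. n \<ge> 1 \<Longrightarrow> s n > 0" and p: "p > 0"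
    and le: "AE \<omega> in M. \<exists>A. \<forall>n\<ge>1. norm (x n \<omega>) \<le> \<bar>u n \<omega>\<bar> + s n * (A * v n \<omega>)"
  shows "\<exists>(U :: nat \<Rightarrow> 'w \<Rightarrow> real^'k) (V :: nat \<Rightarrow> 'w \<Rightarrow> real^'k) (A :: nat \<Rightarrow> 'w \<Rightarrow> real).
       O_Lp M p U \<and> O_Lp M (p / 2) V \<and> O_as M A \<and> (\<forall>n\<ge>1. \<forall>\<omega>\<in>space M. x n \<omega> = U n \<omega> + s n *\<^sub>R (A n \<omega> *\<^sub>R V n \<omega>))"
proof -
  have um[measurable]: "u n \<in> borel_measurable M" if "n \<ge> 1" for n using Lp_leD(1)[OF U[OF that]] .
  have vm[measurable]: "v n \<in> borel_measurable M" if "n \<ge> 1" for n using Lp_leD(1)[OF V[OF that]] .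
  \<comment> \<open>The direction of the vector, equal to 0 where the vector is 0.\<close>
  define y where "y n \<omega> = (1 / norm (x n \<omega>)) *\<^sub>R x n \<omega>" for n \<omega>
  have ny: "norm (y n \<omega>) \<le> 1" for n \<omega> by (simp add: y_def)
  have xy: "x n \<omega> = norm (x n \<omega>) *\<^sub>R y n \<omega>" for n \<omega> by (simp add: y_def)
  have ym[measurable]: "y n \<in> borel_measurable M" if "n \<ge> 1" for n unfolding y_def using x[OF that] by measurable
  define Uf where "Uf n \<omega> = min (norm (x n \<omega>)) \<bar>u n \<omega>\<bar> *\<^sub>R y n \<omega>" for n \<omega>
  define Vf where "Vf n \<omega> = v n \<omega> *\<^sub>R y n \<omega>" for n \<omega>
  \<comment> \<open>The smallest admissible factor, given by an explicit formula so that it is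
    measurable, whereas the bound in the hypothesis may depend on the point in an arbitrary
    way.\<close>
  define Af where "Af n \<omega> = max 0 (norm (x n \<omega>) - \<bar>u n \<omega>\<bar>) / (s n * v n \<omega>)" for n \<omega>
  have ineq: "(SUP n\<in>{1..}. f n) < \<infinity>" if "\<And>n. n \<ge> 1 \<Longrightarrow> f n \<le> ennreal c" for f :: "nat \<Rightarrow> ennreal" and c
    by (rule le_less_trans[OF SUP_least]) (use that in auto)
  have "O_Lp M p Uf"
    unfolding O_Lp_def
  proof (intro conjI allI impI ineq)
    fix n :: nat assume n: "n \<ge> 1"
    show "Uf n \<in> borel_measurable M" unfolding Uf_def using x[OF n] um[OF n] ym[OF n] by measurable
    have "norm (Uf n \<omega>) powr p \<le> norm (u n \<omega>) powr p" for \<omega>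
    proof (rule powr_mono2)
      have "norm (Uf n \<omega>) \<le> \<bar>u n \<omega>\<bar> * norm (y n \<omega>)" unfolding Uf_def by (simp add: mult_right_mono)
      also have "\<dots> \<le> \<bar>u n \<omega>\<bar>" using ny[of n \<omega>] by (simp add: mult_left_le)
      finally show "norm (Uf n \<omega>) \<le> norm (u n \<omega>)" by simp
    qed (use p in auto)
    then have "(\<integral>\<^sup>+\<omega>. ennreal (norm (Uf n \<omega>) powr p) \<partial>M) \<le> (\<integral>\<^sup>+\<omega>. ennreal (norm (u n \<omega>) powr p) \<partial>M)"
      by (intro nn_integral_mono ennreal_leI)
    also have "\<dots> \<le> ennreal (cu powr p)" by (rule nn_integral_of_Lp_le[OF U[OF n]])
    finally show "(\<integral>\<^sup>+\<omega>. ennreal (norm (Uf n \<omega>) powr p) \<partial>M) \<le> ennreal (cu powr p)" .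
  qed
  moreover have "O_Lp M (p / 2) Vf"
    unfolding O_Lp_def
  proof (intro conjI allI impI ineq)
    fix n :: nat assume n: "n \<ge> 1"
    show "Vf n \<in> borel_measurable M" unfolding Vf_def using vm[OF n] ym[OF n] by measurable
    have "norm (Vf n \<omega>) powr (p / 2) \<le> norm (v n \<omega>) powr (p / 2)" for \<omega>
      using ny[of n \<omega>] p by (intro powr_mono2) (auto simp: Vf_def mult_left_le)
    then have "(\<integral>\<^sup>+\<omega>. ennreal (norm (Vf n \<omega>) powr (p / 2)) \<partial>M) \<le> (\<integral>\<^sup>+\<omega>. ennreal (norm (v n \<omega>) powr (p / 2)) \<partial>M)"
      by (intro nn_integral_mono ennreal_leI)
    also have "\<dots> \<le> ennreal (cv powr (p / 2))" by (rule nn_integral_of_Lp_le[OF V[OF n]])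
    finally show "(\<integral>\<^sup>+\<omega>. ennreal (norm (Vf n \<omega>) powr (p / 2)) \<partial>M) \<le> ennreal (cv powr (p / 2))" .
  qed
  moreover have "O_as M Af"
    unfolding O_as_def
  proof (intro conjI allI impI)
    fix n :: nat assume n: "n \<ge> 1"
    show "Af n \<in> borel_measurable M" unfolding Af_def using x[OF n] um[OF n] vm[OF n] by measurable
  next
    show "AE \<omega> in M. bdd_above ((\<lambda>n. norm (Af n \<omega>)) ` {1..})"
      using le
    proof eventually_elim
      case (elim \<omega>)
      then obtain A where A: "\<And>n. n \<ge> 1 \<Longrightarrow> norm (x n \<omega>) \<le> \<bar>u n \<omega>\<bar> + s n * (A * v n \<omega>)" by blast
      have "norm (Af n \<omega>) \<le> max 0 A" if n: "n \<ge> 1" for n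
      proof -
        have sv: "s n * v n \<omega> > 0" using s[OF n] v1[OF n, of \<omega>] by simp
        have "norm (x n \<omega>) - \<bar>u n \<omega>\<bar> \<le> A * (s n * v n \<omega>)" using A[OF n] by (simp add: mult_ac)
        also have "\<dots> \<le> max 0 A * (s n * v n \<omega>)" using sv by (intro mult_right_mono) auto
        finally have "max 0 (norm (x n \<omega>) - \<bar>u n \<omega>\<bar>) \<le> max 0 A * (s n * v n \<omega>)"
          using sv by simp
        then show ?thesis using sv by (simp add: Af_def pos_divide_le_eq)
      qed
      then show ?case by (intro bdd_aboveI[of _ "max 0 A"]) auto
    qed
  qed
  moreover have "\<forall>n\<ge>1. \<forall>\<omega>\<in>space M. x n \<omega> = Uf n \<omega> + s n *\<^sub>R (Af n \<omega> *\<^sub>R Vf n \<omega>)"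
  proof (intro allI impI ballI)
    fix n :: nat and \<omega> assume n: "n \<ge> 1"
    have sv: "s n * v n \<omega> > 0" using s[OF n] v1[OF n, of \<omega>] by simp
    have "s n *\<^sub>R (Af n \<omega> *\<^sub>R Vf n \<omega>) = (s n * v n \<omega> * Af n \<omega>) *\<^sub>R y n \<omega>" by (simp add: Vf_def mult_ac)
    also have "s n * v n \<omega> * Af n \<omega> = max 0 (norm (x n \<omega>) - \<bar>u n \<omega>\<bar>)"
      unfolding Af_def using sv by (simp only: times_divide_eq_right nonzero_mult_div_cancel_left less_imp_neq[symmetric] not_False_eq_True)
    finally have "Uf n \<omega> + s n *\<^sub>R (Af n \<omega> *\<^sub>R Vf n \<omega>) = (min (norm (x n \<omega>)) \<bar>u n \<omega>\<bar> + max 0 (norm (x n \<omega>) - \<bar>u n \<omega>\<bar>)) *\<^sub>R y n \<omega>"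
      by (simp add: Uf_def scaleR_add_left)
    also have "min (norm (x n \<omega>)) \<bar>u n \<omega>\<bar> + max 0 (norm (x n \<omega>) - \<bar>u n \<omega>\<bar>) = norm (x n \<omega>)" by (simp add: min_def max_def)
    finally show "x n \<omega> = Uf n \<omega> + s n *\<^sub>R (Af n \<omega> *\<^sub>R Vf n \<omega>)" using xy by simp
  qed
  ultimately show ?thesis by blast
qed

section \<open>The averaged algorithm\<close>

lemma C2_on_continuous: 
  assumes "C2_on f A" shows "continuous_on A f"
proof -
  obtain U F F' where F: "A \<subseteq> U" "\<And>x. x \<in> A \<Longrightarrow> F x = f x" "\<And>x. x \<in> U \<Longrightarrow> (F has_derivative blinfun_apply (F' x)) (at x)"
    using assms unfolding C2_on_def by metis
  have "continuous_on A F"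
    by (intro continuous_at_imp_continuous_on ballI has_derivative_continuous[OF F(3)]) (use F(1) in auto)
  then show ?thesis using F(2) by (simp cong: continuous_on_cong)
qed

text \<open>Near \<open>s0\<close> this is the Taylor bound; elsewhere the range is bounded while
  the distance to \<open>s0\<close> is at least d. A bound on all of \<open>U\<close> is wanted
  because the averaged statistic may be far from \<open>s0\<close>.\<close>

lemma C2_on_lipschitz_bounded_range:
  fixes h :: "'a::euclidean_space \<Rightarrow> 'b::euclidean_space"
  assumes h: "C2_on h U" "s0 \<in> U" and B: "\<And>s. s \<in> U \<Longrightarrow> norm (h s) \<le> B"
  shows "\<exists>L\<ge>0. \<forall>s\<in>U. norm (h s - h s0) \<le> L * norm (s - s0)"
proof -
  obtain h' Kh d where h': "bounded_linear h'" "d > 0" "Kh \<ge> 0"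
    "\<And>x. x \<in> U \<Longrightarrow> dist x s0 < d \<Longrightarrow> norm (h x - h s0 - h' (x - s0)) \<le> Kh * norm (x - s0) ^ 2"
    using C2_on_quadratic_bound[OF h] by metis
  obtain Bh where Bh: "Bh > 0" "\<And>x. norm (h' x) \<le> norm x * Bh" using bounded_linear.pos_bounded[OF h'(1)] by blast
  have B0: "B \<ge> 0" using B[OF h(2)] norm_ge_zero order_trans by blast
  define L where "L = max (Kh * d + Bh) (2 * B / d)"
  have L0: "L \<ge> 0" using B0 h' by (simp add: L_def max.coboundedI2)
  have "norm (h s - h s0) \<le> L * norm (s - s0)" if s: "s \<in> U" for s
  proof (cases "norm (s - s0) < d")
    case True
    have "norm (h s - h s0) \<le> norm (h s - h s0 - h' (s - s0)) + norm (h' (s - s0))" by (metis diff_add_cancel norm_triangle_ineq)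
    also have "\<dots> \<le> Kh * norm (s - s0) ^ 2 + norm (s - s0) * Bh" using h'(4)[OF s] True by (intro add_mono Bh) (simp add: dist_norm)
    also have "Kh * norm (s - s0) ^ 2 \<le> Kh * (d * norm (s - s0))"
      unfolding power2_eq_square using True h' by (intro mult_left_mono mult_right_mono) auto
    also have "Kh * (d * norm (s - s0)) + norm (s - s0) * Bh = (Kh * d + Bh) * norm (s - s0)" by (simp add: algebra_simps)
    also have "\<dots> \<le> L * norm (s - s0)" by (intro mult_right_mono) (auto simp: L_def)
    finally show ?thesis by simp
  next
    case False
    have "norm (h s - h s0) \<le> 2 * B" using B[OF s] B[OF h(2)] norm_triangle_ineq4[of "h s" "h s0"] by linarith
    also have "\<dots> = 2 * B / d * d" using h' by simp
    also have "\<dots> \<le> L * norm (s - s0)" using False L0 h' by (intro mult_mono) (auto simp: L_def)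
    finally show ?thesis .
  qed
  then show ?thesis using L0 by blast
qed

locale boem_algorithm =
  boem_blocks \<Theta> lam mu m g \<phi> \<psi> S sm sp K M Y pbar chi0 HH bk \<beta> Cb p + block_sizes c a \<tau>
  for \<Theta> :: "(real^'k) set" and lam :: "'x measure" and mu :: "'y measure"
    and m :: "real^'k \<Rightarrow> 'x \<Rightarrow> 'x \<Rightarrow> real" and g :: "real^'k \<Rightarrow> 'x \<Rightarrow> 'y \<Rightarrow> real"
    and \<phi> :: "real^'k \<Rightarrow> real" and \<psi> :: "real^'k \<Rightarrow> real^'d" and S :: "'x \<Rightarrow> 'x \<Rightarrow> 'y \<Rightarrow> real^'d"
    and sm sp :: real and K :: "'x measure set" and M :: "'w measure"
    and Y :: "int \<Rightarrow> 'w \<Rightarrow> 'y" and pbar :: real and chi0 :: "'x measure"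
    and HH :: "'w set set" and bk :: "nat \<Rightarrow> real" and \<beta> Cb p c a :: real and \<tau> :: "nat \<Rightarrow> nat" +
  fixes chi :: "nat \<Rightarrow> 'x measure" and \<theta> :: "nat \<Rightarrow> 'w \<Rightarrow> real^'k" and St Sn :: "nat \<Rightarrow> 'w \<Rightarrow> real^'d"
    and SS :: "(real^'d) set" and \<theta>bar :: "real^'d \<Rightarrow> real^'k" and \<theta>star :: "real^'k" and gam Cm :: real
  assumes chi: "\<And>n. distribution_on lam (chi n)" "\<And>n. chi n \<in> K"
    and theta_AA: "\<And>n. \<theta> n \<in> borel_measurable (AA (int (block_end \<tau> n)))"
    and theta_in: "\<And>n \<omega>. \<omega> \<in> space M \<Longrightarrow> \<theta> n \<omega> \<in> \<Theta>"
    and theta_Suc: "\<And>n \<omega>. \<omega> \<in> space M \<Longrightarrow> \<theta> (Suc n) \<omega> = \<theta>bar (St n \<omega>)"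
    and St: "\<And>n. St n \<in> borel_measurable M" "\<And>n \<omega>. \<omega> \<in> space M \<Longrightarrow> St n \<omega> \<in> SS"
    and Sn: "\<And>n \<omega>. \<omega> \<in> space M \<Longrightarrow> Sn n \<omega> =
      block_stat lam (m (\<theta> n \<omega>)) (g (\<theta> n \<omega>)) (chi n) (block_end \<tau> n) (\<tau> (Suc n)) S (\<lambda>k. Y k \<omega>)"
    and SS: "open SS" "convex hull (range (\<lambda>(x, x', y). S x x' y)) \<subseteq> SS"
    and theta_bar_in: "\<And>s. s \<in> SS \<Longrightarrow> \<theta>bar s \<in> \<Theta>"
    and averaged_in: "\<And>n \<omega>. n \<ge> 1 \<Longrightarrow> \<omega> \<in> space M \<Longrightarrow> averaged_stat \<tau> St n \<omega> \<in> SS"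
    and Cm: "Cm > 0"
    and MC: "\<And>n. Lp_le M p (\<lambda>\<omega>. norm (Sn n \<omega> - St n \<omega>)) (Cm * real (\<tau> (Suc n)) powr (- ((a + 1) / (2 * a))))"
    and theta_star: "\<theta>star \<in> \<Theta>" "\<theta>bar (mean_stat M Y lam m g S \<theta>star) = \<theta>star"
    and smooth: "C2_on (mean_stat M Y lam m g S) \<Theta>" "C2_on \<theta>bar SS"
    and gam: "0 < gam" "gam < 1"
      "spectral_radius (jacobian (mean_stat M Y lam m g S \<circ> \<theta>bar) (at (mean_stat M Y lam m g S \<theta>star))) < gam"
begin

abbreviation T :: "nat \<Rightarrow> nat" where "T \<equiv> block_end \<tau>"

definition sstar :: "real^'d" where "sstar = Sb \<theta>star"

lemma sstar_in: "sstar \<in> SS"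
  unfolding sstar_def using mean_stat_in_hull[OF theta_star(1)] SS(2) by blast

abbreviation tt :: "nat \<Rightarrow> real" where "tt k \<equiv> real (\<tau> (Suc k))"

lemma tt_ge1: "1 \<le> tt k" using tau(1)[of "Suc k"] by simp

definition e :: "nat \<Rightarrow> 'w \<Rightarrow> real^'d" where "e k \<omega> = St k \<omega> - Sb (\<theta> k \<omega>)"

definition Bk :: "nat \<Rightarrow> 'd \<Rightarrow> 'w \<Rightarrow> real" where
  "Bk k l = B (chi k) (\<theta> k) (int (T k)) (int (T (Suc k))) l"

lemma T_le: "int (T k) \<le> int (T (Suc k))" by (simp add: block_end_mono)

lemma Bk_measurable: "Bk k l \<in> borel_measurable M"
  unfolding Bk_def using borel_measurable_integrable[OF B_integrable[OF chi(1) theta_AA theta_in T_le]] .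

lemma theta_measurable: "\<theta> k \<in> borel_measurable M"
  by (rule measurable_from_subalg[OF subalgebra_AA theta_AA])

lemma measurable_vec_nth_comp: "f \<in> borel_measurable M \<Longrightarrow> (\<lambda>\<omega>. (f \<omega> :: real^'d) $ l) \<in> borel_measurable M"
proof -
  assume "f \<in> borel_measurable M"
  then have "(\<lambda>\<omega>. f \<omega> \<bullet> axis l 1) \<in> borel_measurable M" by measurable
  then show ?thesis by (simp add: inner_axis)
qed

lemma e_comp_measurable: "(\<lambda>\<omega>. e k \<omega> $ l) \<in> borel_measurable M"
proof -
  have "(\<lambda>\<omega>. St k \<omega> $ l - Sb (\<theta> k \<omega>) $ l) \<in> borel_measurable M"
    by (intro borel_measurable_diff measurable_vec_nth_comp St Sb_comp_measurable theta_measurable theta_in)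
  then show ?thesis by (simp add: e_def)
qed

text \<open>The first transition of a block starts from \<open>chi k\<close>; its membership in
  \<open>K\<close> makes the truncated components exact along every good path.\<close>

lemma Sn_component:
  assumes w: "\<omega> \<in> space M" and y: "good (\<lambda>k. Y k \<omega>)"
  shows "tt k * (Sn k \<omega> $ l - Sb (\<theta> k \<omega>) $ l) = Bk k l \<omega>"
proof -
  let ?s = "\<lambda>t. smo (\<theta> k \<omega>) (chi k) (int (T k)) t (int (T (Suc k))) l \<omega>"
  have Sc: "smoothing lam (m (\<theta> k \<omega>)) (g (\<theta> k \<omega>)) (chi k) (int (T k)) t (int (T (Suc k))) S (\<lambda>k. Y k \<omega>) $ l = ?s t"
    if "t \<in> {int (T k) + 1..int (T (Suc k))}" for t
    by (rule smoothing_S_component[OF theta_in[OF w] y chi(1)]) (use that chi(2) in auto)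
  have "tt k * (Sn k \<omega> $ l) = (\<Sum>t = T k + 1..T k + \<tau> (Suc k). smoothing lam (m (\<theta> k \<omega>)) (g (\<theta> k \<omega>)) (chi k) (int (T k)) (int t) (int (T k + \<tau> (Suc k))) S (\<lambda>k. Y k \<omega>) $ l)"
    using tt_ge1[of k] unfolding Sn[OF w] block_stat_def by (simp add: sum_distrib_left)
  also have "\<dots> = (\<Sum>t\<in>{T k + 1..T (Suc k)}. ?s (int t))"
    unfolding block_end_Suc[symmetric] by (intro sum.cong refl Sc) auto
  also have "\<dots> = (\<Sum>t\<in>{int (T k) + 1..int (T (Suc k))}. ?s t)"
    by (rule sum.reindex_bij_witness[of _ nat int]) auto
  finally have 1: "tt k * (Sn k \<omega> $ l) = \<dots>" .
  have "B (chi k) (\<theta> k) (int (T k)) (int (T (Suc k))) l \<omega> =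
      (\<Sum>t\<in>{int (T k) + 1..int (T (Suc k))}. X (chi k) (\<theta> k) (int (T k)) (int (T (Suc k))) l t \<omega>)"
    by (rule B_def) (auto intro: chi(1) theta_AA theta_in simp: block_end_mono)
  then have "Bk k l \<omega> = (\<Sum>t\<in>{int (T k) + 1..int (T (Suc k))}. ?s t) - (\<Sum>t\<in>{int (T k) + 1..int (T (Suc k))}. Sb (\<theta> k \<omega>) $ l)"
    unfolding Bk_def X_def by (simp only: sum_subtractf)
  also have "(\<Sum>t\<in>{int (T k) + 1..int (T (Suc k))}. Sb (\<theta> k \<omega>) $ l) = tt k * Sb (\<theta> k \<omega>) $ l"
    by (simp add: block_end_Suc)
  finally show ?thesis using 1 by (simp add: right_diff_distrib)
qed

definition b0 :: real where "b0 = (a + 1) / (2 * a)"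

lemma b0: "1 / 2 \<le> b0" using c_a by (simp add: b0_def field_simps)

text \<open>Almost surely minus a component of the Monte Carlo error. Defining it as a difference
  makes \<open>e_split\<close> hold everywhere.\<close>

definition Nk :: "nat \<Rightarrow> 'd \<Rightarrow> 'w \<Rightarrow> real" where "Nk k l \<omega> = e k \<omega> $ l - Bk k l \<omega> / tt k"

lemma Nk_Lp: "Lp_le M p (Nk k l) (Cm * tt k powr (- b0))"
proof (rule Lp_le_dominated[OF MC[of k, folded b0_def]])
  show "Nk k l \<in> borel_measurable M" unfolding Nk_def[abs_def] using e_comp_measurable Bk_measurable by measurable
  show "AE \<omega> in M. \<bar>Nk k l \<omega>\<bar> \<le> \<bar>norm (Sn k \<omega> - St k \<omega>)\<bar>"
    using AE_good AE_space
  proof eventually_elim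
    case (elim \<omega>)
    have "Bk k l \<omega> / tt k = Sn k \<omega> $ l - Sb (\<theta> k \<omega>) $ l"
      using Sn_component[OF elim(2,1), of k l] tt_ge1[of k] by (simp add: field_simps)
    then have "Nk k l \<omega> = - ((Sn k \<omega> - St k \<omega>) $ l)" by (simp add: Nk_def e_def)
    then show ?case using component_le_norm_cart[of "Sn k \<omega> - St k \<omega>" l] by simp
  qed
qed (use p in auto)

lemma e_split: "e k \<omega> $ l = Nk k l \<omega> + Bk k l \<omega> / tt k" by (simp add: Nk_def)

definition KM :: real where "KM = martingale_const p"

lemma KM: "KM \<ge> 1" unfolding KM_def by (rule martingale_const_ge_1)

lemma block_sum_Lp:
  assumes w: "\<And>j. \<bar>w j\<bar> \<le> 1" and n: "i0 \<le> n"
  shows "Lp_le M p (\<lambda>\<omega>. \<Sum>j\<in>{i0..<n}. w j * Bk j l \<omega>) (C2 * real (n - i0) + KM * C2 * sqrt (real (T n - T i0)))"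
  unfolding Bk_def KM_def by (rule block_moment[where chi = chi and th = \<theta> and T = T and w = w, OF chi(1) theta_AA theta_in _ w n]) (simp_all add: block_end_mono)

definition Ce :: real where "Ce = Cm + (C2 + KM * C2)"

lemma Ce_pos: "Ce > 0" unfolding Ce_def using Cm C2_pos KM by (intro add_pos_pos mult_pos_pos) auto

text \<open>For a single block the martingale bound gives the root of the block size divided by the
  block size, and the Monte Carlo error is of no larger order because \<open>b0\<close> is at least
  1/2.\<close>

lemma e_Lp: "Lp_le M p (\<lambda>\<omega>. e k \<omega> $ l) (Ce * tt k powr (- 1 / 2))"
proof -
  have t1: "1 \<le> tt k" by (rule tt_ge1)
  have sq: "sqrt (tt k) / tt k = tt k powr (- 1 / 2)"
  proof -
    have "tt k powr (- 1 / 2) = tt k powr (1 / 2 - 1)" by simp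
    also have "\<dots> = tt k powr (1 / 2) / tt k powr 1" by (rule powr_diff)
    finally show ?thesis using t1 by (simp add: powr_half_sqrt)
  qed
  have "Lp_le M p (\<lambda>\<omega>. \<Sum>j\<in>{k..<Suc k}. 1 * Bk j l \<omega>) (C2 * real (Suc k - k) + KM * C2 * sqrt (real (T (Suc k) - T k)))"
    by (rule block_sum_Lp) auto
  then have "Lp_le M p (Bk k l) (C2 + KM * C2 * sqrt (tt k))" by (simp add: block_end_Suc)
  from Lp_le_cmult[OF this, of "1 / tt k"]
  have L: "Lp_le M p (\<lambda>\<omega>. Bk k l \<omega> / tt k) ((C2 + KM * C2 * sqrt (tt k)) / tt k)" by simp
  have "Lp_le M p (\<lambda>\<omega>. Nk k l \<omega> + Bk k l \<omega> / tt k) (Cm * tt k powr (- b0) + (C2 + KM * C2 * sqrt (tt k)) / tt k)"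
    by (rule Lp_le_add[OF _ Nk_Lp L]) (use p in simp)
  then have "Lp_le M p (\<lambda>\<omega>. e k \<omega> $ l) (Cm * tt k powr (- b0) + (C2 + KM * C2 * sqrt (tt k)) / tt k)"
    by (simp only: e_split)
  then show ?thesis
  proof (rule Lp_le_mono)
    have "Cm * tt k powr (- b0) \<le> Cm * tt k powr (- 1 / 2)" using Cm t1 b0 by (intro mult_left_mono powr_mono) auto
    moreover have "(C2 + KM * C2 * sqrt (tt k)) / tt k \<le> (C2 + KM * C2) * (sqrt (tt k) / tt k)"
    proof -
      have "C2 * 1 \<le> C2 * sqrt (tt k)" using C2_pos t1 by (intro mult_left_mono) auto
      then have "C2 + KM * C2 * sqrt (tt k) \<le> (C2 + KM * C2) * sqrt (tt k)" by (simp add: distrib_right)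
      then have "(C2 + KM * C2 * sqrt (tt k)) / tt k \<le> (C2 + KM * C2) * sqrt (tt k) / tt k" using t1 by (intro divide_right_mono) auto
      then show ?thesis by simp
    qed
    ultimately show "Cm * tt k powr (- b0) + (C2 + KM * C2 * sqrt (tt k)) / tt k \<le> Ce * tt k powr (- 1 / 2)"
      unfolding sq Ce_def by (simp add: distrib_right)
  qed (use p in auto)
qed

definition Cq :: real where "Cq = Cm * (c powr (1 - b0) / c3) + (C2 / c3 + KM * C2)"

text \<open>The root of the total time bounds all three contributions: Monte Carlo errors by the
  choice of \<open>b0\<close>, predictable starts because n is at most of that order, and the common
  martingale directly.\<close>

lemma weighted_e_Lp:
  assumes w: "\<And>j. \<bar>w j\<bar> \<le> 1" and n: "i0 \<le> n"
  shows "Lp_le M p (\<lambda>\<omega>. \<Sum>j\<in>{i0..<n}. w j * (tt j * e j \<omega> $ l)) (Cq * sqrt (real (T n)))"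
proof -
  have p1: "p \<ge> 1" using p by simp
  have "Lp_le M p (\<lambda>\<omega>. \<Sum>j\<in>{i0..<n}. (w j * tt j) * Nk j l \<omega>) (\<Sum>j\<in>{i0..<n}. Cm * tt j powr (1 - b0))"
  proof (rule Lp_le_sum[OF p1])
    fix j
    show "Lp_le M p (\<lambda>\<omega>. (w j * tt j) * Nk j l \<omega>) (Cm * tt j powr (1 - b0))"
    proof (rule Lp_le_mono[OF Lp_le_cmult[OF Nk_Lp]])
      have "tt j * tt j powr (- b0) = tt j powr (1 - b0)"
        using powr_add[of "tt j" 1 "- b0"] tt_ge1[of j] by simp
      then have "\<bar>w j * tt j\<bar> * (Cm * tt j powr (- b0)) = \<bar>w j\<bar> * (Cm * tt j powr (1 - b0))"
        by (simp add: abs_mult mult_ac)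
      also have "\<dots> \<le> 1 * (Cm * tt j powr (1 - b0))" using w[of j] Cm by (intro mult_right_mono) auto
      finally show "\<bar>w j * tt j\<bar> * (Cm * tt j powr (- b0)) \<le> Cm * tt j powr (1 - b0)" by simp
    qed (use p in auto)
  qed auto
  from Lp_le_add[OF p1 this block_sum_Lp[OF w n]]
  have "Lp_le M p (\<lambda>\<omega>. (\<Sum>j\<in>{i0..<n}. (w j * tt j) * Nk j l \<omega>) + (\<Sum>j\<in>{i0..<n}. w j * Bk j l \<omega>))
    ((\<Sum>j\<in>{i0..<n}. Cm * tt j powr (1 - b0)) + (C2 * real (n - i0) + KM * C2 * sqrt (real (T n - T i0))))" .
  moreover have "(\<Sum>j\<in>{i0..<n}. (w j * tt j) * Nk j l \<omega>) + (\<Sum>j\<in>{i0..<n}. w j * Bk j l \<omega>) = (\<Sum>j\<in>{i0..<n}. w j * (tt j * e j \<omega> $ l))" for \<omega>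
  proof -
    have "w j * (tt j * e j \<omega> $ l) = (w j * tt j) * Nk j l \<omega> + w j * Bk j l \<omega>" for j
      using tt_ge1[of j] unfolding e_split by (simp add: distrib_left)
    then show ?thesis by (simp add: sum.distrib)
  qed
  ultimately have "Lp_le M p (\<lambda>\<omega>. \<Sum>j\<in>{i0..<n}. w j * (tt j * e j \<omega> $ l))
    ((\<Sum>j\<in>{i0..<n}. Cm * tt j powr (1 - b0)) + (C2 * real (n - i0) + KM * C2 * sqrt (real (T n - T i0))))" by simp
  then show ?thesis
  proof (rule Lp_le_mono)
    have "(\<Sum>j\<in>{i0..<n}. Cm * tt j powr (1 - b0)) \<le> Cm * (\<Sum>j<n. tt j powr (1 - b0))"
      unfolding sum_distrib_left using Cm by (intro sum_mono2) auto
    also have "\<dots> \<le> Cm * (c powr (1 - b0) / c3 * sqrt (real (T n)))"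
      using Cm sum_tau_powr[of n] unfolding b0_def by (intro mult_left_mono) auto
    finally have A: "(\<Sum>j\<in>{i0..<n}. Cm * tt j powr (1 - b0)) \<le> Cm * (c powr (1 - b0) / c3) * sqrt (real (T n))" by simp
    have "real (n - i0) \<le> sqrt (real (T n)) / c3" using n_le_sqrt_block_end[of n] by linarith
    then have "C2 * real (n - i0) \<le> C2 * (sqrt (real (T n)) / c3)" using C2_pos by (intro mult_left_mono) auto
    moreover have "KM * C2 * sqrt (real (T n - T i0)) \<le> KM * C2 * sqrt (real (T n))"
      using KM C2_pos by (intro mult_left_mono) auto
    ultimately show "(\<Sum>j\<in>{i0..<n}. Cm * tt j powr (1 - b0)) + (C2 * real (n - i0) + KM * C2 * sqrt (real (T n - T i0))) \<le> Cq * sqrt (real (T n))"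
      using A unfolding Cq_def by (simp add: distrib_right)
  qed (use p in auto)
qed

section \<open>The linear part of the recursion\<close>

definition \<Gamma> :: "real^'d^'d" where "\<Gamma> = jacobian (Sb \<circ> \<theta>bar) (at sstar)"

abbreviation Gm :: "nat \<Rightarrow> real^'d \<Rightarrow> real^'d" where "Gm k \<equiv> ((*v) \<Gamma>) ^^ k"

definition Kg :: real where "Kg = (SOME K. K \<ge> 0 \<and> (\<forall>k v. norm (Gm k v) \<le> K * gam ^ k * norm v))"

lemma Kg: "Kg \<ge> 0" "norm (Gm k v) \<le> Kg * gam ^ k * norm v"
proof -
  have "\<exists>K\<ge>0. \<forall>k v. norm (Gm k v) \<le> K * gam ^ k * norm v"
    by (rule spectral_radius_power_bound) (use gam in \<open>auto simp: \<Gamma>_def sstar_def\<close>)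
  then have "\<exists>K. K \<ge> 0 \<and> (\<forall>k v. norm (Gm k v) \<le> K * gam ^ k * norm v)" by blast
  from someI_ex[OF this] show "Kg \<ge> 0" "norm (Gm k v) \<le> Kg * gam ^ k * norm v" unfolding Kg_def by blast+
qed

text \<open>The entry (i, l) of the k-th power of \<open>\<Gamma>\<close>.\<close>

definition gg :: "nat \<Rightarrow> 'd \<Rightarrow> 'd \<Rightarrow> real" where "gg k i l = Gm k (axis l 1) $ i"

lemma gg_bound: "\<bar>gg k i l\<bar> \<le> Kg * gam ^ k"
  unfolding gg_def using component_le_norm_cart[of "Gm k (axis l 1)" i] Kg(2)[of k "axis l 1"] by simp

lemma Gm_component: "Gm k v $ i = (\<Sum>l\<in>UNIV. gg k i l * v $ l)"
proof -
  have "v = (\<Sum>l\<in>UNIV. v $ l *s axis l 1)" by (simp add: basis_expansion)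
  then have "Gm k v = (\<Sum>l\<in>UNIV. v $ l *s Gm k (axis l 1))"
    by (metis (no_types, lifting) matrix_vector_funpow_scale matrix_vector_funpow_sum sum.cong)
  then show ?thesis by (simp add: gg_def mult.commute)
qed

text \<open>The sequence \<mu> of the overview. The sum starts at 1, since the initial deviation
  \<open>d 0\<close> is carried by the remainder d - \<mu>.\<close>

definition mv :: "nat \<Rightarrow> 'w \<Rightarrow> real^'d" where "mv n \<omega> = (\<Sum>k=1..n. Gm (n - k) (e k \<omega>))"

lemma mv_component: "mv n \<omega> $ i = (\<Sum>k=1..n. \<Sum>l\<in>UNIV. gg (n - k) i l * e k \<omega> $ l)"
  unfolding mv_def by (simp add: Gm_component)

definition Cu :: real where "Cu = real CARD('d) * Kg * Ce * G gam"

lemma Cu_nonneg: "Cu \<ge> 0" unfolding Cu_def using Kg(1) Ce_pos G_bound(2)[OF gam(1,2)] by simp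

text \<open>The bounds for the errors of earlier blocks are larger only by a factor polynomial in n
  - k, which the geometric decay of the powers outweighs; \<mu> is thus of the same order as a
  single block error.\<close>

lemma mv_Lp: "Lp_le M p (\<lambda>\<omega>. mv n \<omega> $ i) (Cu * tt n powr (- 1 / 2))"
proof -
  have p1: "p \<ge> 1" using p by simp
  have "Lp_le M p (\<lambda>\<omega>. \<Sum>k\<in>{1..n}. \<Sum>l\<in>UNIV. gg (n - k) i l * e k \<omega> $ l) (\<Sum>k\<in>{1..n}. \<Sum>l\<in>(UNIV::'d set). Kg * gam ^ (n - k) * (Ce * tt k powr (- 1 / 2)))"
  proof (intro Lp_le_sum[OF p1])
    fix k l
    show "Lp_le M p (\<lambda>\<omega>. gg (n - k) i l * e k \<omega> $ l) (Kg * gam ^ (n - k) * (Ce * tt k powr (- 1 / 2)))"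
      by (rule Lp_le_mono[OF Lp_le_cmult[OF e_Lp]]) (use mult_right_mono[OF gg_bound, of "Ce * tt k powr (- 1 / 2)" "n - k" i l] Ce_pos p in simp_all)
  qed auto
  then show ?thesis unfolding mv_component
  proof (rule Lp_le_mono)
    have "(\<Sum>k\<in>{1..n}. \<Sum>l\<in>(UNIV::'d set). Kg * gam ^ (n - k) * (Ce * tt k powr (- 1 / 2)))
      = real CARD('d) * Kg * Ce * (\<Sum>k\<in>{1..n}. gam ^ (n - k) * tt k powr (- 1 / 2))"
      by (simp add: sum_distrib_left mult_ac)
    also have "(\<Sum>k\<in>{1..n}. gam ^ (n - k) * tt k powr (- 1 / 2)) \<le> G gam * tt n powr (- 1 / 2)"
    proof -
      have "gam ^ (n - k) * tt k powr (- 1 / 2) \<le> gam ^ (n - k) * (2 * (1 + real (n - k)) powr a) * tt n powr (- 1 / 2)" if "k \<in> {1..n}" for k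
      proof -
        let ?R = "2 * (1 + real (n - k)) powr a"
        have R1: "1 \<le> ?R" using ge_one_powr_ge_zero[of "1 + real (n - k)" a] c_a by simp
        have "tt n \<le> ?R * tt k" using tau_ratio[of k "n - k"] that by simp
        \<comment> \<open>As the factor is at least 1, squaring it weakens the inequality and makes
          the coming root exact.\<close>
        then have "tt n \<le> ?R powr 2 * tt k" using R1 tt_ge1[of k]
          by (simp only: powr_numeral power2_eq_square) (smt (verit) mult_right_mono mult_left_mono mult_le_cancel_right1)
        then have "tt n powr (1 / 2) \<le> (?R powr 2 * tt k) powr (1 / 2)" by (intro powr_mono2) auto
        also have "\<dots> = ?R * tt k powr (1 / 2)" using R1 by (simp add: powr_mult powr_powr)
        finally have h: "tt n powr (1 / 2) \<le> ?R * tt k powr (1 / 2)" .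
        have "tt k powr (- 1 / 2) \<le> ?R * tt n powr (- 1 / 2)"
        proof -
          have "tt j powr (- 1 / 2) = 1 / tt j powr (1 / 2)" for j
            by (simp add: powr_minus_divide[symmetric])
          then show ?thesis using h tt_ge1[of n] tt_ge1[of k] by (simp add: field_simps)
        qed
        then have "gam ^ (n - k) * tt k powr (- 1 / 2) \<le> gam ^ (n - k) * (?R * tt n powr (- 1 / 2))" using gam by (intro mult_left_mono) auto
        then show ?thesis by (simp only: mult.assoc)
      qed
      then have "(\<Sum>k\<in>{1..n}. gam ^ (n - k) * tt k powr (- 1 / 2)) \<le> (\<Sum>k\<in>{1..n}. gam ^ (n - k) * (2 * (1 + real (n - k)) powr a) * tt n powr (- 1 / 2))"
        by (rule sum_mono)
      also have "\<dots> = (\<Sum>k\<in>{1..n}. gam ^ (n - k) * (2 * (1 + real (n - k)) powr a)) * tt n powr (- 1 / 2)" by (simp only: sum_distrib_right)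
      also have "(\<Sum>k\<in>{1..n}. gam ^ (n - k) * (2 * (1 + real (n - k)) powr a)) = (\<Sum>i<n. gam ^ i * (2 * (1 + real i) powr a))"
        by (rule sum.reindex_bij_witness[of _ "\<lambda>i. n - i" "\<lambda>k. n - k"]) auto
      also have "(\<Sum>i<n. gam ^ i * (2 * (1 + real i) powr a)) * tt n powr (- 1 / 2) \<le> G gam * tt n powr (- 1 / 2)"
        using G_bound(1)[OF gam(1,2)] by (intro mult_right_mono) auto
      finally show ?thesis .
    qed
    finally show "(\<Sum>k\<in>{1..n}. \<Sum>l\<in>(UNIV::'d set). Kg * gam ^ (n - k) * (Ce * tt k powr (- 1 / 2))) \<le> Cu * tt n powr (- 1 / 2)"
      using Kg(1) Ce_pos by (simp add: Cu_def mult_left_mono mult.assoc)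
  qed (use p in auto)
qed

definition Cw :: real where "Cw = real CARD('d) * ((Kg * G gam + 1) * Cq)"

text \<open>Bounding each \<mu> by its norm would lose the cancellation between blocks. Exchanging
  the sums expresses the total through the \<open>tt k * e k\<close> with bounded deterministic
  weights, to which the martingale bound applies.\<close>

lemma weighted_mv_Lp: "Lp_le M p (\<lambda>\<omega>. (\<Sum>j<n. tt j *\<^sub>R mv j \<omega>) $ i) (Cw * sqrt (real (T n)))"
proof -
  have p1: "p \<ge> 1" using p by simp
  define W where "W l k = (\<Sum>i'<n - k. gam ^ i' * (tt (k + i') / tt k) * (gg i' i l / gam ^ i'))" for l k
  \<comment> \<open>Normalises the weights to modulus at most 1; the summand 1 keeps it positive
    even if \<open>Kg\<close> vanishes.\<close>
  define D where "D = Kg * G gam + 1"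
  have G1: "G gam \<ge> 1" by (rule G_bound(2)[OF gam(1,2)])
  have D: "D > 0" unfolding D_def using Kg(1) G1 by (simp add: add_nonneg_pos)
  have WD: "\<bar>W l k / D\<bar> \<le> 1" for l k
  proof -
    have "\<bar>W l k\<bar> \<le> (\<Sum>i'<n - k. \<bar>gam ^ i' * (tt (k + i') / tt k) * (gg i' i l / gam ^ i')\<bar>)" unfolding W_def by (rule sum_abs)
    also have "\<dots> \<le> (\<Sum>i'<n - k. gam ^ i' * (2 * (1 + real i') powr a) * Kg)"
    proof (rule sum_mono)
      fix i'
      have "tt (k + i') / tt k \<le> 2 * (1 + real i') powr a" using tau_ratio[of k i'] tt_ge1[of k] by (simp add: pos_divide_le_eq)
      moreover have "\<bar>gg i' i l / gam ^ i'\<bar> \<le> Kg" using gg_bound[of i' i l] gam by (simp add: abs_divide pos_divide_le_eq)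
      ultimately show "\<bar>gam ^ i' * (tt (k + i') / tt k) * (gg i' i l / gam ^ i')\<bar> \<le> gam ^ i' * (2 * (1 + real i') powr a) * Kg"
        unfolding abs_mult using gam by (intro mult_mono) auto
    qed
    also have "\<dots> = (\<Sum>i'<n - k. gam ^ i' * (2 * (1 + real i') powr a)) * Kg" by (simp only: sum_distrib_right)
    also have "\<dots> \<le> G gam * Kg" using G_bound(1)[OF gam(1,2)] Kg(1) by (intro mult_right_mono) auto
    also have "\<dots> \<le> D" by (simp add: D_def mult.commute)
    finally show ?thesis using D by (simp add: abs_divide pos_divide_le_eq)
  qed
  have eq: "(\<Sum>j<n. tt j *\<^sub>R mv j \<omega>) $ i = (\<Sum>l\<in>UNIV. D * (\<Sum>k\<in>{min 1 n..<n}. W l k / D * (tt k * e k \<omega> $ l)))" for \<omega>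
  proof -
    have "(\<Sum>j<n. tt j *\<^sub>R mv j \<omega>) $ i = (\<Sum>j<n. \<Sum>k\<in>{1..j}. tt j * (\<Sum>l\<in>UNIV. gg (j - k) i l * e k \<omega> $ l))"
      by (simp add: mv_component sum_distrib_left)
    also have "\<dots> = (\<Sum>(j, k)\<in>(SIGMA j:{..<n}. {1..j}). tt j * (\<Sum>l\<in>UNIV. gg (j - k) i l * e k \<omega> $ l))"
      by (simp add: sum.Sigma)
    also have "\<dots> = (\<Sum>(k, i')\<in>(SIGMA k:{1..<n}. {..<n - k}). tt (k + i') * (\<Sum>l\<in>UNIV. gg i' i l * e k \<omega> $ l))"
      by (rule sum.reindex_bij_witness[of _ "\<lambda>(k, i). (k + i, k)" "\<lambda>(j, k). (k, j - k)"]) auto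
    also have "\<dots> = (\<Sum>k\<in>{1..<n}. \<Sum>i'<n - k. \<Sum>l\<in>UNIV. tt (k + i') * (gg i' i l * e k \<omega> $ l))"
      by (simp add: sum.Sigma[symmetric] sum_distrib_left)
    also have "\<dots> = (\<Sum>k\<in>{1..<n}. \<Sum>l\<in>UNIV. \<Sum>i'<n - k. tt (k + i') * (gg i' i l * e k \<omega> $ l))"
      by (intro sum.cong refl sum.swap)
    also have "\<dots> = (\<Sum>l\<in>UNIV. \<Sum>k\<in>{1..<n}. \<Sum>i'<n - k. tt (k + i') * (gg i' i l * e k \<omega> $ l))"
      by (rule sum.swap)
    \<comment> \<open>The lower end \<open>min 1 n\<close> leaves the range unchanged and keeps it
      at most n also for n = 0.\<close>
    also have "\<dots> = (\<Sum>l\<in>UNIV. \<Sum>k\<in>{min 1 n..<n}. W l k * (tt k * e k \<omega> $ l))"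
    proof (intro sum.cong refl)
      show "{1..<n} = {min 1 n..<n}" by auto
      fix l k
      have "tt (k + i') * (gg i' i l * e k \<omega> $ l) = gam ^ i' * (tt (k + i') / tt k) * (gg i' i l / gam ^ i') * (tt k * e k \<omega> $ l)" for i'
        using tt_ge1[of k] gam by simp
      then show "(\<Sum>i'<n - k. tt (k + i') * (gg i' i l * e k \<omega> $ l)) = W l k * (tt k * e k \<omega> $ l)"
        unfolding W_def sum_distrib_right by (intro sum.cong) auto
    qed
    also have "\<dots> = (\<Sum>l\<in>UNIV. D * (\<Sum>k\<in>{min 1 n..<n}. W l k / D * (tt k * e k \<omega> $ l)))"
      using D by (simp add: sum_distrib_left)
    finally show ?thesis .
  qed
  have "Lp_le M p (\<lambda>\<omega>. \<Sum>l\<in>UNIV. D * (\<Sum>k\<in>{min 1 n..<n}. W l k / D * (tt k * e k \<omega> $ l))) (\<Sum>l\<in>(UNIV::'d set). \<bar>D\<bar> * (Cq * sqrt (real (T n))))"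
    by (intro Lp_le_sum[OF p1] Lp_le_cmult weighted_e_Lp WD) auto
  then show ?thesis unfolding eq using D by (simp add: Cw_def D_def mult_ac)
qed

text \<open>The exponent a p / 2 exceeds 1 because a > 1 and p > 2.\<close>

lemma summable_tt:
  assumes C: "C \<ge> 0"
  shows "summable (\<lambda>k. (C * tt k powr (- 1 / 2)) powr p)"
proof -
  have s: "summable (\<lambda>k. real (Suc k) powr (- (a * p / 2)))"
  proof -
    have "a * p > 1 * 2" using c_a p by (intro mult_strict_mono) auto
    then have "summable (\<lambda>k. real k powr (- (a * p / 2)))" by (subst summable_real_powr_iff) simp
    then show ?thesis by (subst summable_Suc_iff)
  qed
  have "summable (\<lambda>k. (C powr p * (c / 2) powr (- (p / 2))) * real (Suc k) powr (- (a * p / 2)))"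
    by (rule summable_mult[OF s])
  then show ?thesis
  proof (rule summable_comparison_test'[where N = 0])
    fix k :: nat
    have "tt k powr (- (p / 2)) \<le> (c / 2 * real (Suc k) powr a) powr (- (p / 2))"
      using tau_ge[of "Suc k"] c_a p by (intro powr_mono2') auto
    also have "\<dots> = (c / 2) powr (- (p / 2)) * real (Suc k) powr (- (a * p / 2))"
      by (subst powr_mult) (simp add: powr_powr)
    finally have t: "tt k powr (- (p / 2)) \<le> (c / 2) powr (- (p / 2)) * real (Suc k) powr (- (a * p / 2))" .
    have "norm ((C * tt k powr (- 1 / 2)) powr p) = C powr p * tt k powr (- (p / 2))" using C by (simp add: powr_mult powr_powr)
    also have "\<dots> \<le> C powr p * ((c / 2) powr (- (p / 2)) * real (Suc k) powr (- (a * p / 2)))" using t by (intro mult_left_mono) auto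
    finally show "norm ((C * tt k powr (- 1 / 2)) powr p) \<le> (C powr p * (c / 2) powr (- (p / 2))) * real (Suc k) powr (- (a * p / 2))"
      by (simp add: mult.assoc)
  qed
qed

lemma AE_e_tendsto: "AE \<omega> in M. (\<lambda>k. e k \<omega>) \<longlonglongrightarrow> 0"
proof -
  have "AE \<omega> in M. \<forall>l. (\<lambda>k. e k \<omega> $ l) \<longlonglongrightarrow> 0"
    unfolding AE_all_countable by (intro allI AE_tendsto_0_of_summable_moments[OF prob_space_axioms _ e_Lp summable_tt[OF less_imp_le[OF Ce_pos]]]) (use p in simp)
  then show ?thesis by eventually_elim (auto intro!: vec_tendstoI)
qed

lemma AE_mv_tendsto: "AE \<omega> in M. (\<lambda>k. mv k \<omega>) \<longlonglongrightarrow> 0"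
proof -
  have "AE \<omega> in M. \<forall>l. (\<lambda>k. mv k \<omega> $ l) \<longlonglongrightarrow> 0"
    unfolding AE_all_countable by (intro allI AE_tendsto_0_of_summable_moments[OF prob_space_axioms _ mv_Lp summable_tt[OF Cu_nonneg]]) (use p in simp)
  then show ?thesis by eventually_elim (auto intro!: vec_tendstoI)
qed

lemma averaged_stat_deviation:
  assumes n: "n \<ge> 1"
  shows "averaged_stat \<tau> St n \<omega> - sstar = (1 / real (T n)) *\<^sub>R (\<Sum>j<n. tt j *\<^sub>R (St j \<omega> - sstar))"
proof -
  have Tn: "real (T n) > 0" using block_end_pos[OF n] by simp
  have sumT: "(\<Sum>j<n. tt j) = real (T n)" unfolding block_end_def of_nat_sum
    by (rule sum.reindex_bij_witness[of _ "\<lambda>j. j - 1" Suc]) auto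
  have "(\<Sum>j = 1..n. real (\<tau> j) *\<^sub>R St (j - 1) \<omega>) = (\<Sum>j<n. tt j *\<^sub>R St j \<omega>)"
    by (rule sum.reindex_bij_witness[of _ Suc "\<lambda>j. j - 1"]) auto
  also have "\<dots> = (\<Sum>j<n. tt j *\<^sub>R (St j \<omega> - sstar)) + real (T n) *\<^sub>R sstar"
    unfolding sumT[symmetric] by (simp add: scaleR_diff_right sum_subtractf scaleR_sum_left)
  finally show ?thesis unfolding averaged_stat_def using Tn by (simp add: scaleR_add_right)
qed

text \<open>On the event of convergence d tends to 0, since it is the block error plus the
  difference of the mean statistic at \<open>\<theta> k\<close> and at its limit. So the absorption
  argument runs path by path, and A inherits the dependence on the path. Off the event the left-hand
  side is 0.\<close>

lemma pathwise_bound: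
  assumes L: "L \<ge> 0" "\<And>s. s \<in> SS \<Longrightarrow> norm (\<theta>bar s - \<theta>star) \<le> L * norm (s - sstar)"
  shows "AE \<omega> in M. \<exists>A. \<forall>n\<ge>1.
    norm ((sqrt (real (T n)) * indicat_real {\<omega>'. (\<lambda>k. \<theta> k \<omega>') \<longlonglongrightarrow> \<theta>star} \<omega>) *\<^sub>R (\<theta>bar (averaged_stat \<tau> St n \<omega>) - \<theta>star))
    \<le> \<bar>L / sqrt (real (T n)) * norm (\<Sum>j<n. tt j *\<^sub>R mv j \<omega>)\<bar>
      + real n / sqrt (real (T n)) * (A * (1 + (1 / real n) * (\<Sum>i<n. tt i * (norm (mv i \<omega>))\<^sup>2)))"
proof -
  obtain R dl where R: "dl > 0" "R \<ge> 0" "\<And>s. norm (s - sstar) < dl \<Longrightarrow>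
    norm (Sb (\<theta>bar s) - Sb (\<theta>bar sstar) - \<Gamma> *v (s - sstar)) \<le> R * (norm (s - sstar))\<^sup>2"
    using C2_on_compose_quadratic_bound[OF smooth SS(1) sstar_in theta_bar_in] unfolding \<Gamma>_def by blast
  have fixed_point: "Sb (\<theta>bar sstar) = sstar" using theta_star(2) by (simp add: sstar_def)
  show ?thesis
    using AE_e_tendsto AE_mv_tendsto AE_space
  proof eventually_elim
    case (elim \<omega>)
    let ?E = "{\<omega>'. (\<lambda>k. \<theta> k \<omega>') \<longlonglongrightarrow> \<theta>star}"
    show ?case
    proof (cases "\<omega> \<in> ?E")
      case False
      then show ?thesis by (intro exI[of _ 0]) simp
    next
      case True
      define d where "d k = St k \<omega> - sstar" for k
      define r where "r k = Sb (\<theta>bar (St k \<omega>)) - sstar - \<Gamma> *v d k" for k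
      have dS: "d (Suc k) = \<Gamma> *v d k + r k + e (Suc k) \<omega>" for k
        unfolding r_def d_def e_def using theta_Suc[OF elim(3), of k] by simp
      have rb: "norm (r k) \<le> R * (norm (d k))\<^sup>2" if "norm (d k) < dl" for k
        using R(3)[of "St k \<omega>"] that unfolding r_def d_def fixed_point by simp
      have "(\<lambda>k. Sb (\<theta> k \<omega>)) \<longlonglongrightarrow> Sb \<theta>star"
        by (rule continuous_on_tendsto_compose[OF Sb_cont]) (use True theta_star(1) theta_in[OF elim(3)] in auto)
      then have "(\<lambda>k. e k \<omega> + (Sb (\<theta> k \<omega>) - sstar)) \<longlonglongrightarrow> 0 + (Sb \<theta>star - sstar)"
        using elim(1) by (intro tendsto_intros)
      then have dlim: "d \<longlonglongrightarrow> 0" unfolding d_def e_def sstar_def by (simp add: algebra_simps)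
      have mlim: "(\<lambda>n. \<Sum>k=1..n. Gm (n - k) (e k \<omega>)) \<longlonglongrightarrow> 0" using elim(2) unfolding mv_def .
      have Gp: "G gam > 0" using G_bound(2)[OF gam(1,2)] by linarith
      obtain A0 where A0: "A0 \<ge> 0" "\<And>n. (\<Sum>j<n. tt j * norm (d j - mv j \<omega>)) \<le> A0 + 4 * R * Kg * (G gam)\<^sup>2 / gam * (\<Sum>i<n. tt i * (norm (mv i \<omega>))\<^sup>2)"
        using nonlinear_remainder_bound[where d = d and e = "\<lambda>k. e k \<omega>" and A = \<Gamma> and t = "\<lambda>k. real (\<tau> k)" and r = r,
            OF Kg(2) Kg(1) gam(1) tau_convolution[OF gam(1,2)] _ Gp dS rb R(1,2) dlim mlim]
        unfolding mv_def by auto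
      define C4 where "C4 = 4 * R * Kg * (G gam)\<^sup>2 / gam"
      have C4: "C4 \<ge> 0" unfolding C4_def using R Kg(1) gam by simp
      show ?thesis
      proof (intro exI[of _ "L * (A0 + C4)"] allI impI)
        fix n :: nat assume n: "n \<ge> 1"
        let ?q = "sqrt (real (T n))" and ?V = "\<Sum>i<n. tt i * (norm (mv i \<omega>))\<^sup>2"
        have Tn: "real (T n) > 0" using block_end_pos[OF n] by simp
        have V: "?V \<ge> 0" by (intro sum_nonneg) auto
        have "norm (\<Sum>j<n. tt j *\<^sub>R (St j \<omega> - sstar)) \<le> norm (\<Sum>j<n. tt j *\<^sub>R mv j \<omega>) + (\<Sum>j<n. tt j * norm (d j - mv j \<omega>))"
        proof -
          have "(\<Sum>j<n. tt j *\<^sub>R (St j \<omega> - sstar)) = (\<Sum>j<n. tt j *\<^sub>R mv j \<omega>) + (\<Sum>j<n. tt j *\<^sub>R (d j - mv j \<omega>))"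
            by (simp add: d_def sum.distrib[symmetric] scaleR_add_right[symmetric])
          then have "norm (\<Sum>j<n. tt j *\<^sub>R (St j \<omega> - sstar)) \<le> norm (\<Sum>j<n. tt j *\<^sub>R mv j \<omega>) + norm (\<Sum>j<n. tt j *\<^sub>R (d j - mv j \<omega>))"
            by (simp only: norm_triangle_ineq)
          also have "norm (\<Sum>j<n. tt j *\<^sub>R (d j - mv j \<omega>)) \<le> (\<Sum>j<n. tt j * norm (d j - mv j \<omega>))"
            by (rule order_trans[OF norm_sum]) simp
          finally show ?thesis by simp
        qed
        also have "(\<Sum>j<n. tt j * norm (d j - mv j \<omega>)) \<le> (A0 + C4) * (real n + ?V)"
        proof -
          \<comment> \<open>The additive constant is spread over n \<ge> 1, so that a path constant
            times one common expression remains.\<close>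
          have "A0 * 1 \<le> A0 * (real n + ?V)" using A0(1) V n by (intro mult_left_mono) auto
          moreover have "C4 * ?V \<le> C4 * (real n + ?V)" using C4 by (intro mult_left_mono) auto
          ultimately show ?thesis using A0(2)[of n] unfolding C4_def[symmetric] by (simp add: distrib_right)
        qed
        finally have s: "norm (\<Sum>j<n. tt j *\<^sub>R (St j \<omega> - sstar)) \<le> norm (\<Sum>j<n. tt j *\<^sub>R mv j \<omega>) + (A0 + C4) * (real n + ?V)" by simp
        have "norm ((?q * indicat_real ?E \<omega>) *\<^sub>R (\<theta>bar (averaged_stat \<tau> St n \<omega>) - \<theta>star)) = ?q * norm (\<theta>bar (averaged_stat \<tau> St n \<omega>) - \<theta>star)"
          using True by simp
        also have "\<dots> \<le> ?q * (L * norm (averaged_stat \<tau> St n \<omega> - sstar))"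
          using L(2)[OF averaged_in[OF n elim(3)]] by (intro mult_left_mono) auto
        also have "\<dots> = L / ?q * norm (\<Sum>j<n. tt j *\<^sub>R (St j \<omega> - sstar))"
        proof -
          have e1: "?q * (1 / real (T n)) = 1 / ?q" using Tn by (simp add: field_simps flip: real_sqrt_mult)
          have e2: "norm (averaged_stat \<tau> St n \<omega> - sstar) = 1 / real (T n) * norm (\<Sum>j<n. tt j *\<^sub>R (St j \<omega> - sstar))"
            unfolding averaged_stat_deviation[OF n] by simp
          have e3: "q' * (L * (t' * N)) = L * (q' * t') * N" for q' t' N :: real by (simp add: mult_ac)
          show ?thesis unfolding e2 e3 e1 by simp
        qed
        also have "\<dots> \<le> L / ?q * (norm (\<Sum>j<n. tt j *\<^sub>R mv j \<omega>) + (A0 + C4) * (real n + ?V))"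
          using L(1) s by (intro mult_left_mono) auto
        also have "\<dots> = L / ?q * norm (\<Sum>j<n. tt j *\<^sub>R mv j \<omega>) + real n / ?q * (L * (A0 + C4) * (1 + (1 / real n) * ?V))"
          using n Tn by (simp add: field_simps)
        finally show "norm ((?q * indicat_real ?E \<omega>) *\<^sub>R (\<theta>bar (averaged_stat \<tau> St n \<omega>) - \<theta>star))
          \<le> \<bar>L / ?q * norm (\<Sum>j<n. tt j *\<^sub>R mv j \<omega>)\<bar> + real n / ?q * (L * (A0 + C4) * (1 + (1 / real n) * ?V))"
          using L(1) by simp
      qed
    qed
  qed
qed

lemma averaged_rate:
  "\<exists>(U :: nat \<Rightarrow> 'w \<Rightarrow> real^'k) (V :: nat \<Rightarrow> 'w \<Rightarrow> real^'k) (A :: nat \<Rightarrow> 'w \<Rightarrow> real).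
       O_Lp M p U \<and> O_Lp M (p / 2) V \<and> O_as M A \<and>
       (\<forall>n\<ge>1. \<forall>\<omega>\<in>space M.
          (sqrt (real (block_end \<tau> n)) * indicat_real {\<omega>'. (\<lambda>k. \<theta> k \<omega>') \<longlonglongrightarrow> \<theta>star} \<omega>)
            *\<^sub>R (\<theta>bar (averaged_stat \<tau> St n \<omega>) - \<theta>star)
          = U n \<omega> + (real n / sqrt (real (block_end \<tau> n))) *\<^sub>R (A n \<omega> *\<^sub>R V n \<omega>))"
proof -
  have "bounded \<Theta>" using Theta_compact by (rule compact_imp_bounded)
  then obtain Bd where Bd: "\<And>t. t \<in> \<Theta> \<Longrightarrow> norm t \<le> Bd" by (auto simp: bounded_iff)
  obtain L where L: "L \<ge> 0" "\<And>s. s \<in> SS \<Longrightarrow> norm (\<theta>bar s - \<theta>bar sstar) \<le> L * norm (s - sstar)"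
    using C2_on_lipschitz_bounded_range[OF smooth(2) sstar_in, of Bd] Bd theta_bar_in by blast
  have ts: "\<theta>bar sstar = \<theta>star" using theta_star(2) by (simp add: sstar_def)
  let ?x = "\<lambda>n \<omega>. (sqrt (real (T n)) * indicat_real {\<omega>'. (\<lambda>k. \<theta> k \<omega>') \<longlonglongrightarrow> \<theta>star} \<omega>) *\<^sub>R (\<theta>bar (averaged_stat \<tau> St n \<omega>) - \<theta>star)"
  let ?u = "\<lambda>n \<omega>. L / sqrt (real (T n)) * norm (\<Sum>j<n. tt j *\<^sub>R mv j \<omega>)"
  \<comment> \<open>An average of terms bounded in L_(p/2). The summand 1 hosts the additive path
    constant and keeps the factor at least 1, which allows the division in
    \<open>O_decomposition\<close>.\<close>
  let ?v = "\<lambda>n \<omega>. 1 + (1 / real n) * (\<Sum>i<n. tt i * (norm (mv i \<omega>))\<^sup>2)"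
  have p1: "p \<ge> 1" "p / 2 \<ge> 1" using p by auto
  show ?thesis
  proof (rule O_decomposition[OF prob_space_axioms, where x = ?x and u = ?u and v = ?v
        and cu = "L * (real CARD('d) * Cw)" and cv = "1 + (real CARD('d) * Cu)\<^sup>2"])
    fix n :: nat assume n: "n \<ge> 1"
    have Tn: "real (T n) > 0" using block_end_pos[OF n] by simp
    show "?x n \<in> borel_measurable M"
    proof -
      have am: "averaged_stat \<tau> St n \<in> borel_measurable M"
        unfolding averaged_stat_def[abs_def] using St(1) by measurable
      have "averaged_stat \<tau> St n \<in> measurable M (restrict_space borel SS)"
        using am averaged_in[OF n] by (intro measurable_restrict_space2) auto
      from measurable_compose[OF this borel_measurable_continuous_on_restrict[OF C2_on_continuous[OF smooth(2)]]]
      have b: "(\<lambda>\<omega>. \<theta>bar (averaged_stat \<tau> St n \<omega>)) \<in> borel_measurable M" .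
      \<comment> \<open>Convergence through countably many radii shows that the event is
        measurable.\<close>
      have "((\<lambda>k. \<theta> k \<omega>) \<longlonglongrightarrow> \<theta>star) \<longleftrightarrow> (\<forall>i::nat. \<forall>\<^sub>F k in sequentially. dist (\<theta> k \<omega>) \<theta>star < inverse (real (Suc i)))" for \<omega>
      proof
        assume *: "\<forall>i::nat. \<forall>\<^sub>F k in sequentially. dist (\<theta> k \<omega>) \<theta>star < inverse (real (Suc i))"
        show "(\<lambda>k. \<theta> k \<omega>) \<longlonglongrightarrow> \<theta>star"
        proof (rule tendstoI)
          fix r :: real assume "r > 0"
          then obtain i where "inverse (real (Suc i)) < r" using reals_Archimedean by blast
          then show "\<forall>\<^sub>F k in sequentially. dist (\<theta> k \<omega>) \<theta>star < r" using *[rule_format, of i] by (auto elim: eventually_mono)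
        qed
      qed (simp add: tendstoD)
      then have "{\<omega> \<in> space M. (\<lambda>k. \<theta> k \<omega>) \<longlonglongrightarrow> \<theta>star} \<in> sets M"
        using theta_measurable by simp
      then have "(\<lambda>\<omega>. indicat_real {\<omega>'. (\<lambda>k. \<theta> k \<omega>') \<longlonglongrightarrow> \<theta>star} \<omega>) \<in> borel_measurable M"
        by (subst borel_measurable_indicator_iff) (simp add: Int_def conj_commute)
      then show ?thesis using b by measurable
    qed
    show "Lp_le M p (?u n) (L * (real CARD('d) * Cw))"
    proof -
      have "Lp_le M p (\<lambda>\<omega>. norm (\<Sum>j<n. tt j *\<^sub>R mv j \<omega>)) (real CARD('d) * (Cw * sqrt (real (T n))))"
        by (rule Lp_le_norm_vec[OF p1(1) weighted_mv_Lp])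
      from Lp_le_cmult[OF this, of "L / sqrt (real (T n))"] show ?thesis using L(1) Tn by (simp add: mult_ac)
    qed
    show "Lp_le M (p / 2) (?v n) (1 + (real CARD('d) * Cu)\<^sup>2)"
    proof (rule Lp_le_add[OF p1(2)])
      show "Lp_le M (p / 2) (\<lambda>_. 1) 1" using Lp_le_const[OF prob_space_axioms, of "p / 2" 1] by simp
      have sq: "Lp_le M (p / 2) (\<lambda>\<omega>. tt i * (norm (mv i \<omega>))\<^sup>2) ((real CARD('d) * Cu)\<^sup>2)" for i
      proof -
        have "Lp_le M p (\<lambda>\<omega>. norm (mv i \<omega>)) (real CARD('d) * (Cu * tt i powr (- 1 / 2)))"
          by (rule Lp_le_norm_vec[OF p1(1) mv_Lp])
        from Lp_le_cmult[OF Lp_le_square[OF this], of "tt i"]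
        have "Lp_le M (p / 2) (\<lambda>\<omega>. tt i * (norm (mv i \<omega>))\<^sup>2) (\<bar>tt i\<bar> * (real CARD('d) * (Cu * tt i powr (- 1 / 2)))\<^sup>2)" using p by simp
        also have "\<bar>tt i\<bar> * (real CARD('d) * (Cu * tt i powr (- 1 / 2)))\<^sup>2 = (real CARD('d) * Cu)\<^sup>2"
        proof -
          have "(tt i powr (- 1 / 2))\<^sup>2 = tt i powr (- 1)" by (simp add: power2_eq_square powr_add[symmetric])
          also have "\<dots> = 1 / tt i" using tt_ge1[of i] by (simp add: powr_minus_divide)
          finally show ?thesis using tt_ge1[of i] by (simp add: power_mult_distrib)
        qed
        finally show ?thesis .
      qed
      have "Lp_le M (p / 2) (\<lambda>\<omega>. \<Sum>i<n. tt i * (norm (mv i \<omega>))\<^sup>2) (\<Sum>i<n. (real CARD('d) * Cu)\<^sup>2)"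
        by (rule Lp_le_sum[OF p1(2) sq]) simp
      from Lp_le_cmult[OF this, of "1 / real n"]
      show "Lp_le M (p / 2) (\<lambda>\<omega>. 1 / real n * (\<Sum>i<n. tt i * (norm (mv i \<omega>))\<^sup>2)) ((real CARD('d) * Cu)\<^sup>2)"
        using n by simp
    qed
    show "1 \<le> ?v n \<omega>" for \<omega> by (simp add: sum_nonneg)
    show "0 < real n / sqrt (real (T n))" using n Tn by simp
  next
    show "AE \<omega> in M. \<exists>A. \<forall>n\<ge>1. norm (?x n \<omega>) \<le> \<bar>?u n \<omega>\<bar> + real n / sqrt (real (T n)) * (A * ?v n \<omega>)"
      by (rule pathwise_bound[OF L(1)]) (use L(2) ts in auto)
  qed (use p in simp)
qed

end

section \<open>From the hypotheses to the assumptions of the algorithm\<close>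

lemma Lp_le_of_bigo:
  fixes Z :: "nat \<Rightarrow> 'w \<Rightarrow> 'v::real_normed_vector" and r :: "nat \<Rightarrow> real"
  assumes M: "prob_space M" and pq: "0 < p" "p \<le> q" and r: "\<And>n. r n \<ge> 1" and b: "b' \<le> b"
    and int: "\<And>n. integrable M (\<lambda>\<omega>. norm (Z n \<omega>) powr q)"
    and O: "(\<lambda>n. Lp_norm M q (Z n)) \<in> O(\<lambda>n. r n powr (- b))"
  obtains C where "C > 0" "\<And>n. Lp_le M p (\<lambda>\<omega>. norm (Z n \<omega>)) (C * r n powr (- b'))"
proof -
  obtain c where c: "c > 0" "\<forall>\<^sub>F n in sequentially. norm (Lp_norm M q (Z n)) \<le> c * norm (r n powr (- b))"
    using landau_o.bigE[OF O] by blast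
  then obtain N where "\<And>n. n \<ge> N \<Longrightarrow> \<bar>Lp_norm M q (Z n)\<bar> \<le> c * r n powr (- b)"
    by (auto simp: eventually_sequentially)
  then have N: "Lp_norm M q (Z n) \<le> c * r n powr (- b)" if "n \<ge> N" for n using that abs_ge_self order_trans by blast
  \<comment> \<open>Makes the asymptotic bound uniform: each of the finitely many early indices
    contributes its own ratio.\<close>
  define C where "C = c + (\<Sum>k<N. Lp_norm M q (Z k) / r k powr (- b))"
  have nn: "Lp_norm M q (Z k) \<ge> 0" for k by (simp add: Lp_norm_def)
  have rp: "r k powr (- b) > 0" for k using r[of k] by simp
  have sn: "(\<Sum>k<N. Lp_norm M q (Z k) / r k powr (- b)) \<ge> 0" by (intro sum_nonneg divide_nonneg_nonneg nn) simp
  have C: "C > 0" using c(1) sn by (simp add: C_def)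
  have bound: "Lp_norm M q (Z n) \<le> C * r n powr (- b')" for n
  proof -
    have "Lp_norm M q (Z n) \<le> C * r n powr (- b)"
    proof (cases "n < N")
      case True
      have "Lp_norm M q (Z n) / r n powr (- b) \<le> (\<Sum>k<N. Lp_norm M q (Z k) / r k powr (- b))"
        using True by (intro member_le_sum divide_nonneg_nonneg nn) auto
      then have "Lp_norm M q (Z n) / r n powr (- b) \<le> C" using c(1) by (simp add: C_def)
      then show ?thesis using rp[of n] by (simp add: pos_divide_le_eq)
    next
      case False
      then have "Lp_norm M q (Z n) \<le> c * r n powr (- b)" using N by simp
      also have "\<dots> \<le> C * r n powr (- b)" using sn by (intro mult_right_mono) (auto simp: C_def)
      finally show ?thesis .
    qed
    also have "\<dots> \<le> C * r n powr (- b')" using C r[of n] b by (intro mult_left_mono powr_mono) auto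
    finally show ?thesis .
  qed
  show thesis
  proof (rule that[OF C])
    fix n
    have q: "q > 0" using pq by simp
    have "(\<lambda>\<omega>. (norm (Z n \<omega>) powr q) powr (1 / q)) \<in> borel_measurable M"
      using borel_measurable_integrable[OF int[of n]] by measurable
    then have meas: "(\<lambda>\<omega>. norm (Z n \<omega>)) \<in> borel_measurable M" using q by (simp add: powr_powr)
    have I0: "(\<integral>\<omega>. norm (Z n \<omega>) powr q \<partial>M) \<ge> 0" by (rule Bochner_Integration.integral_nonneg) simp
    have pos: "C * r n powr (- b') > 0" using C r[of n] by simp
    have "(\<integral>\<omega>. norm (Z n \<omega>) powr q \<partial>M) = Lp_norm M q (Z n) powr q"
      using q I0 by (simp add: Lp_norm_def powr_powr)
    also have "\<dots> \<le> (C * r n powr (- b')) powr q" using q nn bound by (intro powr_mono2) auto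
    finally have "Lp_le M q (\<lambda>\<omega>. norm (Z n \<omega>)) (C * r n powr (- b'))"
      unfolding Lp_le_def using meas int[of n] pos by simp
    then show "Lp_le M p (\<lambda>\<omega>. norm (Z n \<omega>)) (C * r n powr (- b'))"
      by (rule Lp_le_exponent_mono[OF M pq _ pos])
  qed
qed

theorem theorem5p2:
  fixes pbar :: real
    and \<Theta> :: "(real^'k) set"
    and lam :: "'x::topological_space measure"
    and mu :: "'y::topological_space measure"
    and m :: "real^'k \<Rightarrow> 'x \<Rightarrow> 'x \<Rightarrow> real"
    and g :: "real^'k \<Rightarrow> 'x \<Rightarrow> 'y \<Rightarrow> real"
    and M :: "'w measure"
    and Y :: "int \<Rightarrow> 'w \<Rightarrow> 'y"
    and \<phi> :: "real^'k \<Rightarrow> real"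
    and \<psi> :: "real^'k \<Rightarrow> real^'d"
    and S :: "'x \<Rightarrow> 'x \<Rightarrow> 'y \<Rightarrow> real^'d"
    and SS :: "(real^'d) set"
    and \<theta>bar :: "real^'d \<Rightarrow> real^'k"
    and \<sigma>_minus \<sigma>_plus C0 \<beta> c a b \<gamma> :: real
    and \<tau> :: "nat \<Rightarrow> nat"
    and chi :: "nat \<Rightarrow> 'x measure"
    and \<theta>0 \<theta>star :: "real^'k"
    and \<theta> :: "nat \<Rightarrow> 'w \<Rightarrow> real^'k"
    and Sn St :: "nat \<Rightarrow> 'w \<Rightarrow> real^'d"
    and H :: "nat \<Rightarrow> 'w measure"
  assumes pbar: "pbar > 2"
    \<comment> \<open>model\<close>
    and Theta_compact: "compact \<Theta>"
    and lam: "space lam = UNIV" "finite_measure lam"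
    and mu: "space mu = UNIV" "sigma_finite_measure mu"
    and m_density: "\<And>t. t \<in> \<Theta> \<Longrightarrow> transition_density lam lam (m t)"
    and g_density: "\<And>t. t \<in> \<Theta> \<Longrightarrow> transition_density lam mu (g t)"
    \<comment> \<open>observations\<close>
    and M: "prob_space M"
    and Y_measurable: "\<And>k. Y k \<in> measurable M mu"
    \<comment> \<open>(1) exponential family\<close>
    and phi_cont: "continuous_on \<Theta> \<phi>"
    and psi_cont: "continuous_on \<Theta> \<psi>"
    and S_cont: "continuous_on UNIV (\<lambda>(x, x', y). S x x' y)"
    and S_measurable: "(\<lambda>(x, x', y). S x x' y) \<in> borel_measurable (lam \<Otimes>\<^sub>M lam \<Otimes>\<^sub>M mu)"
    and exp_family: "\<And>t x x' y. t \<in> \<Theta> \<Longrightarrow>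
      m t x x' > 0 \<and> g t x' y > 0 \<and>
      ln (m t x x') + ln (g t x' y) = \<phi> t + S x x' y \<bullet> \<psi> t"
    and SS: "open SS" "convex hull (range (\<lambda>(x, x', y). S x x' y)) \<subseteq> SS"
    and theta_bar_cont: "continuous_on SS \<theta>bar"
    and theta_bar_argmax: "\<And>s. s \<in> SS \<Longrightarrow> \<theta>bar s \<in> \<Theta> \<and>
      (\<forall>t\<in>\<Theta>. t \<noteq> \<theta>bar s \<longrightarrow> \<phi> t + s \<bullet> \<psi> t < \<phi> (\<theta>bar s) + s \<bullet> \<psi> (\<theta>bar s))"
    \<comment> \<open>(2) strong mixing\<close>
    and strong_mixing: "0 < \<sigma>_minus"
      "\<And>t x x'. t \<in> \<Theta> \<Longrightarrow> \<sigma>_minus \<le> m t x x' \<and> m t x x' \<le> \<sigma>_plus"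
    \<comment> \<open>(3) moments\<close>
    and moments:
      "(\<lambda>\<omega>. SUP (x, x')\<in>UNIV. ennreal (norm (S x x' (Y 0 \<omega>)) powr pbar)) \<in> borel_measurable M"
      "(\<integral>\<^sup>+\<omega>. (SUP (x, x')\<in>UNIV. ennreal (norm (S x x' (Y 0 \<omega>)) powr pbar)) \<partial>M) < \<infinity>"
    \<comment> \<open>(4) observations\<close>
    and Y_stationary: "stationary M mu Y"
    and beta: "0 \<le> C0" "C0 < 1" "0 < \<beta>" "\<beta> < 1"
      "\<And>n. beta_mixing M mu Y n \<le> ennreal (C0 * \<beta> ^ n)"
    and log_b:
      "(\<lambda>\<omega>. \<bar>eln (b_minus lam g \<Theta> (Y 0 \<omega>))\<bar> + \<bar>eln (b_plus lam g \<Theta> (Y 0 \<omega>))\<bar>)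
         \<in> borel_measurable M"
      "(\<integral>\<^sup>+\<omega>. e2ennreal (\<bar>eln (b_minus lam g \<Theta> (Y 0 \<omega>))\<bar> + \<bar>eln (b_plus lam g \<Theta> (Y 0 \<omega>))\<bar>) \<partial>M)
         < \<infinity>"
    \<comment> \<open>(5) block sizes\<close>
    and c_a: "c > 0" "a > 1"
    and tau: "\<And>n. n \<ge> 1 \<Longrightarrow> \<tau> n > 0" "\<And>n. n \<ge> 1 \<Longrightarrow> int (\<tau> n) = \<lfloor>c * real n powr a\<rfloor>"
    \<comment> \<open>Monte Carlo BOEM algorithm\<close>
    and chi_distribution: "\<And>n. distribution_on lam (chi n)"
    and theta_0: "\<theta>0 \<in> \<Theta>" "\<And>\<omega>. \<omega> \<in> space M \<Longrightarrow> \<theta> 0 \<omega> = \<theta>0"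
    and Sn: "\<And>n \<omega>. \<omega> \<in> space M \<Longrightarrow> Sn n \<omega> =
      block_stat lam (m (\<theta> n \<omega>)) (g (\<theta> n \<omega>)) (chi n) (block_end \<tau> n) (\<tau> (Suc n)) S (\<lambda>k. Y k \<omega>)"
    and St_in: "\<And>n \<omega>. \<omega> \<in> space M \<Longrightarrow> St n \<omega> \<in> SS"
    and theta_Suc: "\<And>n \<omega>. \<omega> \<in> space M \<Longrightarrow> \<theta> (Suc n) \<omega> = \<theta>bar (St n \<omega>)"
    and H_subalgebra: "\<And>n. subalgebra M (H n)"
    and H_mono: "\<And>n. sets (H n) \<subseteq> sets (H (Suc n))"
    and H_indep: "prob_space.indep_set M (sigma_sets (space M) (\<Union>n. sets (H n)))
      (sets (generated_by M mu Y UNIV))"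
    and theta_adapted: "\<And>n. \<theta> n \<in> borel_measurable (enlarged_past M mu Y H \<tau> n)"
    and St_adapted: "\<And>n. St n \<in> borel_measurable (enlarged_past M mu Y H \<tau> (Suc n))"
    and averaged_in: "\<And>n \<omega>. n \<ge> 1 \<Longrightarrow> \<omega> \<in> space M \<Longrightarrow> averaged_stat \<tau> St n \<omega> \<in> SS"
    \<comment> \<open>(6) Monte Carlo error\<close>
    and b: "b \<ge> (a + 1) / (2 * a)"
    and MC_error: "\<And>n. integrable M (\<lambda>\<omega>. norm (Sn n \<omega> - St n \<omega>) powr pbar)"
      "(\<lambda>n. Lp_norm M pbar (\<lambda>\<omega>. Sn n \<omega> - St n \<omega>)) \<in> O(\<lambda>n. real (\<tau> (Suc n)) powr (- b))"
    \<comment> \<open>(7) stable fixed point\<close>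
    and theta_star: "\<theta>star \<in> \<Theta>" "\<theta>bar (mean_stat M Y lam m g S \<theta>star) = \<theta>star"
    and smooth: "C2_on (mean_stat M Y lam m g S) \<Theta>" "C2_on \<theta>bar SS"
    and gamma: "0 < \<gamma>" "\<gamma> < 1"
      "spectral_radius
        (jacobian (mean_stat M Y lam m g S \<circ> \<theta>bar) (at (mean_stat M Y lam m g S \<theta>star))) < \<gamma>"
  shows "\<forall>p. 2 < p \<and> p < pbar \<longrightarrow>
    (\<exists>(U :: nat \<Rightarrow> 'w \<Rightarrow> real^'k) (V :: nat \<Rightarrow> 'w \<Rightarrow> real^'k) (A :: nat \<Rightarrow> 'w \<Rightarrow> real).
       O_Lp M p U \<and> O_Lp M (p / 2) V \<and> O_as M A \<and>
       (\<forall>n\<ge>1. \<forall>\<omega>\<in>space M.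
          (sqrt (real (block_end \<tau> n)) * indicat_real {\<omega>'. (\<lambda>k. \<theta> k \<omega>') \<longlonglongrightarrow> \<theta>star} \<omega>)
            *\<^sub>R (\<theta>bar (averaged_stat \<tau> St n \<omega>) - \<theta>star)
          = U n \<omega> + (real n / sqrt (real (block_end \<tau> n))) *\<^sub>R (A n \<omega> *\<^sub>R V n \<omega>)))"
proof (intro allI impI)
  fix p :: real assume p: "2 < p \<and> p < pbar"
  \<comment> \<open>The noise of all stages at once, as the filtration \<open>AA\<close>
    requires.\<close>
  define HH where "HH = sigma_sets (space M) (\<Union>n. sets (H n))"
  \<comment> \<open>The reference measure and the countably many initial laws under which null sets
    must be controlled.\<close>
  define K where "K = insert lam (range chi)"
  have H_sub: "sets (H n) \<subseteq> sets M" for n using H_subalgebra by (simp add: subalgebra_def)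
  have tau_ge_1: "real (\<tau> (Suc n)) \<ge> 1" for n using tau(1)[of "Suc n"] by simp
  obtain Cm where Cm: "Cm > 0"
    "\<And>n. Lp_le M p (\<lambda>\<omega>. norm (Sn n \<omega> - St n \<omega>)) (Cm * real (\<tau> (Suc n)) powr (- ((a + 1) / (2 * a))))"
    by (rule Lp_le_of_bigo[OF M _ _ tau_ge_1 b MC_error, of p]) (use p in auto)
  have EF: "exp_family_model \<Theta> lam mu m g \<phi> \<psi> S \<sigma>_minus \<sigma>_plus K"
  proof (rule exp_family_model.intro)
    show "countable K" "lam \<in> K" by (auto simp: K_def)
    show "finite_measure \<kappa> \<and> sets \<kappa> = sets lam" if "\<kappa> \<in> K" for \<kappa>
      using that lam(2) chi_distribution by (auto simp: K_def distribution_on_def prob_space_def)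
  qed (fact Theta_compact lam mu(1) m_density g_density phi_cont psi_cont S_measurable exp_family strong_mixing)+
  have ST: "stationary_hmm \<Theta> lam mu m g \<phi> \<psi> S \<sigma>_minus \<sigma>_plus K M Y pbar (chi 0)"
    by (rule stationary_hmm.intro[OF EF M], rule stationary_hmm_axioms.intro)
      (fact Y_measurable Y_stationary pbar moments chi_distribution)+
  \<comment> \<open>\<open>C0\<close> may be 0, so \<open>C0 + 1\<close> is used to obtain a
    strictly positive dominating sequence.\<close>
  have BM: "beta_mixing_process M mu Y HH (\<lambda>n. (C0 + 1) * \<beta> ^ n)"
  proof (rule beta_mixing_process.intro[OF M], rule beta_mixing_process_axioms.intro)
    show "HH \<subseteq> sets M" unfolding HH_def using H_sub by (intro sets.sigma_sets_subset) auto
    show "sigma_algebra (space M) HH" unfolding HH_def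
      using H_sub sets.sets_into_space by (intro sigma_algebra_sigma_sets) blast
    show "prob_space.indep_set M HH (sets (generated_by M mu Y UNIV))" unfolding HH_def by (rule H_indep)
    show "beta_mixing M mu Y n \<le> ennreal ((C0 + 1) * \<beta> ^ n)" for n
      by (rule order_trans[OF beta(5)]) (use beta(1-4) in \<open>auto intro!: ennreal_leI mult_right_mono\<close>)
    show "(C0 + 1) * \<beta> ^ n > 0" for n using beta(1-4) by (simp add: add_nonneg_pos)
  qed (fact Y_measurable)
  have BB: "boem_blocks \<Theta> lam mu m g \<phi> \<psi> S \<sigma>_minus \<sigma>_plus K M Y pbar (chi 0) HH (\<lambda>n. (C0 + 1) * \<beta> ^ n) \<beta> (C0 + 1) p"
    by (rule boem_blocks.intro[OF ST BM], rule boem_blocks_axioms.intro)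
      (use beta p theta_0(1) C2_on_continuous[OF smooth(1)] in auto)
  interpret BM: beta_mixing_process M mu Y HH "\<lambda>n. (C0 + 1) * \<beta> ^ n" by (rule BM)
  \<comment> \<open>The noise of one stage is part of the total noise, so adaptedness passes to the
    larger sigma-algebra at the end of the block.\<close>
  have enlarged: "subalgebra (BM.AA (int (block_end \<tau> n))) (enlarged_past M mu Y H \<tau> n)" for n
  proof -
    have "sets (enlarged_past M mu Y H \<tau> n) = sigma_sets (space M) (sets (past M mu Y (int (block_end \<tau> n))) \<union> sets (H n))"
      unfolding enlarged_past_def
      using H_sub[of n] BM.past_sub[of "int (block_end \<tau> n)"] sets.sets_into_space by (intro sets_measure_of) blast
    also have "\<dots> \<subseteq> sets (BM.AA (int (block_end \<tau> n)))"
      unfolding BM.sets_AA by (intro sigma_sets_mono') (auto simp: HH_def)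
    finally show ?thesis by (simp add: subalgebra_def enlarged_past_def space_measure_of_conv)
  qed
  have "boem_algorithm \<Theta> lam mu m g \<phi> \<psi> S \<sigma>_minus \<sigma>_plus K M Y pbar (chi 0) HH (\<lambda>n. (C0 + 1) * \<beta> ^ n) \<beta> (C0 + 1) p c a \<tau>
     chi \<theta> St Sn SS \<theta>bar \<theta>star \<gamma> Cm"
  proof (rule boem_algorithm.intro[OF BB block_sizes.intro], goal_cases)
    case 5
    show ?case
    proof (rule boem_algorithm_axioms.intro)
      show "chi n \<in> K" for n by (simp add: K_def)
      show "\<theta> n \<in> borel_measurable (BM.AA (int (block_end \<tau> n)))" for n
        by (rule measurable_from_subalg[OF enlarged theta_adapted])
      show "\<theta> n \<omega> \<in> \<Theta>" if "\<omega> \<in> space M" for n \<omega>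
        using theta_0 theta_Suc St_in theta_bar_argmax that by (cases n) auto
      show "St n \<in> borel_measurable M" for n
        by (rule measurable_from_subalg[OF BM.subalgebra_AA measurable_from_subalg[OF enlarged St_adapted]])
      show "\<theta>bar s \<in> \<Theta>" if "s \<in> SS" for s using theta_bar_argmax[OF that] by simp
    qed (fact chi_distribution theta_Suc St_in Sn SS averaged_in Cm theta_star smooth gamma)+
  qed (fact c_a tau)+
  then show "\<exists>(U :: nat \<Rightarrow> 'w \<Rightarrow> real^'k) (V :: nat \<Rightarrow> 'w \<Rightarrow> real^'k) (A :: nat \<Rightarrow> 'w \<Rightarrow> real).
       O_Lp M p U \<and> O_Lp M (p / 2) V \<and> O_as M A \<and>
       (\<forall>n\<ge>1. \<forall>\<omega>\<in>space M.
          (sqrt (real (block_end \<tau> n)) * indicat_real {\<omega>'. (\<lambda>k. \<theta> k \<omega>') \<longlonglongrightarrow> \<theta>star} \<omega>)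
            *\<^sub>R (\<theta>bar (averaged_stat \<tau> St n \<omega>) - \<theta>star)
          = U n \<omega> + (real n / sqrt (real (block_end \<tau> n))) *\<^sub>R (A n \<omega> *\<^sub>R V n \<omega>))"
    by (rule boem_algorithm.averaged_rate)
qed

end
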